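(* Let $\mathcal G$ be a stratified Lie group and let $f\in{\rm BMO}(\mathcal G)$. Then $f\in{\rm VMO}(\mathcal G)$ if and only if $f$ satisfies the following three conditions: (i) $\displaystyle\lim_{a\to0}\ \sup_{r_B=a}M(f,B)=0$; (ii) $\displaystyle\lim_{a\to\infty}\ \sup_{r_B=a}M(f,B)=0$; (iii) $\displaystyle\lim_{r\to\infty}\ \sup_{B\subset\mathcal G\setminus B(0,r)}M(f,B)=0$.
   Context: A connected, simply connected nilpotent Lie group $\mathcal G$ is stratified if its left-invariant Lie algebra $\mathfrak g$ (real, finite dimensional) has a direct sum decomposition $\mathfrak g=\bigoplus_{i=1}^sV_i$ with $[V_1,V_i]=V_{i+1}$ for $i\le s-1$ and $[V_1,V_s]=0$. Let $n=\dim V_1$ and let $X_1,\dots,X_n$ be a basis of $V_1$ (left-invariant vector fields). Fix a (bi-invariant) Haar measure $dg$ on $\mathcal G$; $|E|$ is the measure of $E$, and $0$ denotes the identity element of $\mathcal G$. Let $d$ be the Carnot--Carath\'eodory metric associated to $X_1,\dots,X_n$, and $B(g,r)=\{g':d(g,g')<r\}$. In all suprema $B$ ranges over open balls for $d$, and $r_B$ is the radius of $B$. For a locally integrable $f$ and a ball $B$ put $f_B=\frac1{|B|}\int_Bf(g)\,dg$ and $$M(f,B)=\frac1{|B|}\int_B|f(g)-f_B|\,dg.$$ ${\rm BMO}(\mathcal G)$ is the space of locally integrable $f$ with $\|f\|_{{\rm BMO}(\mathcal G)}=\sup_{B\subset\mathcal G}M(f,B)<\infty$. ${\rm VMO}(\mathcal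 G)$ is the closure of $C_0^\infty(\mathcal G)$ (smooth compactly supported functions) in the BMO norm. *)

theory Defs
  imports "HOL-Analysis.Analysis" "HOL-Library.Function_Algebras"
begin

section \<open>Smooth maps between open subsets of Euclidean spaces\<close>

primrec Ck_on :: "nat \<Rightarrow> 'a::euclidean_space set \<Rightarrow> ('a \<Rightarrow> 'b::real_normed_vector) \<Rightarrow> bool" where
  "Ck_on 0 S f \<longleftrightarrow> continuous_on S f"
| "Ck_on (Suc k) S f \<longleftrightarrow> (\<forall>x\<in>S. f differentiable at x) \<and>
     (\<forall>v. Ck_on k S (\<lambda>x. frechet_derivative f (at x) v))"

text \<open>Meant for open \<open>S\<close> only: derivatives are taken in the ambient space.\<close>

definition smooth_on :: "'a::euclidean_space set \<Rightarrow> ('a \<Rightarrow> 'b::real_normed_vector) \<Rightarrow> bool" where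
  "smooth_on S f \<longleftrightarrow> (\<forall>k. Ck_on k S f)"


section \<open>Lie groups\<close>

text \<open>
  The group is a whole type of class \<^class>\<open>topological_group_add\<close>. This class does not assume
  commutativity; the group law is merely written \<open>+\<close> and the identity \<open>0\<close>.
  A chart is a pair of its domain and its coordinate map; the latter is only relevant on the domain.
\<close>

type_synonym ('g, 'e) atlas = "('g set \<times> ('g \<Rightarrow> 'e)) set"

definition smooth_atlas :: "('g::topological_space, 'e::euclidean_space) atlas \<Rightarrow> bool" where
  "smooth_atlas A \<longleftrightarrow>
     (\<Union>(U, \<phi>)\<in>A. U) = UNIV \<and>
     (\<forall>(U, \<phi>)\<in>A. open U \<and> open (\<phi> ` U) \<and> homeomorphism U (\<phi> ` U) \<phi> (inv_into U \<phi>)) \<and>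
     (\<forall>(U, \<phi>)\<in>A. \<forall>(W, \<psi>)\<in>A. smooth_on (\<phi> ` (U \<inter> W)) (\<psi> \<circ> inv_into U \<phi>))"

definition smooth_fun ::
    "('g::topological_space, 'e::euclidean_space) atlas \<Rightarrow> ('g \<Rightarrow> 'b::real_normed_vector) \<Rightarrow> bool" where
  "smooth_fun A f \<longleftrightarrow> (\<forall>(U, \<phi>)\<in>A. smooth_on (\<phi> ` U) (f \<circ> inv_into U \<phi>))"

definition lie_group ::
    "('g::{topological_group_add, t2_space, second_countable_topology}, 'e::euclidean_space) atlas \<Rightarrow> bool" where
  "lie_group A \<longleftrightarrow>
     smooth_atlas A \<and>
     (\<forall>(U, \<phi>)\<in>A. \<forall>(U', \<phi>')\<in>A. \<forall>(W, \<psi>)\<in>A.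
        smooth_on {(x, y). x \<in> \<phi> ` U \<and> y \<in> \<phi>' ` U' \<and> inv_into U \<phi> x + inv_into U' \<phi>' y \<in> W}
          (\<lambda>(x, y). \<psi> (inv_into U \<phi> x + inv_into U' \<phi>' y))) \<and>
     (\<forall>(U, \<phi>)\<in>A. \<forall>(W, \<psi>)\<in>A.
        smooth_on {x \<in> \<phi> ` U. - inv_into U \<phi> x \<in> W} (\<lambda>x. \<psi> (- inv_into U \<phi> x)))"

definition generated_subgroup :: "'g::group_add set \<Rightarrow> 'g set" where
  "generated_subgroup S = (\<lambda>H. 0 \<in> H \<and> (\<forall>x\<in>H. \<forall>y\<in>H. x - y \<in> H)) hull S"

primrec lower_central :: "nat \<Rightarrow> 'g::group_add set" where
  "lower_central 0 = UNIV"
| "lower_central (Suc k) = generated_subgroup {x + y - x - y | x y. x \<in> lower_central k}"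

definition nilpotent_group :: "'g::group_add itself \<Rightarrow> bool" where
  "nilpotent_group _ \<longleftrightarrow> (\<exists>k. lower_central k = {0 :: 'g})"


section \<open>The Lie algebra of left-invariant vector fields\<close>

instantiation "fun" :: (type, real_vector) real_vector
begin

definition scaleR_fun_def: "c *\<^sub>R f = (\<lambda>x. c *\<^sub>R f x)"

instance
  by standard (simp_all add: scaleR_fun_def fun_eq_iff scaleR_add_left scaleR_add_right)

end

text \<open>Vector fields are derivations of the algebra of smooth real functions.\<close>

type_synonym 'g vfield = "('g \<Rightarrow> real) \<Rightarrow> ('g \<Rightarrow> real)"

text \<open>
  A derivation acts on smooth functions only. Since HOL functions are total, the value on
  non-smooth functions is fixed to be \<open>0\<close>, so that equality of vector fields is equality in HOL.
\<close>

definition vector_field ::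
    "('g::topological_space, 'e::euclidean_space) atlas \<Rightarrow> 'g vfield \<Rightarrow> bool" where
  "vector_field A X \<longleftrightarrow>
     (\<forall>u. smooth_fun A u \<longrightarrow> smooth_fun A (X u)) \<and>
     (\<forall>u v. smooth_fun A u \<longrightarrow> smooth_fun A v \<longrightarrow> X (\<lambda>p. u p + v p) = (\<lambda>p. X u p + X v p)) \<and>
     (\<forall>c u. smooth_fun A u \<longrightarrow> X (\<lambda>p. c * u p) = (\<lambda>p. c * X u p)) \<and>
     (\<forall>u v. smooth_fun A u \<longrightarrow> smooth_fun A v \<longrightarrow>
        X (\<lambda>p. u p * v p) = (\<lambda>p. u p * X v p + v p * X u p)) \<and>
     (\<forall>u. \<not> smooth_fun A u \<longrightarrow> X u = (\<lambda>p. 0))"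

definition left_invariant ::
    "('g::{topological_space, plus}, 'e::euclidean_space) atlas \<Rightarrow> 'g vfield \<Rightarrow> bool" where
  "left_invariant A X \<longleftrightarrow>
     (\<forall>g u. smooth_fun A u \<longrightarrow> X (\<lambda>p. u (g + p)) = (\<lambda>p. X u (g + p)))"

definition lie_algebra ::
    "('g::{topological_space, plus}, 'e::euclidean_space) atlas \<Rightarrow> 'g vfield set" where
  "lie_algebra A = {X. vector_field A X \<and> left_invariant A X}"

definition lie_bracket :: "'g vfield \<Rightarrow> 'g vfield \<Rightarrow> 'g vfield" where
  "lie_bracket X Y = (\<lambda>u. X (Y u) - Y (X u))"

definition bracket_space :: "'g vfield set \<Rightarrow> 'g vfield set \<Rightarrow> 'g vfield set" where
  "bracket_space V W = span {lie_bracket X Y | X Y. X \<in> V \<and> Y \<in> W}"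

definition stratification ::
    "('g::{topological_space, plus}, 'e::euclidean_space) atlas \<Rightarrow> nat \<Rightarrow> (nat \<Rightarrow> 'g vfield set) \<Rightarrow> bool" where
  "stratification A s V \<longleftrightarrow>
     1 \<le> s \<and>
     (\<forall>i\<in>{1..s}. subspace (V i) \<and> V i \<subseteq> lie_algebra A) \<and>
     (\<forall>X\<in>lie_algebra A. \<exists>!Y. Y \<in> (\<Pi>\<^sub>E i\<in>{1..s}. V i) \<and> X = (\<Sum>i = 1..s. Y i)) \<and>
     (\<forall>i\<in>{1..<s}. bracket_space (V 1) (V i) = V (Suc i)) \<and>
     bracket_space (V 1) (V s) = {0}"

definition indexed_basis :: "nat \<Rightarrow> (nat \<Rightarrow> 'v::real_vector) \<Rightarrow> 'v set \<Rightarrow> bool" where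
  "indexed_basis n X V \<longleftrightarrow>
     inj_on X {1..n} \<and> independent (X ` {1..n}) \<and> span (X ` {1..n}) = V"


section \<open>The Carnot--Caratheodory metric\<close>

definition absolutely_continuous_on :: "real \<Rightarrow> real \<Rightarrow> (real \<Rightarrow> real) \<Rightarrow> bool" where
  "absolutely_continuous_on a b f \<longleftrightarrow>
     (\<forall>\<epsilon>>0. \<exists>\<delta>>0. \<forall>D. finite D \<longrightarrow>
        (\<forall>(u, v)\<in>D. a \<le> u \<and> u \<le> v \<and> v \<le> b) \<longrightarrow>
        pairwise (\<lambda>(u, v) (u', v'). {u<..<v} \<inter> {u'<..<v'} = {}) D \<longrightarrow>
        (\<Sum>(u, v)\<in>D. v - u) < \<delta> \<longrightarrow> (\<Sum>(u, v)\<in>D. \<bar>f v - f u\<bar>) < \<epsilon>)"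

text \<open>
  Absolutely continuous curves on \<open>[0, T]\<close> with
  \<open>\<gamma>'(t) = a\<^sub>1(t) X\<^sub>1(\<gamma>(t)) + \<dots> + a\<^sub>n(t) X\<^sub>n(\<gamma>(t))\<close> and
  \<open>a\<^sub>1(t)\<^sup>2 + \<dots> + a\<^sub>n(t)\<^sup>2 \<le> 1\<close> for almost every \<open>t\<close>;
  regularity and velocity of a curve in the manifold are tested on smooth functions.
\<close>

definition subunit_curve ::
    "('g::topological_space, 'e::euclidean_space) atlas \<Rightarrow> nat \<Rightarrow> (nat \<Rightarrow> 'g vfield) \<Rightarrow>
     real \<Rightarrow> (real \<Rightarrow> 'g) \<Rightarrow> bool" where
  "subunit_curve A n X T \<gamma> \<longleftrightarrow>
     continuous_on {0..T} \<gamma> \<and>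
     (\<forall>u. smooth_fun A u \<longrightarrow> absolutely_continuous_on 0 T (u \<circ> \<gamma>)) \<and>
     (\<exists>a :: nat \<Rightarrow> real \<Rightarrow> real. AE t in lborel. t \<in> {0..T} \<longrightarrow>
        (\<Sum>j = 1..n. (a j t)\<^sup>2) \<le> 1 \<and>
        (\<forall>u. smooth_fun A u \<longrightarrow>
           ((u \<circ> \<gamma>) has_real_derivative (\<Sum>j = 1..n. a j t * X j u (\<gamma> t))) (at t within {0..T})))"

definition cc_dist ::
    "('g::topological_space, 'e::euclidean_space) atlas \<Rightarrow> nat \<Rightarrow> (nat \<Rightarrow> 'g vfield) \<Rightarrow>
     'g \<Rightarrow> 'g \<Rightarrow> real" where
  "cc_dist A n X g h = Inf {T. 0 < T \<and> (\<exists>\<gamma>. subunit_curve A n X T \<gamma> \<and> \<gamma> 0 = g \<and> \<gamma> T = h)}"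

definition dball :: "('g \<Rightarrow> 'g \<Rightarrow> real) \<Rightarrow> 'g \<Rightarrow> real \<Rightarrow> 'g set" where
  "dball d g r = {h. d g h < r}"


section \<open>Haar measure, BMO and VMO\<close>

text \<open>
  No regularity condition is needed: in a second countable locally compact Hausdorff space every
  Borel measure that is finite on compact sets is regular.
\<close>

definition haar_measure :: "'g::{topological_space, plus} measure \<Rightarrow> bool" where
  "haar_measure \<mu> \<longleftrightarrow>
     sets \<mu> = sets borel \<and>
     (\<forall>K. compact K \<longrightarrow> emeasure \<mu> K < \<infinity>) \<and>
     emeasure \<mu> UNIV \<noteq> 0 \<and>
     (\<forall>g. \<forall>E\<in>sets borel. emeasure \<mu> ((\<lambda>x. g + x) ` E) = emeasure \<mu> E) \<and>
     (\<forall>g. \<forall>E\<in>sets borel. emeasure \<mu> ((\<lambda>x. x + g) ` E) = emeasure \<mu> E)"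

definition locally_integrable ::
    "'g::topological_space measure \<Rightarrow> ('g \<Rightarrow> 'b::{banach, second_countable_topology}) \<Rightarrow> bool" where
  "locally_integrable \<mu> f \<longleftrightarrow> (\<forall>K. compact K \<longrightarrow> set_integrable \<mu> K f)"

definition set_average ::
    "'g measure \<Rightarrow> ('g \<Rightarrow> 'b::{banach, second_countable_topology}) \<Rightarrow> 'g set \<Rightarrow> 'b" where
  "set_average \<mu> f B = (1 / measure \<mu> B) *\<^sub>R (LINT x:B|\<mu>. f x)"

definition mean_osc ::
    "'g measure \<Rightarrow> ('g \<Rightarrow> 'b::{banach, second_countable_topology}) \<Rightarrow> 'g set \<Rightarrow> real" where
  "mean_osc \<mu> f B = (1 / measure \<mu> B) * (LINT x:B|\<mu>. norm (f x - set_average \<mu> f B))"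

definition bmo_norm ::
    "'g measure \<Rightarrow> ('g \<Rightarrow> 'g \<Rightarrow> real) \<Rightarrow> ('g \<Rightarrow> 'b::{banach, second_countable_topology}) \<Rightarrow> ennreal" where
  "bmo_norm \<mu> d f = (SUP (g, r)\<in>UNIV \<times> {0<..}. ennreal (mean_osc \<mu> f (dball d g r)))"

definition BMO ::
    "'g::topological_space measure \<Rightarrow> ('g \<Rightarrow> 'g \<Rightarrow> real) \<Rightarrow>
     ('g \<Rightarrow> 'b::{banach, second_countable_topology}) set" where
  "BMO \<mu> d = {f. locally_integrable \<mu> f \<and> bmo_norm \<mu> d f < \<infinity>}"

definition test_functions ::
    "('g::topological_space, 'e::euclidean_space) atlas \<Rightarrow> ('g \<Rightarrow> 'b::real_normed_vector) set" where
  "test_functions A = {u. smooth_fun A u \<and> compact (closure {p. u p \<noteq> 0})}"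

definition VMO ::
    "('g::topological_space, 'e::euclidean_space) atlas \<Rightarrow> 'g measure \<Rightarrow> ('g \<Rightarrow> 'g \<Rightarrow> real) \<Rightarrow>
     ('g \<Rightarrow> 'b::{banach, second_countable_topology}) set" where
  "VMO A \<mu> d = {f \<in> BMO \<mu> d. \<forall>\<epsilon>>0. \<exists>u\<in>test_functions A. bmo_norm \<mu> d (\<lambda>p. f p - u p) < \<epsilon>}"

end

theory Submission
  imports Defs
begin

text \<open>
  Call \<open>f\<close> of vanishing oscillation if \<open>M(f,B)\<close> is small for all balls outside a compact range of radii and
  centres. This is equivalent to (i), (ii) and (iii) together; it passes to BMO limits, and it holds for
  continuous functions of compact support because the volume of balls is unbounded. Hence every \<open>f\<close> in VMO satisfies
  the three conditions.

  Conversely, every \<open>f\<close> in BMO is the limit in \<open>L\<^sup>1\<close> on compact sets of test functions \<open>F\<^sub>k\<close> with bounded BMO norms: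
  truncate \<open>f\<close> radially at the height of a compactly supported plateau function of bounded mean oscillation,
  and mollify on the left. If \<open>f\<close> has vanishing oscillation and the indices \<open>k\<^sub>1, \<dots>, k\<^sub>N\<close> are chosen sparse
  enough, then on each ball at most one of the differences \<open>f - F\<^sub>k\<close> has large oscillation, so that
  \<open>f - (F\<^sub>k\<^sub>1 + \<dots> + F\<^sub>k\<^sub>N) / N\<close> has BMO norm of order \<open>1 / N\<close>.

  About the metric one only needs that balls are open, relatively compact, shrink to points and have unbounded
  volume. The first of these is local accessibility by horizontal curves. The last one holds since
  the group is not compact: in a compact group the adjoint action is bounded, which forces a nilpotent bracket to vanish,
  and a commutative simply connected Lie group is a vector space.
\<close>

section \<open>Calculus of smooth maps\<close>

text \<open>A function in BMO may have large averages, and multiplying it by a cutoff creates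
  oscillation of the size of those averages. Truncation at a variable height is Lipschitz in the
  value and in the height, so it costs only the oscillations of these two; hence the plateaus must
  be tall as well as wide. The resulting \<open>F\<^sub>k\<close> approach \<open>f\<close> only
  weakly: \<open>f - F\<^sub>k\<close> is bounded in BMO but does not become small there. Averaging
  turns this into norm convergence, because widely spaced differences have their large oscillations
  on disjoint families of balls. Mollification acts on the left because left translations carry
  balls to balls and preserve the measure, so an average of left translates stays bounded in BMO.
  The detour through the structure of the group serves condition (ii): on a compact group a
  nonconstant test function violates it, since all large balls are the whole group. Unbounded volume
  is what makes the oscillation of test functions over large balls vanish.\<close>

lemma frechet_derivative_cong_open:
  assumes "open S" "x \<in> S" "\<And>y. y \<in> S \<Longrightarrow> f y = g y"
  shows "frechet_derivative f (at x) = frechet_derivative g (at x)"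
proof -
  have "(f has_derivative D) (at x) \<longleftrightarrow> (g has_derivative D) (at x)" for D
    using has_derivative_transform_within_open[of f D x UNIV S g]
      has_derivative_transform_within_open[of g D x UNIV S f] assms by auto
  then show ?thesis by (simp add: frechet_derivative_def)
qed

lemma Ck_on_subset: "Ck_on k S f \<Longrightarrow> T \<subseteq> S \<Longrightarrow> Ck_on k T f"
  by (induction k arbitrary: f) (auto intro: continuous_on_subset)

lemma differentiable_cong_open:
  assumes "open S" "x \<in> S" "\<And>y. y \<in> S \<Longrightarrow> f y = g y" "f differentiable (at x)"
  shows "g differentiable (at x)"
  using assms has_derivative_transform_within_open[of f _ x UNIV S g]
  unfolding differentiable_def by blast

lemma Ck_on_cong:
  assumes "open S" "\<And>x. x \<in> S \<Longrightarrow> f x = g x" "Ck_on k S f"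
  shows "Ck_on k S g"
  using assms(2,3)
proof (induction k arbitrary: f g)
  case 0
  then show ?case using continuous_on_cong[of S S f g] by auto
next
  case (Suc k)
  have "g differentiable (at x)" if "x \<in> S" for x
    using differentiable_cong_open[OF assms(1) that Suc.prems(1)] Suc.prems(2) that by auto
  moreover have "Ck_on k S (\<lambda>x. frechet_derivative g (at x) v)" for v
    apply (rule Suc.IH[of "\<lambda>x. frechet_derivative f (at x) v"])
    using frechet_derivative_cong_open[OF assms(1) _ Suc.prems(1)] Suc.prems by (auto simp: fun_eq_iff)
  ultimately show ?case by simp
qed

text \<open>\<open>frechet_derivative\<close> is a choice operator; this rule lets any explicit
  derivative take its place. Openness of \<open>S\<close> makes the replacement survive further
  differentiation.\<close>

lemma Ck_on_SucI:
  assumes "open S" "\<And>x. x \<in> S \<Longrightarrow> (f has_derivative f' x) (at x)" "\<And>v. Ck_on k S (\<lambda>x. f' x v)"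
  shows "Ck_on (Suc k) S f"
proof -
  have "Ck_on k S (\<lambda>x. frechet_derivative f (at x) v)" for v
    apply (rule Ck_on_cong[OF assms(1) _ assms(3)[of v]])
    by (simp add: frechet_derivative_at[OF assms(2), symmetric])
  then show ?thesis using assms(2) by (auto simp: differentiable_def)
qed

lemma Ck_on_has_derivative:
  "Ck_on (Suc k) S f \<Longrightarrow> x \<in> S \<Longrightarrow> (f has_derivative frechet_derivative f (at x)) (at x)"
  by (auto simp: frechet_derivative_works)

lemma Ck_on_frechet: "Ck_on (Suc k) S f \<Longrightarrow> Ck_on k S (\<lambda>x. frechet_derivative f (at x) v)"
  by simp

lemma Ck_on_SucD: "Ck_on (Suc k) S f \<Longrightarrow> Ck_on k S f"
proof (induction k arbitrary: f)
  case 0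
  then show ?case by (auto intro!: continuous_at_imp_continuous_on differentiable_imp_continuous_within)
next
  case (Suc k)
  have "Ck_on k S (\<lambda>x. frechet_derivative f (at x) v)" for v
    by (rule Suc.IH) (use Suc.prems in simp)
  with Suc.prems show ?case by simp
qed

declare Ck_on.simps(2) [simp del]

lemma Ck_on_const [simp]: "open S \<Longrightarrow> Ck_on k S (\<lambda>x. c)"
proof (induction k arbitrary: c)
  case (Suc k)
  show ?case by (rule Ck_on_SucI[where f' = "\<lambda>x v. 0"]) (auto intro: Suc)
qed simp

lemma Ck_on_bounded_linear:
  assumes "bounded_linear L" "open S"
  shows "Ck_on k S f \<Longrightarrow> Ck_on k S (\<lambda>x. L (f x))"
proof (induction k arbitrary: f)
  case 0
  then show ?case using bounded_linear.continuous_on[OF assms(1)] by auto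
next
  case (Suc k)
  show ?case
    by (rule Ck_on_SucI[OF assms(2), where f' = "\<lambda>x v. L (frechet_derivative f (at x) v)"])
      (rule bounded_linear.has_derivative[OF assms(1) Ck_on_has_derivative[OF Suc.prems]] Suc.IH Ck_on_frechet Suc.prems
        | assumption)+
qed

lemma Ck_on_id: "open S \<Longrightarrow> Ck_on k S (\<lambda>x. x)"
proof (induction k)
  case (Suc k)
  show ?case by (rule Ck_on_SucI[where f' = "\<lambda>x v. v"]) (auto simp: Suc)
qed simp

lemma Ck_on_add:
  assumes "open S"
  shows "Ck_on k S f \<Longrightarrow> Ck_on k S g \<Longrightarrow> Ck_on k S (\<lambda>x. f x + g x)"
proof (induction k arbitrary: f g)
  case 0
  then show ?case by (auto intro: continuous_on_add)
next
  case (Suc k)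
  show ?case
    by (rule Ck_on_SucI[OF assms, where f' = "\<lambda>x v. frechet_derivative f (at x) v + frechet_derivative g (at x) v"])
      (rule has_derivative_add[OF Ck_on_has_derivative[OF Suc.prems(1)] Ck_on_has_derivative[OF Suc.prems(2)]]
        Suc.IH Ck_on_frechet Suc.prems | assumption)+
qed

lemma Ck_on_sum:
  assumes "open S" "\<And>i. i \<in> I \<Longrightarrow> Ck_on k S (f i)"
  shows "Ck_on k S (\<lambda>x. \<Sum>i\<in>I. f i x)"
  using assms(2)
proof (induction I rule: infinite_finite_induct)
  case (infinite I)
  then show ?case using assms(1) by simp
next
  case empty
  then show ?case using assms(1) by simp
next
  case (insert i I)
  then show ?case using Ck_on_add[OF assms(1), of k "f i" "\<lambda>x. \<Sum>i\<in>I. f i x"] by simp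
qed

lemma Ck_on_bilinear:
  assumes "bounded_bilinear p" "open S"
  shows "Ck_on k S f \<Longrightarrow> Ck_on k S g \<Longrightarrow> Ck_on k S (\<lambda>x. p (f x) (g x))"
proof (induction k arbitrary: f g)
  case 0
  then show ?case by (auto intro: bounded_bilinear.continuous_on[OF assms(1)])
next
  case (Suc k)
  show ?case
  proof (rule Ck_on_SucI[OF assms(2)])
    show "((\<lambda>x. p (f x) (g x)) has_derivative
       (\<lambda>v. p (f x) (frechet_derivative g (at x) v) + p (frechet_derivative f (at x) v) (g x))) (at x)" if "x \<in> S" for x
      by (rule bounded_bilinear.FDERIV[OF assms(1) Ck_on_has_derivative[OF Suc.prems(1) that]
            Ck_on_has_derivative[OF Suc.prems(2) that]])
    show "Ck_on k S (\<lambda>x. p (f x) (frechet_derivative g (at x) v) + p (frechet_derivative f (at x) v) (g x))" for v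
      by (rule Ck_on_add[OF assms(2)]; rule Suc.IH)
        (rule Ck_on_SucD[OF Suc.prems(1)] Ck_on_SucD[OF Suc.prems(2)] Ck_on_frechet Suc.prems)+
  qed
qed

lemma Ck_on_compose:
  fixes f :: "'a::euclidean_space \<Rightarrow> 'c::euclidean_space" and g :: "'c \<Rightarrow> 'b::real_normed_vector"
  assumes "open S" "open T" "\<And>x. x \<in> S \<Longrightarrow> f x \<in> T"
  shows "Ck_on k S f \<Longrightarrow> Ck_on k T g \<Longrightarrow> Ck_on k S (\<lambda>x. g (f x))"
  using assms(3)
proof (induction k arbitrary: f g)
  case 0
  then show ?case by (auto intro: continuous_on_compose2)
next
  case (Suc k)
  show ?case
  proof (rule Ck_on_SucI[OF assms(1)])
    \<comment> \<open>\<open>Ck_on\<close> controls derivatives in a fixed direction only, while the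
      chain rule produces the moving direction \<open>frechet_derivative f (at x) v\<close>.
      Expanding that direction in the basis restores fixed directions, with coefficients to which
      the product rule applies.\<close>
    show "((\<lambda>x. g (f x)) has_derivative
       (\<lambda>v. \<Sum>b\<in>Basis. (frechet_derivative f (at x) v \<bullet> b) *\<^sub>R frechet_derivative g (at (f x)) b)) (at x)"
      if "x \<in> S" for x
    proof -
      note g = Ck_on_has_derivative[OF Suc.prems(2) Suc.prems(3)[OF that]]
      note f = Ck_on_has_derivative[OF Suc.prems(1) that]
      have eq: "frechet_derivative g (at (f x)) w = (\<Sum>b\<in>Basis. (w \<bullet> b) *\<^sub>R frechet_derivative g (at (f x)) b)" for w
        using linear_sum[OF has_derivative_linear[OF g], of "\<lambda>b. (w \<bullet> b) *\<^sub>R b" Basis]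
        by (simp add: euclidean_representation linear_scale[OF has_derivative_linear[OF g]])
      have "((\<lambda>x. g (f x)) has_derivative (\<lambda>v. frechet_derivative g (at (f x)) (frechet_derivative f (at x) v))) (at x)"
        using diff_chain_at[OF f g] by (simp add: o_def)
      then show ?thesis by (rule has_derivative_eq_rhs) (rule ext, rule eq)
    qed
    show "Ck_on k S (\<lambda>x. \<Sum>b\<in>Basis. (frechet_derivative f (at x) v \<bullet> b) *\<^sub>R frechet_derivative g (at (f x)) b)" for v
    proof (intro Ck_on_sum assms(1) Ck_on_bilinear[OF bounded_bilinear_scaleR] Ck_on_bounded_linear[OF bounded_linear_inner_left])
      show "Ck_on k S (\<lambda>x. frechet_derivative f (at x) v)"
        by (rule Ck_on_frechet[OF Suc.prems(1)])
      show "Ck_on k S (\<lambda>x. frechet_derivative g (at (f x)) b)" for b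
        using Suc.IH[OF Ck_on_SucD[OF Suc.prems(1)] Ck_on_frechet[OF Suc.prems(2)]] Suc.prems(3) .
    qed
  qed
qed

lemma smooth_on_subset: "smooth_on S f \<Longrightarrow> T \<subseteq> S \<Longrightarrow> smooth_on T f"
  by (auto simp: smooth_on_def intro: Ck_on_subset)

lemma smooth_on_cong: "open S \<Longrightarrow> (\<And>x. x \<in> S \<Longrightarrow> f x = g x) \<Longrightarrow> smooth_on S f \<Longrightarrow> smooth_on S g"
  unfolding smooth_on_def by (intro allI, rule Ck_on_cong[of S f g]) auto

lemma smooth_on_has_derivative:
  "smooth_on S f \<Longrightarrow> x \<in> S \<Longrightarrow> (f has_derivative frechet_derivative f (at x)) (at x)"
  by (rule Ck_on_has_derivative[of 0 S]) (simp_all add: smooth_on_def)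

lemma smooth_on_frechet: "smooth_on S f \<Longrightarrow> smooth_on S (\<lambda>x. frechet_derivative f (at x) v)"
  by (simp add: smooth_on_def Ck_on_frechet)

lemma smooth_on_continuous_on: "smooth_on S f \<Longrightarrow> continuous_on S f"
  unfolding smooth_on_def using Ck_on.simps(1) by blast

lemma smooth_on_const [simp]: "open S \<Longrightarrow> smooth_on S (\<lambda>x. c)"
  by (simp add: smooth_on_def)

lemma smooth_on_id: "open S \<Longrightarrow> smooth_on S (\<lambda>x. x)"
  by (simp add: smooth_on_def Ck_on_id)

lemma smooth_on_bounded_linear: "bounded_linear L \<Longrightarrow> open S \<Longrightarrow> smooth_on S f \<Longrightarrow> smooth_on S (\<lambda>x. L (f x))"
  by (simp add: smooth_on_def Ck_on_bounded_linear)

lemma smooth_on_linear: "bounded_linear L \<Longrightarrow> open S \<Longrightarrow> smooth_on S L"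
  by (rule smooth_on_bounded_linear[OF _ _ smooth_on_id])

lemma smooth_on_add: "open S \<Longrightarrow> smooth_on S f \<Longrightarrow> smooth_on S g \<Longrightarrow> smooth_on S (\<lambda>x. f x + g x)"
  by (simp add: smooth_on_def Ck_on_add)

lemma smooth_on_sum: "open S \<Longrightarrow> (\<And>i. i \<in> I \<Longrightarrow> smooth_on S (f i)) \<Longrightarrow> smooth_on S (\<lambda>x. \<Sum>i\<in>I. f i x)"
  by (simp add: smooth_on_def Ck_on_sum)

lemma smooth_on_bilinear:
  "bounded_bilinear p \<Longrightarrow> open S \<Longrightarrow> smooth_on S f \<Longrightarrow> smooth_on S g \<Longrightarrow> smooth_on S (\<lambda>x. p (f x) (g x))"
  by (simp add: smooth_on_def Ck_on_bilinear)

lemma smooth_on_compose: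
  fixes f :: "'a::euclidean_space \<Rightarrow> 'c::euclidean_space" and g :: "'c \<Rightarrow> 'b::real_normed_vector"
  shows "open S \<Longrightarrow> open T \<Longrightarrow> smooth_on S f \<Longrightarrow> smooth_on T g \<Longrightarrow> (\<And>x. x \<in> S \<Longrightarrow> f x \<in> T) \<Longrightarrow>
     smooth_on S (\<lambda>x. g (f x))"
  unfolding smooth_on_def by (rule allI, rule Ck_on_compose[of S T]) auto

lemma smooth_on_Pair:
  fixes f :: "'a::euclidean_space \<Rightarrow> 'c::euclidean_space" and g :: "'a \<Rightarrow> 'd::euclidean_space"
  assumes "open S" "smooth_on S f" "smooth_on S g"
  shows "smooth_on S (\<lambda>x. (f x, g x))"
proof -
  have "bounded_linear (\<lambda>x. (x, 0) :: 'c \<times> 'd)" "bounded_linear (\<lambda>x. (0, x) :: 'c \<times> 'd)"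
    by (auto intro!: bounded_linear_Pair bounded_linear_ident bounded_linear_zero)
  from smooth_on_add[OF assms(1) smooth_on_bounded_linear[OF this(1) assms(1,2)] smooth_on_bounded_linear[OF this(2) assms(1,3)]]
  show ?thesis by simp
qed

lemma Ck_on_local:
  assumes "\<And>x. x \<in> S \<Longrightarrow> \<exists>T. open T \<and> x \<in> T \<and> Ck_on k T f"
  shows "Ck_on k S f"
  using assms
proof (induction k arbitrary: f)
  case 0
  have "isCont f x" if "x \<in> S" for x
    using 0[OF that] by (auto simp: continuous_on_eq_continuous_at)
  then show ?case by (simp add: continuous_at_imp_continuous_on)
next
  case (Suc k)
  show ?case
    unfolding Ck_on.simps
  proof (intro conjI allI ballI)
    show "f differentiable at x" if "x \<in> S" for x
      using Suc.prems[OF that] by (auto simp: Ck_on.simps(2))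
    show "Ck_on k S (\<lambda>x. frechet_derivative f (at x) v)" for v
    proof (rule Suc.IH)
      fix x assume "x \<in> S"
      from Suc.prems[OF this] obtain T where "open T" "x \<in> T" "Ck_on (Suc k) T f" by blast
      then show "\<exists>T. open T \<and> x \<in> T \<and> Ck_on k T (\<lambda>x. frechet_derivative f (at x) v)"
        using Ck_on_frechet by blast
    qed
  qed
qed

lemma smooth_on_local:
  assumes "\<And>x. x \<in> S \<Longrightarrow> \<exists>T. open T \<and> x \<in> T \<and> smooth_on T f"
  shows "smooth_on S f"
  unfolding smooth_on_def
proof
  fix k
  show "Ck_on k S f"
  proof (rule Ck_on_local)
    fix x assume "x \<in> S"
    from assms[OF this] show "\<exists>T. open T \<and> x \<in> T \<and> Ck_on k T f"
      by (auto simp: smooth_on_def)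
  qed
qed

text \<open>The partial derivative at a fixed second argument is a full derivative of
  \<open>q\<close> in the direction \<open>(0, v)\<close>, hence smooth in the first argument.
  Smoothness of everything obtained by differentiating the group law at the identity comes from
  here.\<close>

lemma smooth_on_slice:
  fixes q :: "'a::euclidean_space \<times> 'c::euclidean_space \<Rightarrow> 'b::real_normed_vector"
  assumes "smooth_on (S \<times> T) q" "open S" "open T" "y0 \<in> T"
  shows "smooth_on S (\<lambda>x. frechet_derivative (\<lambda>y. q (x, y)) (at y0) v)"
    and "x \<in> S \<Longrightarrow> ((\<lambda>y. q (x, y)) has_derivative (\<lambda>v. frechet_derivative q (at (x, y0)) (0, v))) (at y0)"
proof -
  show D: "((\<lambda>y. q (x, y)) has_derivative (\<lambda>v. frechet_derivative q (at (x, y0)) (0, v))) (at y0)"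
    if "x \<in> S" for x
  proof -
    have 1: "((\<lambda>y. (x, y)) has_derivative (\<lambda>v. (0, v))) (at y0)"
      by (auto intro!: derivative_eq_intros)
    have 2: "(q has_derivative frechet_derivative q (at (x, y0))) (at (x, y0))"
      by (rule smooth_on_has_derivative[OF assms(1)]) (use that assms in auto)
    show ?thesis using diff_chain_at[OF 1 2] by (simp add: o_def)
  qed
  have "smooth_on S (\<lambda>x. frechet_derivative q (at (x, y0)) (0, v))"
    by (rule smooth_on_compose[OF assms(2) open_Times[OF assms(2,3)] _ smooth_on_frechet[OF assms(1)]])
      (use assms in \<open>auto intro: smooth_on_Pair smooth_on_id\<close>)
  then show "smooth_on S (\<lambda>x. frechet_derivative (\<lambda>y. q (x, y)) (at y0) v)"
    by (rule smooth_on_cong[OF assms(2), rotated]) (simp add: frechet_derivative_at[OF D, symmetric])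
qed

section \<open>Bump functions and Hadamard's lemma\<close>

lemma Ck_on_continuous_on: "Ck_on k S f \<Longrightarrow> continuous_on S f"
proof (induction k)
  case (Suc k)
  then show ?case using Ck_on_SucD by blast
qed simp

lemma has_real_derivative_along_line:
  fixes f :: "'a::real_normed_vector \<Rightarrow> real"
  assumes "(f has_derivative D) (at (p + s *\<^sub>R v))"
  shows "((\<lambda>s. f (p + s *\<^sub>R v)) has_real_derivative D v) (at s)"
proof -
  have "((\<lambda>s. p + s *\<^sub>R v) has_derivative (\<lambda>h. h *\<^sub>R v)) (at s)"
    by (auto intro!: derivative_eq_intros)
  from diff_chain_at[OF this assms] show ?thesis
    by (simp add: has_field_derivative_def o_def linear_scale[OF has_derivative_linear[OF assms]] mult.commute[of _ "D v"])
qed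

text \<open>Mean value theorem twice: first along \<open>v\<close>, then along \<open>w\<close> for
  the derivative in direction \<open>v\<close>. The left side is symmetric in \<open>v\<close> and
  \<open>w\<close> and the right side is not, which is the source of the symmetry of second
  derivatives.\<close>

lemma second_difference:
  fixes f :: "'a::euclidean_space \<Rightarrow> real"
  assumes "smooth_on (ball x r) f" "0 < h" "h * (norm v + norm w) < r"
  obtains \<xi> \<eta> where "0 < \<xi>" "\<xi> < h" "0 < \<eta>" "\<eta> < h"
    "f (x + h *\<^sub>R v + h *\<^sub>R w) - f (x + h *\<^sub>R v) - f (x + h *\<^sub>R w) + f x =
      h * h * frechet_derivative (\<lambda>z. frechet_derivative f (at z) v) (at (x + \<xi> *\<^sub>R v + \<eta> *\<^sub>R w)) w"
proof -
  have inb: "x + s *\<^sub>R v + t *\<^sub>R w \<in> ball x r" if "0 \<le> s" "s \<le> h" "0 \<le> t" "t \<le> h" for s t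
  proof -
    have "norm (s *\<^sub>R v + t *\<^sub>R w) \<le> s * norm v + t * norm w"
      using norm_triangle_ineq[of "s *\<^sub>R v" "t *\<^sub>R w"] that by simp
    also have "\<dots> \<le> h * norm v + h * norm w"
      using that by (intro add_mono mult_right_mono) auto
    also have "\<dots> < r" using assms(3) by (simp add: distrib_left)
    finally have "norm (s *\<^sub>R v + t *\<^sub>R w) < r" .
    moreover have "dist x (x + s *\<^sub>R v + t *\<^sub>R w) = norm (s *\<^sub>R v + t *\<^sub>R w)"
      unfolding dist_norm by (subst norm_minus_commute) (simp add: add.assoc)
    ultimately show ?thesis by simp
  qed
  let ?D = "\<lambda>z. frechet_derivative f (at z)"
  have d1: "((\<lambda>s. f (x + s *\<^sub>R v + h *\<^sub>R w) - f (x + s *\<^sub>R v)) has_real_derivative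
      ?D (x + s *\<^sub>R v + h *\<^sub>R w) v - ?D (x + s *\<^sub>R v) v) (at s)" if "0 \<le> s" "s \<le> h" for s
  proof (rule DERIV_diff)
    have "(f has_derivative ?D ((x + h *\<^sub>R w) + s *\<^sub>R v)) (at ((x + h *\<^sub>R w) + s *\<^sub>R v))"
      by (rule smooth_on_has_derivative[OF assms(1)]) (use inb[of s h] that assms in \<open>auto simp: algebra_simps\<close>)
    from has_real_derivative_along_line[OF this]
    show "((\<lambda>s. f (x + s *\<^sub>R v + h *\<^sub>R w)) has_real_derivative ?D (x + s *\<^sub>R v + h *\<^sub>R w) v) (at s)"
      by (simp add: algebra_simps)
    show "((\<lambda>s. f (x + s *\<^sub>R v)) has_real_derivative ?D (x + s *\<^sub>R v) v) (at s)"
      by (rule has_real_derivative_along_line, rule smooth_on_has_derivative[OF assms(1)])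
        (use inb[of s 0] that assms in auto)
  qed
  obtain \<xi> where \<xi>: "0 < \<xi>" "\<xi> < h" "(f (x + h *\<^sub>R v + h *\<^sub>R w) - f (x + h *\<^sub>R v)) - (f (x + h *\<^sub>R w) - f x) =
      h * (?D (x + \<xi> *\<^sub>R v + h *\<^sub>R w) v - ?D (x + \<xi> *\<^sub>R v) v)"
    using MVT2[OF assms(2), of "\<lambda>s. f (x + s *\<^sub>R v + h *\<^sub>R w) - f (x + s *\<^sub>R v)"
      "\<lambda>s. ?D (x + s *\<^sub>R v + h *\<^sub>R w) v - ?D (x + s *\<^sub>R v) v"] d1 by auto
  have d2: "((\<lambda>t. ?D (x + \<xi> *\<^sub>R v + t *\<^sub>R w) v) has_real_derivative
      frechet_derivative (\<lambda>z. ?D z v) (at (x + \<xi> *\<^sub>R v + t *\<^sub>R w)) w) (at t)" if "0 \<le> t" "t \<le> h" for t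
    by (rule has_real_derivative_along_line[where f = "\<lambda>z. ?D z v"],
        rule smooth_on_has_derivative[OF smooth_on_frechet[OF assms(1)]])
      (use inb[of \<xi> t] that \<xi> in auto)
  obtain \<eta> where \<eta>: "0 < \<eta>" "\<eta> < h" "?D (x + \<xi> *\<^sub>R v + h *\<^sub>R w) v - ?D (x + \<xi> *\<^sub>R v + 0 *\<^sub>R w) v =
      (h - 0) * frechet_derivative (\<lambda>z. ?D z v) (at (x + \<xi> *\<^sub>R v + \<eta> *\<^sub>R w)) w"
    using MVT2[OF assms(2) d2] by auto
  show ?thesis
    by (rule that[OF \<xi>(1,2) \<eta>(1,2)]) (use \<xi>(3) \<eta>(3) in \<open>simp add: algebra_simps\<close>)
qed

lemma second_derivative_symmetric:
  fixes f :: "'a::euclidean_space \<Rightarrow> real"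
  assumes "smooth_on S f" "open S" "x \<in> S"
  shows "frechet_derivative (\<lambda>z. frechet_derivative f (at z) v) (at x) w =
    frechet_derivative (\<lambda>z. frechet_derivative f (at z) w) (at x) v"
proof -
  obtain r where r: "0 < r" "ball x r \<subseteq> S" using assms by (meson open_contains_ball)
  have sm: "smooth_on (ball x r) f" by (rule smooth_on_subset[OF assms(1) r(2)])
  have close: "\<exists>\<delta>>0. \<forall>\<xi> \<eta>. 0 < \<xi> \<longrightarrow> \<xi> < \<delta> \<longrightarrow> 0 < \<eta> \<longrightarrow> \<eta> < \<delta> \<longrightarrow>
      \<bar>frechet_derivative (\<lambda>z. frechet_derivative f (at z) v) (at (x + \<xi> *\<^sub>R v + \<eta> *\<^sub>R w)) w -
       frechet_derivative (\<lambda>z. frechet_derivative f (at z) v) (at x) w\<bar> < \<epsilon>" if "\<epsilon> > 0" for \<epsilon> v w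
  proof -
    have "isCont (\<lambda>z. frechet_derivative (\<lambda>z. frechet_derivative f (at z) v) (at z) w) x"
      by (rule continuous_on_interior[OF smooth_on_continuous_on[OF smooth_on_frechet[OF smooth_on_frechet[OF assms(1)]]]])
        (simp add: assms interior_open)
    then have "\<exists>\<rho>>0. \<forall>y. dist y x < \<rho> \<longrightarrow>
      \<bar>frechet_derivative (\<lambda>z. frechet_derivative f (at z) v) (at y) w -
       frechet_derivative (\<lambda>z. frechet_derivative f (at z) v) (at x) w\<bar> < \<epsilon>"
      using that by (simp add: continuous_at_eps_delta dist_real_def)
    then obtain \<rho> where \<rho>: "\<rho> > 0" "\<And>y. dist y x < \<rho> \<Longrightarrow>
      \<bar>frechet_derivative (\<lambda>z. frechet_derivative f (at z) v) (at y) w -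
       frechet_derivative (\<lambda>z. frechet_derivative f (at z) v) (at x) w\<bar> < \<epsilon>"
      by blast
    define \<delta> where "\<delta> = \<rho> / (norm v + norm w + 1)"
    have pos: "norm v + norm w + 1 > 0" by (smt (verit) norm_ge_zero)
    show ?thesis
    proof (intro exI[of _ \<delta>] conjI allI impI)
      show "\<delta> > 0" using \<rho> pos by (simp add: \<delta>_def)
      fix \<xi> \<eta> assume *: "0 < \<xi>" "\<xi> < \<delta>" "0 < \<eta>" "\<eta> < \<delta>"
      have "norm (\<xi> *\<^sub>R v + \<eta> *\<^sub>R w) \<le> \<xi> * norm v + \<eta> * norm w"
        using norm_triangle_ineq[of "\<xi> *\<^sub>R v" "\<eta> *\<^sub>R w"] * by simp
      also have "\<dots> \<le> \<delta> * norm v + \<delta> * norm w"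
        using * by (intro add_mono mult_right_mono) auto
      also have "\<dots> < \<delta> * (norm v + norm w + 1)" using \<open>\<delta> > 0\<close> by (simp add: algebra_simps)
      also have "\<dots> = \<rho>" using pos by (simp add: \<delta>_def)
      finally show "\<bar>frechet_derivative (\<lambda>z. frechet_derivative f (at z) v) (at (x + \<xi> *\<^sub>R v + \<eta> *\<^sub>R w)) w -
       frechet_derivative (\<lambda>z. frechet_derivative f (at z) v) (at x) w\<bar> < \<epsilon>"
        by (intro \<rho>(2)) (simp add: dist_norm add.assoc)
    qed
  qed
  let ?a = "frechet_derivative (\<lambda>z. frechet_derivative f (at z) v) (at x) w"
  let ?b = "frechet_derivative (\<lambda>z. frechet_derivative f (at z) w) (at x) v"
  have "\<bar>?a - ?b\<bar> < 2 * \<epsilon>" if eps: "\<epsilon> > 0" for \<epsilon>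
  proof -
    obtain \<delta>1 where \<delta>1: "\<delta>1 > 0" "\<And>\<xi> \<eta>. 0 < \<xi> \<Longrightarrow> \<xi> < \<delta>1 \<Longrightarrow> 0 < \<eta> \<Longrightarrow> \<eta> < \<delta>1 \<Longrightarrow>
      \<bar>frechet_derivative (\<lambda>z. frechet_derivative f (at z) v) (at (x + \<xi> *\<^sub>R v + \<eta> *\<^sub>R w)) w - ?a\<bar> < \<epsilon>"
      using close[OF eps, of v w] by blast
    obtain \<delta>2 where \<delta>2: "\<delta>2 > 0" "\<And>\<xi> \<eta>. 0 < \<xi> \<Longrightarrow> \<xi> < \<delta>2 \<Longrightarrow> 0 < \<eta> \<Longrightarrow> \<eta> < \<delta>2 \<Longrightarrow>
      \<bar>frechet_derivative (\<lambda>z. frechet_derivative f (at z) w) (at (x + \<xi> *\<^sub>R w + \<eta> *\<^sub>R v)) v - ?b\<bar> < \<epsilon>"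
      using close[OF eps, of w v] by blast
    have pos: "norm v + norm w + 1 > 0" by (smt (verit) norm_ge_zero)
    \<comment> \<open>Small enough for both closeness estimates and for the parallelogram spanned by
      \<open>h *\<^sub>R v\<close> and \<open>h *\<^sub>R w\<close> to stay in the ball.\<close>
    define h where "h = min (min \<delta>1 \<delta>2) (r / (norm v + norm w + 1))"
    have h: "h > 0" "h \<le> \<delta>1" "h \<le> \<delta>2" using \<delta>1 \<delta>2 r pos by (auto simp: h_def)
    have "h * (norm v + norm w) < h * (norm v + norm w + 1)" using h by simp
    also have "\<dots> \<le> r / (norm v + norm w + 1) * (norm v + norm w + 1)"
      using pos by (intro mult_right_mono) (auto simp: h_def)
    also have "\<dots> = r" using pos by simp
    finally have hr: "h * (norm v + norm w) < r" "h * (norm w + norm v) < r" by (simp_all add: add.commute)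
    obtain \<xi> \<eta> where 1: "0 < \<xi>" "\<xi> < h" "0 < \<eta>" "\<eta> < h"
      "f (x + h *\<^sub>R v + h *\<^sub>R w) - f (x + h *\<^sub>R v) - f (x + h *\<^sub>R w) + f x =
        h * h * frechet_derivative (\<lambda>z. frechet_derivative f (at z) v) (at (x + \<xi> *\<^sub>R v + \<eta> *\<^sub>R w)) w"
      using second_difference[OF sm h(1) hr(1)] by blast
    obtain \<xi>' \<eta>' where 2: "0 < \<xi>'" "\<xi>' < h" "0 < \<eta>'" "\<eta>' < h"
      "f (x + h *\<^sub>R w + h *\<^sub>R v) - f (x + h *\<^sub>R w) - f (x + h *\<^sub>R v) + f x =
        h * h * frechet_derivative (\<lambda>z. frechet_derivative f (at z) w) (at (x + \<xi>' *\<^sub>R w + \<eta>' *\<^sub>R v)) v"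
      using second_difference[OF sm h(1) hr(2)] by blast
    have comm: "x + h *\<^sub>R w + h *\<^sub>R v = x + h *\<^sub>R v + h *\<^sub>R w" by (simp add: algebra_simps)
    have "h * h * frechet_derivative (\<lambda>z. frechet_derivative f (at z) v) (at (x + \<xi> *\<^sub>R v + \<eta> *\<^sub>R w)) w =
      h * h * frechet_derivative (\<lambda>z. frechet_derivative f (at z) w) (at (x + \<xi>' *\<^sub>R w + \<eta>' *\<^sub>R v)) v"
      using 1(5) 2(5)[unfolded comm] by linarith
    then have "frechet_derivative (\<lambda>z. frechet_derivative f (at z) v) (at (x + \<xi> *\<^sub>R v + \<eta> *\<^sub>R w)) w =
      frechet_derivative (\<lambda>z. frechet_derivative f (at z) w) (at (x + \<xi>' *\<^sub>R w + \<eta>' *\<^sub>R v)) v"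
      using h(1) by simp
    moreover have "\<bar>frechet_derivative (\<lambda>z. frechet_derivative f (at z) v) (at (x + \<xi> *\<^sub>R v + \<eta> *\<^sub>R w)) w - ?a\<bar> < \<epsilon>"
      using 1 h by (intro \<delta>1(2)) auto
    moreover have "\<bar>frechet_derivative (\<lambda>z. frechet_derivative f (at z) w) (at (x + \<xi>' *\<^sub>R w + \<eta>' *\<^sub>R v)) v - ?b\<bar> < \<epsilon>"
      using 2 h by (intro \<delta>2(2)) auto
    ultimately show ?thesis by linarith
  qed
  from this[of "\<bar>?a - ?b\<bar> / 2"] show ?thesis by force
qed

text \<open>The factor \<open>inverse t ^ m\<close> makes the family closed under differentiation.\<close>

definition flat_exp :: "nat \<Rightarrow> real \<Rightarrow> real" where
  "flat_exp m t = (if t > 0 then inverse t ^ m * exp (- inverse t) else 0)"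

lemma power_le_fact_exp:
  fixes x :: real
  assumes "0 \<le> x"
  shows "x ^ n \<le> fact n * exp x"
proof -
  have "(\<Sum>k\<in>{n}. x ^ k /\<^sub>R fact k) \<le> (\<Sum>k. x ^ k /\<^sub>R fact k)"
    by (rule sum_le_suminf[OF summable_exp_generic]) (use assms in auto)
  then have "x ^ n / fact n \<le> exp x"
    by (simp add: exp_def divide_inverse mult.commute)
  then show ?thesis by (simp add: field_simps)
qed

text \<open>With \<open>x = inverse t\<close> this is
  \<open>x ^ (m + 2) \<le> fact (m + 2) * exp x\<close>. The second power of \<open>t\<close>,
  rather than the first, makes the difference quotient at 0 tend to 0.\<close>

lemma flat_exp_bound: "\<bar>flat_exp m t\<bar> \<le> fact (m + 2) * t\<^sup>2"
proof (cases "t > 0")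
  case True
  define C :: real where "C = fact (m + 2)"
  define x where "x = inverse t"
  have x: "x > 0" using True by (simp add: x_def)
  have "x ^ m * x\<^sup>2 \<le> C * exp x"
    using power_le_fact_exp[of x "m + 2"] x unfolding C_def power_add by simp
  then have "x ^ m * exp (- x) \<le> C * inverse x ^ 2"
    using x by (simp add: field_simps exp_minus)
  then show ?thesis using True unfolding C_def[symmetric] by (simp add: flat_exp_def x_def)
qed (simp add: flat_exp_def)

lemma flat_exp_has_derivative:
  "(flat_exp m has_real_derivative (flat_exp (m + 2) t - real m * flat_exp (m + 1) t)) (at t)"
proof (cases t "0::real" rule: linorder_cases)
  case less
  have "((\<lambda>t. 0) has_real_derivative 0) (at t)" by simp
  then have "(flat_exp m has_real_derivative 0) (at t)"
    by (rule has_field_derivative_transform_within_open[where S = "{..<0}"]) (use less in \<open>auto simp: flat_exp_def\<close>)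
  then show ?thesis using less by (simp add: flat_exp_def)
next
  case equal
  have "((\<lambda>h. flat_exp m h / h) \<longlongrightarrow> 0) (at 0)"
  proof (rule Lim_null_comparison)
    show "\<forall>\<^sub>F h in at 0. norm (flat_exp m h / h) \<le> fact (m + 2) * \<bar>h\<bar>"
    proof (rule eventuallyI)
      fix h :: real
      show "norm (flat_exp m h / h) \<le> fact (m + 2) * \<bar>h\<bar>"
      proof -
        have "\<bar>flat_exp m h\<bar> / \<bar>h\<bar> \<le> fact (m + 2) * (\<bar>h\<bar> * \<bar>h\<bar>) / \<bar>h\<bar>"
          using flat_exp_bound[of m h] by (intro divide_right_mono) (simp_all only: power2_eq_square abs_mult_self_eq abs_ge_zero)
        also have "\<dots> = fact (m + 2) * \<bar>h\<bar>"
        proof -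
          have "c * (a * a) / a = c * a" for c a :: real by simp
          then show ?thesis .
        qed
        finally show ?thesis by simp
      qed
    qed
    show "((\<lambda>h. fact (m + 2) * \<bar>h\<bar>) \<longlongrightarrow> 0) (at (0::real))"
      by (rule tendsto_eq_intros refl | simp)+
  qed
  then show ?thesis using equal by (simp add: DERIV_def flat_exp_def)
next
  case greater
  have 1: "((\<lambda>y. y ^ m * exp (- y)) has_real_derivative (real m * y ^ (m - 1) - y ^ m) * exp (- y)) (at y)" for y :: real
    by (auto intro!: derivative_eq_intros simp: algebra_simps)
  have "(inverse has_real_derivative - (inverse t)\<^sup>2) (at t)"
    using DERIV_inverse[of t] greater by (simp add: numeral_2_eq_2)
  from DERIV_chain2[OF 1 this]
  have "((\<lambda>t. inverse t ^ m * exp (- inverse t)) has_real_derivative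
     (real m * inverse t ^ (m - 1) - inverse t ^ m) * exp (- inverse t) * - (inverse t)\<^sup>2) (at t)" .
  moreover have "(real m * inverse t ^ (m - 1) - inverse t ^ m) * exp (- inverse t) * - (inverse t)\<^sup>2 =
     flat_exp (m + 2) t - real m * flat_exp (m + 1) t"
    using greater by (cases m) (simp_all add: flat_exp_def algebra_simps power2_eq_square)
  ultimately have "((\<lambda>t. inverse t ^ m * exp (- inverse t)) has_real_derivative
     (flat_exp (m + 2) t - real m * flat_exp (m + 1) t)) (at t)" by simp
  then show ?thesis
    by (rule has_field_derivative_transform_within_open[where S = "{0<..}"]) (use greater in \<open>auto simp: flat_exp_def\<close>)
qed

lemma Ck_on_flat_exp: "Ck_on k UNIV (flat_exp m)"
proof (induction k arbitrary: m)
  case 0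
  then show ?case
    by (simp add: continuous_at_imp_continuous_on DERIV_isCont[OF flat_exp_has_derivative])
next
  case (Suc k)
  show ?case
  proof (rule Ck_on_SucI[where f' = "\<lambda>t v. (flat_exp (m + 2) t + (- real m) * flat_exp (m + 1) t) * v"])
    show "(flat_exp m has_derivative (*) (flat_exp (m + 2) t + - real m * flat_exp (m + 1) t)) (at t)" for t
      using flat_exp_has_derivative[of m t] by (simp add: has_field_derivative_def)
    show "Ck_on k UNIV (\<lambda>t. (flat_exp (m + 2) t + - real m * flat_exp (m + 1) t) * v)" for v
      by (intro Ck_on_bilinear[OF bounded_bilinear_mult] Ck_on_add Suc.IH Ck_on_const) auto
  qed auto
qed

lemma smooth_bump:
  fixes r :: real
  assumes "r > 0"
  obtains \<beta> :: "'a::euclidean_space \<Rightarrow> real" where "smooth_on UNIV \<beta>" "\<beta> 0 = 1"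
    "\<And>x. 0 \<le> \<beta> x" "\<And>x. norm x < r \<Longrightarrow> 0 < \<beta> x" "\<And>x. r \<le> norm x \<Longrightarrow> \<beta> x = 0"
proof -
  \<comment> \<open>The factor in front cancels \<open>flat_exp 0 (r\<^sup>2)\<close> and so
    normalises the value at 0 to 1.\<close>
  define \<beta> where "\<beta> = (\<lambda>x::'a. exp (inverse (r\<^sup>2)) * flat_exp 0 (r\<^sup>2 + - (x \<bullet> x)))"
  show ?thesis
  proof
    have sq: "smooth_on UNIV (\<lambda>x::'a. r\<^sup>2 + - (x \<bullet> x))"
      by (intro smooth_on_add smooth_on_bounded_linear[OF bounded_linear_minus[OF bounded_linear_ident]] smooth_on_const
          smooth_on_bilinear[OF bounded_bilinear_inner] smooth_on_id open_UNIV)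
    have "smooth_on UNIV (flat_exp 0)" by (simp add: smooth_on_def Ck_on_flat_exp)
    from smooth_on_compose[OF open_UNIV open_UNIV sq this]
    have "smooth_on UNIV (\<lambda>x::'a. flat_exp 0 (r\<^sup>2 + - (x \<bullet> x)))" by simp
    then show "smooth_on UNIV \<beta>"
      unfolding \<beta>_def by (intro smooth_on_bilinear[OF bounded_bilinear_mult]) auto
    show "\<beta> 0 = 1" using assms by (simp add: \<beta>_def flat_exp_def exp_minus)
    show "0 \<le> \<beta> x" for x by (simp add: \<beta>_def flat_exp_def)
    show "0 < \<beta> x" if "norm x < r" for x
      using that assms by (simp add: \<beta>_def flat_exp_def power2_norm_eq_inner[symmetric] power_strict_mono)
    show "\<beta> x = 0" if "r \<le> norm x" for x
      using power_mono[OF that, of 2] assms by (simp add: \<beta>_def flat_exp_def power2_norm_eq_inner[symmetric] not_less)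
  qed
qed

text \<open>Differentiating \<open>h (t *\<^sub>R x)\<close> in \<open>x\<close> brings out a factor
  \<open>t\<close>, so the induction on \<open>k\<close> closes only for all weights
  \<open>t ^ m\<close> at once.\<close>

lemma Ck_on_radial_integral:
  fixes h :: "'a::euclidean_space \<Rightarrow> real"
  shows "Ck_on k (ball 0 R) h \<Longrightarrow> Ck_on k (ball 0 R) (\<lambda>x. integral {0..1} (\<lambda>t. t ^ m * h (t *\<^sub>R x)))"
proof (induction k arbitrary: h m)
  have inb: "t *\<^sub>R x \<in> ball 0 R" if "x \<in> ball 0 R" "t \<in> {0..1}" for x :: 'a and t :: real
    using that mult_left_le_one_le[of "norm x" t] by (auto simp: dist_norm)
  have cont: "continuous_on (ball 0 R \<times> {0..1}) (\<lambda>(x, t). t ^ m * h (t *\<^sub>R x))" if "continuous_on (ball 0 R) h"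
    for h :: "'a \<Rightarrow> real" and m
    using inb that
    by (auto intro!: continuous_intros continuous_on_compose2[OF that] simp: split_beta')
  {
    case 0
    then show ?case
      using integral_continuous_on_param[of "ball 0 R" 0 1 "\<lambda>x t. t ^ m * h (t *\<^sub>R x)"] cont[of h m]
      by (simp add: cbox_interval)
  next
    case (Suc k)
    have conth: "continuous_on (ball 0 R) h"
      by (rule Ck_on_continuous_on[OF Suc.prems])
    have Ckf: "Ck_on k (ball 0 R) (\<lambda>x. frechet_derivative h (at x) v)" for v
      by (rule Ck_on_frechet[OF Suc.prems])
    have contf: "continuous_on (ball 0 R) (\<lambda>x. frechet_derivative h (at x) v)" for v
      by (rule Ck_on_continuous_on[OF Ckf])
    let ?J = "\<lambda>x v. integral {0..1} (\<lambda>t. t ^ Suc m * frechet_derivative h (at (t *\<^sub>R x)) v)"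
    \<comment> \<open>The Leibniz rule asks for a derivative that is continuous as a bounded linear
      map; in finite dimension this follows from continuity along each basis vector.\<close>
    define B where "B = (\<lambda>x t. Blinfun (\<lambda>v. t ^ Suc m * frechet_derivative h (at (t *\<^sub>R x)) v))"
    have bl: "bounded_linear (\<lambda>v. t ^ Suc m * frechet_derivative h (at (t *\<^sub>R x)) v)"
      if "x \<in> ball 0 R" "t \<in> {0..1}" for x t
      using bounded_linear_const_mult[OF has_derivative_bounded_linear[OF Ck_on_has_derivative[OF Suc.prems inb[OF that]]]] .
    have app: "blinfun_apply (B x t) v = t ^ Suc m * frechet_derivative h (at (t *\<^sub>R x)) v"
      if "x \<in> ball 0 R" "t \<in> {0..1}" for x t v
      unfolding B_def by (subst bounded_linear_Blinfun_apply[OF bl[OF that]]) simp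
    have contB: "continuous_on (ball 0 R \<times> {0..1}) (\<lambda>(x, t). B x t)"
    proof (rule continuous_on_blinfun_componentwise)
      fix i :: 'a
      show "continuous_on (ball 0 R \<times> {0..1}) (\<lambda>z. blinfun_apply (case z of (x, t) \<Rightarrow> B x t) i)"
        using cont[OF contf[of i], of "Suc m"] by (rule continuous_on_eq) (auto simp: app)
    qed
    have contx: "continuous_on {0..1} (B x)" if "x \<in> ball 0 R" for x
    proof -
      have "continuous_on {0..1} (\<lambda>t. case (x, t) of (x, t) \<Rightarrow> B x t)"
        by (rule continuous_on_compose2[OF contB]) (use that in \<open>auto intro!: continuous_intros\<close>)
      then show ?thesis by simp
    qed
    have der: "((\<lambda>x. integral (cbox 0 1) (\<lambda>t. t ^ m * h (t *\<^sub>R x))) has_derivative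
        blinfun_apply (integral (cbox 0 1) (B x))) (at x within ball 0 R)" if x: "x \<in> ball 0 R" for x
    proof (rule leibniz_rule[OF _ _ _ x convex_ball])
      fix y :: 'a and t :: real assume yt: "y \<in> ball 0 R" "t \<in> cbox 0 1"
      then have t: "t \<in> {0..1}" by simp
      have 1: "((\<lambda>y. t *\<^sub>R y) has_derivative (\<lambda>v. t *\<^sub>R v)) (at y)" by (auto intro!: derivative_eq_intros)
      note h = Ck_on_has_derivative[OF Suc.prems inb[OF yt(1) t]]
      have "((\<lambda>y. t ^ m * h (t *\<^sub>R y)) has_derivative (\<lambda>v. t ^ m * frechet_derivative h (at (t *\<^sub>R y)) (t *\<^sub>R v))) (at y)"
        using has_derivative_mult_right[OF diff_chain_at[OF 1 h], of "t ^ m"] by (simp add: o_def)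
      moreover have "(\<lambda>v. t ^ m * frechet_derivative h (at (t *\<^sub>R y)) (t *\<^sub>R v)) = blinfun_apply (B y t)"
        by (simp add: fun_eq_iff app[OF yt(1) t] linear_scale[OF has_derivative_linear[OF h]])
      ultimately show "((\<lambda>y. t ^ m * h (t *\<^sub>R y)) has_derivative blinfun_apply (B y t)) (at y within ball 0 R)"
        by (simp add: has_derivative_at_withinI)
    next
      fix y :: 'a assume y: "y \<in> ball 0 R"
      have "continuous_on {0..1} (\<lambda>t. t ^ m * h (t *\<^sub>R y))"
      proof -
        have "continuous_on {0..1} (\<lambda>t. case (y, t) of (y, t) \<Rightarrow> t ^ m * h (t *\<^sub>R y))"
          by (rule continuous_on_compose2[OF cont[OF conth, of m]]) (use y in \<open>auto intro!: continuous_intros\<close>)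
        then show ?thesis by simp
      qed
      then show "(\<lambda>t. t ^ m * h (t *\<^sub>R y)) integrable_on cbox 0 1"
        by (simp add: integrable_continuous_interval)
    next
      show "continuous_on (ball 0 R \<times> cbox 0 1) (\<lambda>(x, t). B x t)" using contB by simp
    qed
    show ?case
    proof (rule Ck_on_SucI)
      fix x :: 'a assume x: "x \<in> ball 0 R"
      have "blinfun_apply (integral (cbox 0 1) (B x)) v = ?J x v" for v
      proof -
        have "B x integrable_on {0..1}" using contx[OF x] by (simp add: integrable_continuous_interval)
        from integral_linear[OF this, of "\<lambda>b. blinfun_apply b v"]
        have "blinfun_apply (integral (cbox 0 1) (B x)) v = integral {0..1} (\<lambda>t. blinfun_apply (B x t) v)"
          by (simp add: o_def blinfun.bounded_linear_left)
        also have "\<dots> = ?J x v" by (rule integral_cong) (simp add: app[OF x] )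
        finally show ?thesis .
      qed
      then have eq: "blinfun_apply (integral (cbox 0 1) (B x)) = ?J x" by (rule ext)
      show "((\<lambda>x. integral {0..1} (\<lambda>t. t ^ m * h (t *\<^sub>R x))) has_derivative ?J x) (at x)"
        using der[OF x] unfolding eq at_within_open[OF x open_ball] by (simp only: box_real)
    next
      show "Ck_on k (ball 0 R) (\<lambda>x. ?J x v)" for v
        by (rule Suc.IH[OF Ckf])
    qed auto
  }
qed

text \<open>Fundamental theorem of calculus along the ray from 0 to \<open>x\<close>. The
  coefficients are averages of partial derivatives over that ray, and radial averages of smooth
  functions are smooth.\<close>

lemma Hadamard:
  fixes w :: "'a::euclidean_space \<Rightarrow> real"
  assumes "smooth_on (ball 0 R) w"
  obtains W where "\<And>b. smooth_on (ball 0 R) (W b)"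
    "\<And>b. W b 0 = frechet_derivative w (at 0) b"
    "\<And>x. x \<in> ball 0 R \<Longrightarrow> w x = w 0 + (\<Sum>b\<in>Basis. (x \<bullet> b) * W b x)"
proof -
  define W where "W = (\<lambda>b x. integral {0..1} (\<lambda>t. t ^ 0 * frechet_derivative w (at (t *\<^sub>R x)) b))"
  show ?thesis
  proof
    show "smooth_on (ball 0 R) (W b)" for b
      unfolding smooth_on_def W_def
    proof
      fix k
      show "Ck_on k (ball 0 R) (\<lambda>x. integral {0..1} (\<lambda>t. t ^ 0 * frechet_derivative w (at (t *\<^sub>R x)) b))"
        by (rule Ck_on_radial_integral) (use smooth_on_frechet[OF assms] in \<open>simp add: smooth_on_def\<close>)
    qed
    show "W b 0 = frechet_derivative w (at 0) b" for b by (simp add: W_def)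
    fix x :: 'a assume x: "x \<in> ball 0 R"
    have inb: "t *\<^sub>R x \<in> ball 0 R" if "t \<in> {0..1}" for t :: real
      using that x mult_left_le_one_le[of "norm x" t] by (auto simp: dist_norm)
    have der: "((\<lambda>t. w (t *\<^sub>R x)) has_vector_derivative frechet_derivative w (at (t *\<^sub>R x)) x) (at t within {0..1})"
      if "t \<in> {0..1}" for t
      using has_real_derivative_along_line[of w "frechet_derivative w (at (t *\<^sub>R x))" 0 t x]
        smooth_on_has_derivative[OF assms inb[OF that]]
      by (auto simp: has_real_derivative_iff_has_vector_derivative intro: has_vector_derivative_at_within)
    have "((\<lambda>t. frechet_derivative w (at (t *\<^sub>R x)) x) has_integral (w (1 *\<^sub>R x) - w (0 *\<^sub>R x))) {0..1}"
      by (rule fundamental_theorem_of_calculus) (use der in auto)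
    then have "w x - w 0 = integral {0..1} (\<lambda>t. frechet_derivative w (at (t *\<^sub>R x)) x)"
      by (simp add: integral_unique)
    also have "\<dots> = integral {0..1} (\<lambda>t. \<Sum>b\<in>Basis. (x \<bullet> b) * frechet_derivative w (at (t *\<^sub>R x)) b)"
    proof (rule integral_cong)
      fix t :: real assume "t \<in> {0..1}"
      note lin = has_derivative_linear[OF smooth_on_has_derivative[OF assms inb[OF this]]]
      show "frechet_derivative w (at (t *\<^sub>R x)) x = (\<Sum>b\<in>Basis. (x \<bullet> b) * frechet_derivative w (at (t *\<^sub>R x)) b)"
        using linear_sum[OF lin, of "\<lambda>b. (x \<bullet> b) *\<^sub>R b" Basis]
        by (simp add: euclidean_representation linear_scale[OF lin])
    qed
    also have "\<dots> = (\<Sum>b\<in>Basis. (x \<bullet> b) * W b x)"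
    proof -
      have "(\<lambda>t. frechet_derivative w (at (t *\<^sub>R x)) b) integrable_on {0..1}" for b
        by (rule integrable_continuous_interval)
          (rule continuous_on_compose2[OF smooth_on_continuous_on[OF smooth_on_frechet[OF assms]]],
            use inb in \<open>auto intro!: continuous_intros\<close>)
      then show ?thesis by (simp add: integral_sum W_def integrable_on_mult_right)
    qed
    finally show "w x = w 0 + (\<Sum>b\<in>Basis. (x \<bullet> b) * W b x)" by simp
  qed
qed

section \<open>Smooth maps into a Lie group\<close>

lemma open_Int_vimage: "open S \<Longrightarrow> continuous_on S F \<Longrightarrow> open W \<Longrightarrow> open (S \<inter> F -` W)"
  by (metis continuous_on_open_vimage Int_commute)

lemma continuous_on_minus':
  fixes F :: "'c::topological_space \<Rightarrow> 'a::topological_group_add"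
  shows "continuous_on S F \<Longrightarrow> continuous_on S (\<lambda>x. - F x)"
  unfolding continuous_on_def by (auto intro: tendsto_minus)

locale lie =
  fixes A :: "('g::{topological_group_add, t2_space, second_countable_topology}, 'e::euclidean_space) atlas"
  assumes lie: "lie_group A"
begin

lemma chart_ex: obtains W \<kappa> where "(W, \<kappa>) \<in> A" "p \<in> W"
proof -
  have "p \<in> (\<Union>(U, \<phi>)\<in>A. U)" using lie by (auto simp: lie_group_def smooth_atlas_def)
  then show ?thesis using that by auto
qed

lemma
  assumes "(W, \<kappa>) \<in> A"
  shows chart_open: "open W" and chart_image_open: "open (\<kappa> ` W)"
    and chart_cont: "continuous_on W \<kappa>" and chart_inv_cont: "continuous_on (\<kappa> ` W) (inv_into W \<kappa>)"
    and chart_inj: "inj_on \<kappa> W"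
proof -
  have *: "open W \<and> open (\<kappa> ` W) \<and> homeomorphism W (\<kappa> ` W) \<kappa> (inv_into W \<kappa>)"
    using lie assms unfolding lie_group_def smooth_atlas_def by blast
  then show "open W" "open (\<kappa> ` W)" "continuous_on W \<kappa>" "continuous_on (\<kappa> ` W) (inv_into W \<kappa>)"
    by (auto simp: homeomorphism_def)
  show "inj_on \<kappa> W"
    using * by (intro inj_on_inverseI[where g = "inv_into W \<kappa>"]) (auto simp: homeomorphism_def)
qed

lemma chart_inv_left: "(W, \<kappa>) \<in> A \<Longrightarrow> p \<in> W \<Longrightarrow> inv_into W \<kappa> (\<kappa> p) = p"
  using chart_inj by simp

lemma chart_transition:
  "(U, \<phi>) \<in> A \<Longrightarrow> (W, \<kappa>) \<in> A \<Longrightarrow> smooth_on (\<phi> ` (U \<inter> W)) (\<lambda>x. \<kappa> (inv_into U \<phi> x))"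
  using lie unfolding lie_group_def smooth_atlas_def by (fastforce simp: o_def)

lemma chart_add:
  "(U, \<phi>) \<in> A \<Longrightarrow> (U', \<phi>') \<in> A \<Longrightarrow> (W, \<psi>) \<in> A \<Longrightarrow>
    smooth_on {(x, y). x \<in> \<phi> ` U \<and> y \<in> \<phi>' ` U' \<and> inv_into U \<phi> x + inv_into U' \<phi>' y \<in> W}
          (\<lambda>(x, y). \<psi> (inv_into U \<phi> x + inv_into U' \<phi>' y))"
  using lie unfolding lie_group_def by fast

lemma chart_uminus:
  "(U, \<phi>) \<in> A \<Longrightarrow> (W, \<psi>) \<in> A \<Longrightarrow>
    smooth_on {x \<in> \<phi> ` U. - inv_into U \<phi> x \<in> W} (\<lambda>x. \<psi> (- inv_into U \<phi> x))"
  using lie unfolding lie_group_def by fast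

text \<open>Smooth maps from Euclidean space into the group. Continuity is a separate clause because
  it makes the preimage of a chart domain open, and \<open>smooth_on\<close> is meant for open
  sets.\<close>

definition smap :: "'a::euclidean_space set \<Rightarrow> ('a \<Rightarrow> 'g) \<Rightarrow> bool" where
  "smap S F \<longleftrightarrow> open S \<and> continuous_on S F \<and> (\<forall>(W, \<kappa>)\<in>A. smooth_on (S \<inter> F -` W) (\<lambda>x. \<kappa> (F x)))"

lemma smapD: "smap S F \<Longrightarrow> (W, \<kappa>) \<in> A \<Longrightarrow> smooth_on (S \<inter> F -` W) (\<lambda>x. \<kappa> (F x))"
  by (auto simp: smap_def)

lemma smap_open: "smap S F \<Longrightarrow> open S" and smap_cont: "smap S F \<Longrightarrow> continuous_on S F"
  by (auto simp: smap_def)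

lemma smap_openD: "smap S F \<Longrightarrow> open W \<Longrightarrow> open (S \<inter> F -` W)"
  by (simp add: smap_def open_Int_vimage)

lemma smap_const: "open S \<Longrightarrow> smap S (\<lambda>x. p)"
proof -
  assume S: "open S"
  have "open (S \<inter> (\<lambda>x. p) -` W)" for W using S by (auto simp: vimage_def)
  then show ?thesis using S by (auto simp: smap_def)
qed

lemma smap_inv_chart:
  assumes "(U, \<phi>) \<in> A"
  shows "smap (\<phi> ` U) (inv_into U \<phi>)"
  unfolding smap_def
proof (intro conjI ballI, goal_cases)
  case (3 C)
  obtain W \<kappa> where C: "C = (W, \<kappa>)" by force
  have "\<phi> ` U \<inter> inv_into U \<phi> -` W = \<phi> ` (U \<inter> W)"
    using chart_inv_left[OF assms] by auto
  then show ?case using chart_transition[OF assms] 3 by (simp add: C)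
qed (use chart_image_open chart_inv_cont assms in auto)

lemma smap_compose:
  assumes "smap S F" "open T" "smooth_on T k" "\<And>x. x \<in> T \<Longrightarrow> k x \<in> S"
  shows "smap T (\<lambda>x. F (k x))"
  unfolding smap_def
proof (intro conjI ballI, goal_cases)
  case 2
  show ?case
    by (rule continuous_on_compose2[OF smap_cont[OF assms(1)] smooth_on_continuous_on[OF assms(3)]]) (use assms in auto)
next
  case (3 C)
  obtain W \<kappa> where C: "C = (W, \<kappa>)" by force
  have W: "(W, \<kappa>) \<in> A" using 3 C by simp
  have "T \<inter> (\<lambda>x. F (k x)) -` W = T \<inter> k -` (S \<inter> F -` W)" using assms(4) by auto
  then have op: "open (T \<inter> (\<lambda>x. F (k x)) -` W)"
    using open_Int_vimage[OF assms(2) smooth_on_continuous_on[OF assms(3)] smap_openD[OF assms(1) chart_open[OF W]]] by simp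
  have "smooth_on (T \<inter> (\<lambda>x. F (k x)) -` W) (\<lambda>x. \<kappa> (F (k x)))"
    by (rule smooth_on_compose[OF op smap_openD[OF assms(1) chart_open[OF W]] _ smapD[OF assms(1) W]])
      (use assms in \<open>auto intro: smooth_on_subset[OF assms(3)]\<close>)
  then show ?case using C by simp
qed (use assms in auto)

lemma smooth_fun_comp_inv:
  "smooth_fun A u \<Longrightarrow> (W, \<kappa>) \<in> A \<Longrightarrow> smooth_on (\<kappa> ` W) (\<lambda>x. u (inv_into W \<kappa> x))"
  by (fastforce simp: smooth_fun_def o_def)

lemma smooth_funI:
  assumes "\<And>W \<kappa>. (W, \<kappa>) \<in> A \<Longrightarrow> smooth_on (\<kappa> ` W) (\<lambda>x. u (inv_into W \<kappa> x))"
  shows "smooth_fun A u"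
  using assms by (fastforce simp: smooth_fun_def o_def)

lemma smap_smooth_fun:
  assumes "smap S F" "smooth_fun A u"
  shows "smooth_on S (\<lambda>x. u (F x))"
proof (rule smooth_on_local)
  fix x assume x: "x \<in> S"
  obtain W \<kappa> where W: "(W, \<kappa>) \<in> A" "F x \<in> W" by (rule chart_ex)
  let ?T = "S \<inter> F -` W"
  have op: "open ?T" by (rule smap_openD[OF assms(1) chart_open[OF W(1)]])
  have "smooth_on ?T (\<lambda>x. u (inv_into W \<kappa> (\<kappa> (F x))))"
    by (rule smooth_on_compose[OF op chart_image_open[OF W(1)] smapD[OF assms(1) W(1)] smooth_fun_comp_inv[OF assms(2) W(1)]]) auto
  then have "smooth_on ?T (\<lambda>x. u (F x))"
    by (rule smooth_on_cong[OF op, rotated]) (simp add: chart_inv_left[OF W(1)])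
  then show "\<exists>T. open T \<and> x \<in> T \<and> smooth_on T (\<lambda>x. u (F x))"
    using op x W by blast
qed

lemma smap_add:
  assumes F: "smap S F" and G: "smap S G"
  shows "smap S (\<lambda>x. F x + G x)"
  unfolding smap_def
proof (intro conjI ballI, goal_cases)
  case 1
  then show ?case using F by (rule smap_open)
next
  case 2
  then show ?case using F G by (intro continuous_on_add smap_cont)
next
  case (3 C)
  obtain W \<kappa> where C: "C = (W, \<kappa>)" by force
  have W: "(W, \<kappa>) \<in> A" using 3 C by simp
  have opW: "open (S \<inter> (\<lambda>x. F x + G x) -` W)"
    using F G by (intro open_Int_vimage smap_open[OF F] continuous_on_add smap_cont chart_open[OF W])
  have "smooth_on (S \<inter> (\<lambda>x. F x + G x) -` W) (\<lambda>x. \<kappa> (F x + G x))"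
  proof (rule smooth_on_local)
    fix x assume x: "x \<in> S \<inter> (\<lambda>x. F x + G x) -` W"
    obtain U1 \<phi>1 where U1: "(U1, \<phi>1) \<in> A" "F x \<in> U1" by (rule chart_ex)
    obtain U2 \<phi>2 where U2: "(U2, \<phi>2) \<in> A" "G x \<in> U2" by (rule chart_ex)
    \<comment> \<open>Near \<open>x\<close> each of \<open>F\<close>, \<open>G\<close> and their sum
      stays in a single chart, where the smoothness of the group law is available in
      coordinates.\<close>
    let ?T = "(S \<inter> (\<lambda>x. F x + G x) -` W) \<inter> (S \<inter> F -` U1) \<inter> (S \<inter> G -` U2)"
    have op: "open ?T"
      by (intro open_Int opW smap_openD[OF F chart_open[OF U1(1)], unfolded Int_def]
          smap_openD[OF F chart_open[OF U1(1)]] smap_openD[OF G chart_open[OF U2(1)]])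
    let ?P = "\<phi>1 ` U1 \<times> \<phi>2 ` U2"
    let ?m = "\<lambda>z. inv_into U1 \<phi>1 (fst z) + inv_into U2 \<phi>2 (snd z)"
    let ?M = "{(x, y). x \<in> \<phi>1 ` U1 \<and> y \<in> \<phi>2 ` U2 \<and> inv_into U1 \<phi>1 x + inv_into U2 \<phi>2 y \<in> W}"
    have "continuous_on ?P ?m"
      by (intro continuous_intros continuous_on_compose2[OF chart_inv_cont[OF U1(1)] continuous_on_fst[OF continuous_on_id]]
          continuous_on_compose2[OF chart_inv_cont[OF U2(1)] continuous_on_snd[OF continuous_on_id]]) auto
    then have "open (?P \<inter> ?m -` W)"
      by (intro open_Int_vimage open_Times chart_image_open[OF U1(1)] chart_image_open[OF U2(1)] chart_open[OF W])
    also have "?P \<inter> ?m -` W = ?M" by auto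
    finally have opM: "open ?M" .
    have pr: "smooth_on ?T (\<lambda>x. (\<phi>1 (F x), \<phi>2 (G x)))"
      by (intro smooth_on_Pair op smooth_on_subset[OF smapD[OF F U1(1)]] smooth_on_subset[OF smapD[OF G U2(1)]]) auto
    have "smooth_on ?T (\<lambda>x. (\<lambda>(x, y). \<kappa> (inv_into U1 \<phi>1 x + inv_into U2 \<phi>2 y)) (\<phi>1 (F x), \<phi>2 (G x)))"
      by (rule smooth_on_compose[OF op opM pr chart_add[OF U1(1) U2(1) W]])
        (auto simp: chart_inv_left[OF U1(1)] chart_inv_left[OF U2(1)])
    then have "smooth_on ?T (\<lambda>x. \<kappa> (F x + G x))"
      by (rule smooth_on_cong[OF op, rotated]) (auto simp: chart_inv_left[OF U1(1)] chart_inv_left[OF U2(1)])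
    then show "\<exists>T. open T \<and> x \<in> T \<and> smooth_on T (\<lambda>x. \<kappa> (F x + G x))"
      using op x U1 U2 by (intro exI[of _ ?T]) auto
  qed
  then show ?case using C by simp
qed

lemma smap_uminus:
  assumes F: "smap S F"
  shows "smap S (\<lambda>x. - F x)"
  unfolding smap_def
proof (intro conjI ballI, goal_cases)
  case 1
  then show ?case using F by (rule smap_open)
next
  case 2
  then show ?case using F by (intro continuous_on_minus' smap_cont)
next
  case (3 C)
  obtain W \<kappa> where C: "C = (W, \<kappa>)" by force
  have W: "(W, \<kappa>) \<in> A" using 3 C by simp
  have opW: "open (S \<inter> (\<lambda>x. - F x) -` W)"
    using F by (intro open_Int_vimage smap_open[OF F] continuous_on_minus' smap_cont chart_open[OF W])
  have "smooth_on (S \<inter> (\<lambda>x. - F x) -` W) (\<lambda>x. \<kappa> (- F x))"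
  proof (rule smooth_on_local)
    fix x assume x: "x \<in> S \<inter> (\<lambda>x. - F x) -` W"
    obtain U1 \<phi>1 where U1: "(U1, \<phi>1) \<in> A" "F x \<in> U1" by (rule chart_ex)
    let ?T = "(S \<inter> (\<lambda>x. - F x) -` W) \<inter> (S \<inter> F -` U1)"
    have op: "open ?T"
      by (intro open_Int[OF opW] smap_openD[OF F chart_open[OF U1(1)]])
    let ?M = "{x \<in> \<phi>1 ` U1. - inv_into U1 \<phi>1 x \<in> W}"
    have "open (\<phi>1 ` U1 \<inter> (\<lambda>x. - inv_into U1 \<phi>1 x) -` W)"
      by (intro open_Int_vimage chart_image_open[OF U1(1)] chart_open[OF W] continuous_on_minus' chart_inv_cont[OF U1(1)])
    also have "\<phi>1 ` U1 \<inter> (\<lambda>x. - inv_into U1 \<phi>1 x) -` W = ?M" by auto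
    finally have opM: "open ?M" .
    have pr: "smooth_on ?T (\<lambda>x. \<phi>1 (F x))"
      by (rule smooth_on_subset[OF smapD[OF F U1(1)]]) auto
    have "smooth_on ?T (\<lambda>x. \<kappa> (- inv_into U1 \<phi>1 (\<phi>1 (F x))))"
      by (rule smooth_on_compose[OF op opM pr chart_uminus[OF U1(1) W]])
        (auto simp: chart_inv_left[OF U1(1)])
    then have "smooth_on ?T (\<lambda>x. \<kappa> (- F x))"
      by (rule smooth_on_cong[OF op, rotated]) (auto simp: chart_inv_left[OF U1(1)])
    then show "\<exists>T. open T \<and> x \<in> T \<and> smooth_on T (\<lambda>x. \<kappa> (- F x))"
      using op x U1 by (intro exI[of _ ?T]) auto
  qed
  then show ?case using C by simp
qed

lemma smooth_fun_translate:
  assumes "smooth_fun A u"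
  shows "smooth_fun A (\<lambda>p. u (g + p + h))"
proof (rule smooth_funI)
  fix W \<kappa> assume W: "(W, \<kappa>) \<in> A"
  show "smooth_on (\<kappa> ` W) (\<lambda>x. u (g + inv_into W \<kappa> x + h))"
    by (intro smap_smooth_fun[OF _ assms] smap_add smap_const smap_inv_chart[OF W] chart_image_open[OF W])
qed

lemma smooth_fun_left: "smooth_fun A u \<Longrightarrow> smooth_fun A (\<lambda>p. u (g + p))"
  using smooth_fun_translate[of u g 0] by simp

lemma smooth_fun_right: "smooth_fun A u \<Longrightarrow> smooth_fun A (\<lambda>p. u (p + h))"
  using smooth_fun_translate[of u 0 h] by simp

lemma smooth_fun_cont: "smooth_fun A u \<Longrightarrow> continuous_on UNIV u"
proof (rule continuous_at_imp_continuous_on, rule ballI)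
  fix p assume u: "smooth_fun A u"
  obtain W \<kappa> where W: "(W, \<kappa>) \<in> A" "p \<in> W" by (rule chart_ex)
  have "continuous_on W (\<lambda>p. u (inv_into W \<kappa> (\<kappa> p)))"
    by (rule continuous_on_compose2[OF smooth_on_continuous_on[OF smooth_fun_comp_inv[OF u W(1)]] chart_cont[OF W(1)]]) auto
  then have "continuous_on W u"
    by (rule continuous_on_eq) (simp add: chart_inv_left[OF W(1)])
  then show "isCont u p" using chart_open[OF W(1)] W(2) by (simp add: continuous_on_eq_continuous_at)
qed

lemma smooth_fun_const: "smooth_fun A (\<lambda>p. c)"
  by (rule smooth_funI) (simp add: chart_image_open)

lemma smooth_fun_add: "smooth_fun A u \<Longrightarrow> smooth_fun A v \<Longrightarrow> smooth_fun A (\<lambda>p. u p + v p)"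
  by (rule smooth_funI) (intro smooth_on_add chart_image_open smooth_fun_comp_inv)

lemma smooth_fun_sum: "(\<And>i. i \<in> I \<Longrightarrow> smooth_fun A (u i)) \<Longrightarrow> smooth_fun A (\<lambda>p. \<Sum>i\<in>I. u i p)"
  by (rule smooth_funI) (intro smooth_on_sum chart_image_open smooth_fun_comp_inv)

lemma smooth_fun_scaleR: "smooth_fun A u \<Longrightarrow> smooth_fun A v \<Longrightarrow> smooth_fun A (\<lambda>p. u p *\<^sub>R v p)"
  by (rule smooth_funI) (intro smooth_on_bilinear[OF bounded_bilinear_scaleR] chart_image_open smooth_fun_comp_inv)

lemma smooth_fun_mult:
  fixes u v :: "'g \<Rightarrow> real"
  shows "smooth_fun A u \<Longrightarrow> smooth_fun A v \<Longrightarrow> smooth_fun A (\<lambda>p. u p * v p)"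
  using smooth_fun_scaleR[of u v] by simp

end

section \<open>Coordinates centred at the identity\<close>

locale lie0 = lie A for A :: "('g::{topological_group_add, t2_space, second_countable_topology}, 'e::euclidean_space) atlas" +
  fixes U0 :: "'g set" and \<phi> :: "'g \<Rightarrow> 'e"
  assumes chart0: "(U0, \<phi>) \<in> A" and zero_in_U0: "0 \<in> U0"
begin

text \<open>
  The maps \<open>co\<close> and \<open>ex\<close> are mutually inverse between \<open>U0\<close> and \<open>D0\<close> only.
\<close>

definition co :: "'g \<Rightarrow> 'e" where "co p = \<phi> p - \<phi> 0"
definition ex :: "'e \<Rightarrow> 'g" where "ex x = inv_into U0 \<phi> (x + \<phi> 0)"
definition D0 :: "'e set" where "D0 = co ` U0"

lemma co_0 [simp]: "co 0 = 0" by (simp add: co_def)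

lemma U0_open: "open U0" by (rule chart_open[OF chart0])

lemma D0_eq: "D0 = (\<lambda>x. x + \<phi> 0) -` (\<phi> ` U0)"
  unfolding D0_def co_def by (auto simp: image_iff eq_diff_eq)

lemma D0_open: "open D0"
  unfolding D0_eq by (intro continuous_open_vimage chart_image_open[OF chart0] allI continuous_intros)

lemma zero_in_D0 [simp]: "0 \<in> D0" using zero_in_U0 by (force simp: D0_def)

lemma ex_co: "p \<in> U0 \<Longrightarrow> ex (co p) = p"
  by (simp add: ex_def co_def chart_inv_left[OF chart0])

lemma ex_0 [simp]: "ex 0 = 0" using ex_co[OF zero_in_U0] by simp

lemma co_ex: "x \<in> D0 \<Longrightarrow> co (ex x) = x" by (auto simp: D0_def ex_co)

lemma ex_in_U0: "x \<in> D0 \<Longrightarrow> ex x \<in> U0" by (auto simp: D0_def ex_co)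

lemma co_in_D0: "p \<in> U0 \<Longrightarrow> co p \<in> D0" by (simp add: D0_def)

lemma co_cont: "continuous_on U0 co"
  unfolding co_def by (intro continuous_intros chart_cont[OF chart0])

lemma smap_ex: "smap D0 ex"
  unfolding ex_def
  by (rule smap_compose[OF smap_inv_chart[OF chart0] D0_open])
    (auto simp: D0_eq D0_open[unfolded D0_eq] intro!: smooth_on_add smooth_on_id)

lemma ex_cont: "continuous_on D0 ex" by (rule smap_cont[OF smap_ex])

lemma smap_co: "smap S F \<Longrightarrow> smooth_on (S \<inter> F -` U0) (\<lambda>x. co (F x))"
proof -
  assume F: "smap S F"
  have op: "open (S \<inter> F -` U0)" by (rule smap_openD[OF F U0_open])
  from smooth_on_add[OF op smapD[OF F chart0] smooth_on_const[OF op, of "- \<phi> 0"]]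
  show ?thesis by (simp add: co_def)
qed

text \<open>The image of \<open>cball 0 r\<close> under \<open>ex\<close> is compact, hence closed
  in the Hausdorff group. The function is smooth on \<open>U0\<close> and zero on the open
  complement of that image, and these two open sets cover the group.\<close>

lemma smooth_fun_extend:
  fixes w :: "'e \<Rightarrow> 'b::real_normed_vector"
  assumes "smooth_on D0 w" "cball 0 r \<subseteq> D0" "\<And>x. x \<in> D0 \<Longrightarrow> r \<le> norm x \<Longrightarrow> w x = 0"
  shows "smooth_fun A (\<lambda>p. if p \<in> U0 then w (co p) else 0)"
proof (rule smooth_funI)
  fix W \<kappa> assume W: "(W, \<kappa>) \<in> A"
  let ?f = "\<lambda>p. if p \<in> U0 then w (co p) else 0"
  let ?S = "\<kappa> ` W" and ?F = "inv_into W \<kappa>"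
  note F = smap_inv_chart[OF W]
  define K where "K = ex ` cball 0 r"
  have "compact K" unfolding K_def
    by (intro compact_continuous_image continuous_on_subset[OF ex_cont assms(2)]) simp
  then have opK: "open (- K)" by (simp add: compact_imp_closed open_closed)
  have zero: "?f p = 0" if "p \<in> - K" for p
  proof (cases "p \<in> U0")
    case True
    have "r \<le> norm (co p)"
    proof (rule ccontr)
      assume "\<not> r \<le> norm (co p)"
      then have "p \<in> K" using ex_co[OF True] unfolding K_def by (intro image_eqI[of _ _ "co p"]) auto
      then show False using that by simp
    qed
    then show ?thesis using assms(3)[OF co_in_D0[OF True]] by simp
  qed simp
  have K: "K \<subseteq> U0" unfolding K_def using assms(2) ex_in_U0 by auto
  show "smooth_on ?S (\<lambda>x. ?f (?F x))"
  proof (rule smooth_on_local)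
    fix x assume x: "x \<in> ?S"
    show "\<exists>T. open T \<and> x \<in> T \<and> smooth_on T (\<lambda>x. ?f (?F x))"
    proof (cases "?F x \<in> U0")
      case True
      let ?T = "?S \<inter> ?F -` U0"
      have op: "open ?T" by (rule smap_openD[OF F U0_open])
      have "smooth_on ?T (\<lambda>x. w (co (?F x)))"
        by (rule smooth_on_compose[OF op D0_open smap_co[OF F] assms(1)]) (auto intro: co_in_D0)
      then have "smooth_on ?T (\<lambda>x. ?f (?F x))"
        by (rule smooth_on_cong[OF op, rotated]) auto
      then show ?thesis using op True x by blast
    next
      case False
      let ?T = "?S \<inter> ?F -` (- K)"
      have op: "open ?T" by (rule smap_openD[OF F opK])
      have "smooth_on ?T (\<lambda>x. ?f (?F x))"
        by (rule smooth_on_cong[OF op _ smooth_on_const[OF op, of 0]]) (use zero in auto)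
      then show ?thesis using op False x K by blast
    qed
  qed
qed

lemma small_ball:
  assumes "open N" "0 \<in> N"
  obtains r where "r > 0" "cball 0 r \<subseteq> D0" "ex ` cball 0 r \<subseteq> N"
proof -
  have "open (D0 \<inter> ex -` N)" by (rule smap_openD[OF smap_ex assms(1)])
  moreover have "0 \<in> D0 \<inter> ex -` N" using assms by simp
  ultimately obtain r where "r > 0" "cball 0 r \<subseteq> D0 \<inter> ex -` N" by (meson open_contains_cball)
  then show ?thesis using that by blast
qed

lemma bump_fun:
  assumes "open N" "0 \<in> N"
  obtains \<beta> K where "smooth_fun A \<beta>" "\<beta> 0 = (1::real)" "\<And>p. 0 \<le> \<beta> p" "\<And>p. p \<notin> K \<Longrightarrow> \<beta> p = 0"
    "compact K" "K \<subseteq> N" "K \<subseteq> U0"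
proof -
  obtain r where r: "r > 0" "cball 0 r \<subseteq> D0" "ex ` cball 0 r \<subseteq> N" by (rule small_ball[OF assms])
  obtain b :: "'e \<Rightarrow> real" where b: "smooth_on UNIV b" "b 0 = 1"
    "\<And>x. 0 \<le> b x" "\<And>x. norm x < r \<Longrightarrow> 0 < b x" "\<And>x. r \<le> norm x \<Longrightarrow> b x = 0"
    using smooth_bump[OF r(1), where 'a = 'e] by metis
  show ?thesis
  proof (rule that[of "\<lambda>p. if p \<in> U0 then b (co p) else 0" "ex ` cball 0 r"])
    show "smooth_fun A (\<lambda>p. if p \<in> U0 then b (co p) else 0)"
      by (rule smooth_fun_extend[OF smooth_on_subset[OF b(1)] r(2)]) (use b in auto)
    show "compact (ex ` cball 0 r)"
      by (intro compact_continuous_image continuous_on_subset[OF ex_cont r(2)]) simp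
    show "ex ` cball 0 r \<subseteq> U0" using r(2) ex_in_U0 by auto
    fix p assume p: "p \<notin> ex ` cball 0 r"
    show "(if p \<in> U0 then b (co p) else 0) = 0"
    proof (cases "p \<in> U0")
      case True
      then have "\<not> norm (co p) \<le> r" using p ex_co[OF True] by (metis image_eqI mem_cball_0)
      then show ?thesis using b(5)[of "co p"] by simp
    qed simp
  qed (use b r zero_in_U0 in auto)
qed

section \<open>Derivations at the identity\<close>

text \<open>
  Differentiability at a single point which \<open>F\<close> sends to the identity; other points are reduced to this by
  left translation.
\<close>

definition tang :: "('a::real_normed_vector \<Rightarrow> 'g) \<Rightarrow> ('a \<Rightarrow> 'e) \<Rightarrow> 'a \<Rightarrow> bool" where
  "tang F F' x0 \<longleftrightarrow> F x0 = 0 \<and> isCont F x0 \<and> ((\<lambda>x. co (F x)) has_derivative F') (at x0)"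

text \<open>The left-invariant vector field with value \<open>v\<close> at the identity, applied to
  \<open>u\<close> at \<open>p\<close>.\<close>

definition L :: "'e \<Rightarrow> ('g \<Rightarrow> real) \<Rightarrow> 'g \<Rightarrow> real" where
  "L v u p = frechet_derivative (\<lambda>x. u (p + ex x)) (at 0) v"

definition Ad :: "'g \<Rightarrow> 'e \<Rightarrow> 'e" where
  "Ad g v = frechet_derivative (\<lambda>x. co (g + ex x + - g)) (at 0) v"

lemma L_has_derivative:
  assumes "smooth_fun A u"
  shows "((\<lambda>x. u (p + ex x)) has_derivative (\<lambda>v. L v u p)) (at 0)"
  unfolding L_def
  by (rule smooth_on_has_derivative[OF smap_smooth_fun[OF smap_add[OF smap_const[OF D0_open] smap_ex] assms] zero_in_D0])

lemma L_linear: "smooth_fun A u \<Longrightarrow> linear (\<lambda>v. L v u p)"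
  by (rule has_derivative_linear[OF L_has_derivative])

lemma L_left: "L v (\<lambda>q. u (g + q)) p = L v u (g + p)"
  by (simp add: L_def add.assoc)

lemma tang_derivative: "tang F F' x0 \<Longrightarrow> ((\<lambda>x. co (F x)) has_derivative F') (at x0)"
  by (simp add: tang_def)

lemma tang_eventually_U0: "tang F F' x0 \<Longrightarrow> \<forall>\<^sub>F x in nhds x0. F x \<in> U0"
proof -
  assume F: "tang F F' x0"
  then have "F x0 = 0" "F \<midarrow>x0\<rightarrow> F x0" by (auto simp: tang_def isCont_def)
  then have "\<forall>\<^sub>F x in at x0. F x \<in> U0"
    using topological_tendstoD[of F 0 "at x0" U0] U0_open zero_in_U0 by simp
  then show ?thesis using F zero_in_U0 by (simp add: tang_def eventually_nhds_conv_at)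
qed

lemma tang_cong:
  assumes "tang F F' x0" "\<forall>\<^sub>F x in nhds x0. F x = G x"
  shows "tang G F' x0"
proof -
  have *: "F x0 = G x0" "\<forall>\<^sub>F x in at x0. F x = G x"
    using assms(2) by (auto simp: eventually_nhds_conv_at)
  have "isCont G x0"
    using assms(1) isCont_cong[OF assms(2)] by (simp add: tang_def)
  moreover have "((\<lambda>x. co (G x)) has_derivative F') (at x0)"
    by (rule has_derivative_transform_eventually[OF tang_derivative[OF assms(1)]])
      (use * in \<open>auto elim: eventually_mono\<close>)
  ultimately show ?thesis using assms(1) * by (simp add: tang_def)
qed

lemma tang_unique: "tang F F1 x0 \<Longrightarrow> tang F F2 x0 \<Longrightarrow> F1 = F2"
  unfolding tang_def using has_derivative_unique by blast

lemma tang_bounded_linear: "tang F F' x0 \<Longrightarrow> bounded_linear F'"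
  unfolding tang_def using has_derivative_bounded_linear by blast

lemma tang_const: "tang (\<lambda>x. 0) (\<lambda>x. 0) x0"
  by (simp add: tang_def)

lemma tang_smap:
  assumes "smap S F" "x0 \<in> S" "F x0 = 0"
  shows "tang F (frechet_derivative (\<lambda>x. co (F x)) (at x0)) x0"
  unfolding tang_def
proof (intro conjI assms)
  show "isCont F x0"
    using smap_cont[OF assms(1)] smap_open[OF assms(1)] assms(2) by (simp add: continuous_on_eq_continuous_at)
  show "((\<lambda>x. co (F x)) has_derivative frechet_derivative (\<lambda>x. co (F x)) (at x0)) (at x0)"
    by (rule smooth_on_has_derivative[OF smap_co[OF assms(1)]]) (use assms zero_in_U0 in simp)
qed

lemma tang_ex: "tang ex (\<lambda>v. v) 0"
proof -
  have "isCont ex 0" using ex_cont D0_open by (simp add: continuous_on_eq_continuous_at)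
  moreover have "((\<lambda>x. co (ex x)) has_derivative (\<lambda>v. v)) (at 0)"
    by (rule has_derivative_transform_within_open[OF has_derivative_ident D0_open]) (simp_all add: co_ex)
  ultimately show ?thesis by (simp add: tang_def)
qed

lemma tang_chain:
  assumes "tang \<Theta> T 0" "tang F F' x0"
  shows "tang (\<lambda>x. \<Theta> (co (F x))) (\<lambda>h. T (F' h)) x0"
proof -
  have 0: "co (F x0) = 0" using assms(2) by (simp add: tang_def)
  have "isCont (\<lambda>x. co (F x)) x0"
    by (rule has_derivative_continuous[OF tang_derivative[OF assms(2)]])
  then have "isCont (\<lambda>x. \<Theta> (co (F x))) x0"
    by (rule isCont_o2) (use assms(1) in \<open>simp add: 0 tang_def\<close>)
  moreover have "((\<lambda>x. co (\<Theta> (co (F x)))) has_derivative (\<lambda>h. T (F' h))) (at x0)"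
    using diff_chain_at[OF tang_derivative[OF assms(2)], of "\<lambda>x. co (\<Theta> x)" T] tang_derivative[OF assms(1)]
    by (simp add: o_def 0)
  ultimately show ?thesis using assms(1) 0 by (simp add: tang_def)
qed

lemma tang_compose:
  assumes "tang F F' (k y0)" "(k has_derivative k') (at y0)"
  shows "tang (\<lambda>y. F (k y)) (\<lambda>h. F' (k' h)) y0"
  unfolding tang_def
  using assms diff_chain_at[OF assms(2) tang_derivative[OF assms(1)]]
    isCont_o2[OF has_derivative_continuous[OF assms(2)], of F]
  by (simp add: tang_def o_def)

lemma tang_fun:
  assumes F: "tang F F' x0" and u: "smooth_fun A u"
  shows "((\<lambda>x. u (p + F x)) has_derivative (\<lambda>h. L (F' h) u p)) (at x0)"
proof -
  have 0: "co (F x0) = 0" using F by (simp add: tang_def)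
  have "((\<lambda>x. u (p + ex (co (F x)))) has_derivative (\<lambda>h. L (F' h) u p)) (at x0)"
    using diff_chain_at[OF tang_derivative[OF F], of "\<lambda>x. u (p + ex x)"] L_has_derivative[OF u, of p]
    by (simp add: o_def 0)
  then show ?thesis
  proof (rule has_derivative_transform_eventually)
    have "\<forall>\<^sub>F x in nhds x0. u (p + ex (co (F x))) = u (p + F x)"
      using tang_eventually_U0[OF F] by (auto elim!: eventually_mono simp: ex_co)
    then show "\<forall>\<^sub>F x in at x0. u (p + ex (co (F x))) = u (p + F x)"
      "u (p + ex (co (F x0))) = u (p + F x0)"
      by (auto simp: eventually_nhds_conv_at)
  qed simp
qed

lemma smap_ex_add: "smap (D0 \<times> D0) (\<lambda>z. ex (fst z) + ex (snd z))"
  by (rule smap_add; rule smap_compose[OF smap_ex])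
    (auto simp: D0_open open_Times intro!: smooth_on_linear bounded_linear_fst bounded_linear_snd)

text \<open>On each factor alone the product is \<open>ex\<close>, whose derivative is the identity,
  and a linear map on a product space is determined by its restrictions to the factors.\<close>

lemma tang_ex_add: "tang (\<lambda>z. ex (fst z) + ex (snd z)) (\<lambda>h. fst h + snd h) 0"
proof -
  let ?m = "\<lambda>z. ex (fst z) + ex (snd z)"
  define T where "T = frechet_derivative (\<lambda>x. co (?m x)) (at (0 :: 'e \<times> 'e))"
  have t: "tang ?m T 0"
    unfolding T_def by (rule tang_smap[OF smap_ex_add]) (auto simp: zero_prod_def)
  have "tang (\<lambda>x. ?m (x, 0)) (\<lambda>h. T (h, 0)) 0"
    by (rule tang_compose[of ?m T "\<lambda>x. (x, 0)"]) (use t in \<open>auto simp: zero_prod_def intro!: derivative_eq_intros\<close>)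
  then have 1: "(\<lambda>h. T (h, 0)) = (\<lambda>h. h)" using tang_ex tang_unique by fastforce
  have "tang (\<lambda>x. ?m (0, x)) (\<lambda>h. T (0, h)) 0"
    by (rule tang_compose[of ?m T "\<lambda>x. (0, x)"]) (use t in \<open>auto simp: zero_prod_def intro!: derivative_eq_intros\<close>)
  then have 2: "(\<lambda>h. T (0, h)) = (\<lambda>h. h)" using tang_ex tang_unique by fastforce
  have "T h = fst h + snd h" for h
  proof -
    have "T h = T ((fst h, 0) + (0, snd h))" by simp
    also have "\<dots> = T (fst h, 0) + T (0, snd h)"
      using linear_add[OF bounded_linear.linear[OF tang_bounded_linear[OF t]]] .
    also have "\<dots> = fst h + snd h" using fun_cong[OF 1, of "fst h"] fun_cong[OF 2, of "snd h"] by simp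
    finally show ?thesis .
  qed
  then have "T = (\<lambda>h. fst h + snd h)" by (rule ext)
  then show ?thesis using t by simp
qed

lemma tang_add:
  assumes F: "tang F F' x0" and G: "tang G G' x0"
  shows "tang (\<lambda>x. F x + G x) (\<lambda>h. F' h + G' h) x0"
proof -
  have 0: "co (F x0) = 0" "co (G x0) = 0" using F G by (auto simp: tang_def)
  have "((\<lambda>x. (co (F x), co (G x))) has_derivative (\<lambda>h. (F' h, G' h))) (at x0)"
    by (rule has_derivative_Pair[OF tang_derivative[OF F] tang_derivative[OF G]])
  from tang_compose[OF _ this, of "\<lambda>z. ex (fst z) + ex (snd z)" "\<lambda>h. fst h + snd h"] tang_ex_add
  have "tang (\<lambda>x. ex (co (F x)) + ex (co (G x))) (\<lambda>h. F' h + G' h) x0"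
    by (simp add: 0 zero_prod_def)
  then show ?thesis
    by (rule tang_cong)
      (use eventually_conj[OF tang_eventually_U0[OF F] tang_eventually_U0[OF G]] in
        \<open>auto elim!: eventually_mono simp: ex_co\<close>)
qed

text \<open>Differentiating \<open>ex x + - ex x = 0\<close> by \<open>tang_add\<close> determines
  the derivative of inversion.\<close>

lemma tang_uminus:
  assumes F: "tang F F' x0"
  shows "tang (\<lambda>x. - F x) (\<lambda>h. - F' h) x0"
proof -
  define T where "T = frechet_derivative (\<lambda>x. co (- ex x)) (at 0)"
  have t: "tang (\<lambda>x. - ex x) T 0"
    unfolding T_def by (rule tang_smap[OF smap_uminus[OF smap_ex]]) auto
  from tang_add[OF tang_ex t] have "tang (\<lambda>x. 0) (\<lambda>h. h + T h) 0" by simp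
  from tang_unique[OF this tang_const] have "T h = - h" for h
    by (metis add_eq_0_iff)
  with tang_chain[OF t F] have "tang (\<lambda>x. - ex (co (F x))) (\<lambda>h. - F' h) x0" by simp
  then show ?thesis
    by (rule tang_cong) (use tang_eventually_U0[OF F] in \<open>auto elim!: eventually_mono simp: ex_co\<close>)
qed

lemma tang_Ad: "tang (\<lambda>x. g + ex x + - g) (Ad g) 0"
proof -
  have "Ad g = frechet_derivative (\<lambda>x. co (g + ex x + - g)) (at 0)" by (rule ext) (simp add: Ad_def)
  then show ?thesis
    using tang_smap[OF smap_add[OF smap_add[OF smap_const smap_ex] smap_const], of 0 g "- g"] D0_open by simp
qed

lemma tang_conj:
  assumes F: "tang F F' x0"
  shows "tang (\<lambda>x. g + F x + - g) (\<lambda>h. Ad g (F' h)) x0"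
  by (rule tang_cong[OF tang_chain[OF tang_Ad F]])
     (use tang_eventually_U0[OF F] in \<open>auto elim!: eventually_mono simp: ex_co\<close>)

lemma Ad_bounded_linear: "bounded_linear (Ad g)"
  by (rule tang_bounded_linear[OF tang_Ad])

lemma Ad_linear: "linear (Ad g)"
  by (rule bounded_linear.linear[OF Ad_bounded_linear])

lemma Ad_add: "Ad (g + h) v = Ad g (Ad h v)"
proof -
  have "tang (\<lambda>x. g + (h + ex x + - h) + - g) (\<lambda>v. Ad g (Ad h v)) 0"
    by (rule tang_conj[OF tang_Ad])
  moreover have "(\<lambda>x. g + (h + ex x + - h) + - g) = (\<lambda>x. (g + h) + ex x + - (g + h))"
    by (simp add: fun_eq_iff add.assoc minus_add del: add_uminus_conv_diff)
  ultimately show ?thesis using tang_unique[OF tang_Ad[of "g + h"]] by (metis (no_types))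
qed

lemma Ad_0 [simp]: "Ad 0 v = v"
  using tang_unique[OF tang_Ad[of 0]] tang_ex by (simp add: fun_eq_iff)

text \<open>Both sides differentiate \<open>u (p + (g + ex x + - g))\<close> at
  \<open>x = 0\<close>. Moving the conjugation from the vector to the function exhibits
  \<open>Ad g\<close> through derivatives of smooth functions, which is how its dependence on
  \<open>g\<close> is controlled later.\<close>

lemma L_Ad:
  assumes u: "smooth_fun A u"
  shows "L (Ad g v) u p = L v (\<lambda>q. u (q + - g)) (p + g)"
proof -
  have "((\<lambda>x. u (p + (g + ex x + - g))) has_derivative (\<lambda>h. L (Ad g h) u p)) (at 0)"
    by (rule tang_fun[OF tang_Ad u])
  moreover have "((\<lambda>x. u (p + (g + ex x + - g))) has_derivative (\<lambda>h. L h (\<lambda>q. u (q + - g)) (p + g))) (at 0)"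
    using L_has_derivative[OF smooth_fun_right[OF u, of "- g"], of "p + g"] by (simp add: add.assoc del: add_uminus_conv_diff)
  ultimately have "(\<lambda>h. L (Ad g h) u p) = (\<lambda>h. L h (\<lambda>q. u (q + - g)) (p + g))"
    by (rule has_derivative_unique)
  then show ?thesis by (rule fun_cong)
qed

lemma smap_pair:
  assumes "(W, \<kappa>) \<in> A"
  shows "smap (\<kappa> ` W \<times> D0) (\<lambda>z. inv_into W \<kappa> (fst z) + ex (snd z))"
proof (rule smap_add)
  have op: "open (\<kappa> ` W \<times> D0)" by (intro open_Times chart_image_open[OF assms] D0_open)
  show "smap (\<kappa> ` W \<times> D0) (\<lambda>z. inv_into W \<kappa> (fst z))"
    by (rule smap_compose[OF smap_inv_chart[OF assms] op smooth_on_linear[OF bounded_linear_fst op]]) auto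
  show "smap (\<kappa> ` W \<times> D0) (\<lambda>z. ex (snd z))"
    by (rule smap_compose[OF smap_ex op smooth_on_linear[OF bounded_linear_snd op]]) auto
qed

lemma smooth_fun_L:
  assumes u: "smooth_fun A u"
  shows "smooth_fun A (L v u)"
proof (rule smooth_funI)
  fix W \<kappa> assume W: "(W, \<kappa>) \<in> A"
  have "smooth_on (\<kappa> ` W \<times> D0) (\<lambda>z. u (inv_into W \<kappa> (fst z) + ex (snd z)))"
    by (rule smap_smooth_fun[OF smap_pair[OF W] u])
  from smooth_on_slice(1)[OF this chart_image_open[OF W] D0_open zero_in_D0, of v]
  show "smooth_on (\<kappa> ` W) (\<lambda>x. L v u (inv_into W \<kappa> x))"
    by (simp add: L_def)
qed

lemma L_of_const: "L v (\<lambda>p. c) p = 0"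
  using has_derivative_unique[OF L_has_derivative[OF smooth_fun_const[of c], where p = p] has_derivative_const]
  by (simp add: fun_eq_iff)

lemma L_of_add: "smooth_fun A u \<Longrightarrow> smooth_fun A w \<Longrightarrow> L v (\<lambda>p. u p + w p) p = L v u p + L v w p"
  using has_derivative_unique[OF L_has_derivative[OF smooth_fun_add, of u w p]
    has_derivative_add[OF L_has_derivative[of u p] L_has_derivative[of w p]]] by metis

lemma L_of_mult: "smooth_fun A u \<Longrightarrow> smooth_fun A w \<Longrightarrow> L v (\<lambda>p. u p * w p) p = u p * L v w p + w p * L v u p"
  using fun_cong[OF has_derivative_unique[OF L_has_derivative[OF smooth_fun_mult, of u w p]
    has_derivative_mult[OF L_has_derivative[of u p] L_has_derivative[of w p]]], of v] by (simp add: mult.commute)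

text \<open>Coordinates times a bump, extended by zero. The bump is 1 and the coordinate 0 at the
  identity, so the product rule leaves the derivative of the coordinate. Vectors can thus be tested
  on globally smooth functions.\<close>

lemma coordinate_functions:
  obtains cf :: "'e \<Rightarrow> 'g \<Rightarrow> real" where "\<And>b. smooth_fun A (cf b)" "\<And>v b. L v (cf b) 0 = v \<bullet> b"
proof -
  obtain r where r: "r > 0" "cball 0 r \<subseteq> D0" "ex ` cball 0 r \<subseteq> UNIV" by (rule small_ball[of UNIV]) auto
  obtain \<beta> :: "'e \<Rightarrow> real" where \<beta>: "smooth_on UNIV \<beta>" "\<beta> 0 = 1" "\<And>x. r \<le> norm x \<Longrightarrow> \<beta> x = 0"
    using smooth_bump[OF r(1), where 'a = 'e] by metis
  define cf where "cf = (\<lambda>b p. if p \<in> U0 then \<beta> (co p) * (co p \<bullet> b) else 0)"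
  have sm: "smooth_on D0 (\<lambda>x. \<beta> x * (x \<bullet> b))" for b
    by (intro smooth_on_bilinear[OF bounded_bilinear_mult] D0_open smooth_on_subset[OF \<beta>(1)]
        smooth_on_linear bounded_linear_inner_left bounded_linear_ident) auto
  show ?thesis
  proof
    show cf: "smooth_fun A (cf b)" for b
      unfolding cf_def by (rule smooth_fun_extend[OF sm r(2)]) (use \<beta> in auto)
    fix v b
    have "((\<lambda>x. \<beta> x * (x \<bullet> b)) has_derivative (\<lambda>h. \<beta> 0 * (h \<bullet> b) + frechet_derivative \<beta> (at 0) h * (0 \<bullet> b))) (at 0)"
      by (intro has_derivative_mult smooth_on_has_derivative[OF \<beta>(1)] derivative_intros) auto
    then have "((\<lambda>x. \<beta> x * (x \<bullet> b)) has_derivative (\<lambda>h. h \<bullet> b)) (at 0)" by (simp add: \<beta>)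
    then have "((\<lambda>x. cf b (0 + ex x)) has_derivative (\<lambda>h. h \<bullet> b)) (at 0)"
      by (rule has_derivative_transform_within_open[OF _ D0_open]) (auto simp: cf_def ex_in_U0 co_ex)
    from fun_cong[OF has_derivative_unique[OF L_has_derivative[OF cf] this]] show "L v (cf b) 0 = v \<bullet> b" .
  qed
qed

lemma L_inject:
  assumes "\<And>u. smooth_fun A u \<Longrightarrow> L v u 0 = L w u 0"
  shows "v = w"
proof -
  obtain cf :: "'e \<Rightarrow> 'g \<Rightarrow> real" where cf: "\<And>b. smooth_fun A (cf b)" "\<And>v b. L v (cf b) 0 = v \<bullet> b"
    using coordinate_functions by blast
  show ?thesis using assms[OF cf(1)] cf(2) by (metis euclidean_eqI)
qed

text \<open>By Hadamard's lemma \<open>u\<close> minus its value at 0 is locally a sum of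
  coordinates times smooth functions. The coordinates vanish at 0, so the product rule leaves only
  the values of \<open>D\<close> on the coordinates.\<close>

lemma derivation_at_0:
  fixes D :: "('g \<Rightarrow> real) \<Rightarrow> real"
  assumes add: "\<And>u w. smooth_fun A u \<Longrightarrow> smooth_fun A w \<Longrightarrow> D (\<lambda>p. u p + w p) = D u + D w"
    and mult: "\<And>u w. smooth_fun A u \<Longrightarrow> smooth_fun A w \<Longrightarrow> D (\<lambda>p. u p * w p) = u 0 * D w + w 0 * D u"
    and scale: "\<And>c u. smooth_fun A u \<Longrightarrow> D (\<lambda>p. c * u p) = c * D u"
  obtains v where "\<And>u. smooth_fun A u \<Longrightarrow> D u = L v u 0"
proof -
  obtain r where r: "r > 0" "cball 0 r \<subseteq> D0" "ex ` cball 0 r \<subseteq> UNIV" by (rule small_ball[of UNIV]) auto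
  \<comment> \<open>Half the radius keeps the support of the bump away from the boundary of
    \<open>ball 0 r\<close>, where \<open>w\<close> may stop being smooth.\<close>
  define r' where "r' = r / 2"
  have r': "r' > 0" "cball 0 r' \<subseteq> D0" "cball 0 r' \<subseteq> ball 0 r"
    using r by (auto simp: r'_def)
  obtain \<beta> :: "'e \<Rightarrow> real" where \<beta>: "smooth_on UNIV \<beta>" "\<beta> 0 = 1" "\<And>x. r' \<le> norm x \<Longrightarrow> \<beta> x = 0"
    using smooth_bump[OF r'(1), where 'a = 'e] by metis
  define ext where "ext = (\<lambda>w p. if p \<in> U0 then \<beta> (co p) * w (co p) else (0::real))"
  have ext_smooth: "smooth_fun A (ext w)" if "smooth_on (ball 0 r) w" for w
    unfolding ext_def
  proof (rule smooth_fun_extend[OF _ r'(2)])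
    show "smooth_on D0 (\<lambda>x. \<beta> x * w x)"
    proof (rule smooth_on_local)
      fix x assume x: "x \<in> D0"
      show "\<exists>T. open T \<and> x \<in> T \<and> smooth_on T (\<lambda>x. \<beta> x * w x)"
      proof (cases "x \<in> ball 0 r")
        case True
        have "smooth_on (ball 0 r) (\<lambda>x. \<beta> x * w x)"
          by (intro smooth_on_bilinear[OF bounded_bilinear_mult] smooth_on_subset[OF \<beta>(1)] that) auto
        then show ?thesis using True by blast
      next
        case False
        have op: "open (- cball (0::'e) r')" by (simp add: open_Compl)
        have "smooth_on (- cball 0 r') (\<lambda>x. \<beta> x * w x)"
          by (rule smooth_on_cong[OF op _ smooth_on_const[OF op, of 0]]) (use \<beta>(3) in auto)
        then show ?thesis using op False r'(3) by blast
      qed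
    qed
  qed (use \<beta> in auto)
  define v where "v = (\<Sum>b\<in>Basis. D (ext (\<lambda>x. x \<bullet> b)) *\<^sub>R b)"
  have coord_smooth: "smooth_fun A (ext (\<lambda>x. x \<bullet> b))" for b
    by (rule ext_smooth) (intro smooth_on_linear bounded_linear_inner_left bounded_linear_ident open_ball)
  have Dz: "D (\<lambda>p. 0) = 0" using scale[OF smooth_fun_const, of 0 0] by simp
  have Dsum: "D (\<lambda>p. \<Sum>b\<in>I. g b p) = (\<Sum>b\<in>I. D (g b))" if "finite I" "\<And>b. b \<in> I \<Longrightarrow> smooth_fun A (g b)"
    for I and g :: "'e \<Rightarrow> 'g \<Rightarrow> real"
    using that by (induction I rule: finite_induct) (auto simp: Dz add smooth_fun_sum)
  show ?thesis
  proof
    fix u :: "'g \<Rightarrow> real" assume u: "smooth_fun A u"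
    have "smooth_on D0 (\<lambda>x. u (ex x))" by (rule smap_smooth_fun[OF smap_ex u])
    then have sm: "smooth_on (ball 0 r) (\<lambda>x. u (ex x))" by (rule smooth_on_subset) (use r in auto)
    from Hadamard[OF this] obtain W where W: "\<And>b. smooth_on (ball 0 r) (W b)"
      "\<And>b. W b 0 = frechet_derivative (\<lambda>x. u (ex x)) (at 0) b"
      "\<And>x. x \<in> ball 0 r \<Longrightarrow> u (ex x) = u (ex 0) + (\<Sum>b\<in>Basis. (x \<bullet> b) * W b x)" by blast
    define B where "B = ext (\<lambda>x. 1)"
    have B: "smooth_fun A B" unfolding B_def by (rule ext_smooth) simp
    have B0: "B 0 = 1" using zero_in_U0 by (simp add: B_def ext_def \<beta>)
    have WB: "W b 0 = L b u 0" for b by (simp add: W(2) L_def)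
    have ext0: "ext w 0 = w 0" for w using zero_in_U0 by (simp add: ext_def \<beta>)
    \<comment> \<open>\<open>D\<close> acts on global functions, so Hadamard's formula is multiplied
      by the squared bump: one factor goes to the coordinate, the other to the coefficient. The term
      \<open>u 0 * D (\<lambda>p. B p * B p)\<close> appears on both sides and cancels.\<close>
    have eq: "(\<lambda>p. B p * B p * u p) = (\<lambda>p. u 0 * (B p * B p) + (\<Sum>b\<in>Basis. ext (\<lambda>x. x \<bullet> b) p * ext (W b) p))"
    proof
      fix p
      show "B p * B p * u p = u 0 * (B p * B p) + (\<Sum>b\<in>Basis. ext (\<lambda>x. x \<bullet> b) p * ext (W b) p)"
      proof (cases "p \<in> U0 \<and> norm (co p) < r")
        case True
        then have "u p = u 0 + (\<Sum>b\<in>Basis. (co p \<bullet> b) * W b (co p))"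
          using W(3)[of "co p"] by (simp add: ex_co)
        then show ?thesis using True
          by (simp add: B_def ext_def distrib_left sum_distrib_left mult_ac)
      next
        case False
        then have "B p = 0" "ext (W b) p = 0" for b
          using \<beta>(3)[of "co p"] r by (auto simp: B_def ext_def r'_def)
        then show ?thesis by simp
      qed
    qed
    have "D (\<lambda>p. B p * B p * u p) = D u + u 0 * D (\<lambda>p. B p * B p)"
      using mult[OF smooth_fun_mult[OF B B] u] by (simp add: B0)
    moreover have "D (\<lambda>p. u 0 * (B p * B p) + (\<Sum>b\<in>Basis. ext (\<lambda>x. x \<bullet> b) p * ext (W b) p)) =
      u 0 * D (\<lambda>p. B p * B p) + (\<Sum>b\<in>Basis. D (ext (\<lambda>x. x \<bullet> b)) * L b u 0)"
    proof -
      have 1: "smooth_fun A (\<lambda>p. u 0 * (B p * B p))"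
        by (intro smooth_fun_mult smooth_fun_const B)
      have 2: "smooth_fun A (\<lambda>p. ext (\<lambda>x. x \<bullet> b) p * ext (W b) p)" for b
        by (intro smooth_fun_mult coord_smooth ext_smooth W)
      have 3: "D (\<lambda>p. ext (\<lambda>x. x \<bullet> b) p * ext (W b) p) = D (ext (\<lambda>x. x \<bullet> b)) * L b u 0" for b
        by (subst mult[OF coord_smooth ext_smooth[OF W(1)]]) (simp add: ext0 WB)
      show ?thesis
        by (subst add[OF 1 smooth_fun_sum[OF 2]], subst Dsum[OF finite_Basis 2])
          (simp add: scale[OF smooth_fun_mult[OF B B]] 3)
    qed
    ultimately have "D u = (\<Sum>b\<in>Basis. D (ext (\<lambda>x. x \<bullet> b)) * L b u 0)"
      using eq by simp
    also have "\<dots> = L v u 0"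
      unfolding v_def by (simp add: linear_sum[OF L_linear[OF u]] linear_scale[OF L_linear[OF u]])
    finally show "D u = L v u 0" .
  qed
qed

end

section \<open>The bracket and one-parameter subgroups\<close>

lemma smooth_on_partial:
  fixes q :: "'a::euclidean_space \<times> 'c::euclidean_space \<Rightarrow> 'b::real_normed_vector"
  assumes "smooth_on S q" "(x0, y0) \<in> S"
  shows "((\<lambda>x. q (x, y0)) has_derivative (\<lambda>h. frechet_derivative q (at (x0, y0)) (h, 0))) (at x0)"
    and "((\<lambda>y. q (x0, y)) has_derivative (\<lambda>h. frechet_derivative q (at (x0, y0)) (0, h))) (at y0)"
proof -
  note q = smooth_on_has_derivative[OF assms]
  have "((\<lambda>x. (x, y0)) has_derivative (\<lambda>h. (h, 0))) (at x0)" by (auto intro!: derivative_eq_intros)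
  from diff_chain_at[OF this q]
  show "((\<lambda>x. q (x, y0)) has_derivative (\<lambda>h. frechet_derivative q (at (x0, y0)) (h, 0))) (at x0)"
    by (simp add: o_def)
  have "((\<lambda>y. (x0, y)) has_derivative (\<lambda>h. (0, h))) (at y0)" by (auto intro!: derivative_eq_intros)
  from diff_chain_at[OF this q]
  show "((\<lambda>y. q (x0, y)) has_derivative (\<lambda>h. frechet_derivative q (at (x0, y0)) (0, h))) (at y0)"
    by (simp add: o_def)
qed

text \<open>Extend by the \<open>n\<close>-fold multiple of \<open>f0 (x /\<^sub>R real n)\<close>
  for large \<open>n\<close>. The target is not commutative, but
  \<open>f0 (x /\<^sub>R real n)\<close> and \<open>f0 (y /\<^sub>R real n)\<close> commute because
  addition in the source does, and multiples of commuting elements distribute.\<close>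

lemma local_hom_extends:
  fixes f0 :: "'a::real_normed_vector \<Rightarrow> 'b::group_add"
  assumes "\<delta> > 0"
    and hom: "\<And>x y. norm x < \<delta> \<Longrightarrow> norm y < \<delta> \<Longrightarrow> norm (x + y) < \<delta> \<Longrightarrow> f0 (x + y) = f0 x + f0 y"
  obtains f where "\<And>x y. f (x + y) = f x + f y" "\<And>x. norm x < \<delta> \<Longrightarrow> f x = f0 x"
proof -
  define pw where "pw = (\<lambda>n (g::'b). ((+) g ^^ n) 0)"
  have pw0: "pw 0 g = 0" and pwS: "pw (Suc n) g = g + pw n g" for g n by (simp_all add: pw_def)
  have pw_add: "pw (m + n) g = pw m g + pw n g" for m n g
    by (induction m) (simp_all add: pw0 pwS add.assoc)
  have pw_mult: "pw (m * n) g = pw m (pw n g)" for m n g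
    by (induction m) (simp_all add: pw0 pwS pw_add)
  have pw_comm: "h + pw n g = pw n g + h" if "g + h = h + g" for g h n
  proof (induction n)
    case (Suc n)
    have "h + pw (Suc n) g = (g + h) + pw n g" by (simp add: pwS that add.assoc)
    also have "\<dots> = pw (Suc n) g + h" by (simp add: pwS Suc add.assoc)
    finally show ?case .
  qed (simp add: pw0)
  have pw_dist: "pw n (g + h) = pw n g + pw n h" if "g + h = h + g" for g h n
  proof (induction n)
    case (Suc n)
    have "pw (Suc n) (g + h) = g + (h + pw n g) + pw n h" by (simp add: pwS Suc add.assoc)
    also have "\<dots> = pw (Suc n) g + pw (Suc n) h" by (simp add: pw_comm[OF that] pwS add.assoc)
    finally show ?case .
  qed (simp add: pw0)
  have f00: "f0 0 = 0" using hom[of 0 0] assms(1) by (metis add.right_neutral add_left_cancel norm_zero)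
  have step: "pw k (f0 (x /\<^sub>R real n)) = f0 (real k *\<^sub>R (x /\<^sub>R real n))" if "norm x < \<delta>" "k \<le> n" "n > 0" for x k n
    using that(2)
  proof (induction k)
    case 0
    then show ?case by (simp add: pw0 f00)
  next
    case (Suc k)
    let ?z = "x /\<^sub>R real n"
    have bd: "norm (real j *\<^sub>R ?z) < \<delta>" if "j \<le> n" for j
    proof -
      have "norm (real j *\<^sub>R ?z) = (real j / real n) * norm x" by (simp add: divide_inverse)
      also have "\<dots> \<le> 1 * norm x" using that \<open>n > 0\<close> by (intro mult_right_mono) auto
      finally show ?thesis using \<open>norm x < \<delta>\<close> by simp
    qed
    have "f0 (?z + real k *\<^sub>R ?z) = f0 ?z + f0 (real k *\<^sub>R ?z)"
    proof (rule hom)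
      show "norm ?z < \<delta>" using bd[of 1] \<open>n > 0\<close> by simp
      show "norm (real k *\<^sub>R ?z) < \<delta>" using bd[of k] Suc.prems by simp
      have "?z + real k *\<^sub>R ?z = real (Suc k) *\<^sub>R ?z"
        unfolding of_nat_Suc scaleR_add_left by simp
      then show "norm (?z + real k *\<^sub>R ?z) < \<delta>" using bd[of "Suc k"] Suc.prems by metis
    qed
    moreover have "?z + real k *\<^sub>R ?z = real (Suc k) *\<^sub>R ?z"
        unfolding of_nat_Suc scaleR_add_left by simp
    ultimately show ?case using Suc by (simp add: pwS)
  qed
  have root: "pw n (f0 (x /\<^sub>R real n)) = f0 x" if "norm x < \<delta>" "n > 0" for x n
    using step[OF that(1) le_refl that(2)] that by simp
  define f where "f = (\<lambda>x. let n = Suc (nat \<lceil>norm x / \<delta>\<rceil>) in pw n (f0 (x /\<^sub>R real n)))"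
  \<comment> \<open>Independence of the subdivision: both sides are the \<open>n * N\<close>-fold
    multiple of the value of \<open>f0\<close> at \<open>x\<close> divided by
    \<open>n * N\<close>.\<close>
  have f_eq: "f x = pw n (f0 (x /\<^sub>R real n))" if "n > 0" "norm x / real n < \<delta>" for x n
  proof -
    define N where "N = Suc (nat \<lceil>norm x / \<delta>\<rceil>)"
    have "norm x / \<delta> < real N" unfolding N_def by linarith
    moreover have N0: "N > 0" by (simp add: N_def)
    ultimately have N: "N > 0" "norm x / real N < \<delta>" using assms(1) by (auto simp: field_simps)
    have "pw N (f0 (x /\<^sub>R real N)) = pw N (pw n (f0 ((x /\<^sub>R real N) /\<^sub>R real n)))"
      by (subst root) (use N that in \<open>auto simp: divide_inverse mult.commute\<close>)
    also have "\<dots> = pw (n * N) (f0 ((x /\<^sub>R real n) /\<^sub>R real N))"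
      by (simp add: pw_mult[symmetric] mult.commute)
    also have "\<dots> = pw n (f0 (x /\<^sub>R real n))"
      unfolding pw_mult by (subst root) (use N that in \<open>auto simp: divide_inverse mult.commute\<close>)
    finally show ?thesis by (simp add: f_def N_def Let_def)
  qed
  show ?thesis
  proof
    show "f x = f0 x" if "norm x < \<delta>" for x
      using f_eq[of 1 x] that by (simp add: pwS pw0)
    fix x y :: 'a
    obtain n where n: "real n > (norm x + norm y) / \<delta>" using reals_Archimedean2 by blast
    have "real n > 0" using n assms(1) by (smt (verit) divide_nonneg_pos norm_ge_zero)
    then have n0: "n > 0" by simp
    have *: "(norm x + norm y) / real n < \<delta>" using n assms(1) \<open>real n > 0\<close> by (simp add: field_simps)
    have nx: "norm x / real n < \<delta>" "norm y / real n < \<delta>" "norm (x + y) / real n < \<delta>"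
      using * \<open>real n > 0\<close> norm_triangle_ineq[of x y]
      by (smt (verit, best) divide_right_mono norm_ge_zero)+
    then have nx': "norm (x /\<^sub>R real n) < \<delta>" "norm (y /\<^sub>R real n) < \<delta>" "norm (x /\<^sub>R real n + y /\<^sub>R real n) < \<delta>"
      by (auto simp: divide_inverse mult.commute simp flip: scaleR_add_right)
    have eq: "f0 (x /\<^sub>R real n + y /\<^sub>R real n) = f0 (x /\<^sub>R real n) + f0 (y /\<^sub>R real n)"
      using nx' by (rule hom)
    have "f0 (y /\<^sub>R real n + x /\<^sub>R real n) = f0 (y /\<^sub>R real n) + f0 (x /\<^sub>R real n)"
      using nx' by (intro hom) (auto simp: add.commute)
    then have comm: "f0 (x /\<^sub>R real n) + f0 (y /\<^sub>R real n) = f0 (y /\<^sub>R real n) + f0 (x /\<^sub>R real n)"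
      using eq by (simp add: add.commute)
    show "f (x + y) = f x + f y"
      by (simp add: f_eq[OF n0 nx(1)] f_eq[OF n0 nx(2)] f_eq[OF n0 nx(3)] scaleR_add_right eq pw_dist[OF comm])
  qed
qed

text \<open>Banach's fixed point theorem in the bounded continuous functions on the whole line;
  clamping time to the interval from \<open>- \<delta>\<close> to \<open>\<delta>\<close> by
  \<open>cl\<close> makes this complete space usable for a local problem.\<close>

lemma Picard:
  fixes F :: "'a::euclidean_space \<Rightarrow> 'a"
  assumes \<rho>: "\<rho> > 0" and M: "\<And>x. x \<in> cball 0 \<rho> \<Longrightarrow> norm (F x) \<le> M"
    and \<Lambda>: "\<And>x y. x \<in> cball 0 \<rho> \<Longrightarrow> y \<in> cball 0 \<rho> \<Longrightarrow> norm (F x - F y) \<le> \<Lambda> * norm (x - y)"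
  obtains \<delta> and x :: "real \<Rightarrow> 'a" where "\<delta> > 0" "x 0 = 0" "\<And>t. x t \<in> cball 0 \<rho>"
    "\<And>t. \<bar>t\<bar> < \<delta> \<Longrightarrow> (x has_vector_derivative F (x t)) (at t)"
proof -
  define N where "N = \<bar>M\<bar> + \<bar>\<Lambda>\<bar> + 1"
  have N: "N > 0" "M \<le> N" "\<Lambda> \<le> N" by (auto simp: N_def)
  \<comment> \<open>The Picard map is a difference of two integrals, each over length at most
    \<open>2 * \<delta>\<close>, which gives the factor \<open>4 * \<delta> * N\<close>. The first
    bound keeps the iterates in the ball of radius \<open>\<rho>\<close>, the second makes the
    contraction constant \<open>1 / 2\<close>.\<close>
  define \<delta> where "\<delta> = min (\<rho> / (4 * N)) (1 / (8 * N))"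
  have \<delta>: "\<delta> > 0" "4 * \<delta> * N \<le> \<rho>" "4 * \<delta> * N \<le> 1 / 2"
  proof -
    show "\<delta> > 0" using \<rho> N by (simp add: \<delta>_def)
    have "\<delta> \<le> \<rho> / (4 * N)" "\<delta> \<le> 1 / (8 * N)" by (auto simp: \<delta>_def)
    then show "4 * \<delta> * N \<le> \<rho>" "4 * \<delta> * N \<le> 1 / 2" using N by (auto simp: field_simps)
  qed
  define cl where "cl = (\<lambda>t. max (-\<delta>) (min \<delta> t))"
  have cl: "cl t \<in> {-\<delta>..\<delta>}" for t using \<delta> by (auto simp: cl_def)
  have clcont: "continuous_on UNIV cl" unfolding cl_def by (intro continuous_intros)
  have Fcont: "continuous_on (cball 0 \<rho>) F"
  proof (rule continuous_onI)
    fix x :: 'a and \<epsilon> :: real assume *: "x \<in> cball 0 \<rho>" "0 < \<epsilon>"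
    show "\<exists>d>0. \<forall>x'\<in>cball 0 \<rho>. dist x' x < d \<longrightarrow> dist (F x') (F x) \<le> \<epsilon>"
    proof (intro exI[of _ "\<epsilon> / N"] conjI ballI impI)
      show "\<epsilon> / N > 0" using * N by simp
      fix x' assume x': "x' \<in> cball 0 \<rho>" "dist x' x < \<epsilon> / N"
      have "norm (F x' - F x) \<le> \<Lambda> * norm (x' - x)" by (rule \<Lambda>) (use x' * in auto)
      also have "\<dots> \<le> N * norm (x' - x)" using N by (intro mult_right_mono) auto
      also have "\<dots> \<le> N * (\<epsilon> / N)" using x' N by (intro mult_left_mono) (auto simp: dist_norm)
      finally show "dist (F x') (F x) \<le> \<epsilon>" using N by (simp add: dist_norm)
    qed
  qed
  define s where "s = {y :: real \<Rightarrow>\<^sub>C 'a. \<forall>t. norm (apply_bcontfun y t) \<le> \<rho>}"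
  have gcont: "continuous_on UNIV (\<lambda>\<tau>. F (apply_bcontfun y \<tau>))" if "y \<in> s" for y
    by (rule continuous_on_compose2[OF Fcont]) (use that in \<open>auto simp: s_def intro!: continuous_intros\<close>)
  have gint: "(\<lambda>\<tau>. F (apply_bcontfun y \<tau>)) integrable_on {a..b}" if "y \<in> s" for y a b
    by (rule integrable_continuous_interval[OF continuous_on_subset[OF gcont[OF that]]]) simp
  \<comment> \<open>The difference of two integrals starting at \<open>- \<delta>\<close> stands for
    the signed integral from 0, so that negative times are included.\<close>
  define J where "J = (\<lambda>y t. integral {-\<delta>..cl t} (\<lambda>\<tau>. F (apply_bcontfun y \<tau>)) - integral {-\<delta>..0} (\<lambda>\<tau>. F (apply_bcontfun y \<tau>)))"
  have Jcont: "continuous_on UNIV (J y)" if "y \<in> s" for y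
    unfolding J_def
    by (intro continuous_intros continuous_on_compose2[OF indefinite_integral_continuous_1[OF gint[OF that, of "-\<delta>" \<delta>]] clcont])
      (use cl in auto)
  have ibound: "norm (integral {-\<delta>..a} h) \<le> 2 * \<delta> * B" if "a \<in> {-\<delta>..\<delta>}" "continuous_on UNIV h" "\<And>\<tau>. norm (h \<tau>) \<le> B"
    for a B and h :: "real \<Rightarrow> 'a"
  proof -
    have "norm (integral {-\<delta>..a} h) \<le> B * (a - - \<delta>)"
      by (rule integral_bound) (use that in \<open>auto intro: continuous_on_subset\<close>)
    also have "\<dots> \<le> B * (2 * \<delta>)"
      using that(1) order_trans[OF norm_ge_zero that(3)] by (intro mult_left_mono) auto
    finally show ?thesis by (simp add: mult_ac)
  qed
  have Jb: "norm (J y t) \<le> \<rho>" if "y \<in> s" for y t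
  proof -
    have B: "norm (F (apply_bcontfun y \<tau>)) \<le> N" for \<tau>
      using M[of "apply_bcontfun y \<tau>"] that N by (force simp: s_def)
    have "norm (J y t) \<le> 2 * \<delta> * N + 2 * \<delta> * N"
      unfolding J_def
      by (rule order_trans[OF norm_triangle_ineq4 add_mono]; rule ibound[OF _ gcont[OF that] B]) (use cl \<delta> in auto)
    also have "\<dots> = 4 * \<delta> * N" by simp
    finally show ?thesis using \<delta>(2) by simp
  qed
  define \<Phi> where "\<Phi> = (\<lambda>y. Bcontfun (J y))"
  have \<Phi>: "apply_bcontfun (\<Phi> y) = J y" if "y \<in> s" for y
    unfolding \<Phi>_def using Jcont[OF that] Jb[OF that] by (intro Bcontfun_inverse bcontfun_normI) auto
  have "\<exists>!y\<in>s. \<Phi> y = y"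
  proof (rule Banach_fix[where c = "1/2"])
    have "closed s"
    proof -
      have "s = PiC UNIV (\<lambda>_. cball 0 \<rho>)" by (auto simp: s_def mem_PiC_iff Pi_iff)
      then show ?thesis using closed_PiC[of UNIV "\<lambda>_. cball 0 \<rho>"] by simp
    qed
    then show "complete s" by (simp add: complete_eq_closed)
    have "0 \<in> s" using \<rho> by (simp add: s_def)
    then show "s \<noteq> {}" by auto
    show "\<Phi> ` s \<subseteq> s" using \<Phi> Jb by (auto simp: s_def)
    show "dist (\<Phi> y) (\<Phi> z) \<le> 1 / 2 * dist y z" if "y \<in> s" "z \<in> s" for y z
    proof (rule dist_bound)
      have yz: "y \<in> s \<and> z \<in> s" using that by simp
      fix t
      let ?h = "\<lambda>\<tau>. F (apply_bcontfun y \<tau>) - F (apply_bcontfun z \<tau>)"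
      have B: "norm (?h \<tau>) \<le> N * dist y z" for \<tau>
      proof -
        have "norm (?h \<tau>) \<le> \<Lambda> * norm (apply_bcontfun y \<tau> - apply_bcontfun z \<tau>)"
          by (rule \<Lambda>) (use yz in \<open>auto simp: s_def\<close>)
        also have "\<dots> \<le> N * norm (apply_bcontfun y \<tau> - apply_bcontfun z \<tau>)"
          using N by (intro mult_right_mono) auto
        also have "\<dots> \<le> N * dist y z"
          using dist_bounded[of y \<tau> z] N by (intro mult_left_mono) (auto simp: dist_norm)
        finally show ?thesis .
      qed
      have hc: "continuous_on UNIV ?h" using yz by (intro continuous_intros gcont) auto
      have "J y t - J z t = integral {-\<delta>..cl t} ?h - integral {-\<delta>..0} ?h"
        using yz by (simp add: J_def integral_diff gint)
      also have "norm \<dots> \<le> 2 * \<delta> * (N * dist y z) + 2 * \<delta> * (N * dist y z)"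
        by (rule order_trans[OF norm_triangle_ineq4 add_mono]; rule ibound[OF _ hc B]) (use cl \<delta> in auto)
      also have "\<dots> = (4 * \<delta> * N) * dist y z" by simp
      also have "\<dots> \<le> 1 / 2 * dist y z" using \<delta> by (intro mult_right_mono) auto
      finally show "dist (apply_bcontfun (\<Phi> y) t) (apply_bcontfun (\<Phi> z) t) \<le> 1 / 2 * dist y z"
        using yz by (simp add: \<Phi> dist_norm)
    qed
  qed auto
  then obtain y where y: "y \<in> s" "\<Phi> y = y" by blast
  define x where "x = apply_bcontfun y"
  have x: "x t = J y t" for t unfolding x_def using \<Phi>[OF y(1)] y(2) by metis
  show ?thesis
  proof (rule that[OF \<delta>(1)])
    show "x 0 = 0" unfolding x using \<delta> by (simp add: J_def cl_def)
    show "x t \<in> cball 0 \<rho>" for t using Jb[OF y(1)] x by simp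
    fix t :: real assume t: "\<bar>t\<bar> < \<delta>"
    have tin: "t \<in> {-\<delta><..<\<delta>}" using t by auto
    have "((\<lambda>u. integral {-\<delta>..u} (\<lambda>\<tau>. F (x \<tau>))) has_vector_derivative F (x t)) (at t within {-\<delta>..\<delta>})"
      unfolding x_def using continuous_on_subset[OF gcont[OF y(1)]] tin
      by (intro integral_has_vector_derivative) auto
    then have "((\<lambda>u. integral {-\<delta>..u} (\<lambda>\<tau>. F (x \<tau>))) has_vector_derivative F (x t)) (at t)"
      using tin by (simp add: at_within_Icc_at)
    then have "((\<lambda>u. integral {-\<delta>..u} (\<lambda>\<tau>. F (x \<tau>)) - integral {-\<delta>..0} (\<lambda>\<tau>. F (x \<tau>))) has_vector_derivative F (x t)) (at t)"
      by (auto intro!: derivative_eq_intros)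
    then show "(x has_vector_derivative F (x t)) (at t)"
    proof (rule has_vector_derivative_transform_within_open[OF _ _ tin])
      fix u assume "u \<in> {-\<delta><..<\<delta>}"
      then show "integral {-\<delta>..u} (\<lambda>\<tau>. F (x \<tau>)) - integral {-\<delta>..0} (\<lambda>\<tau>. F (x \<tau>)) = x u"
        unfolding x[of u] J_def by (simp add: cl_def x_def)
    qed auto
  qed
qed

text \<open>Continuity of the derivative is known one direction at a time, so the operator norm is
  bounded by the sum of the bounds over the basis directions.\<close>

lemma smooth_on_cball_Lipschitz:
  fixes F :: "'a::euclidean_space \<Rightarrow> 'b::real_normed_vector"
  assumes "smooth_on S F" "cball 0 \<rho> \<subseteq> S"
  obtains \<Lambda> where "\<And>x y. x \<in> cball 0 \<rho> \<Longrightarrow> y \<in> cball 0 \<rho> \<Longrightarrow> norm (F x - F y) \<le> \<Lambda> * norm (x - y)"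
proof -
  let ?D = "\<lambda>x. frechet_derivative F (at x)"
  have "\<exists>B. \<forall>x\<in>cball 0 \<rho>. norm (?D x b) \<le> B" for b
  proof -
    have "continuous_on (cball 0 \<rho>) (\<lambda>x. ?D x b)"
      by (rule continuous_on_subset[OF smooth_on_continuous_on[OF smooth_on_frechet[OF assms(1)]] assms(2)])
    then have "bounded ((\<lambda>x. ?D x b) ` cball 0 \<rho>)"
      by (intro compact_imp_bounded compact_continuous_image) auto
    then show ?thesis unfolding bounded_iff by blast
  qed
  then obtain B where B: "\<And>b x. x \<in> cball 0 \<rho> \<Longrightarrow> norm (?D x b) \<le> B b" by metis
  show ?thesis
  proof (rule that[of "\<Sum>b\<in>Basis. B b"])
    fix x y :: 'a assume xy: "x \<in> cball 0 \<rho>" "y \<in> cball 0 \<rho>"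
    show "norm (F x - F y) \<le> (\<Sum>b\<in>Basis. B b) * norm (x - y)"
    proof (rule differentiable_bound[OF convex_cball[of 0 \<rho>]])
      show "(F has_derivative ?D z) (at z within cball 0 \<rho>)" if "z \<in> cball 0 \<rho>" for z
        using smooth_on_has_derivative[OF assms(1)] that assms(2) has_derivative_at_withinI by blast
      show "onorm (?D z) \<le> (\<Sum>b\<in>Basis. B b)" if z: "z \<in> cball 0 \<rho>" for z
      proof (rule onorm_bound)
        have lin: "linear (?D z)"
          using smooth_on_has_derivative[OF assms(1)] z assms(2) has_derivative_linear by blast
        show "0 \<le> (\<Sum>b\<in>Basis. B b)"
          using order_trans[OF norm_ge_zero B[OF z]] by (simp add: sum_nonneg)
        fix h
        have "?D z h = ?D z (\<Sum>b\<in>Basis. (h \<bullet> b) *\<^sub>R b)" by (simp add: euclidean_representation)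
        also have "\<dots> = (\<Sum>b\<in>Basis. (h \<bullet> b) *\<^sub>R ?D z b)"
          by (simp add: linear_sum[OF lin] linear_scale[OF lin])
        also have "norm \<dots> \<le> (\<Sum>b\<in>Basis. norm h * B b)"
          by (rule sum_norm_le) (use B[OF z] Basis_le_norm in \<open>auto intro!: mult_mono\<close>)
        finally show "norm (?D z h) \<le> (\<Sum>b\<in>Basis. B b) * norm h"
          by (simp add: sum_distrib_left mult.commute)
      qed
    qed (use xy in auto)
  qed
qed

context lie0
begin

text \<open>Conjugation by \<open>e t\<close> involves the curve twice, and \<open>a\<close> gives
  the two occurrences separate variables. The inverse curve has velocity \<open>- v\<close>, so the
  derivative is the difference of the partial ones: the left factor yields
  \<open>L v (L w u)\<close>, the right factor \<open>L w (L v u)\<close>.\<close>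

lemma Ad_derivative_fun:
  fixes e :: "real \<Rightarrow> 'g"
  assumes e: "tang e (\<lambda>t. t *\<^sub>R v) 0" and u: "smooth_fun A u"
  shows "((\<lambda>t. L (Ad (e t) w) u 0) has_real_derivative (L v (L w u) 0 - L w (L v u) 0)) (at 0)"
proof -
  define S where "S = D0 \<times> D0"
  have S: "open S" "(0, 0) \<in> S" unfolding S_def by (auto intro: open_Times D0_open)
  have op: "open (S \<times> D0)" by (intro open_Times S D0_open)
  define a where "a = (\<lambda>x. frechet_derivative (\<lambda>z. u (ex (fst x) + ex z + ex (snd x))) (at 0) w)"
  have "smap (S \<times> D0) (\<lambda>z. ex (fst (fst z)) + ex (snd z) + ex (snd (fst z)))"
  proof (intro smap_add)
    show "smap (S \<times> D0) (\<lambda>z. ex (fst (fst z)))"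
      by (rule smap_compose[OF smap_ex op smooth_on_linear[OF bounded_linear_compose[OF bounded_linear_fst bounded_linear_fst] op]])
        (auto simp: S_def)
    show "smap (S \<times> D0) (\<lambda>z. ex (snd z))"
      by (rule smap_compose[OF smap_ex op smooth_on_linear[OF bounded_linear_snd op]]) (auto simp: S_def)
    show "smap (S \<times> D0) (\<lambda>z. ex (snd (fst z)))"
      by (rule smap_compose[OF smap_ex op smooth_on_linear[OF bounded_linear_compose[OF bounded_linear_snd bounded_linear_fst] op]])
        (auto simp: S_def)
  qed
  from smooth_on_slice(1)[OF smap_smooth_fun[OF this u] S(1) D0_open zero_in_D0, of w]
  have a: "smooth_on S a" by (simp add: a_def)
  let ?Da = "frechet_derivative a (at (0, 0))"
  have linDa: "linear ?Da" by (rule has_derivative_linear[OF smooth_on_has_derivative[OF a S(2)]])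
  have 1: "?Da (v, 0) = L v (L w u) 0"
  proof -
    have "((\<lambda>x. L w u (0 + ex x)) has_derivative (\<lambda>h. ?Da (h, 0))) (at 0)"
      using smooth_on_partial(1)[OF a S(2)] by (simp add: a_def L_def)
    from fun_cong[OF has_derivative_unique[OF this L_has_derivative[OF smooth_fun_L[OF u]]], of v]
    show ?thesis .
  qed
  define q where "q = (\<lambda>z. u (ex (fst z) + ex (snd z)))"
  have q: "smooth_on S q" unfolding q_def S_def by (rule smap_smooth_fun[OF smap_ex_add u])
  \<comment> \<open>As a function of its second variable \<open>a\<close> is the
    \<open>w\<close>-derivative of the product \<open>q\<close> in the first; exchanging the order
    of differentiation makes the \<open>v\<close>-derivative the inner one.\<close>
  have 2: "?Da (0, v) = L w (L v u) 0"
  proof -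
    have "a (0, y) = frechet_derivative q (at (0, y)) (w, 0)" if "y \<in> D0" for y
    proof -
      have "((\<lambda>x. u (ex x + ex y)) has_derivative (\<lambda>h. frechet_derivative q (at (0, y)) (h, 0))) (at 0)"
        using smooth_on_partial(1)[OF q, of 0 y] that by (simp add: q_def S_def)
      then show ?thesis by (simp add: a_def frechet_derivative_at[symmetric])
    qed
    then have "((\<lambda>y. frechet_derivative q (at (0, y)) (w, 0)) has_derivative (\<lambda>h. ?Da (0, h))) (at 0)"
      by (intro has_derivative_transform_within_open[OF smooth_on_partial(2)[OF a S(2)] D0_open]) auto
    from fun_cong[OF has_derivative_unique[OF this smooth_on_partial(2)[OF smooth_on_frechet[OF q] S(2)]], of v]
    have "?Da (0, v) = frechet_derivative (\<lambda>x. frechet_derivative q (at x) (w, 0)) (at (0, 0)) (0, v)" .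
    also have "\<dots> = frechet_derivative (\<lambda>x. frechet_derivative q (at x) (0, v)) (at (0, 0)) (w, 0)"
      by (rule second_derivative_symmetric[OF q S])
    also have "\<dots> = L w (L v u) 0"
    proof -
      have "frechet_derivative q (at (x, 0)) (0, v) = L v u (0 + ex x)" if "x \<in> D0" for x
      proof -
        have "((\<lambda>y. u (ex x + ex y)) has_derivative (\<lambda>h. frechet_derivative q (at (x, 0)) (0, h))) (at 0)"
          using smooth_on_partial(2)[OF q, of x 0] that by (simp add: q_def S_def)
        from fun_cong[OF has_derivative_unique[OF this L_has_derivative[OF u]]] show ?thesis by simp
      qed
      then have "((\<lambda>x. L v u (0 + ex x)) has_derivative
         (\<lambda>h. frechet_derivative (\<lambda>x. frechet_derivative q (at x) (0, v)) (at (0, 0)) (h, 0))) (at 0)"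
        by (intro has_derivative_transform_within_open[OF smooth_on_partial(1)[OF smooth_on_frechet[OF q] S(2)] D0_open]) auto
      from fun_cong[OF has_derivative_unique[OF this L_has_derivative[OF smooth_fun_L[OF u]]], of w] show ?thesis .
    qed
    finally show ?thesis .
  qed
  have "((\<lambda>t. (co (e t), co (- e t))) has_derivative (\<lambda>t. (t *\<^sub>R v, - (t *\<^sub>R v)))) (at 0)"
    by (intro has_derivative_Pair tang_derivative[OF e] tang_derivative[OF tang_uminus[OF e]])
  moreover have "(co (e 0), co (- e 0)) = (0, 0)" using e by (simp add: tang_def)
  ultimately have "((\<lambda>t. a (co (e t), co (- e t))) has_derivative (\<lambda>t. ?Da (t *\<^sub>R v, - (t *\<^sub>R v)))) (at 0)"
    using diff_chain_at[of "\<lambda>t. (co (e t), co (- e t))" _ 0 a ?Da] smooth_on_has_derivative[OF a S(2)] by (simp add: o_def)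
  moreover have "?Da (t *\<^sub>R v, - (t *\<^sub>R v)) = (L v (L w u) 0 - L w (L v u) 0) * t" for t
  proof -
    have "(t *\<^sub>R v, - (t *\<^sub>R v)) = t *\<^sub>R ((v, 0) - (0, v))" by simp
    then show ?thesis using 1 2 by (simp only: linear_scale[OF linDa] linear_diff[OF linDa]) simp
  qed
  ultimately have D: "((\<lambda>t. a (co (e t), co (- e t))) has_real_derivative (L v (L w u) 0 - L w (L v u) 0)) (at 0)"
    by (simp add: has_field_derivative_def)
  have ev: "\<forall>\<^sub>F t in nhds 0. a (co (e t), co (- e t)) = L (Ad (e t) w) u 0"
  proof (rule eventually_mono[OF eventually_conj[OF tang_eventually_U0[OF e] tang_eventually_U0[OF tang_uminus[OF e]]]])
    fix t assume t: "e t \<in> U0 \<and> - e t \<in> U0"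
    show "a (co (e t), co (- e t)) = L (Ad (e t) w) u 0"
      using t unfolding L_Ad[OF u] by (simp add: a_def L_def ex_co del: add_uminus_conv_diff)
  qed
  show ?thesis using D DERIV_cong_ev[OF refl ev refl] by simp
qed

text \<open>Pairing with the coordinate functions reduces differentiability of a vector to that of
  finitely many numbers.\<close>

lemma Ad_derivative_ex:
  fixes e :: "real \<Rightarrow> 'g"
  assumes e: "tang e (\<lambda>t. t *\<^sub>R v) 0"
  shows "\<exists>c. ((\<lambda>t. Ad (e t) w) has_vector_derivative c) (at 0)"
proof -
  obtain cf :: "'e \<Rightarrow> 'g \<Rightarrow> real" where cf: "\<And>b. smooth_fun A (cf b)" "\<And>v b. L v (cf b) 0 = v \<bullet> b"
    using coordinate_functions by blast
  have "((\<lambda>t. \<Sum>b\<in>Basis. L (Ad (e t) w) (cf b) 0 *\<^sub>R b) has_vector_derivative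
     (\<Sum>b\<in>Basis. (L v (L w (cf b)) 0 - L w (L v (cf b)) 0) *\<^sub>R b)) (at 0)"
  proof (rule has_vector_derivative_sum)
    fix b :: 'e
    have "((\<lambda>t. L (Ad (e t) w) (cf b) 0) has_vector_derivative (L v (L w (cf b)) 0 - L w (L v (cf b)) 0)) (at 0)"
      using Ad_derivative_fun[OF e cf(1)] by (simp add: has_real_derivative_iff_has_vector_derivative)
    from bounded_linear.has_vector_derivative[OF bounded_linear_scaleR_left this]
    show "((\<lambda>t. L (Ad (e t) w) (cf b) 0 *\<^sub>R b) has_vector_derivative (L v (L w (cf b)) 0 - L w (L v (cf b)) 0) *\<^sub>R b) (at 0)" .
  qed
  then show ?thesis by (auto simp: cf euclidean_representation)
qed

text \<open>The Lie bracket transported to the coordinate space, introduced as the derivative of the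
  adjoint action. \<open>L_br\<close> identifies it with the commutator of left-invariant
  fields.\<close>

definition br :: "'e \<Rightarrow> 'e \<Rightarrow> 'e" where
  "br v w = vector_derivative (\<lambda>t. Ad (ex (t *\<^sub>R v)) w) (at 0)"

lemma tang_ex_line: "tang (\<lambda>t. ex (t *\<^sub>R v)) (\<lambda>t. t *\<^sub>R v) 0"
  by (rule tang_compose[of ex "\<lambda>v. v" "\<lambda>t. t *\<^sub>R v"]) (auto simp: tang_ex intro!: derivative_eq_intros)

lemma L_Ad_derivative:
  assumes "((\<lambda>t. Ad (e t) w) has_vector_derivative c) (at 0)" "smooth_fun A u"
  shows "((\<lambda>t. L (Ad (e t) w) u 0) has_real_derivative L c u 0) (at 0)"
  using bounded_linear.has_vector_derivative[OF has_derivative_bounded_linear[OF L_has_derivative[OF assms(2)]] assms(1)]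
  by (simp add: has_real_derivative_iff_has_vector_derivative)

lemma L_br:
  assumes u: "smooth_fun A u"
  shows "L (br v w) u 0 = L v (L w u) 0 - L w (L v u) 0"
proof -
  obtain c where c: "((\<lambda>t. Ad (ex (t *\<^sub>R v)) w) has_vector_derivative c) (at 0)"
    using Ad_derivative_ex[OF tang_ex_line] by blast
  then have "br v w = c" by (simp add: br_def vector_derivative_at)
  then show ?thesis
    using DERIV_unique[OF L_Ad_derivative[OF c u] Ad_derivative_fun[OF tang_ex_line u]] by simp
qed

text \<open>A vector is determined by its action on smooth functions, so the derivative depends on
  the curve only through its velocity.\<close>

lemma Ad_derivative:
  assumes e: "tang e (\<lambda>t. t *\<^sub>R v) 0"
  shows "((\<lambda>t. Ad (e t) w) has_vector_derivative br v w) (at 0)"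
proof -
  obtain c where c: "((\<lambda>t. Ad (e t) w) has_vector_derivative c) (at 0)"
    using Ad_derivative_ex[OF e] by blast
  have "c = br v w"
    by (rule L_inject) (use DERIV_unique[OF L_Ad_derivative[OF c] Ad_derivative_fun[OF e]] L_br in simp)
  then show ?thesis using c by simp
qed

text \<open>The left logarithmic derivative: the curve is translated back to the identity, so that
  the one centred chart serves at every point.\<close>

definition velocity :: "(real \<Rightarrow> 'g) \<Rightarrow> 'e \<Rightarrow> real \<Rightarrow> bool" where
  "velocity c v t \<longleftrightarrow> tang (\<lambda>\<tau>. - c t + c \<tau>) (\<lambda>h. h *\<^sub>R v) t"

lemma velocity_deriv:
  assumes "velocity c v t" "smooth_fun A u"
  shows "((\<lambda>\<tau>. u (c \<tau>)) has_real_derivative L v u (c t)) (at t)"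
proof -
  have "((\<lambda>\<tau>. u (c t + (- c t + c \<tau>))) has_derivative (\<lambda>h. L (h *\<^sub>R v) u (c t))) (at t)"
    by (rule tang_fun[OF assms[unfolded velocity_def]])
  then show ?thesis
    by (simp add: has_field_derivative_def linear_scale[OF L_linear[OF assms(2)]] mult.commute[of _ "L v u (c t)"]
        flip: add.assoc)
qed

lemma velocity_isCont: "velocity c v t \<Longrightarrow> isCont c t"
proof -
  assume "velocity c v t"
  then have "isCont (\<lambda>\<tau>. - c t + c \<tau>) t" by (simp add: velocity_def tang_def)
  from continuous_add[OF continuous_const this, of "c t"] show ?thesis by (simp flip: add.assoc)
qed

text \<open>Translated back at time \<open>t\<close>, the quotient of the two curves is the
  conjugate by \<open>c2 t\<close> of the quotient of the translated curves. For equal velocities it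
  has velocity 0, which is what uniqueness rests on.\<close>

lemma velocity_diff:
  assumes "velocity c1 v1 t" "velocity c2 v2 t"
  shows "velocity (\<lambda>\<tau>. c1 \<tau> + - c2 \<tau>) (Ad (c2 t) (v1 - v2)) t"
proof -
  have "tang (\<lambda>\<tau>. c2 t + ((- c1 t + c1 \<tau>) + - (- c2 t + c2 \<tau>)) + - c2 t)
      (\<lambda>h. Ad (c2 t) (h *\<^sub>R v1 + - (h *\<^sub>R v2))) t"
    by (intro tang_conj tang_add tang_uminus assms[unfolded velocity_def])
  moreover have "(\<lambda>\<tau>. c2 t + ((- c1 t + c1 \<tau>) + - (- c2 t + c2 \<tau>)) + - c2 t) =
      (\<lambda>\<tau>. - (c1 t + - c2 t) + (c1 \<tau> + - c2 \<tau>))"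
    by (simp add: minus_add add.assoc del: add_uminus_conv_diff)
  moreover have "(\<lambda>h. Ad (c2 t) (h *\<^sub>R v1 + - (h *\<^sub>R v2))) = (\<lambda>h. h *\<^sub>R Ad (c2 t) (v1 - v2))"
    by (simp add: linear_scale[OF Ad_linear, symmetric] scaleR_diff_right)
  ultimately show ?thesis by (simp add: velocity_def)
qed

lemma velocity_left: "velocity c v t \<Longrightarrow> velocity (\<lambda>\<tau>. g + c \<tau>) v t"
  by (simp add: velocity_def minus_add add.assoc del: add_uminus_conv_diff)

lemma velocity_shift:
  assumes "velocity c v (s + t)"
  shows "velocity (\<lambda>\<tau>. c (s + \<tau>)) v t"
  unfolding velocity_def
  by (rule tang_compose[of "\<lambda>\<tau>. - c (s + t) + c \<tau>" "\<lambda>h. h *\<^sub>R v" "\<lambda>\<tau>. s + \<tau>" t "\<lambda>h. h"])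
    (use assms in \<open>auto simp: velocity_def intro!: derivative_eq_intros\<close>)

lemma separate:
  assumes "p \<noteq> 0"
  obtains \<beta> :: "'g \<Rightarrow> real" where "smooth_fun A \<beta>" "\<beta> 0 = 1" "\<beta> p = 0"
proof -
  have "open (- {p})" "0 \<in> - {p}" using assms by auto
  from bump_fun[OF this] obtain \<beta> :: "'g \<Rightarrow> real" and K where
    "smooth_fun A \<beta>" "\<beta> 0 = 1" "\<And>q. q \<notin> K \<Longrightarrow> \<beta> q = 0" "K \<subseteq> - {p}" by metis
  then show ?thesis using that by blast
qed

text \<open>The quotient of the two curves has velocity 0, so every smooth function is constant
  along it, and a bump function separates the identity from any other value.\<close>

lemma velocity_unique:
  assumes S: "open S" "convex S" "t0 \<in> S" "t \<in> S" and c: "c1 t0 = c2 t0"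
    and v: "\<And>t. t \<in> S \<Longrightarrow> velocity c1 v t" "\<And>t. t \<in> S \<Longrightarrow> velocity c2 v t"
  shows "c1 t = c2 t"
proof (rule ccontr)
  assume ne: "c1 t \<noteq> c2 t"
  let ?c = "\<lambda>\<tau>. c1 \<tau> + - c2 \<tau>"
  have "?c t \<noteq> 0" using ne by simp
  then obtain \<beta> :: "'g \<Rightarrow> real" where \<beta>: "smooth_fun A \<beta>" "\<beta> 0 = 1" "\<beta> (?c t) = 0" by (rule separate)
  have "((\<lambda>\<tau>. \<beta> (?c \<tau>)) has_field_derivative 0) (at \<tau> within S)" if "\<tau> \<in> S" for \<tau>
    using velocity_deriv[OF velocity_diff[OF v(1)[OF that] v(2)[OF that]] \<beta>(1)]
    by (simp add: linear_0[OF Ad_linear] linear_0[OF L_linear[OF \<beta>(1)]] has_field_derivative_at_within)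
  then have "\<exists>k. \<forall>\<tau>\<in>S. \<beta> (?c \<tau>) = k"
    by (rule has_field_derivative_zero_constant[OF S(2)])
  then obtain k where "\<And>\<tau>. \<tau> \<in> S \<Longrightarrow> \<beta> (?c \<tau>) = k" by blast
  from this[OF S(3)] this[OF S(4)] show False using \<beta> c by simp
qed

text \<open>Read in coordinates, the left-invariant field at \<open>x\<close> is \<open>F x\<close>,
  the derivative of right multiplication at the identity applied to \<open>v\<close>. It is smooth,
  hence Lipschitz on a ball, and Picard's theorem applies.\<close>

lemma local_integral_curve:
  obtains \<delta> c where "\<delta> > 0" "c 0 = 0" "\<And>t. \<bar>t\<bar> < \<delta> \<Longrightarrow> velocity c v t"
proof -
  let ?m = "\<lambda>z. ex (fst z) + ex (snd z)"
  let ?M = "(D0 \<times> D0) \<inter> ?m -` U0"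
  have "open ?M" by (rule smap_openD[OF smap_ex_add U0_open])
  moreover have "(0, 0) \<in> ?M" using zero_in_U0 by simp
  ultimately obtain S1 S2 where S12: "open S1" "open S2" "(0, 0) \<in> S1 \<times> S2" "S1 \<times> S2 \<subseteq> ?M"
    by (rule open_prod_elim)
  obtain r where r: "r > 0" "cball 0 r \<subseteq> S1" using S12 by (metis SigmaD1 open_contains_cball)
  define F where "F = (\<lambda>x. frechet_derivative (\<lambda>y. co (?m (x, y))) (at 0) v)"
  have m: "smooth_on (S1 \<times> S2) (\<lambda>z. co (?m z))"
    by (rule smooth_on_subset[OF smap_co[OF smap_ex_add] S12(4)])
  have F: "smooth_on S1 F"
    unfolding F_def by (rule smooth_on_slice(1)[OF m S12(1,2)]) (use S12 in auto)
  obtain \<Lambda> where \<Lambda>: "\<And>x y. x \<in> cball 0 r \<Longrightarrow> y \<in> cball 0 r \<Longrightarrow> norm (F x - F y) \<le> \<Lambda> * norm (x - y)"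
    using smooth_on_cball_Lipschitz[OF F r(2)] by blast
  have "bounded (F ` cball 0 r)"
    by (intro compact_imp_bounded compact_continuous_image continuous_on_subset[OF smooth_on_continuous_on[OF F] r(2)]) simp
  then obtain M where M: "\<And>x. x \<in> cball 0 r \<Longrightarrow> norm (F x) \<le> M" unfolding bounded_iff by blast
  obtain \<delta> x where x: "\<delta> > 0" "x 0 = 0" "\<And>t. x t \<in> cball 0 r"
    "\<And>t. \<bar>t\<bar> < \<delta> \<Longrightarrow> (x has_vector_derivative F (x t)) (at t)"
    using Picard[of r F M \<Lambda>, OF r(1) M \<Lambda>] by blast
  show ?thesis
  proof (rule that[of \<delta> "\<lambda>t. ex (x t)"])
    fix t :: real assume t: "\<bar>t\<bar> < \<delta>"
    define \<xi> where "\<xi> = x t"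
    have \<xi>1: "\<xi> \<in> S1" using x(3) r(2) by (auto simp: \<xi>_def)
    have zS2: "0 \<in> S2" using S12 by auto
    have \<xi>: "\<xi> \<in> D0" "ex \<xi> \<in> U0" using \<xi>1 zS2 S12(4) by force+
    \<comment> \<open>\<open>P\<close> is the derivative of translation from \<open>ex \<xi>\<close>
      back to the identity. Following right multiplication by that translation gives
      \<open>ex\<close>, so \<open>P\<close> undoes the derivative that defines \<open>F\<close>,
      and the coordinate velocity \<open>F \<xi>\<close> becomes \<open>v\<close>.\<close>
    define P where "P = frechet_derivative (\<lambda>z. co (- ex \<xi> + ex z)) (at \<xi>)"
    have P: "tang (\<lambda>z. - ex \<xi> + ex z) P \<xi>"
      unfolding P_def by (rule tang_smap[OF smap_add[OF smap_const[OF D0_open] smap_ex] \<xi>(1)]) simp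
    let ?k = "\<lambda>y. co (?m (\<xi>, y))"
    have k: "(?k has_derivative frechet_derivative ?k (at 0)) (at 0)"
      by (rule frechet_derivative_works[THEN iffD1, OF differentiableI[OF smooth_on_slice(2)[OF m S12(1,2) zS2 \<xi>1]]])
    have k0: "?k 0 = \<xi>" using \<xi> by (simp add: co_ex)
    have P': "tang (\<lambda>z. - ex \<xi> + ex z) P (?k 0)" unfolding k0 by (rule P)
    from tang_compose[OF P' k] have "tang ex (\<lambda>h. P (frechet_derivative ?k (at 0) h)) 0"
    proof (rule tang_cong)
      have "\<forall>\<^sub>F y in nhds 0. y \<in> S2" using S12(2) zS2 by (rule eventually_nhds_in_open)
      then show "\<forall>\<^sub>F y in nhds 0. - ex \<xi> + ex (?k y) = ex y"
      proof (rule eventually_mono)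
        fix y assume "y \<in> S2"
        then have "ex \<xi> + ex y \<in> U0" using \<xi>1 S12(4) by force
        then show "- ex \<xi> + ex (?k y) = ex y" by (simp add: ex_co flip: add.assoc)
      qed
    qed
    from fun_cong[OF tang_unique[OF this tang_ex], of v] have "P (frechet_derivative ?k (at 0) v) = v" .
    then have PF: "P (F \<xi>) = v" by (simp add: F_def)
    have "tang (\<lambda>\<tau>. - ex \<xi> + ex (x \<tau>)) (\<lambda>h. P (h *\<^sub>R F (x t))) t"
      unfolding \<xi>_def by (rule tang_compose[OF P[unfolded \<xi>_def] x(4)[OF t, unfolded has_vector_derivative_def]])
    then show "velocity (\<lambda>t. ex (x t)) v t"
      using PF unfolding velocity_def by (simp add: \<xi>_def linear_scale[OF bounded_linear.linear[OF tang_bounded_linear[OF P]], unfolded \<xi>_def])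
  qed (use x in auto)
qed

definition one_param :: "'e \<Rightarrow> (real \<Rightarrow> 'g) \<Rightarrow> bool" where
  "one_param v e \<longleftrightarrow> (\<forall>s t. e (s + t) = e s + e t) \<and> tang e (\<lambda>t. t *\<^sub>R v) 0"

lemma one_param_add: "one_param v e \<Longrightarrow> e (s + t) = e s + e t" by (simp add: one_param_def)

lemma one_param_0: "one_param v e \<Longrightarrow> e 0 = 0" by (simp add: one_param_def tang_def)

lemma one_param_minus: "one_param v e \<Longrightarrow> e (- t) = - e t"
  using one_param_add[of v e t "- t"] one_param_0[of v e] by (simp add: eq_neg_iff_add_eq_0 minus_unique)

lemma one_param_velocity:
  assumes "one_param v e" shows "velocity e v t"
proof -
  have "velocity (\<lambda>\<tau>. e (- t + \<tau>)) v t"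
    by (rule velocity_shift) (use assms in \<open>simp add: velocity_def one_param_def one_param_0[OF assms]\<close>)
  from velocity_left[OF this, of "e t"] show ?thesis
    by (simp add: one_param_add[OF assms, symmetric])
qed

text \<open>As functions of \<open>t\<close>, \<open>c (s + t)\<close> and \<open>c s + c t\<close>
  have the same velocity and the same value at 0, so the local integral curve is a local
  homomorphism and extends to all times.\<close>

lemma one_param_ex: "\<exists>e. one_param v e"
proof -
  obtain \<delta> c where c: "\<delta> > 0" "c 0 = 0" "\<And>t. \<bar>t\<bar> < \<delta> \<Longrightarrow> velocity c v t" using local_integral_curve by blast
  have "c (s + t) = c s + c t" if st: "\<bar>s\<bar> < \<delta>" "\<bar>t\<bar> < \<delta>" "\<bar>s + t\<bar> < \<delta>" for s t
  proof -
    let ?S = "{-\<delta><..<\<delta>} \<inter> {-\<delta>-s<..<\<delta>-s}"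
    show ?thesis
    proof (rule velocity_unique[of ?S 0 t])
      show "c (s + 0) = c s + c 0" using c by simp
      show "velocity (\<lambda>t. c (s + t)) v \<tau>" if "\<tau> \<in> ?S" for \<tau> using that by (intro velocity_shift c) auto
      show "velocity (\<lambda>t. c s + c t) v \<tau>" if "\<tau> \<in> ?S" for \<tau> using that by (intro velocity_left c) auto
    qed (use st c in \<open>auto intro: convex_Int\<close>)
  qed
  with c(1) obtain e where e: "\<And>s t. e (s + t) = e s + e t" "\<And>t. \<bar>t\<bar> < \<delta> \<Longrightarrow> e t = c t"
    using local_hom_extends[of \<delta> c] by (metis real_norm_def)
  have "tang c (\<lambda>t. t *\<^sub>R v) 0" using c(3)[of 0] c(1,2) by (simp add: velocity_def)
  then have "tang e (\<lambda>t. t *\<^sub>R v) 0"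
  proof (rule tang_cong)
    have "\<forall>\<^sub>F t in nhds 0. t \<in> {-\<delta><..<\<delta>}" using c(1) by (intro eventually_nhds_in_open) auto
    then show "\<forall>\<^sub>F t in nhds 0. c t = e t" by (rule eventually_mono) (use e in auto)
  qed
  then show ?thesis using e(1) by (auto simp: one_param_def)
qed

lemma one_param_unique: "one_param v e \<Longrightarrow> one_param v e' \<Longrightarrow> e t = e' t"
  by (rule velocity_unique[of UNIV 0 t e e' v]) (auto simp: one_param_0 one_param_velocity)

text \<open>The exponential curve of \<open>v\<close>; the choice is harmless by
  \<open>one_param_unique\<close>.\<close>

definition ep :: "'e \<Rightarrow> real \<Rightarrow> 'g" where "ep v = (SOME e. one_param v e)"

lemma ep: "one_param v (ep v)"
  unfolding ep_def using one_param_ex by (rule someI_ex)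

lemma ep_cont: "continuous_on UNIV (ep v)"
  by (simp add: continuous_at_imp_continuous_on velocity_isCont[OF one_param_velocity[OF ep]])

section \<open>Left-invariant vector fields and local accessibility\<close>

lemma br_linear: "linear (br v)"
proof (rule linearI)
  fix w1 w2 c
  note D = Ad_derivative[OF tang_ex_line]
  have "((\<lambda>t. Ad (ex (t *\<^sub>R v)) (w1 + w2)) has_vector_derivative br v w1 + br v w2) (at 0)"
    using has_vector_derivative_add[OF D D] by (simp add: linear_add[OF Ad_linear])
  from vector_derivative_unique_at[OF D this] show "br v (w1 + w2) = br v w1 + br v w2" .
  have "((\<lambda>t. Ad (ex (t *\<^sub>R v)) (c *\<^sub>R w1)) has_vector_derivative c *\<^sub>R br v w1) (at 0)"
    using bounded_linear.has_vector_derivative[OF bounded_linear_scaleR_right D]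
    by (simp add: linear_scale[OF Ad_linear])
  from vector_derivative_unique_at[OF D this] show "br v (c *\<^sub>R w1) = c *\<^sub>R br v w1" .
qed

lemma br_antisym: "br v w = - br w v"
  by (rule L_inject) (simp add: L_br linear_neg[OF L_linear])

lemma br_linear_left: "linear (\<lambda>v. br v w)"
  using linear_compose_neg[OF br_linear[of w]] by (simp add: br_antisym[of _ w])

text \<open>Identifies a left-invariant field with its value at the identity, which turns the
  abstract Lie algebra into the coordinate space with bracket \<open>br\<close>.\<close>

definition represents :: "'g vfield \<Rightarrow> 'e \<Rightarrow> bool" where
  "represents X v \<longleftrightarrow> (\<forall>u. smooth_fun A u \<longrightarrow> (\<forall>p. X u p = L v u p))"

lemma representsD: "represents X v \<Longrightarrow> smooth_fun A u \<Longrightarrow> X u p = L v u p"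
  by (simp add: represents_def)

lemma represents_unique: "represents X v \<Longrightarrow> represents X w \<Longrightarrow> v = w"
  by (rule L_inject) (simp add: represents_def)

lemma represents_0: "represents 0 0"
  by (simp add: represents_def linear_0[OF L_linear] zero_fun_def)

lemma represents_add: "represents X v \<Longrightarrow> represents Y w \<Longrightarrow> represents (X + Y) (v + w)"
  by (simp add: represents_def linear_add[OF L_linear] plus_fun_def)

lemma represents_scale: "represents X v \<Longrightarrow> represents (c *\<^sub>R X) (c *\<^sub>R v)"
  by (simp add: represents_def linear_scale[OF L_linear] scaleR_fun_def)

lemma represents_sum: "(\<And>i. i \<in> I \<Longrightarrow> represents (X i) (v i)) \<Longrightarrow> represents (\<Sum>i\<in>I. X i) (\<Sum>i\<in>I. v i)"
  by (induction I rule: infinite_finite_induct) (auto intro: represents_0 represents_add)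

lemma represents_bracket:
  assumes "represents X v" "represents Y w"
  shows "represents (lie_bracket X Y) (br v w)"
  unfolding represents_def
proof (intro allI impI)
  fix u :: "'g \<Rightarrow> real" and p assume u: "smooth_fun A u"
  have *: "X u = L v u" "Y u = L w u" if "smooth_fun A u" for u
    using assms that by (auto simp: represents_def fun_eq_iff)
  have "lie_bracket X Y u p = L v (L w u) p - L w (L v u) p"
    by (simp add: lie_bracket_def fun_diff_def * u smooth_fun_L)
  also have "\<dots> = L v (L w (\<lambda>q. u (p + q))) 0 - L w (L v (\<lambda>q. u (p + q))) 0"
  proof -
    have "L v (\<lambda>q. u (p + q)) = (\<lambda>q. L v u (p + q))" for v by (simp add: fun_eq_iff L_left)
    then show ?thesis by (simp add: L_left)
  qed
  also have "\<dots> = L (br v w) u p" by (simp add: L_br[symmetric] smooth_fun_left[OF u] L_left)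
  finally show "lie_bracket X Y u p = L (br v w) u p" .
qed

text \<open>Evaluation of \<open>X u\<close> at the identity is a derivation there, hence given by a
  vector; left invariance carries the formula to every other point.\<close>

lemma lie_algebra_represents:
  assumes "X \<in> lie_algebra A"
  shows "\<exists>v. represents X v"
proof -
  have X: "\<And>u v. smooth_fun A u \<Longrightarrow> smooth_fun A v \<Longrightarrow> X (\<lambda>p. u p + v p) = (\<lambda>p. X u p + X v p)"
     "\<And>c u. smooth_fun A u \<Longrightarrow> X (\<lambda>p. c * u p) = (\<lambda>p. c * X u p)"
     "\<And>u v. smooth_fun A u \<Longrightarrow> smooth_fun A v \<Longrightarrow> X (\<lambda>p. u p * v p) = (\<lambda>p. u p * X v p + v p * X u p)"
     "\<And>g u. smooth_fun A u \<Longrightarrow> X (\<lambda>p. u (g + p)) = (\<lambda>p. X u (g + p))"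
    using assms by (simp_all add: lie_algebra_def vector_field_def left_invariant_def)
  obtain v where v: "\<And>u. smooth_fun A u \<Longrightarrow> X u 0 = L v u 0"
    by (rule derivation_at_0[of "\<lambda>u. X u 0"]) (simp_all add: X)
  have "X u p = L v u p" if u: "smooth_fun A u" for u p
  proof -
    have "X u p = X (\<lambda>q. u (p + q)) 0" by (simp add: X(4)[OF u])
    also have "\<dots> = L v u p" by (simp add: v smooth_fun_left[OF u] L_left)
    finally show ?thesis .
  qed
  then show ?thesis by (auto simp: represents_def)
qed

lemma represented_in_lie_algebra: "\<exists>X\<in>lie_algebra A. represents X v"
proof
  let ?X = "\<lambda>u. if smooth_fun A u then L v u else (\<lambda>p. 0)"
  show "represents ?X v" by (simp add: represents_def)
  have "L v (\<lambda>p. c * u p) p = c * L v u p" if "smooth_fun A u" for u c p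
    using L_of_mult[OF smooth_fun_const[of c] that] by (simp add: L_of_const)
  then show "?X \<in> lie_algebra A"
    by (auto simp: lie_algebra_def vector_field_def left_invariant_def fun_eq_iff smooth_fun_L smooth_fun_add
      smooth_fun_mult smooth_fun_const smooth_fun_left L_of_add L_of_mult L_left)
qed

definition ev :: "'g vfield \<Rightarrow> 'e" where "ev X = (SOME v. represents X v)"

lemma ev_eqI: "represents X v \<Longrightarrow> ev X = v"
  unfolding ev_def using represents_unique by (metis someI)

lemma ev_represents: "X \<in> lie_algebra A \<Longrightarrow> represents X (ev X)"
  using lie_algebra_represents ev_eqI by metis

lemma span_represents:
  assumes "X \<in> span B" "subspace W" "\<And>Y. Y \<in> B \<Longrightarrow> \<exists>v\<in>W. represents Y v"
  shows "\<exists>v\<in>W. represents X v"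
  using assms(1)
proof (induction rule: span_induct_alt)
  case base
  then show ?case using represents_0 subspace_0[OF assms(2)] by blast
next
  case (step c x y)
  then show ?case
    using assms(3)[OF step(1)] represents_add represents_scale subspace_add[OF assms(2)] subspace_scale[OF assms(2)]
    by blast
qed

section \<open>The strata as subspaces of the coordinate space\<close>

lemma stratification_decompose:
  assumes "stratification A s V" "\<And>i. i \<in> {1..s} \<Longrightarrow> ev ` V i \<subseteq> W" "subspace W"
  shows "W = UNIV"
proof -
  have "v \<in> W" for v
  proof -
    obtain X where X: "X \<in> lie_algebra A" "represents X v" using represented_in_lie_algebra by blast
    have "\<forall>X\<in>lie_algebra A. \<exists>!Y. Y \<in> (\<Pi>\<^sub>E i\<in>{1..s}. V i) \<and> X = (\<Sum>i = 1..s. Y i)"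
      using assms(1) unfolding stratification_def by (elim conjE)
    from ex1_implies_ex[OF bspec[OF this X(1)]]
    obtain Y where Y: "Y \<in> (\<Pi>\<^sub>E i\<in>{1..s}. V i)" "X = (\<Sum>i = 1..s. Y i)" by (elim exE conjE)
    have "Y i \<in> V i" "V i \<subseteq> lie_algebra A" if "i \<in> {1..s}" for i
      using Y(1) that assms(1) by (auto simp: stratification_def)
    then have "represents (Y i) (ev (Y i))" "ev (Y i) \<in> W" if "i \<in> {1..s}" for i
      using ev_represents that assms(2) by blast+
    then have "represents X (\<Sum>i = 1..s. ev (Y i))" "(\<Sum>i = 1..s. ev (Y i)) \<in> W"
      unfolding Y(2) by (auto intro!: represents_sum subspace_sum[OF assms(3)])
    then show ?thesis using represents_unique[OF X(2)] by simp
  qed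
  then show ?thesis by blast
qed

text \<open>Induction over the strata: each one above the first is spanned by brackets of the first
  with the preceding one. For this reason only brackets with elements of \<open>V 1\<close> appear
  among the assumptions on \<open>W\<close>.\<close>

lemma stratification_generates:
  assumes st: "stratification A s V" and W: "subspace W" "ev ` V 1 \<subseteq> W"
    and br: "\<And>v w. v \<in> ev ` V 1 \<Longrightarrow> w \<in> W \<Longrightarrow> br v w \<in> W"
  shows "W = UNIV"
proof (rule stratification_decompose[OF st _ W(1)])
  have V: "V i \<subseteq> lie_algebra A" if "i \<in> {1..s}" for i
    using st that by (simp add: stratification_def)
  have "i \<in> {1..s} \<longrightarrow> ev ` V i \<subseteq> W" for i
  proof (induction i)
    case (Suc i)
    show ?case
    proof (cases "i = 0")
      case False
      show ?thesis
      proof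
        assume i: "Suc i \<in> {1..s}"
        have i1: "i \<in> {1..s}" "i \<in> {1..<s}" using i False by auto
        have 1: "1 \<in> {1..s}" using i by auto
        have "bracket_space (V 1) (V i) = V (Suc i)" using st i1 by (simp add: stratification_def)
        then have eq: "V (Suc i) = span {lie_bracket X Y | X Y. X \<in> V 1 \<and> Y \<in> V i}"
          by (simp add: bracket_space_def)
        show "ev ` V (Suc i) \<subseteq> W"
        proof (rule image_subsetI)
          fix X assume "X \<in> V (Suc i)"
          then have "\<exists>v\<in>W. represents X v"
            unfolding eq
          proof (rule span_represents[OF _ W(1)])
            fix Z assume "Z \<in> {lie_bracket X Y | X Y. X \<in> V 1 \<and> Y \<in> V i}"
            then obtain X Y where Z: "Z = lie_bracket X Y" "X \<in> V 1" "Y \<in> V i" by blast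
            have "represents Z (br (ev X) (ev Y))"
              unfolding Z(1) using Z V[OF 1] V[OF i1(1)] by (intro represents_bracket ev_represents) auto
            moreover have "br (ev X) (ev Y) \<in> W" using Z Suc i1 by (intro br) auto
            ultimately show "\<exists>v\<in>W. represents Z v" by blast
          qed
          then show "ev X \<in> W" using ev_eqI by auto
        qed
      qed
    qed (use W in simp)
  qed simp
  then show "\<And>i. i \<in> {1..s} \<Longrightarrow> ev ` V i \<subseteq> W" by blast
qed

text \<open>
  The hypothesis \<open>nil\<close> propagates commutation with \<open>V 1\<close> downwards from the top stratum.
\<close>

lemma stratification_abelian:
  assumes st: "stratification A s V"
    and nil: "\<And>v w. v \<in> ev ` V 1 \<Longrightarrow> br v (br v w) = 0 \<Longrightarrow> br v w = 0"
  shows "br v w = 0"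
proof -
  have s1: "1 \<le> s" using st by (simp add: stratification_def)
  have V: "V i \<subseteq> lie_algebra A" if "i \<in> {1..s}" for i
    using st that by (simp add: stratification_def)
  have *: "\<forall>X\<in>V 1. \<forall>Y\<in>V i. br (ev X) (ev Y) = 0" if "i \<in> {1..s}" for i
  proof -
    have "i \<le> s" "1 \<le> i" using that by auto
    then show ?thesis
    proof (induction rule: inc_induct)
      case base
      show ?case
      proof (intro ballI)
        fix X Y assume XY: "X \<in> V 1" "Y \<in> V s"
        have "lie_bracket X Y \<in> bracket_space (V 1) (V s)"
          unfolding bracket_space_def using XY by (intro span_base) blast
        then have "lie_bracket X Y = 0" using st by (simp add: stratification_def)
        moreover have "represents (lie_bracket X Y) (br (ev X) (ev Y))"
          using XY V[of 1] V[of s] s1 by (intro represents_bracket ev_represents) auto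
        ultimately show "br (ev X) (ev Y) = 0" using represents_unique represents_0 by metis
      qed
    next
      case (step i)
      show ?case
      proof (intro ballI)
        fix X Y assume XY: "X \<in> V 1" "Y \<in> V i"
        have i: "i \<in> {1..<s}" "i \<in> {1..s}" "Suc i \<in> {1..s}" using step by auto
        have "lie_bracket X Y \<in> bracket_space (V 1) (V i)"
          unfolding bracket_space_def using XY by (intro span_base) blast
        then have mem: "lie_bracket X Y \<in> V (Suc i)" using st i by (simp add: stratification_def)
        have eq: "ev (lie_bracket X Y) = br (ev X) (ev Y)"
          using XY V[of 1] V[OF i(2)] s1 by (intro ev_eqI represents_bracket ev_represents) auto
        have "br (ev X) (ev (lie_bracket X Y)) = 0"
        proof -
          have "\<forall>X\<in>V 1. \<forall>Y\<in>V (Suc i). br (ev X) (ev Y) = 0" by (rule step.IH) simp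
          from bspec[OF bspec[OF this XY(1)] mem] show ?thesis .
        qed
        then have "br (ev X) (br (ev X) (ev Y)) = 0" unfolding eq .
        then show "br (ev X) (ev Y) = 0" by (rule nil[OF imageI[OF XY(1)]])
      qed
    qed
  qed
  have 1: "{w. br (ev X) w = 0} = UNIV" if "X \<in> V 1" for X
  proof (rule stratification_decompose[OF st])
    show "subspace {w. br (ev X) w = 0}" by (rule linear_subspace_kernel[OF br_linear])
    show "ev ` V i \<subseteq> {w. br (ev X) w = 0}" if "i \<in> {1..s}" for i using *[OF that] \<open>X \<in> V 1\<close> by auto
  qed
  \<comment> \<open>The centraliser of \<open>w\<close> contains the first stratum. It is closed
    under brackets with that stratum for the simple reason that all those brackets are 0.\<close>
  have "{v. br v w = 0} = UNIV"
  proof (rule stratification_generates[OF st])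
    show "subspace {v. br v w = 0}" by (rule linear_subspace_kernel[OF br_linear_left])
    show "ev ` V 1 \<subseteq> {v. br v w = 0}" using 1 by blast
    show "br v w' \<in> {v. br v w = 0}" if "v \<in> ev ` V 1" for v w'
    proof -
      obtain X where X: "X \<in> V 1" "v = ev X" using \<open>v \<in> ev ` V 1\<close> by blast
      have "br v w' = 0" using 1[OF X(1)] unfolding X(2) by blast
      then show ?thesis using linear_0[OF br_linear_left[of w]] by simp
    qed
  qed
  then show ?thesis by blast
qed

text \<open>Coordinates of the second kind: a product of exponential curves with one factor for each
  \<open>c\<close>, conjugated by \<open>h c\<close> to point in the direction
  \<open>Ad (h c) (w c)\<close> and run for the time \<open>\<kappa> c x\<close>.\<close>

primrec flow_product :: "('e \<Rightarrow> 'g) \<Rightarrow> ('e \<Rightarrow> 'e) \<Rightarrow> ('e \<Rightarrow> 'e \<Rightarrow> real) \<Rightarrow> 'e list \<Rightarrow> 'e \<Rightarrow> 'g" where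
  "flow_product h w \<kappa> [] x = 0"
| "flow_product h w \<kappa> (c # cs) x = (h c + ep (w c) (\<kappa> c x) + - h c) + flow_product h w \<kappa> cs x"

lemma tang_flow_product:
  assumes "\<And>c. c \<in> set cs \<Longrightarrow> bounded_linear (\<kappa> c)" "\<And>c. c \<in> set cs \<Longrightarrow> Ad (h c) (w c) = c"
  shows "tang (flow_product h w \<kappa> cs) (\<lambda>x. \<Sum>c\<leftarrow>cs. \<kappa> c x *\<^sub>R c) 0"
  using assms
proof (induction cs)
  case Nil
  then show ?case using tang_const by simp
next
  case (Cons c cs)
  have \<kappa>: "bounded_linear (\<kappa> c)" using Cons.prems by simp
  have "tang (\<lambda>x. ep (w c) (\<kappa> c x)) (\<lambda>x. \<kappa> c x *\<^sub>R w c) 0"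
    by (rule tang_compose[of "ep (w c)" "\<lambda>t. t *\<^sub>R w c" "\<kappa> c" 0 "\<kappa> c"])
      (use ep[of "w c"] bounded_linear_imp_has_derivative[OF \<kappa>] linear_0[OF bounded_linear.linear[OF \<kappa>]] in
        \<open>simp_all add: one_param_def\<close>)
  from tang_conj[OF this, of "h c"] Cons.prems(2)[of c]
  have "tang (\<lambda>x. h c + ep (w c) (\<kappa> c x) + - h c) (\<lambda>x. \<kappa> c x *\<^sub>R c) 0"
    by (simp add: linear_scale[OF Ad_linear])
  from tang_add[OF this Cons.IH] Cons.prems show ?case by simp
qed

lemma flow_product_cont:
  assumes "\<And>c. c \<in> set cs \<Longrightarrow> bounded_linear (\<kappa> c)"
  shows "continuous_on UNIV (flow_product h w \<kappa> cs)"
  using assms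
proof (induction cs)
  case (Cons c cs)
  have "continuous_on UNIV (\<kappa> c)" using Cons.prems by (simp add: linear_continuous_on)
  then have "continuous_on UNIV (\<lambda>x. ep (w c) (\<kappa> c x))"
    by (rule continuous_on_compose2[OF ep_cont]) simp
  then show ?case using Cons by (auto intro!: continuous_intros)
qed (simp add: continuous_on_const)

text \<open>\<open>P\<close> is known to be differentiable at the single point 0 and merely
  continuous elsewhere, so the inverse function theorem is out of reach. The topological open
  mapping theorem for maps with invertible derivative at one point takes its place.\<close>

lemma tang_id_open:
  fixes P :: "'e \<Rightarrow> 'g"
  assumes P: "tang P (\<lambda>x. x) 0" "continuous_on UNIV P" and T: "open T" "0 \<in> T"
  obtains N where "open N" "0 \<in> N" "N \<subseteq> P ` T"
proof -
  have P0: "P 0 = 0" using P(1) by (simp add: tang_def)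
  let ?S = "P -` U0"
  have S: "open ?S" using P(2) U0_open by (simp add: continuous_open_vimage continuous_on_eq_continuous_at)
  have "co (P 0) \<in> interior ((\<lambda>x. co (P x)) ` (?S \<inter> T))"
  proof (rule sussmann_open_mapping[OF S])
    show "continuous_on ?S (\<lambda>x. co (P x))"
      by (rule continuous_on_compose2[OF co_cont continuous_on_subset[OF P(2)]]) auto
    show "((\<lambda>x. co (P x)) has_derivative (\<lambda>x. x)) (at 0)" by (rule tang_derivative[OF P(1)])
    show "0 \<in> interior (?S \<inter> T)" using S T P0 zero_in_U0 by (simp add: interior_open open_Int)
  qed (auto simp: P0 zero_in_U0 o_def id_def intro: bounded_linear_ident)
  then obtain N where N: "open N" "co (P 0) \<in> N" "N \<subseteq> (\<lambda>x. co (P x)) ` (?S \<inter> T)"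
    by (auto simp: interior_def)
  show ?thesis
  proof (rule that[of "U0 \<inter> co -` N"])
    show "open (U0 \<inter> co -` N)" by (rule open_Int_vimage[OF U0_open co_cont N(1)])
    show "0 \<in> U0 \<inter> co -` N" using N P0 zero_in_U0 by simp
    show "U0 \<inter> co -` N \<subseteq> P ` T"
    proof
      fix p assume p: "p \<in> U0 \<inter> co -` N"
      then obtain x where x: "x \<in> T" "P x \<in> U0" "co p = co (P x)" using N by auto
      then have "p = P x" using ex_co p by (metis IntD1)
      then show "p \<in> P ` T" using x by simp
    qed
  qed
qed

text \<open>
  The span of the conjugates \<open>Ad h (v j)\<close> with \<open>h \<in> B r\<close> is constant for small \<open>r\<close>, because its dimension
  is. It is then invariant under \<open>br (v j)\<close>, hence everything, and a product of conjugated
  one-parameter subgroups has the identity as its derivative at \<open>0\<close>.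
\<close>

lemma chow:
  fixes v :: "'j \<Rightarrow> 'e" and B :: "real \<Rightarrow> 'g set"
  assumes B0: "\<And>r. 0 < r \<Longrightarrow> 0 \<in> B r"
    and Badd: "\<And>r s g h. g \<in> B r \<Longrightarrow> h \<in> B s \<Longrightarrow> g + h \<in> B (r + s)"
    and Bneg: "\<And>r g. g \<in> B r \<Longrightarrow> - g \<in> B r"
    and Bmono: "\<And>r s. r \<le> s \<Longrightarrow> B r \<subseteq> B s"
    and Bep: "\<And>j t r. j \<in> J \<Longrightarrow> \<bar>t\<bar> < r \<Longrightarrow> ep (v j) t \<in> B r"
    and gen: "\<And>W. subspace W \<Longrightarrow> v ` J \<subseteq> W \<Longrightarrow> (\<And>j w. j \<in> J \<Longrightarrow> w \<in> W \<Longrightarrow> br (v j) w \<in> W) \<Longrightarrow> W = UNIV"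
    and r: "0 < (r::real)"
  shows "\<exists>N. open N \<and> 0 \<in> N \<and> N \<subseteq> B r"
proof -
  define G where "G = (\<lambda>r. {Ad h (v j) | h j. h \<in> B r \<and> j \<in> J})"
  have G_mono: "G r \<subseteq> G s" if "r \<le> s" for r s using Bmono[OF that] by (auto simp: G_def)
  \<comment> \<open>The spans shrink with the radius. At a radius of minimal dimension they have
    become constant, which is \<open>G_eq\<close>.\<close>
  obtain r0 where r0: "r0 > 0" "\<And>s. s > 0 \<Longrightarrow> dim (span (G r0)) \<le> dim (span (G s))"
    using ex_has_least_nat[of "\<lambda>r. r > 0" 1 "\<lambda>r. dim (span (G r))"] by auto
  have G_eq: "span (G s) = span (G r0)" if "0 < s" "s \<le> r0" for s
    by (rule subspace_dim_equal) (use r0(2)[OF that(1)] span_mono[OF G_mono[OF that(2)]] in auto)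
  \<comment> \<open>Each of the at most \<open>DIM('e)\<close> factors of the product has three
    pieces of size \<open>\<rho>\<close>: the conjugating element, the exponential and the inverse.
    The extra 1 pays for the identity that ends the product, since it too lies only in balls of
    positive radius.\<close>
  define \<rho> where "\<rho> = min r0 (r / (3 * real DIM('e) + 1))"
  have \<rho>: "\<rho> > 0" "\<rho> \<le> r0" "\<rho> * (3 * real DIM('e) + 1) \<le> r"
  proof -
    show "\<rho> > 0" "\<rho> \<le> r0" using r0 r by (auto simp: \<rho>_def intro!: divide_pos_pos add_nonneg_pos)
    have "\<rho> \<le> r / (3 * real DIM('e) + 1)" by (simp add: \<rho>_def)
    then show "\<rho> * (3 * real DIM('e) + 1) \<le> r" by (simp add: pos_le_divide_eq)
  qed
  define W where "W = span (G \<rho>)"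
  have W2: "span (G (\<rho> / 2)) = W" using G_eq[of "\<rho> / 2"] G_eq[of \<rho>] \<rho> by (simp add: W_def)
  \<comment> \<open>By constancy of the span, \<open>W\<close> is already spanned by conjugates from
    \<open>B (\<rho> / 2)\<close>; the other half of \<open>\<rho>\<close> accommodates the
    additional conjugation by \<open>ep (v j) t\<close>.\<close>
  have inv: "Ad (ep (v j) t) w \<in> W" if j: "j \<in> J" and t: "\<bar>t\<bar> < \<rho> / 2" and w: "w \<in> W" for j t w
  proof -
    have "w \<in> span (G (\<rho> / 2))" using w W2 by simp
    then show ?thesis
    proof (induction rule: span_induct_alt)
      case base
      then show ?case by (simp add: linear_0[OF Ad_linear] W_def span_zero)
    next
      case (step c x y)
      obtain h k where x: "x = Ad h (v k)" "h \<in> B (\<rho> / 2)" "k \<in> J" using step(1) by (auto simp: G_def)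
      have "ep (v j) t + h \<in> B \<rho>" using Badd[OF Bep[OF j t] x(2)] by simp
      then have "Ad (ep (v j) t) x \<in> W"
        unfolding W_def x(1) Ad_add[symmetric] using x(3) by (intro span_base) (auto simp: G_def)
      then show ?case using step(2)
        by (simp add: linear_add[OF Ad_linear] linear_scale[OF Ad_linear] W_def span_add span_scale)
    qed
  qed
  have "W = UNIV"
  proof (rule gen)
    show sub: "subspace W" by (simp add: W_def)
    show "v ` J \<subseteq> W"
    proof
      fix x assume "x \<in> v ` J"
      then obtain j where "j \<in> J" "x = Ad 0 (v j)" by auto
      then have "\<exists>h k. x = Ad h (v k) \<and> h \<in> B \<rho> \<and> k \<in> J"
        using B0[OF \<rho>(1)] by blast
      then show "x \<in> W" unfolding W_def G_def by (intro span_base) simp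
    qed
    fix j w assume jw: "j \<in> J" "w \<in> W"
    have "((\<lambda>t. Ad (ep (v j) t) w) has_vector_derivative br (v j) w) (at 0)"
      using ep by (intro Ad_derivative) (simp add: one_param_def)
    \<comment> \<open>A curve inside a subspace has its derivative there. This is checked by pairing
      with the component of the derivative orthogonal to \<open>W\<close>, which then has to
      vanish.\<close>
    obtain y z where yz: "y \<in> span W" "\<And>x. x \<in> span W \<Longrightarrow> orthogonal z x" "br (v j) w = y + z"
      using orthogonal_subspace_decomp_exists[of W "br (v j) w"] by blast
    have spW: "span W = W" using sub by (rule span_eq_iff[THEN iffD2])
    have "((\<lambda>t. Ad (ep (v j) t) w \<bullet> z) has_vector_derivative br (v j) w \<bullet> z) (at 0)"
      using \<open>((\<lambda>t. Ad (ep (v j) t) w) has_vector_derivative br (v j) w) (at 0)\<close>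
      by (rule bounded_linear.has_vector_derivative[OF bounded_linear_inner_left])
    moreover have "((\<lambda>t. Ad (ep (v j) t) w \<bullet> z) has_vector_derivative 0) (at 0)"
    proof (rule has_vector_derivative_transform_within_open[of "\<lambda>t. 0" _ _ "{-\<rho>/2<..<\<rho>/2}"])
      fix t assume "t \<in> {-\<rho>/2<..<\<rho>/2}"
      then have "Ad (ep (v j) t) w \<in> W" by (intro inv jw) auto
      then show "0 = Ad (ep (v j) t) w \<bullet> z"
        using yz(2)[of "Ad (ep (v j) t) w"] unfolding spW by (simp add: orthogonal_def inner_commute)
    qed (use \<rho> in auto)
    ultimately have "br (v j) w \<bullet> z = 0" by (rule vector_derivative_unique_at)
    moreover have "y \<bullet> z = 0" using yz(2)[OF yz(1)] by (simp add: orthogonal_def inner_commute)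
    ultimately have "z \<bullet> z = 0" by (simp add: yz(3) inner_add_left)
    then show "br (v j) w \<in> W" using yz spW by simp
  qed
  \<comment> \<open>A basis of the whole space selected from the conjugates; its coordinate
    functionals are the running times, so that the product has derivative the identity at 0.\<close>
  obtain C where C: "C \<subseteq> G \<rho>" "independent C" "G \<rho> \<subseteq> span C"
    using maximal_independent_subset[of "G \<rho>"] by blast
  have spanC: "span C = UNIV" using \<open>W = UNIV\<close> C(3) span_minimal[OF C(3)] unfolding W_def by auto
  have finC: "finite C" and cardC: "card C \<le> DIM('e)" using independent_bound[OF C(2)] by auto
  have "\<forall>c\<in>C. \<exists>h j. c = Ad h (v j) \<and> h \<in> B \<rho> \<and> j \<in> J" using C(1) by (auto simp: G_def)
  then obtain h j where hj: "\<And>c. c \<in> C \<Longrightarrow> c = Ad (h c) (v (j c)) \<and> h c \<in> B \<rho> \<and> j c \<in> J" by metis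
  obtain cs where cs: "set cs = C" "distinct cs" using finite_distinct_list[OF finC] by blast
  define \<kappa> where "\<kappa> = (\<lambda>c x. representation C x c)"
  have \<kappa>: "bounded_linear (\<kappa> c)" for c
    unfolding \<kappa>_def
    by (intro linear_conv_bounded_linear[THEN iffD1] linearI)
      (use spanC in \<open>auto simp: representation_add[OF C(2)] representation_scale[OF C(2)]\<close>)
  define P where "P = flow_product h (\<lambda>c. v (j c)) \<kappa> cs"
  have "tang P (\<lambda>x. \<Sum>c\<leftarrow>cs. \<kappa> c x *\<^sub>R c) 0"
    unfolding P_def by (rule tang_flow_product[OF \<kappa>]) (use hj cs in auto)
  moreover have "(\<Sum>c\<leftarrow>cs. \<kappa> c x *\<^sub>R c) = x" for x
    using sum_representation_eq[OF C(2), of x C] spanC finC cs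
    by (simp add: \<kappa>_def sum_list_distinct_conv_sum_set)
  ultimately have P: "tang P (\<lambda>x. x) 0" by simp
  have Pc: "continuous_on UNIV P" unfolding P_def by (rule flow_product_cont[OF \<kappa>])
  define T where "T = (\<Inter>c\<in>C. {x. \<bar>\<kappa> c x\<bar> < \<rho>})"
  have "open T"
    unfolding T_def
    by (intro open_INT finC ballI open_Collect_less continuous_intros linear_continuous_on[OF \<kappa>])
  moreover have "0 \<in> T" using \<rho> by (auto simp: T_def linear_0[OF bounded_linear.linear[OF \<kappa>]])
  ultimately obtain N where N: "open N" "0 \<in> N" "N \<subseteq> P ` T" using tang_id_open[OF P Pc] by blast
  have "flow_product h (\<lambda>c. v (j c)) \<kappa> ds x \<in> B (3 * \<rho> * real (length ds) + \<rho>)" if "x \<in> T" "set ds \<subseteq> C" for x ds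
    using that(2)
  proof (induction ds)
    case Nil
    then show ?case using B0[OF \<rho>(1)] by simp
  next
    case (Cons c ds)
    have c: "h c \<in> B \<rho>" "j c \<in> J" "\<bar>\<kappa> c x\<bar> < \<rho>" using hj[of c] Cons.prems that(1) by (auto simp: T_def)
    have "(h c + ep (v (j c)) (\<kappa> c x) + - h c) + flow_product h (\<lambda>c. v (j c)) \<kappa> ds x
      \<in> B ((\<rho> + \<rho> + \<rho>) + (3 * \<rho> * real (length ds) + \<rho>))"
      by (intro Badd Bneg c Bep Cons.IH) (use Cons.prems in auto)
    then show ?case by (simp add: algebra_simps)
  qed
  then have "P ` T \<subseteq> B (3 * \<rho> * real (length cs) + \<rho>)" using cs by (auto simp: P_def)
  also have "\<dots> \<subseteq> B r"
  proof (rule Bmono)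
    have "real (length cs) \<le> real DIM('e)" using cardC distinct_card[OF cs(2)] cs(1) by simp
    then have "3 * \<rho> * real (length cs) + \<rho> \<le> 3 * \<rho> * real DIM('e) + \<rho>" using \<rho> by (intro add_mono mult_left_mono) auto
    also have "\<dots> = \<rho> * (3 * real DIM('e) + 1)" by (simp add: algebra_simps)
    finally show "3 * \<rho> * real (length cs) + \<rho> \<le> r" using \<rho>(3) by simp
  qed
  finally have "P ` T \<subseteq> B r" .
  then show ?thesis using N by (intro exI[of _ N]) simp
qed

end

section \<open>Horizontal curves and their balls\<close>

lemma lipschitz_imp_absolutely_continuous:
  assumes "C-lipschitz_on {a..b} f"
  shows "absolutely_continuous_on a b f"
  unfolding absolutely_continuous_on_def
proof (intro allI impI)
  fix \<epsilon> :: real assume "\<epsilon> > 0"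
  have C: "C \<ge> 0" by (rule lipschitz_on_nonneg[OF assms])
  show "\<exists>\<delta>>0. \<forall>D. finite D \<longrightarrow> (\<forall>(u, v)\<in>D. a \<le> u \<and> u \<le> v \<and> v \<le> b) \<longrightarrow>
       pairwise (\<lambda>(u, v) (u', v'). {u<..<v} \<inter> {u'<..<v'} = {}) D \<longrightarrow>
       (\<Sum>(u, v)\<in>D. v - u) < \<delta> \<longrightarrow> (\<Sum>(u, v)\<in>D. \<bar>f v - f u\<bar>) < \<epsilon>"
  proof (intro exI[of _ "\<epsilon> / (C + 1)"] conjI allI impI)
    show "\<epsilon> / (C + 1) > 0" using C \<open>\<epsilon> > 0\<close> by simp
    fix D assume D: "finite D" "\<forall>(u, v)\<in>D. a \<le> u \<and> u \<le> v \<and> v \<le> b" "(\<Sum>(u, v)\<in>D. v - u) < \<epsilon> / (C + 1)"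
    have nn: "0 \<le> (\<Sum>(u, v)\<in>D. v - u)" using D(2) by (intro sum_nonneg) auto
    have "(\<Sum>(u, v)\<in>D. \<bar>f v - f u\<bar>) \<le> (\<Sum>(u, v)\<in>D. C * (v - u))"
    proof (rule sum_mono, clarify)
      fix u v assume "(u, v) \<in> D"
      then have "a \<le> u" "u \<le> v" "v \<le> b" using D(2) by auto
      then show "\<bar>f v - f u\<bar> \<le> C * (v - u)" using lipschitz_onD[OF assms, of v u] by (auto simp: dist_real_def)
    qed
    also have "\<dots> = C * (\<Sum>(u, v)\<in>D. v - u)" by (simp add: sum_distrib_left case_prod_unfold)
    also have "\<dots> \<le> (C + 1) * (\<Sum>(u, v)\<in>D. v - u)" using nn by (intro mult_right_mono) auto
    also have "\<dots> < \<epsilon>" using D(3) C by (simp add: field_simps)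
    finally show "(\<Sum>(u, v)\<in>D. \<bar>f v - f u\<bar>) < \<epsilon>" .
  qed
qed

text \<open>Split a gauge-fine tagged division by its tags. Intervals tagged where the derivative
  exists contribute at most \<open>C + e\<close> times their length. Those tagged in the exceptional
  null set lie in an open set of small measure, where absolute continuity bounds their total
  contribution by \<open>e\<close>.\<close>

lemma absolutely_continuous_bound:
  fixes f :: "real \<Rightarrow> real"
  assumes ac: "absolutely_continuous_on a b f" and ab: "a \<le> b" and C: "0 \<le> C"
    and AE: "AE t in lborel. t \<in> {a..b} \<longrightarrow> (\<exists>D. (f has_real_derivative D) (at t within {a..b}) \<and> \<bar>D\<bar> \<le> C)"
  shows "\<bar>f b - f a\<bar> \<le> C * (b - a)"
proof (rule field_le_epsilon)
  fix \<epsilon> :: real assume \<epsilon>: "\<epsilon> > 0"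
  define e where "e = \<epsilon> / (b - a + 1)"
  have e: "e > 0" "e * (b - a) + e = \<epsilon>"
  proof -
    show "e > 0" using \<epsilon> ab by (simp add: e_def)
    have "e * (b - a) + e = e * (b - a + 1)" by (simp add: algebra_simps)
    also have "\<dots> = \<epsilon>" using ab by (simp add: e_def)
    finally show "e * (b - a) + e = \<epsilon>" .
  qed
  define Q where "Q = (\<lambda>t. t \<in> {a..b} \<longrightarrow> (\<exists>D. (f has_real_derivative D) (at t within {a..b}) \<and> \<bar>D\<bar> \<le> C))"
  have "AE t in lborel. Q t" using AE by (simp only: Q_def)
  then obtain N where N': "N \<in> null_sets lborel" "{t \<in> space lborel. \<not> Q t} \<subseteq> N"
    unfolding eventually_ae_filter by blast
  then have "Q t" if "t \<notin> N" for t using that by auto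
  with N'(1) have N: "N \<in> null_sets lborel"
    "\<And>t. t \<in> {a..b} \<Longrightarrow> t \<notin> N \<Longrightarrow> \<exists>D. (f has_real_derivative D) (at t within {a..b}) \<and> \<bar>D\<bar> \<le> C"
    unfolding Q_def by blast+
  obtain \<delta> where \<delta>: "\<delta> > 0" "\<And>D. finite D \<Longrightarrow> (\<forall>(u, v)\<in>D. a \<le> u \<and> u \<le> v \<and> v \<le> b) \<Longrightarrow>
       pairwise (\<lambda>(u, v) (u', v'). {u<..<v} \<inter> {u'<..<v'} = {}) D \<Longrightarrow>
       (\<Sum>(u, v)\<in>D. v - u) < \<delta> \<Longrightarrow> (\<Sum>(u, v)\<in>D. \<bar>f v - f u\<bar>) < e"
    using ac e unfolding absolutely_continuous_on_def by blast
  have Nb: "N \<in> sets borel" "emeasure lborel N = 0" using N(1) by (auto simp: null_sets_def)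
  obtain U where U: "open U" "N \<subseteq> U" "emeasure lborel (U - N) \<le> \<delta> / 2"
    using outer_regular_lborel_le[OF Nb(1), of "\<delta> / 2"] \<delta>(1) by auto
  have "emeasure lborel (U - N) = emeasure lborel U"
    by (rule emeasure_Diff_null_set[OF N(1)]) (use U in auto)
  then have mU: "emeasure lborel U \<le> ennreal (\<delta> / 2)" using U(3) by simp
  have "\<exists>r>0. \<forall>s\<in>{a..b}. \<bar>s - t\<bar> < r \<longrightarrow> \<bar>f s - f t\<bar> \<le> (C + e) * \<bar>s - t\<bar>" if t: "t \<in> {a..b}" "t \<notin> N" for t
  proof -
    obtain D where D: "(f has_real_derivative D) (at t within {a..b})" "\<bar>D\<bar> \<le> C" using N(2)[OF t] by blast
    then obtain r where r: "r > 0" "\<And>s. s \<in> {a..b} \<Longrightarrow> \<bar>s - t\<bar> < r \<Longrightarrow> \<bar>f s - f t - D * (s - t)\<bar> \<le> e * \<bar>s - t\<bar>"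
      using e(1) unfolding has_field_derivative_def has_derivative_within_alt by fastforce
    have "\<bar>f s - f t\<bar> \<le> (C + e) * \<bar>s - t\<bar>" if s: "s \<in> {a..b}" "\<bar>s - t\<bar> < r" for s
    proof -
      have "\<bar>f s - f t\<bar> \<le> \<bar>D * (s - t)\<bar> + e * \<bar>s - t\<bar>" using r(2)[OF s] by linarith
      also have "\<bar>D * (s - t)\<bar> \<le> C * \<bar>s - t\<bar>" unfolding abs_mult using D(2) by (intro mult_right_mono) auto
      finally show ?thesis by (simp add: algebra_simps)
    qed
    then show ?thesis using r(1) by blast
  qed
  then obtain r where r: "\<And>t. t \<in> {a..b} \<Longrightarrow> t \<notin> N \<Longrightarrow> r t > 0"
    "\<And>t s. t \<in> {a..b} \<Longrightarrow> t \<notin> N \<Longrightarrow> s \<in> {a..b} \<Longrightarrow> \<bar>s - t\<bar> < r t \<Longrightarrow> \<bar>f s - f t\<bar> \<le> (C + e) * \<bar>s - t\<bar>" by metis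
  \<comment> \<open>At exceptional tags the gauge confines the interval to \<open>U\<close>; at the
    other tags it enforces the differential estimate. The last case only makes the gauge
    total.\<close>
  define \<gamma> where "\<gamma> = (\<lambda>t. if t \<in> N then U else if t \<in> {a..b} then ball t (r t) else UNIV)"
  have "gauge \<gamma>" using U r(1) by (auto simp: gauge_def \<gamma>_def)
  then obtain p where p: "p tagged_division_of {a..b}" "\<gamma> fine p" by (rule fine_division_exists_real)
  note fin = tagged_division_ofD(1)[OF p(1)]
  have pk: "x \<in> {a..b} \<and> Inf k \<le> x \<and> x \<le> Sup k \<and> a \<le> Inf k \<and> Sup k \<le> b \<and> k = {Inf k..Sup k} \<and> k \<subseteq> \<gamma> x"
    if xk: "(x, k) \<in> p" for x k
  proof -
    obtain u v where k: "k = cbox u v" using tagged_division_ofD(4)[OF p(1) xk] by blast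
    have x: "x \<in> k" and sub: "k \<subseteq> {a..b}" using tagged_division_ofD(2,3)[OF p(1) xk] .
    have "u \<le> v" using x k by auto
    moreover have "k \<subseteq> \<gamma> x" using p(2) xk by (auto simp: fine_def)
    ultimately show ?thesis using x sub by (auto simp: k)
  qed
  define g where "g = (\<lambda>(x::real, k). f (Sup k) - f (Inf k))"
  define pN where "pN = {z \<in> p. fst z \<in> N}"
  have split: "f b - f a = sum g pN + sum g (p - pN)"
    using additive_tagged_division_1[OF ab p(1), of f] fin sum.subset_diff[of pN p g]
    by (simp add: g_def pN_def add.commute)
  have good: "\<bar>sum g (p - pN)\<bar> \<le> (C + e) * (b - a)"
  proof -
    have "\<bar>sum g (p - pN)\<bar> \<le> (\<Sum>z\<in>p - pN. \<bar>g z\<bar>)" by (rule sum_abs)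
    also have "\<dots> \<le> (\<Sum>z\<in>p - pN. (C + e) * (case z of (x, k) \<Rightarrow> measure lborel k))"
    proof (rule sum_mono)
      fix z assume "z \<in> p - pN"
      then obtain x k where z: "z = (x, k)" "(x, k) \<in> p" "x \<notin> N" by (cases z) (auto simp: pN_def)
      note k = pk[OF z(2)]
      have kr: "\<bar>s - x\<bar> < r x" if "s \<in> k" for s
      proof -
        have "s \<in> \<gamma> x" using that k by blast
        then show ?thesis using z(3) k by (simp add: \<gamma>_def dist_real_def abs_minus_commute)
      qed
      have ins: "Inf k \<in> k" "Sup k \<in> k"
        using k by (metis atLeastAtMost_iff order_refl order_trans)+
      have "\<bar>f (Sup k) - f x\<bar> \<le> (C + e) * \<bar>Sup k - x\<bar>"
        by (rule r(2)) (use k z(3) kr[OF ins(2)] in auto)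
      moreover have "\<bar>f (Inf k) - f x\<bar> \<le> (C + e) * \<bar>Inf k - x\<bar>"
        by (rule r(2)) (use k z(3) kr[OF ins(1)] in auto)
      ultimately have "\<bar>f (Sup k) - f (Inf k)\<bar> \<le> (C + e) * (Sup k - x) + (C + e) * (x - Inf k)"
        using k by (simp add: abs_of_nonneg abs_of_nonpos)
      also have "\<dots> = (C + e) * (Sup k - Inf k)" by (simp add: algebra_simps)
      also have "Sup k - Inf k = measure lborel k" using k by (metis content_real order_trans)
      finally show "\<bar>g z\<bar> \<le> (C + e) * (case z of (x, k) \<Rightarrow> measure lborel k)" by (simp add: g_def z(1))
    qed
    also have "\<dots> \<le> (\<Sum>z\<in>p. (C + e) * (case z of (x, k) \<Rightarrow> measure lborel k))"
      by (rule sum_mono2[OF fin]) (use C e in \<open>auto intro!: mult_nonneg_nonneg\<close>)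
    also have "\<dots> = (C + e) * (b - a)"
      using additive_content_tagged_division[of p a b] p(1) ab by (simp add: sum_distrib_left[symmetric])
    finally show ?thesis .
  qed
  \<comment> \<open>Degenerate intervals contribute 0. Without them, disjointness of interiors makes
    \<open>\<phi>\<close> injective, so that the sum over tagged intervals becomes a sum over the
    set of endpoint pairs that absolute continuity speaks of.\<close>
  define q where "q = {z \<in> pN. Inf (snd z) < Sup (snd z)}"
  define \<phi> where "\<phi> = (\<lambda>z::real \<times> real set. (Inf (snd z), Sup (snd z)))"
  have finq: "finite q" using fin by (auto simp: q_def pN_def)
  have disj: "{Inf k<..<Sup k} \<inter> {Inf k'<..<Sup k'} = {}"
    if "(x, k) \<in> q" "(x', k') \<in> q" "(x, k) \<noteq> (x', k')" for x k x' k'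
  proof -
    have z: "(x, k) \<in> p" "(x', k') \<in> p" using that by (auto simp: q_def pN_def)
    have "interior k \<inter> interior k' = {}" by (rule tagged_division_ofD(5)[OF p(1) z that(3)])
    moreover have "interior k = {Inf k<..<Sup k}" "interior k' = {Inf k'<..<Sup k'}"
      using pk[OF z(1)] pk[OF z(2)] by (metis interior_atLeastAtMost_real)+
    ultimately show ?thesis by simp
  qed
  have inj: "inj_on \<phi> q"
  proof (rule inj_onI, rule ccontr)
    fix z z' assume z: "z \<in> q" "z' \<in> q" "\<phi> z = \<phi> z'" "z \<noteq> z'"
    have "{Inf (snd z)<..<Sup (snd z)} \<inter> {Inf (snd z')<..<Sup (snd z')} = {}"
      using disj[of "fst z" "snd z" "fst z'" "snd z'"] z by simp
    moreover have "Inf (snd z) < Sup (snd z)" using z by (simp add: q_def)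
    ultimately show False using z(3) by (auto simp: \<phi>_def)
  qed
  have lt: "(\<Sum>(u, v)\<in>\<phi> ` q. \<bar>f v - f u\<bar>) < e"
  proof (rule \<delta>(2))
    show "finite (\<phi> ` q)" using finq by simp
    show "\<forall>(u, v)\<in>\<phi> ` q. a \<le> u \<and> u \<le> v \<and> v \<le> b"
      using pk by (force simp: \<phi>_def q_def pN_def)
    show "pairwise (\<lambda>(u, v) (u', v'). {u<..<v} \<inter> {u'<..<v'} = {}) (\<phi> ` q)"
      unfolding pairwise_def
    proof (intro ballI impI)
      fix y y' assume y: "y \<in> \<phi> ` q" "y' \<in> \<phi> ` q" "y \<noteq> y'"
      then obtain x k x' k' where q: "(x, k) \<in> q" "(x', k') \<in> q" "y = \<phi> (x, k)" "y' = \<phi> (x', k')" by auto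
      then have "{Inf k<..<Sup k} \<inter> {Inf k'<..<Sup k'} = {}" using y(3) by (intro disj) auto
      then show "(case y of (u, v) \<Rightarrow> \<lambda>(u', v'). {u<..<v} \<inter> {u'<..<v'} = {}) y'"
        unfolding q(3,4) \<phi>_def by (simp only: prod.case snd_conv)
    qed
    have "ennreal (\<Sum>z\<in>q. Sup (snd z) - Inf (snd z)) = (\<Sum>z\<in>q. emeasure lborel {Inf (snd z)<..<Sup (snd z)})"
      by (subst sum_ennreal[symmetric]) (auto simp: q_def intro!: sum.cong)
    also have "\<dots> = emeasure lborel (\<Union>z\<in>q. {Inf (snd z)<..<Sup (snd z)})"
    proof (rule sum_emeasure)
      show "disjoint_family_on (\<lambda>z. {Inf (snd z)<..<Sup (snd z)}) q"
        unfolding disjoint_family_on_def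
      proof (intro ballI impI)
        fix z z' assume "z \<in> q" "z' \<in> q" "z \<noteq> z'"
        then show "{Inf (snd z)<..<Sup (snd z)} \<inter> {Inf (snd z')<..<Sup (snd z')} = {}"
          by (intro disj[of "fst z" "snd z" "fst z'" "snd z'"]) simp_all
      qed
    qed (use finq in auto)
    also have "\<dots> \<le> emeasure lborel U"
    proof (rule emeasure_mono)
      show "(\<Union>z\<in>q. {Inf (snd z)<..<Sup (snd z)}) \<subseteq> U"
      proof (rule UN_least)
        fix z assume "z \<in> q"
        then obtain x k where z: "z = (x, k)" "(x, k) \<in> p" "x \<in> N" by (cases z) (auto simp: q_def pN_def)
        have "{Inf k<..<Sup k} \<subseteq> {Inf k..Sup k}" by auto
        also have "\<dots> = k" using pk[OF z(2)] by simp
        also have "\<dots> \<subseteq> U" using pk[OF z(2)] z(3) by (simp add: \<gamma>_def)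
        finally show "{Inf (snd z)<..<Sup (snd z)} \<subseteq> U" by (simp add: z(1))
      qed
    qed (use U in auto)
    also have "\<dots> \<le> ennreal (\<delta> / 2)" by (rule mU)
    finally have "(\<Sum>z\<in>q. Sup (snd z) - Inf (snd z)) \<le> \<delta> / 2" using \<delta>(1) by (simp add: ennreal_le_iff)
    then show "(\<Sum>(u, v)\<in>\<phi> ` q. v - u) < \<delta>"
      using \<delta>(1) by (subst sum.reindex[OF inj]) (simp add: \<phi>_def o_def)
  qed
  have bad: "\<bar>sum g pN\<bar> \<le> e"
  proof -
    have "sum g pN = sum g q"
    proof (rule sum.mono_neutral_right)
      show "\<forall>z\<in>pN - q. g z = 0"
      proof
        fix z assume z: "z \<in> pN - q"
        then obtain x k where xk: "z = (x, k)" "(x, k) \<in> p" by (cases z) (auto simp: pN_def)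
        have "Sup k = Inf k" using pk[OF xk(2)] z by (auto simp: q_def xk(1))
        then show "g z = 0" by (simp add: g_def xk(1))
      qed
    qed (use fin in \<open>auto simp: q_def pN_def\<close>)
    also have "\<bar>\<dots>\<bar> \<le> (\<Sum>z\<in>q. \<bar>g z\<bar>)" by (rule sum_abs)
    also have "\<dots> = (\<Sum>(u, v)\<in>\<phi> ` q. \<bar>f v - f u\<bar>)"
      by (subst sum.reindex[OF inj]) (simp add: \<phi>_def g_def o_def case_prod_unfold)
    also have "\<dots> \<le> e" using lt by simp
    finally show ?thesis .
  qed
  have "\<bar>f b - f a\<bar> \<le> e + (C + e) * (b - a)" using split good bad by linarith
  also have "\<dots> = C * (b - a) + \<epsilon>" using e(2) by (simp add: algebra_simps)
  finally show "\<bar>f b - f a\<bar> \<le> C * (b - a) + \<epsilon>" .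
qed

lemma AE_lborel_affine:
  fixes P :: "real \<Rightarrow> bool"
  assumes "c \<noteq> 0" "AE x in lborel. P x"
  shows "AE x in lborel. P (t + c * x)"
proof -
  have "AE x in density (distr lborel borel (\<lambda>x. t + c * x)) (\<lambda>_. ennreal \<bar>c\<bar>). P x"
    using assms(2) by (subst (asm) lborel_real_affine[OF assms(1), of t])
  then have "AE x in distr lborel borel (\<lambda>x. t + c * x). P x"
    using assms(1) by (subst (asm) AE_density) auto
  then show ?thesis by (rule AE_distrD[rotated]) simp
qed

section \<open>Subunit curves and the operations on them\<close>

locale horizontal = lie0 A U0 \<phi>
  for A :: "('g::{topological_group_add, t2_space, second_countable_topology}, 'e::euclidean_space) atlas"
    and U0 :: "'g set" and \<phi> :: "'g \<Rightarrow> 'e" +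
  fixes n :: nat and X :: "nat \<Rightarrow> 'g vfield" and v :: "nat \<Rightarrow> 'e"
  assumes rep: "j \<in> {1..n} \<Longrightarrow> represents (X j) (v j)"
    and gen: "subspace W \<Longrightarrow> v ` {1..n} \<subseteq> W \<Longrightarrow> (\<And>j w. j \<in> {1..n} \<Longrightarrow> w \<in> W \<Longrightarrow> br (v j) w \<in> W) \<Longrightarrow> W = UNIV"
    and conn: "connected (UNIV :: 'g set)"
begin

definition horizontal_velocity :: "real \<Rightarrow> (real \<Rightarrow> 'g) \<Rightarrow> (nat \<Rightarrow> real) \<Rightarrow> real \<Rightarrow> bool" where
  "horizontal_velocity T \<gamma> a t \<longleftrightarrow> (\<Sum>j = 1..n. (a j)\<^sup>2) \<le> 1 \<and>
     (\<forall>u. smooth_fun A u \<longrightarrow>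
       ((\<lambda>t. u (\<gamma> t)) has_real_derivative (\<Sum>j = 1..n. a j * L (v j) u (\<gamma> t))) (at t within {0..T}))"

lemma sum_X: "smooth_fun A u \<Longrightarrow> (\<Sum>j = 1..n. a j * X j u p) = (\<Sum>j = 1..n. a j * L (v j) u p)"
  by (rule sum.cong) (simp_all add: representsD[OF rep])

lemma subunit_iff:
  "subunit_curve A n X T \<gamma> \<longleftrightarrow> continuous_on {0..T} \<gamma> \<and>
     (\<forall>u. smooth_fun A u \<longrightarrow> absolutely_continuous_on 0 T (\<lambda>t. u (\<gamma> t))) \<and>
     (\<exists>a. AE t in lborel. t \<in> {0..T} \<longrightarrow> horizontal_velocity T \<gamma> (\<lambda>j. a j t) t)"
  unfolding subunit_curve_def horizontal_velocity_def o_def by (simp only: sum_X cong: conj_cong imp_cong)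

lemma horizontal_velocity_bound:
  assumes "horizontal_velocity T \<gamma> a t" "\<And>j. j \<in> {1..n} \<Longrightarrow> \<bar>L (v j) u (\<gamma> t)\<bar> \<le> c j"
  shows "\<bar>\<Sum>j = 1..n. a j * L (v j) u (\<gamma> t)\<bar> \<le> (\<Sum>j = 1..n. c j)"
proof -
  have "\<bar>a j\<bar> \<le> 1" if "j \<in> {1..n}" for j
  proof -
    have "(a j)\<^sup>2 \<le> (\<Sum>j = 1..n. (a j)\<^sup>2)" by (rule member_le_sum) (use that in auto)
    also have "\<dots> \<le> 1" using assms(1) by (simp add: horizontal_velocity_def)
    finally show ?thesis by (simp add: abs_square_le_1)
  qed
  then have "\<bar>a j * L (v j) u (\<gamma> t)\<bar> \<le> c j" if "j \<in> {1..n}" for j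
    using mult_mono[of "\<bar>a j\<bar>" 1 "\<bar>L (v j) u (\<gamma> t)\<bar>" "c j"] assms(2)[OF that] that by (simp add: abs_mult)
  then show ?thesis by (intro order_trans[OF sum_abs] sum_mono)
qed

lemma absolutely_continuous_subset:
  "absolutely_continuous_on a b f \<Longrightarrow> a \<le> a' \<Longrightarrow> b' \<le> b \<Longrightarrow> absolutely_continuous_on a' b' f"
  unfolding absolutely_continuous_on_def
  by (elim all_forward imp_forward ex_forward conj_forward) auto

lemma subunit_bound:
  assumes su: "subunit_curve A n X T \<gamma>" and u: "smooth_fun A u" and xy: "0 \<le> x" "x \<le> y" "y \<le> T"
    and c: "\<And>j t. j \<in> {1..n} \<Longrightarrow> t \<in> {0..T} \<Longrightarrow> \<bar>L (v j) u (\<gamma> t)\<bar> \<le> c j"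
  shows "\<bar>u (\<gamma> y) - u (\<gamma> x)\<bar> \<le> (\<Sum>j = 1..n. c j) * (y - x)"
proof (rule absolutely_continuous_bound)
  have "absolutely_continuous_on 0 T (\<lambda>t. u (\<gamma> t))" using su u by (simp add: subunit_iff)
  then show "absolutely_continuous_on x y (\<lambda>t. u (\<gamma> t))"
    by (rule absolutely_continuous_subset) (use xy in auto)
  show "0 \<le> (\<Sum>j = 1..n. c j)" using c[of _ x] xy by (intro sum_nonneg) fastforce
  obtain a where "AE t in lborel. t \<in> {0..T} \<longrightarrow> horizontal_velocity T \<gamma> (\<lambda>j. a j t) t" using su by (auto simp: subunit_iff)
  then show "AE t in lborel. t \<in> {x..y} \<longrightarrow>
     (\<exists>D. ((\<lambda>t. u (\<gamma> t)) has_real_derivative D) (at t within {x..y}) \<and> \<bar>D\<bar> \<le> (\<Sum>j = 1..n. c j))"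
  proof (rule eventually_mono, intro impI)
    fix t assume t: "t \<in> {0..T} \<longrightarrow> horizontal_velocity T \<gamma> (\<lambda>j. a j t) t" "t \<in> {x..y}"
    have tT: "t \<in> {0..T}" using t(2) xy by auto
    then have h: "horizontal_velocity T \<gamma> (\<lambda>j. a j t) t" using t by simp
    then have "((\<lambda>t. u (\<gamma> t)) has_real_derivative (\<Sum>j = 1..n. a j t * L (v j) u (\<gamma> t))) (at t within {0..T})"
      using u by (simp add: horizontal_velocity_def)
    then have "((\<lambda>t. u (\<gamma> t)) has_real_derivative (\<Sum>j = 1..n. a j t * L (v j) u (\<gamma> t))) (at t within {x..y})"
      by (rule DERIV_subset) (use xy in auto)
    then show "\<exists>D. ((\<lambda>t. u (\<gamma> t)) has_real_derivative D) (at t within {x..y}) \<and> \<bar>D\<bar> \<le> (\<Sum>j = 1..n. c j)"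
      using horizontal_velocity_bound[OF h, of u c] c tT by blast
  qed
qed (use xy in auto)

text \<open>On the compact curve the derivatives \<open>L (v j) u\<close> are bounded, so absolute
  continuity improves to a Lipschitz bound. That property passes directly through reparametrisation
  and concatenation, and \<open>subunitI\<close> therefore asks for it.\<close>

lemma subunit_lipschitz:
  fixes u :: "'g \<Rightarrow> real"
  assumes su: "subunit_curve A n X T \<gamma>" and u: "smooth_fun A u"
  shows "\<exists>C. C-lipschitz_on {0..T} (\<lambda>t. u (\<gamma> t))"
proof -
  have cont: "continuous_on {0..T} \<gamma>" using su by (simp add: subunit_iff)
  have "\<exists>c. \<forall>t\<in>{0..T}. \<bar>L (v j) u (\<gamma> t)\<bar> \<le> c" for j
  proof -
    have "continuous_on {0..T} (\<lambda>t. L (v j) u (\<gamma> t))"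
      by (rule continuous_on_compose2[OF smooth_fun_cont[OF smooth_fun_L[OF u]] cont]) simp
    then have "bounded ((\<lambda>t. L (v j) u (\<gamma> t)) ` {0..T})"
      by (intro compact_imp_bounded compact_continuous_image) auto
    then show ?thesis by (auto simp: bounded_iff)
  qed
  then obtain c where c: "\<And>j t. t \<in> {0..T} \<Longrightarrow> \<bar>L (v j) u (\<gamma> t)\<bar> \<le> c j" by metis
  have *: "\<bar>u (\<gamma> y) - u (\<gamma> x)\<bar> \<le> \<bar>\<Sum>j = 1..n. c j\<bar> * \<bar>y - x\<bar>" if "x \<in> {0..T}" "y \<in> {0..T}" "x \<le> y" for x y
  proof -
    have "\<bar>u (\<gamma> y) - u (\<gamma> x)\<bar> \<le> (\<Sum>j = 1..n. c j) * (y - x)"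
      by (rule subunit_bound[OF su u]) (use that c in auto)
    also have "\<dots> \<le> \<bar>\<Sum>j = 1..n. c j\<bar> * \<bar>y - x\<bar>" using that by (intro mult_mono) auto
    finally show ?thesis .
  qed
  have "\<bar>\<Sum>j = 1..n. c j\<bar>-lipschitz_on {0..T} (\<lambda>t. u (\<gamma> t))"
  proof (rule lipschitz_onI)
    fix x y assume "x \<in> {0..T}" "y \<in> {0..T}"
    then show "dist (u (\<gamma> x)) (u (\<gamma> y)) \<le> \<bar>\<Sum>j = 1..n. c j\<bar> * dist x y"
      using *[of x y] *[of y x] by (cases "x \<le> y") (auto simp: dist_real_def abs_minus_commute)
  qed simp
  then show ?thesis by blast
qed

lemma subunitI:
  assumes "continuous_on {0..T} \<gamma>" "\<And>u::'g \<Rightarrow> real. smooth_fun A u \<Longrightarrow> \<exists>C. C-lipschitz_on {0..T} (\<lambda>t. u (\<gamma> t))"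
    "AE t in lborel. t \<in> {0..T} \<longrightarrow> horizontal_velocity T \<gamma> (\<lambda>j. a j t) t"
  shows "subunit_curve A n X T \<gamma>"
  using assms lipschitz_imp_absolutely_continuous unfolding subunit_iff by blast

lemma subunit_left:
  assumes "subunit_curve A n X T \<gamma>"
  shows "subunit_curve A n X T (\<lambda>t. g + \<gamma> t)"
proof -
  have "horizontal_velocity T (\<lambda>t. g + \<gamma> t) a t" if h: "horizontal_velocity T \<gamma> a t" for a t
    unfolding horizontal_velocity_def
  proof (intro conjI allI impI)
    fix u assume "smooth_fun A (u :: 'g \<Rightarrow> real)"
    from smooth_fun_left[OF this, of g] h
    show "((\<lambda>t. u (g + \<gamma> t)) has_real_derivative (\<Sum>j = 1..n. a j * L (v j) u (g + \<gamma> t))) (at t within {0..T})"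
      unfolding horizontal_velocity_def L_left[symmetric] by fast
  qed (use h in \<open>simp add: horizontal_velocity_def\<close>)
  note hv = this
  obtain a where a: "AE t in lborel. t \<in> {0..T} \<longrightarrow> horizontal_velocity T \<gamma> (\<lambda>j. a j t) t" using assms by (auto simp: subunit_iff)
  have ac: "\<forall>u. smooth_fun A u \<longrightarrow> absolutely_continuous_on 0 T (\<lambda>t. u (\<gamma> t))" and cont: "continuous_on {0..T} \<gamma>"
    using assms by (simp_all add: subunit_iff)
  show ?thesis
    unfolding subunit_iff
  proof (intro conjI allI impI exI[of _ a])
    show "continuous_on {0..T} (\<lambda>t. g + \<gamma> t)" by (intro continuous_intros cont)
    show "absolutely_continuous_on 0 T (\<lambda>t. u (g + \<gamma> t))" if "smooth_fun A u" for u
      using ac smooth_fun_left[OF that, of g] by fast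
    show "AE t in lborel. t \<in> {0..T} \<longrightarrow> horizontal_velocity T (\<lambda>t. g + \<gamma> t) (\<lambda>j. a j t) t"
      using a by (rule eventually_mono) (use hv in blast)
  qed
qed

text \<open>Covers restriction to a shifted interval and reversal of time. Reversal changes the sign
  of the controls, which leaves the sum of their squares unchanged.\<close>

lemma subunit_affine:
  assumes su: "subunit_curve A n X T \<gamma>" and c: "c = 1 \<or> c = -1"
    and sub: "\<And>t. t \<in> {0..T'} \<Longrightarrow> s + c * t \<in> {0..T}"
  shows "subunit_curve A n X T' (\<lambda>t. \<gamma> (s + c * t))"
proof -
  obtain a where a: "AE t in lborel. t \<in> {0..T} \<longrightarrow> horizontal_velocity T \<gamma> (\<lambda>j. a j t) t" using su by (auto simp: subunit_iff)
  have cont: "continuous_on {0..T} \<gamma>" using su by (simp add: subunit_iff)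
  show ?thesis
  proof (rule subunitI[where a = "\<lambda>j t. c * a j (s + c * t)"])
    show "continuous_on {0..T'} (\<lambda>t. \<gamma> (s + c * t))"
      by (rule continuous_on_compose2[OF cont]) (use sub in \<open>auto intro!: continuous_intros\<close>)
    show "\<exists>C. C-lipschitz_on {0..T'} (\<lambda>t. u (\<gamma> (s + c * t)))" if u: "smooth_fun A (u :: 'g \<Rightarrow> real)" for u
    proof -
      obtain C where C: "C-lipschitz_on {0..T} (\<lambda>t. u (\<gamma> t))" using subunit_lipschitz[OF su u] by blast
      have "C-lipschitz_on {0..T'} (\<lambda>t. u (\<gamma> (s + c * t)))"
      proof (rule lipschitz_onI)
        fix x y assume xy: "x \<in> {0..T'}" "y \<in> {0..T'}"
        have "dist (s + c * x) (s + c * y) = dist x y" using c by (auto simp: dist_real_def abs_minus_commute)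
        then show "dist (u (\<gamma> (s + c * x))) (u (\<gamma> (s + c * y))) \<le> C * dist x y"
          using lipschitz_onD[OF C sub[OF xy(1)] sub[OF xy(2)]] by simp
      qed (rule lipschitz_on_nonneg[OF C])
      then show ?thesis by blast
    qed
    have c0: "c \<noteq> 0" using c by auto
    from AE_lborel_affine[OF c0 a, of s]
    show "AE t in lborel. t \<in> {0..T'} \<longrightarrow> horizontal_velocity T' (\<lambda>t. \<gamma> (s + c * t)) (\<lambda>j. c * a j (s + c * t)) t"
    proof (rule eventually_mono, intro impI)
      fix t assume t: "s + c * t \<in> {0..T} \<longrightarrow> horizontal_velocity T \<gamma> (\<lambda>j. a j (s + c * t)) (s + c * t)" "t \<in> {0..T'}"
      then have h: "horizontal_velocity T \<gamma> (\<lambda>j. a j (s + c * t)) (s + c * t)" using sub by blast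
      show "horizontal_velocity T' (\<lambda>t. \<gamma> (s + c * t)) (\<lambda>j. c * a j (s + c * t)) t"
        unfolding horizontal_velocity_def
      proof (intro conjI allI impI)
        have sq: "(c * x)\<^sup>2 = x\<^sup>2" for x using c by auto
        have "(\<Sum>j = 1..n. (c * a j (s + c * t))\<^sup>2) = (\<Sum>j = 1..n. (a j (s + c * t))\<^sup>2)"
          by (rule sum.cong[OF refl sq])
        also have "\<dots> \<le> 1" by (rule conjunct1[OF h[unfolded horizontal_velocity_def]])
        finally show "(\<Sum>j = 1..n. (c * a j (s + c * t))\<^sup>2) \<le> 1" .
        fix u assume u: "smooth_fun A (u :: 'g \<Rightarrow> real)"
        have "((\<lambda>t. u (\<gamma> t)) has_real_derivative (\<Sum>j = 1..n. a j (s + c * t) * L (v j) u (\<gamma> (s + c * t))))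
            (at (s + c * t) within (\<lambda>t. s + c * t) ` {0..T'})"
        proof (rule DERIV_subset)
          show "((\<lambda>t. u (\<gamma> t)) has_real_derivative (\<Sum>j = 1..n. a j (s + c * t) * L (v j) u (\<gamma> (s + c * t))))
            (at (s + c * t) within {0..T})"
            using h u unfolding horizontal_velocity_def by blast
          show "(\<lambda>t. s + c * t) ` {0..T'} \<subseteq> {0..T}" by (rule image_subsetI) (rule sub)
        qed
        moreover have "((\<lambda>t. s + c * t) has_real_derivative c) (at t within {0..T'})"
          by (auto intro!: derivative_eq_intros)
        ultimately have "((\<lambda>t. u (\<gamma> t)) \<circ> (\<lambda>t. s + c * t) has_real_derivative
            (\<Sum>j = 1..n. a j (s + c * t) * L (v j) u (\<gamma> (s + c * t))) * c) (at t within {0..T'})"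
          by (rule DERIV_image_chain)
        then show "((\<lambda>t. u (\<gamma> (s + c * t))) has_real_derivative
            (\<Sum>j = 1..n. c * a j (s + c * t) * L (v j) u (\<gamma> (s + c * t)))) (at t within {0..T'})"
          by (simp add: o_def sum_distrib_left mult_ac)
      qed
    qed
  qed
qed

lemma subunit_concat:
  assumes 1: "subunit_curve A n X T1 \<gamma>1" and 2: "subunit_curve A n X T2 \<gamma>2"
    and T: "0 < T1" "0 < T2" and eq: "\<gamma>1 T1 = \<gamma>2 0"
  shows "subunit_curve A n X (T1 + T2) (\<lambda>t. if t \<le> T1 then \<gamma>1 t else \<gamma>2 (t - T1))"
proof -
  let ?\<gamma> = "\<lambda>t. if t \<le> T1 then \<gamma>1 t else \<gamma>2 (t - T1)"
  obtain a1 where a1: "AE t in lborel. t \<in> {0..T1} \<longrightarrow> horizontal_velocity T1 \<gamma>1 (\<lambda>j. a1 j t) t" using 1 by (auto simp: subunit_iff)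
  obtain a2 where a2: "AE t in lborel. t \<in> {0..T2} \<longrightarrow> horizontal_velocity T2 \<gamma>2 (\<lambda>j. a2 j t) t" using 2 by (auto simp: subunit_iff)
  have cont: "continuous_on {0..T1} \<gamma>1" "continuous_on {0..T2} \<gamma>2" using 1 2 by (simp_all add: subunit_iff)
  have shift: "continuous_on {T1..T1 + T2} (\<lambda>t. \<gamma>2 (t - T1))"
    by (rule continuous_on_compose2[OF cont(2)]) (auto intro!: continuous_intros)
  show ?thesis
  proof (rule subunitI[where a = "\<lambda>j t. if t \<le> T1 then a1 j t else a2 j (t - T1)"])
    have "continuous_on ({0..T1} \<union> {T1..T1 + T2}) ?\<gamma>"
      by (rule continuous_on_If) (use cont(1) shift eq in \<open>auto\<close>)
    moreover have "{0..T1} \<union> {T1..T1 + T2} = {0..T1 + T2}" using T by auto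
    ultimately show "continuous_on {0..T1 + T2} ?\<gamma>" by simp
    show "\<exists>C. C-lipschitz_on {0..T1 + T2} (\<lambda>t. u (?\<gamma> t))" if u: "smooth_fun A (u :: 'g \<Rightarrow> real)" for u
    proof -
      obtain C1 where C1: "C1-lipschitz_on {0..T1} (\<lambda>t. u (\<gamma>1 t))" using subunit_lipschitz[OF 1 u] by blast
      obtain C2 where C2: "C2-lipschitz_on {0..T2} (\<lambda>t. u (\<gamma>2 t))" using subunit_lipschitz[OF 2 u] by blast
      have "C2-lipschitz_on {T1..T1 + T2} (\<lambda>t. u (\<gamma>2 (t - T1)))"
      proof (rule lipschitz_onI)
        fix x y assume "x \<in> {T1..T1 + T2}" "y \<in> {T1..T1 + T2}"
        then show "dist (u (\<gamma>2 (x - T1))) (u (\<gamma>2 (y - T1))) \<le> C2 * dist x y"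
          using lipschitz_onD[OF C2, of "x - T1" "y - T1"] by (simp add: dist_real_def)
      qed (rule lipschitz_on_nonneg[OF C2])
      from lipschitz_on_concat_max[OF C1 this] eq
      have "(max C1 C2)-lipschitz_on {0..T1 + T2} (\<lambda>t. if t \<le> T1 then u (\<gamma>1 t) else u (\<gamma>2 (t - T1)))" by simp
      moreover have "(\<lambda>t. if t \<le> T1 then u (\<gamma>1 t) else u (\<gamma>2 (t - T1))) = (\<lambda>t. u (?\<gamma> t))" by auto
      ultimately show ?thesis by metis
    qed
    have a2': "AE t in lborel. - T1 + 1 * t \<in> {0..T2} \<longrightarrow> horizontal_velocity T2 \<gamma>2 (\<lambda>j. a2 j (- T1 + 1 * t)) (- T1 + 1 * t)"
      by (rule AE_lborel_affine[OF _ a2]) simp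
    \<comment> \<open>At the junction the one-sided velocities may differ; a single time is
      negligible.\<close>
    have ne: "AE t in lborel. t \<noteq> T1" by (rule AE_lborel_singleton)
    show "AE t in lborel. t \<in> {0..T1 + T2} \<longrightarrow>
       horizontal_velocity (T1 + T2) ?\<gamma> (\<lambda>j. if t \<le> T1 then a1 j t else a2 j (t - T1)) t"
      using a1 a2' ne
    proof eventually_elim
      fix t assume t: "t \<in> {0..T1} \<longrightarrow> horizontal_velocity T1 \<gamma>1 (\<lambda>j. a1 j t) t"
        "- T1 + 1 * t \<in> {0..T2} \<longrightarrow> horizontal_velocity T2 \<gamma>2 (\<lambda>j. a2 j (- T1 + 1 * t)) (- T1 + 1 * t)" "t \<noteq> T1"
      show "t \<in> {0..T1 + T2} \<longrightarrow> horizontal_velocity (T1 + T2) ?\<gamma> (\<lambda>j. if t \<le> T1 then a1 j t else a2 j (t - T1)) t"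
      proof
        assume tT: "t \<in> {0..T1 + T2}"
        show "horizontal_velocity (T1 + T2) ?\<gamma> (\<lambda>j. if t \<le> T1 then a1 j t else a2 j (t - T1)) t"
        proof (cases "t < T1")
          case True
          then have h: "horizontal_velocity T1 \<gamma>1 (\<lambda>j. a1 j t) t" using t(1) tT by auto
          have w: "at t within {0..T1 + T2} = at t within {0..T1}"
            by (rule at_within_nhd[of _ "{..<T1}"]) (use True T in auto)
          have "((\<lambda>t. u (?\<gamma> t)) has_real_derivative (\<Sum>j = 1..n. a1 j t * L (v j) u (\<gamma>1 t))) (at t within {0..T1 + T2})"
            if "smooth_fun A u" for u
            unfolding w
            by (rule has_field_derivative_transform_within[of "\<lambda>t. u (\<gamma>1 t)" _ _ _ "T1 - t"])
              (use h that True tT in \<open>auto simp: horizontal_velocity_def dist_real_def\<close>)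
          then show ?thesis using h True by (simp add: horizontal_velocity_def)
        next
          case False
          then have T1t: "T1 < t" using t(3) by simp
          then have h: "horizontal_velocity T2 \<gamma>2 (\<lambda>j. a2 j (t - T1)) (t - T1)" using t(2) tT by auto
          have w: "at t within {0..T1 + T2} = at t within {T1..T1 + T2}"
            by (rule at_within_nhd[of _ "{T1<..}"]) (use T1t T in auto)
          have "((\<lambda>t. u (?\<gamma> t)) has_real_derivative (\<Sum>j = 1..n. a2 j (t - T1) * L (v j) u (\<gamma>2 (t - T1)))) (at t within {0..T1 + T2})"
            if u: "smooth_fun A u" for u
            unfolding w
          proof (rule has_field_derivative_transform_within[of "\<lambda>t. u (\<gamma>2 (t - T1))" _ _ _ "t - T1"])
            have "((\<lambda>t. u (\<gamma>2 t)) has_real_derivative (\<Sum>j = 1..n. a2 j (t - T1) * L (v j) u (\<gamma>2 (t - T1))))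
              (at (t - T1) within (\<lambda>t. t - T1) ` {T1..T1 + T2})"
            proof (rule DERIV_subset)
              show "((\<lambda>t. u (\<gamma>2 t)) has_real_derivative (\<Sum>j = 1..n. a2 j (t - T1) * L (v j) u (\<gamma>2 (t - T1))))
                (at (t - T1) within {0..T2})"
                using h u unfolding horizontal_velocity_def by blast
            qed auto
            moreover have "((\<lambda>t. t - T1) has_real_derivative 1) (at t within {T1..T1 + T2})"
              by (auto intro!: derivative_eq_intros)
            ultimately have "((\<lambda>t. u (\<gamma>2 t)) \<circ> (\<lambda>t. t - T1) has_real_derivative
              (\<Sum>j = 1..n. a2 j (t - T1) * L (v j) u (\<gamma>2 (t - T1))) * 1) (at t within {T1..T1 + T2})"
              by (rule DERIV_image_chain)
            then show "((\<lambda>t. u (\<gamma>2 (t - T1))) has_real_derivative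
              (\<Sum>j = 1..n. a2 j (t - T1) * L (v j) u (\<gamma>2 (t - T1)))) (at t within {T1..T1 + T2})"
              by (simp add: o_def)
          qed (use T1t tT in \<open>auto simp: dist_real_def\<close>)
          then show ?thesis using h T1t by (simp add: horizontal_velocity_def)
        qed
      qed
    qed
  qed
qed

section \<open>Constant and exponential curves\<close>

lemma subunit_const: "subunit_curve A n X T (\<lambda>t. g)"
  by (rule subunitI[where a = "\<lambda>j t. 0"])
    (auto simp: horizontal_velocity_def lipschitz_on_def intro!: exI[of _ 0] always_eventually)

lemma subunit_ep:
  assumes j: "j \<in> {1..n}"
  shows "subunit_curve A n X T (ep (v j))"
proof (rule subunitI[where a = "\<lambda>i t. if i = j then 1 else 0"])
  have der: "((\<lambda>t. u (ep (v j) t)) has_real_derivative L (v j) u (ep (v j) t)) (at t within S)"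
    if "smooth_fun A u" for u t S
    by (rule has_field_derivative_at_within[OF velocity_deriv[OF one_param_velocity[OF ep] that]])
  show "continuous_on {0..T} (ep (v j))" by (rule continuous_on_subset[OF ep_cont]) simp
  show "\<exists>C. C-lipschitz_on {0..T} (\<lambda>t. u (ep (v j) t))" if u: "smooth_fun A (u :: 'g \<Rightarrow> real)" for u
  proof -
    have "continuous_on {0..T} (\<lambda>t. L (v j) u (ep (v j) t))"
      by (rule continuous_on_compose2[OF smooth_fun_cont[OF smooth_fun_L[OF u]] continuous_on_subset[OF ep_cont]]) auto
    then have "bounded ((\<lambda>t. L (v j) u (ep (v j) t)) ` {0..T})"
      by (intro compact_imp_bounded compact_continuous_image) auto
    then obtain C where C: "C > 0" "\<And>t. t \<in> {0..T} \<Longrightarrow> \<bar>L (v j) u (ep (v j) t)\<bar> \<le> C" by (auto simp: bounded_pos)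
    have "C-lipschitz_on {0..T} (\<lambda>t. u (ep (v j) t))"
    proof (rule bounded_derivative_imp_lipschitz)
      show "((\<lambda>t. u (ep (v j) t)) has_derivative (*) (L (v j) u (ep (v j) t))) (at t within {0..T})" for t
        using der[OF u] by (simp add: has_field_derivative_def)
      show "onorm ((*) (L (v j) u (ep (v j) t))) \<le> C" if "t \<in> {0..T}" for t
        by (rule onorm_bound) (use C(1) C(2)[OF that] in \<open>auto simp: abs_mult intro: mult_right_mono\<close>)
    qed (use C in auto)
    then show ?thesis by blast
  qed
  have "horizontal_velocity T (ep (v j)) (\<lambda>i. if i = j then 1 else 0) t" for t
    unfolding horizontal_velocity_def
  proof (intro conjI allI impI)
    show "(\<Sum>i = 1..n. (if i = j then 1 else 0)\<^sup>2) \<le> (1::real)"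
      using j by (simp add: if_distrib[of "\<lambda>x. x\<^sup>2"] cong: if_cong)
    fix u assume "smooth_fun A (u :: 'g \<Rightarrow> real)"
    then show "((\<lambda>t. u (ep (v j) t)) has_real_derivative
       (\<Sum>i = 1..n. (if i = j then 1 else 0) * L (v i) u (ep (v j) t))) (at t within {0..T})"
      using der j by (simp add: if_distrib[of "\<lambda>x. x * _"] cong: if_cong)
  qed
  then show "AE t in lborel. t \<in> {0..T} \<longrightarrow> horizontal_velocity T (ep (v j)) (\<lambda>i. if i = j then 1 else 0) t" by simp
qed

text \<open>The ball about the identity, phrased by the existence of a curve of duration less than
  \<open>r\<close> instead of an infimum. Concatenation and reversal then act on it directly. It is
  empty for \<open>r \<le> 0\<close>, as the metric ball is.\<close>

definition B :: "real \<Rightarrow> 'g set" where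
  "B r = {h. \<exists>T \<gamma>. 0 < T \<and> T < r \<and> subunit_curve A n X T \<gamma> \<and> \<gamma> 0 = 0 \<and> \<gamma> T = h}"

lemma BI: "0 < T \<Longrightarrow> T < r \<Longrightarrow> subunit_curve A n X T \<gamma> \<Longrightarrow> - \<gamma> 0 + \<gamma> T \<in> B r"
  using subunit_left[of T \<gamma> "- \<gamma> 0"] unfolding B_def by fastforce

lemma B_0: "0 < r \<Longrightarrow> 0 \<in> B r"
  using BI[of "r / 2" r "\<lambda>t. 0"] subunit_const by simp

lemma B_mono: "r \<le> s \<Longrightarrow> B r \<subseteq> B s"
  unfolding B_def by fastforce

lemma B_uminus: "g \<in> B r \<Longrightarrow> - g \<in> B r"
proof -
  assume "g \<in> B r"
  then obtain T \<gamma> where T: "0 < T" "T < r" "subunit_curve A n X T \<gamma>" "\<gamma> 0 = 0" "\<gamma> T = g" by (auto simp: B_def)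
  have "subunit_curve A n X T (\<lambda>t. \<gamma> (T + (- 1) * t))" by (rule subunit_affine[OF T(3)]) auto
  from BI[OF T(1,2) this] show ?thesis by (simp add: T)
qed

lemma B_add: "g \<in> B r \<Longrightarrow> h \<in> B s \<Longrightarrow> g + h \<in> B (r + s)"
proof -
  assume "g \<in> B r" "h \<in> B s"
  then obtain T \<gamma> S \<eta> where T: "0 < T" "T < r" "subunit_curve A n X T \<gamma>" "\<gamma> 0 = 0" "\<gamma> T = g"
    and S: "0 < S" "S < s" "subunit_curve A n X S \<eta>" "\<eta> 0 = 0" "\<eta> S = h" by (auto simp: B_def)
  have "subunit_curve A n X (T + S) (\<lambda>t. if t \<le> T then \<gamma> t else g + \<eta> (t - T))"
    by (rule subunit_concat[OF T(3) subunit_left[OF S(3)] T(1) S(1)]) (simp add: T S)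
  from BI[OF _ _ this, of "r + s"] show ?thesis using T S by simp
qed

lemma B_ep: "j \<in> {1..n} \<Longrightarrow> \<bar>t\<bar> < r \<Longrightarrow> ep (v j) t \<in> B r"
proof -
  assume j: "j \<in> {1..n}" and t: "\<bar>t\<bar> < r"
  have pos: "ep (v j) t \<in> B r" if "0 < t" "t < r" for t
    using BI[OF that subunit_ep[OF j]] one_param_0[OF ep] by simp
  consider "t = 0" | "0 < t" | "t < 0" by linarith
  then show ?thesis
  proof cases
    case 1
    then show ?thesis using B_0 t one_param_0[OF ep] by simp
  next
    case 3
    have "- ep (v j) (- t) \<in> B r" by (rule B_uminus[OF pos]) (use 3 t in auto)
    then show ?thesis by (simp add: one_param_minus[OF ep])
  qed (use pos t in auto)
qed

lemma B_nbhd: "0 < r \<Longrightarrow> \<exists>N. open N \<and> 0 \<in> N \<and> N \<subseteq> B r"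
proof (rule chow[of B "{1..n}" v])
  show "\<And>r. 0 < r \<Longrightarrow> 0 \<in> B r" by (rule B_0)
  show "\<And>r s g h. g \<in> B r \<Longrightarrow> h \<in> B s \<Longrightarrow> g + h \<in> B (r + s)" by (rule B_add)
  show "\<And>r g. g \<in> B r \<Longrightarrow> - g \<in> B r" by (rule B_uminus)
  show "\<And>r s. r \<le> s \<Longrightarrow> B r \<subseteq> B s" by (rule B_mono)
  show "\<And>j t r. j \<in> {1..n} \<Longrightarrow> \<bar>t\<bar> < r \<Longrightarrow> ep (v j) t \<in> B r" by (rule B_ep)
  show "\<And>W. subspace W \<Longrightarrow> v ` {1..n} \<subseteq> W \<Longrightarrow> (\<And>j w. j \<in> {1..n} \<Longrightarrow> w \<in> W \<Longrightarrow> br (v j) w \<in> W) \<Longrightarrow> W = UNIV"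
    by (rule gen)
qed

text \<open>Cut the curve at time \<open>T / real (Suc m)\<close>; \<open>m > 0\<close> leaves the
  second piece a positive duration. Compactness of closures thereby propagates from small balls to
  all radii.\<close>

lemma B_split:
  assumes "h \<in> B (real (Suc m) * r)" "m > 0"
  obtains g k where "g \<in> B r" "k \<in> B (real m * r)" "h = g + k"
proof -
  obtain T \<gamma> where T: "0 < T" "T < real (Suc m) * r" "subunit_curve A n X T \<gamma>" "\<gamma> 0 = 0" "\<gamma> T = h"
    using assms(1) by (auto simp: B_def)
  define t where "t = T / real (Suc m)"
  have tm: "real (Suc m) * t = T" by (simp add: t_def)
  then have t: "0 < t" "t < r" "T - t = real m * t" "t < T"
  proof -
    show "0 < t" "t < r" using T(1,2) by (simp_all add: t_def field_simps)
    show "T - t = real m * t" using tm by (simp add: algebra_simps)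
    then show "t < T" using \<open>0 < t\<close> assms(2) by (smt (verit) mult_pos_pos of_nat_0_less_iff)
  qed
  have "subunit_curve A n X t (\<lambda>\<tau>. \<gamma> (0 + 1 * \<tau>))" by (rule subunit_affine[OF T(3)]) (use t in auto)
  from BI[OF t(1,2) this] have 1: "\<gamma> t \<in> B r" by (simp add: T)
  have "subunit_curve A n X (T - t) (\<lambda>\<tau>. \<gamma> (t + 1 * \<tau>))" by (rule subunit_affine[OF T(3)]) (use t in auto)
  from BI[OF _ _ this, of "real m * r"]
  have "- \<gamma> (t + 1 * 0) + \<gamma> (t + 1 * (T - t)) \<in> B (real m * r)" using t assms(2) by simp
  moreover have "t + 1 * 0 = t" "t + 1 * (T - t) = T" by simp_all
  ultimately have 2: "- \<gamma> t + h \<in> B (real m * r)" by (simp only: T(5))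
  show ?thesis by (rule that[OF 1 2]) (simp flip: add.assoc)
qed

lemma L_zero_outside:
  assumes u: "smooth_fun A u" and K: "compact K" "\<And>p. p \<notin> K \<Longrightarrow> u p = 0" and p: "p \<notin> K"
  shows "L w u p = 0"
proof -
  have op: "open (- K)" using K(1) by (simp add: compact_imp_closed open_Compl)
  have "continuous_on D0 (\<lambda>x. p + ex x)" by (intro continuous_intros ex_cont)
  then have "open (D0 \<inter> (\<lambda>x. p + ex x) -` (- K))" by (rule open_Int_vimage[OF D0_open _ op])
  then have "((\<lambda>x. u (p + ex x)) has_derivative (\<lambda>h. 0)) (at 0)"
    by (intro has_derivative_transform_within_open[OF has_derivative_const[of 0]]) (use p K(2) in auto)
  from fun_cong[OF has_derivative_unique[OF L_has_derivative[OF u] this]] show ?thesis .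
qed

text \<open>A bump function changes at a bounded rate along subunit curves, so short ones stay in its support.\<close>

lemma B_small:
  assumes "open N" "0 \<in> N"
  obtains r K where "r > 0" "B r \<subseteq> K" "compact K" "K \<subseteq> N"
proof -
  obtain \<beta> K where \<beta>: "smooth_fun A \<beta>" "\<beta> 0 = (1::real)" "\<And>p. p \<notin> K \<Longrightarrow> \<beta> p = 0" "compact K" "K \<subseteq> N"
    using bump_fun[OF assms] by metis
  have "\<exists>c. \<forall>p. \<bar>L (v j) \<beta> p\<bar> \<le> c" for j
  proof -
    have "bounded (L (v j) \<beta> ` K)"
      by (intro compact_imp_bounded compact_continuous_image \<beta>(4) continuous_on_subset[OF smooth_fun_cont[OF smooth_fun_L[OF \<beta>(1)]]]) simp
    then obtain c where c: "c > 0" "\<And>p. p \<in> K \<Longrightarrow> \<bar>L (v j) \<beta> p\<bar> \<le> c" by (auto simp: bounded_pos)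
    then have "\<bar>L (v j) \<beta> p\<bar> \<le> c" for p
      using L_zero_outside[OF \<beta>(1,4,3), of p "v j"] by (cases "p \<in> K") auto
    then show ?thesis by blast
  qed
  then obtain c where c: "\<And>j p. \<bar>L (v j) \<beta> p\<bar> \<le> c j" by metis
  define C where "C = (\<Sum>j = 1..n. c j)"
  have C: "C \<ge> 0" unfolding C_def using order_trans[OF abs_ge_zero c] by (intro sum_nonneg) auto
  show ?thesis
  \<comment> \<open>Along a subunit curve the bump changes at rate at most \<open>C\<close>, so
    within this time it cannot fall from 1 to 0. Adding 1 keeps the denominator positive.\<close>
  proof (rule that[of "1 / (C + 1)" K])
    show "B (1 / (C + 1)) \<subseteq> K"
    proof
      fix h assume "h \<in> B (1 / (C + 1))"
      then obtain T \<gamma> where T: "0 < T" "T < 1 / (C + 1)" "subunit_curve A n X T \<gamma>" "\<gamma> 0 = 0" "\<gamma> T = h"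
        by (auto simp: B_def)
      have "\<bar>\<beta> (\<gamma> T) - \<beta> (\<gamma> 0)\<bar> \<le> (\<Sum>j = 1..n. c j) * (T - 0)"
        by (rule subunit_bound[OF T(3) \<beta>(1)]) (use T c in auto)
      also have "\<dots> \<le> (C + 1) * T" unfolding C_def[symmetric] using T(1) by (simp add: algebra_simps)
      also have "\<dots> < 1" using T(2) C by (simp add: field_simps)
      finally have "\<beta> h \<noteq> 0" using T \<beta>(2) by auto
      then show "h \<in> K" using \<beta>(3) by blast
    qed
  qed (use C \<beta> in auto)
qed

text \<open>A large ball lies in a sum of finitely many small balls, and sums of compact sets are
  compact.\<close>

lemma B_compact: "\<exists>K. compact K \<and> B r \<subseteq> K"
proof -
  obtain r0 K where r0: "r0 > 0" "B r0 \<subseteq> K" "compact K" using B_small[of UNIV] by auto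
  have "\<exists>K. compact K \<and> B (real (Suc m) * r0) \<subseteq> K" for m
  proof (induction m)
    case 0
    then show ?case using r0 by auto
  next
    case (Suc m)
    then obtain K' where K': "compact K'" "B (real (Suc m) * r0) \<subseteq> K'" by blast
    have "B (real (Suc (Suc m)) * r0) \<subseteq> (\<lambda>z. fst z + snd z) ` (K \<times> K')"
    proof
      fix h assume "h \<in> B (real (Suc (Suc m)) * r0)"
      then obtain g k where "g \<in> B r0" "k \<in> B (real (Suc m) * r0)" "h = g + k" by (rule B_split) auto
      then show "h \<in> (\<lambda>z. fst z + snd z) ` (K \<times> K')" using K' r0 by force
    qed
    moreover have "compact ((\<lambda>z. fst z + snd z) ` (K \<times> K'))"
      by (intro compact_continuous_image compact_Times r0 K' continuous_intros)
    ultimately show ?case by blast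
  qed
  moreover obtain m where "r / r0 < real m" using reals_Archimedean2 by blast
  then have "r \<le> real (Suc m) * r0" using r0(1) by (simp add: field_simps)
  ultimately show ?thesis using B_mono by (meson order_trans)
qed

text \<open>Around each point of \<open>H\<close>, and likewise around each point outside it, a
  translate of \<open>N\<close> stays on the same side, so \<open>H\<close> is both open and closed
  in a connected group.\<close>

lemma open_subgroup_UNIV:
  assumes "open N" "0 \<in> N" "N \<subseteq> H" and add: "\<And>x y. x \<in> H \<Longrightarrow> y \<in> H \<Longrightarrow> x + y \<in> H" and neg: "\<And>x. x \<in> H \<Longrightarrow> - x \<in> H"
  shows "H = (UNIV :: 'g set)"
proof -
  have tr: "open ((\<lambda>x. - g + x) -` N)" for g :: 'g
    by (intro open_vimage assms(1) continuous_intros)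
  have "open H"
  proof (subst open_subopen, intro ballI)
    fix g assume g: "g \<in> H"
    have "(\<lambda>x. - g + x) -` N \<subseteq> H"
    proof
      fix x assume "x \<in> (\<lambda>x. - g + x) -` N"
      then have "g + (- g + x) \<in> H" using assms(3) by (intro add[OF g]) auto
      then show "x \<in> H" by (simp flip: add.assoc)
    qed
    then show "\<exists>T. open T \<and> g \<in> T \<and> T \<subseteq> H" using tr[of g] assms(2) by (intro exI[of _ "(\<lambda>x. - g + x) -` N"]) auto
  qed
  moreover have "open (- H)"
  proof (subst open_subopen, intro ballI)
    fix g assume g: "g \<in> - H"
    have "(\<lambda>x. - g + x) -` N \<subseteq> - H"
    proof
      fix x assume x: "x \<in> (\<lambda>x. - g + x) -` N"
      show "x \<in> - H"
      proof
        assume "x \<in> H"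
        then have "x + - (- g + x) \<in> H" using x assms(3) by (intro add[OF _ neg]) auto
        then show False using g by (simp add: minus_add del: add_uminus_conv_diff)
      qed
    qed
    then show "\<exists>T. open T \<and> g \<in> T \<and> T \<subseteq> - H" using tr[of g] assms(2) by (intro exI[of _ "(\<lambda>x. - g + x) -` N"]) auto
  qed
  ultimately have "H \<inter> UNIV = {} \<or> - H \<inter> UNIV = {}" by (intro connectedD[OF conn]) auto
  then show ?thesis using assms by blast
qed

text \<open>The union of all balls is a subgroup and contains a neighbourhood of the identity. With
  connectedness this means that any two points have finite distance.\<close>

lemma B_exhaust: "\<exists>r>0. h \<in> B r"
proof -
  let ?H = "\<Union>r\<in>{0<..}. B r"
  obtain N where N: "open N" "0 \<in> N" "N \<subseteq> B 1" using B_nbhd[of 1] by auto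
  have "?H = UNIV"
  proof (rule open_subgroup_UNIV[OF N(1,2)])
    show "N \<subseteq> ?H" using N(3) by force
    show "x + y \<in> ?H" if xy: "x \<in> ?H" "y \<in> ?H" for x y
    proof -
      obtain r where "x \<in> B r" "r > 0" using xy(1) by auto
      moreover obtain s where "y \<in> B s" "s > 0" using xy(2) by auto
      ultimately have "x + y \<in> B (r + s)" "r + s > 0" using B_add by auto
      then show ?thesis by blast
    qed
    show "- x \<in> ?H" if "x \<in> ?H" for x using that B_uminus by blast
  qed
  then show ?thesis by blast
qed

lemma cc_dist_less: "cc_dist A n X g h < r \<longleftrightarrow> - g + h \<in> B r"
proof -
  let ?S = "{T. 0 < T \<and> (\<exists>\<gamma>. subunit_curve A n X T \<gamma> \<and> \<gamma> 0 = g \<and> \<gamma> T = h)}"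
  have iff: "T \<in> ?S \<longleftrightarrow> 0 < T \<and> (\<exists>\<gamma>. subunit_curve A n X T \<gamma> \<and> \<gamma> 0 = 0 \<and> \<gamma> T = - g + h)" for T
  proof
    assume "T \<in> ?S"
    then obtain \<gamma> where \<gamma>: "0 < T" "subunit_curve A n X T \<gamma>" "\<gamma> 0 = g" "\<gamma> T = h" by blast
    then show "0 < T \<and> (\<exists>\<gamma>. subunit_curve A n X T \<gamma> \<and> \<gamma> 0 = 0 \<and> \<gamma> T = - g + h)"
      using subunit_left[OF \<gamma>(2), of "- g"] by fastforce
  next
    assume "0 < T \<and> (\<exists>\<gamma>. subunit_curve A n X T \<gamma> \<and> \<gamma> 0 = 0 \<and> \<gamma> T = - g + h)"
    then obtain \<gamma> where \<gamma>: "0 < T" "subunit_curve A n X T \<gamma>" "\<gamma> 0 = 0" "\<gamma> T = - g + h" by blast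
    have "subunit_curve A n X T (\<lambda>t. g + \<gamma> t) \<and> g + \<gamma> 0 = g \<and> g + \<gamma> T = h"
      using subunit_left[OF \<gamma>(2), of g] \<gamma>(3,4) by (simp flip: add.assoc)
    then show "T \<in> ?S" using \<gamma>(1) by blast
  qed
  have B_iff: "- g + h \<in> B r \<longleftrightarrow> (\<exists>T\<in>?S. T < r)" for r
    unfolding B_def using iff by blast
  \<comment> \<open>The infimum of an empty set of reals would be an unspecified number; that every
    pair of points is joined by a subunit curve gives \<open>cc_dist\<close> its meaning.\<close>
  have "?S \<noteq> {}" using B_exhaust[of "- g + h"] B_iff by blast
  moreover have "bdd_below ?S" by (rule bdd_belowI[of _ 0]) auto
  ultimately show ?thesis unfolding cc_dist_def B_iff by (rule cInf_less_iff)
qed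

end

section \<open>Noncompactness\<close>

lemma locally_constant_01:
  fixes f :: "real \<Rightarrow> 'a"
  assumes "\<delta> > 0" "\<And>s t. s \<in> {0..1} \<Longrightarrow> t \<in> {0..1} \<Longrightarrow> \<bar>s - t\<bar> < \<delta> \<Longrightarrow> f s = f t"
  shows "f 0 = f 1"
proof -
  obtain M :: nat where M: "1 / \<delta> < real M" using reals_Archimedean2 by blast
  have M0: "M > 0" using M assms(1) by (metis divide_pos_pos gr0I less_asym of_nat_0 zero_less_one)
  have "f 0 = f (real i / real M)" if "i \<le> M" for i
    using that
  proof (induction i)
    case (Suc i)
    have "real (Suc i) / real M - real i / real M = 1 / real M" by (simp add: diff_divide_distrib[symmetric])
    moreover have "1 / real M < \<delta>" using M M0 assms(1) by (simp add: field_simps)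
    ultimately have "f (real (Suc i) / real M) = f (real i / real M)"
      using Suc.prems M0 by (intro assms(2)) (auto simp: field_simps)
    then show ?case using Suc by simp
  qed simp
  from this[of M] show ?thesis using M0 by simp
qed

text \<open>A local cocycle on a starlike compact set is integrated along rays from the origin.\<close>

lemma cocycle_primitive:
  fixes K :: "'a::euclidean_space set" and c :: "'a \<Rightarrow> 'a \<Rightarrow> 'b::real_vector"
  assumes K: "bounded K" "\<And>p t. p \<in> K \<Longrightarrow> 0 \<le> t \<Longrightarrow> t \<le> 1 \<Longrightarrow> t *\<^sub>R p \<in> K" and \<delta>: "\<delta> > 0"
    and c: "\<And>p q r. p \<in> K \<Longrightarrow> q \<in> K \<Longrightarrow> r \<in> K \<Longrightarrow> dist p q < \<delta> \<Longrightarrow> dist q r < \<delta> \<Longrightarrow> dist p r < \<delta> \<Longrightarrow>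
       c p r = c p q + c q r"
  obtains k \<eta> where "\<eta> > 0" "\<And>p q. p \<in> K \<Longrightarrow> q \<in> K \<Longrightarrow> dist p q < \<eta> \<Longrightarrow> k q - k p = c p q"
proof -
  obtain R where R: "R > 0" "\<And>p. p \<in> K \<Longrightarrow> norm p \<le> R" using K(1) by (auto simp: bounded_pos)
  \<comment> \<open>Fine enough that consecutive points on a ray are closer than
    \<open>\<delta> / 4\<close>. For \<open>p\<close> and \<open>q\<close> within
    \<open>\<delta> / 4\<close>, the sides and the diagonal of every quadrilateral below then stay
    under \<open>\<delta>\<close>.\<close>
  obtain M :: nat where M: "4 * R / \<delta> < real M" using reals_Archimedean2 by blast
  have M0: "real M > 0" using M R \<delta> by (smt (verit) divide_pos_pos mult_pos_pos)
  have RM: "R / real M < \<delta> / 4" using M M0 \<delta> by (simp add: field_simps)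
  define x where "x = (\<lambda>i p. (real i / real M) *\<^sub>R (p::'a))"
  define k where "k = (\<lambda>p. \<Sum>i<M. c (x i p) (x (Suc i) p))"
  have xK: "x i p \<in> K" if "p \<in> K" "i \<le> M" for i p
    unfolding x_def using that M0 by (intro K(2)) auto
  have step: "dist (x i p) (x (Suc i) p) < \<delta> / 4" if "p \<in> K" for i p
  proof -
    have "x (Suc i) p - x i p = (1 / real M) *\<^sub>R p"
      unfolding x_def scaleR_diff_left[symmetric] by (simp add: diff_divide_distrib[symmetric])
    then have "dist (x i p) (x (Suc i) p) = norm p / real M"
      by (simp add: dist_norm norm_minus_commute[of "x i p"] divide_inverse mult.commute)
    also have "\<dots> \<le> R / real M" using R(2)[OF that] M0 by (intro divide_right_mono) auto
    finally show ?thesis using RM by (rule le_less_trans)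
  qed
  have near: "dist (x i p) (x i q) < \<delta> / 4" if "dist p q < \<delta> / 4" "i \<le> M" for i p q
  proof -
    have "dist (x i p) (x i q) = (real i / real M) * dist p q"
      by (simp add: x_def dist_norm scaleR_diff_right[symmetric])
    also have "\<dots> \<le> 1 * dist p q" using that M0 by (intro mult_right_mono) auto
    finally show ?thesis using that by simp
  qed
  show ?thesis
  proof (rule that[of "\<delta> / 4" k])
    fix p q assume pq: "p \<in> K" "q \<in> K" "dist p q < \<delta> / 4"
    \<comment> \<open>The two paths from \<open>x i p\<close> to \<open>x (Suc i) q\<close> around
      the quadrilateral give the same value; summed over \<open>i\<close>, the transversal terms
      telescope.\<close>
    have "c (x i q) (x (Suc i) q) - c (x i p) (x (Suc i) p) =
        c (x (Suc i) p) (x (Suc i) q) - c (x i p) (x i q)" if i: "i < M" for i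
    proof -
      note n = near[OF pq(3), of i] near[OF pq(3), of "Suc i"] step[OF pq(1), of i] step[OF pq(2), of i]
      have d: "dist (x i p) (x (Suc i) q) < \<delta>"
        using n i dist_triangle[of "x i p" "x (Suc i) q" "x i q"] \<delta> by simp
      have "c (x i p) (x (Suc i) q) = c (x i p) (x i q) + c (x i q) (x (Suc i) q)"
        by (rule c) (use n i d \<delta> xK pq in auto)
      moreover have "c (x i p) (x (Suc i) q) = c (x i p) (x (Suc i) p) + c (x (Suc i) p) (x (Suc i) q)"
        by (rule c) (use n i d \<delta> xK pq in auto)
      ultimately show ?thesis by (simp add: algebra_simps)
    qed
    then have "k q - k p = (\<Sum>i<M. c (x (Suc i) p) (x (Suc i) q) - c (x i p) (x i q))"
      unfolding k_def sum_subtractf[symmetric] by (intro sum.cong) auto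
    also have "\<dots> = c (x M p) (x M q) - c (x 0 p) (x 0 q)" by (rule sum_lessThan_telescope)
    \<comment> \<open>Both arguments are the origin, and the cocycle identity with three equal
      points forces the value 0.\<close>
    also have "c (x 0 p) (x 0 q) = 0"
      using c[of "x 0 p" "x 0 p" "x 0 p"] xK[OF pq(1), of 0] \<delta> by (simp add: x_def)
    also have "x M p = p" using M0 by (simp add: x_def)
    also have "x M q = q" using M0 by (simp add: x_def)
    finally show "k q - k p = c p q" by simp
  qed (use \<delta> in simp)
qed

text \<open>The pairs violating the conclusion form a compact set disjoint from the diagonal, so
  their distance has a positive minimum.\<close>

lemma uniform_group_continuity:
  fixes h :: "'a::metric_space \<Rightarrow> 'g::topological_group_add"
  assumes "compact K" "continuous_on K h" "open N" "0 \<in> N"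
  obtains \<delta> where "\<delta> > 0" "\<And>p q. p \<in> K \<Longrightarrow> q \<in> K \<Longrightarrow> dist p q < \<delta> \<Longrightarrow> - h p + h q \<in> N"
proof -
  let ?F = "\<lambda>z. - h (fst z) + h (snd z)"
  have "continuous_on (K \<times> K) ?F"
    by (intro continuous_on_add continuous_on_minus' continuous_on_compose2[OF assms(2) continuous_on_fst[OF continuous_on_id]]
        continuous_on_compose2[OF assms(2) continuous_on_snd[OF continuous_on_id]]) auto
  then obtain T where T: "open T" "T \<inter> (K \<times> K) = ?F -` N \<inter> (K \<times> K)"
    using continuous_on_open_invariant[of "K \<times> K" ?F] assms(3) by metis
  have "compact (K \<times> K - T)" using assms(1) T(1) by (intro compact_diff compact_Times)
  then have cW: "compact ((\<lambda>z. dist (fst z) (snd z)) ` (K \<times> K - T))"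
    by (intro compact_continuous_image continuous_intros)
  show ?thesis
  proof (cases "K \<times> K - T = {}")
    case True
    then have "- h p + h q \<in> N" if "p \<in> K" "q \<in> K" for p q
    proof -
      have "(p, q) \<in> T \<inter> (K \<times> K)" using True that by auto
      then show ?thesis unfolding T(2) by simp
    qed
    then show ?thesis using that[of 1] by simp
  next
    case False
    obtain z where z: "z \<in> K \<times> K - T" "\<And>w. w \<in> K \<times> K - T \<Longrightarrow> dist (fst z) (snd z) \<le> dist (fst w) (snd w)"
      using compact_attains_inf[OF cW] False by auto
    have "fst z \<noteq> snd z"
    proof
      assume "fst z = snd z"
      then have "z \<in> ?F -` N \<inter> (K \<times> K)" using z(1) assms(4) by (cases z) auto
      then show False using z(1) unfolding T(2)[symmetric] by simp
    qed
    then show ?thesis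
    proof (intro that[of "dist (fst z) (snd z)"])
      fix p q assume pq: "p \<in> K" "q \<in> K" "dist p q < dist (fst z) (snd z)"
      then have "(p, q) \<in> T \<inter> (K \<times> K)" using z(2)[of "(p, q)"] by force
      then show "- h p + h q \<in> N" unfolding T(2) by simp
    qed simp
  qed
qed

lemma commutes_uminus:
  fixes g h :: "'a::group_add"
  assumes "g + h = h + g"
  shows "- g + h = h + - g"
proof -
  have "- g + h = - g + ((h + g) + - g)" by (simp add: add.assoc del: add_uminus_conv_diff)
  also have "\<dots> = - g + ((g + h) + - g)" by (simp only: assms)
  also have "\<dots> = h + - g" by (simp add: add.assoc del: add_uminus_conv_diff)
  finally show ?thesis .
qed

lemma commutes_add:
  fixes g h k :: "'a::group_add"
  assumes "g + h = h + g" "k + h = h + k"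
  shows "(g + k) + h = h + (g + k)"
proof -
  have "(g + k) + h = (g + h) + k" by (simp only: add.assoc assms(2))
  also have "\<dots> = h + (g + k)" by (simp only: assms(1) add.assoc)
  finally show ?thesis .
qed

section \<open>The adjoint action of a compact group\<close>

context horizontal
begin

text \<open>By \<open>L_Ad\<close> the number in question is a derivative at the identity of
  \<open>u\<close> along conjugates, which depend smoothly on \<open>g\<close>. On a compact group
  the coordinates of \<open>Ad g w\<close> are therefore bounded.\<close>

lemma smooth_fun_Ad:
  assumes u: "smooth_fun A u"
  shows "smooth_fun A (\<lambda>g. L (Ad g w) u 0)"
proof (rule smooth_funI)
  fix W \<kappa> assume W: "(W, \<kappa>) \<in> A"
  have op: "open (\<kappa> ` W \<times> D0)" by (intro open_Times chart_image_open[OF W] D0_open)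
  have "smap (\<kappa> ` W \<times> D0) (\<lambda>z. inv_into W \<kappa> (fst z))"
    by (rule smap_compose[OF smap_inv_chart[OF W] op smooth_on_linear[OF bounded_linear_fst op]]) auto
  then have "smap (\<kappa> ` W \<times> D0) (\<lambda>z. (inv_into W \<kappa> (fst z) + ex (snd z)) + - inv_into W \<kappa> (fst z))"
    by (intro smap_add smap_uminus smap_pair[OF W])
  from smooth_on_slice(1)[OF smap_smooth_fun[OF this u] chart_image_open[OF W] D0_open zero_in_D0, of w]
  have "smooth_on (\<kappa> ` W) (\<lambda>x. frechet_derivative (\<lambda>z. u (inv_into W \<kappa> x + ex z + - inv_into W \<kappa> x)) (at 0) w)"
    by simp
  then show "smooth_on (\<kappa> ` W) (\<lambda>x. L (Ad (inv_into W \<kappa> x) w) u 0)"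
    unfolding L_Ad[OF u] by (simp add: L_def)
qed

lemma Ad_bounded:
  assumes "compact (UNIV :: 'g set)"
  obtains C where "\<And>g. norm (Ad g w) \<le> C"
proof -
  obtain cf :: "'e \<Rightarrow> 'g \<Rightarrow> real" where cf: "\<And>b. smooth_fun A (cf b)" "\<And>v b. L v (cf b) 0 = v \<bullet> b"
    using coordinate_functions by blast
  have "\<exists>c. \<forall>g. \<bar>Ad g w \<bullet> b\<bar> \<le> c" for b
  proof -
    have "bounded (range (\<lambda>g. L (Ad g w) (cf b) 0))"
      by (intro compact_imp_bounded compact_continuous_image assms smooth_fun_cont smooth_fun_Ad cf)
    then show ?thesis by (auto simp: bounded_iff cf(2))
  qed
  then obtain c where c: "\<And>g b. \<bar>Ad g w \<bullet> b\<bar> \<le> c b" by metis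
  show ?thesis
    by (rule that[of "\<Sum>b\<in>Basis. c b"]) (intro order_trans[OF norm_le_l1] sum_mono c)
qed

text \<open>The homomorphism property transports the derivative at time 0 to time
  \<open>t\<close>.\<close>

lemma Ad_ep_derivative: "((\<lambda>t. Ad (ep v' t) w) has_vector_derivative Ad (ep v' t) (br v' w)) (at t)"
proof -
  have tg: "tang (ep v') (\<lambda>t. t *\<^sub>R v') 0" using ep[of v'] by (simp add: one_param_def)
  have "((\<lambda>\<tau>. Ad (ep v' t) (Ad (ep v' \<tau>) w)) has_vector_derivative Ad (ep v' t) (br v' w)) (at 0)"
    by (rule bounded_linear.has_vector_derivative[OF Ad_bounded_linear Ad_derivative[OF tg]])
  then have "((\<lambda>\<tau>. Ad (ep v' (t + \<tau>)) w) has_vector_derivative Ad (ep v' t) (br v' w)) (at 0)"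
    by (simp add: one_param_add[OF ep] Ad_add)
  then have 1: "((\<lambda>\<tau>. Ad (ep v' (t + \<tau>)) w) has_vector_derivative Ad (ep v' t) (br v' w)) (at (- t + t))" by simp
  have 2: "((\<lambda>\<tau>. - t + \<tau>) has_vector_derivative 1) (at t)" by (auto intro!: derivative_eq_intros)
  from vector_diff_chain_at[OF 2 1] show ?thesis by (simp add: o_def)
qed

lemma constant_of_zero_derivative:
  fixes f :: "real \<Rightarrow> 'b::real_normed_vector"
  assumes "\<And>t. (f has_vector_derivative 0) (at t)"
  shows "f t = f 0"
proof -
  have "\<exists>c. \<forall>x\<in>UNIV. f x = c"
    by (rule has_derivative_zero_constant) (use assms in \<open>auto simp: has_vector_derivative_def\<close>)
  then show ?thesis by auto
qed

text \<open>
  Otherwise \<open>Ad (ep v' t) w = w + t *\<^sub>R br v' w\<close> would be unbounded in \<open>t\<close>.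
\<close>

lemma compact_br_0:
  assumes c: "compact (UNIV :: 'g set)" and z: "br v' (br v' w) = 0"
  shows "br v' w = 0"
proof -
  obtain C where C: "\<And>g. norm (Ad g w) \<le> C" using Ad_bounded[OF c] by blast
  have "((\<lambda>t. Ad (ep v' t) (br v' w)) has_vector_derivative 0) (at t)" for t
    using Ad_ep_derivative[of v' "br v' w" t] z by (simp add: linear_0[OF Ad_linear])
  from constant_of_zero_derivative[OF this] have k: "Ad (ep v' t) (br v' w) = br v' w" for t
    by (simp add: one_param_0[OF ep])
  have "((\<lambda>t. Ad (ep v' t) w - t *\<^sub>R br v' w) has_vector_derivative 0) (at t)" for t
    using Ad_ep_derivative[of v' w t] by (auto simp: k intro!: derivative_eq_intros)
  from constant_of_zero_derivative[OF this] have y: "Ad (ep v' t) w = w + t *\<^sub>R br v' w" for t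
    by (simp add: one_param_0[OF ep] algebra_simps)
  have C0: "norm w \<le> C" using C[of 0] by simp
  have "\<bar>t\<bar> * norm (br v' w) \<le> 2 * C" for t
  proof -
    have "t *\<^sub>R br v' w = Ad (ep v' t) w - w" by (simp add: y)
    then have "norm (t *\<^sub>R br v' w) \<le> norm (Ad (ep v' t) w) + norm w" by (metis norm_triangle_ineq4)
    then show ?thesis using C[of "ep v' t"] C0 by simp
  qed
  \<comment> \<open>At this time the left side would be \<open>2 * C + 1\<close> if the bracket were
    nonzero.\<close>
  from this[of "(2 * C + 1) / norm (br v' w)"] show ?thesis
    using order_trans[OF norm_ge_zero C0] by (cases "br v' w = 0") auto
qed

text \<open>
  The local inverse of \<open>P\<close> along a null homotopy of the loop \<open>P (s *\<^sub>R x)\<close> is a local cocycle. Its primitive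
  changes by \<open>x\<close> along the loop, equally along the two lateral sides of the square, and not at all along
  the fourth.
\<close>

lemma homotopy_period:
  fixes P :: "'e \<Rightarrow> 'g"
  assumes sc: "simply_connected (UNIV :: 'g set)"
    and P: "continuous_on UNIV P" "\<And>x y. P (x + y) = P x + P y"
    and \<rho>: "\<rho> > 0" "\<And>x. norm x < \<rho> \<Longrightarrow> P x = 0 \<Longrightarrow> x = 0"
    and op: "\<And>r. r > 0 \<Longrightarrow> \<exists>N. open N \<and> 0 \<in> N \<and> N \<subseteq> P ` ball 0 r"
    and x: "P x = 0"
  shows "x = 0"
proof -
  have P0: "P 0 = 0" using P(2)[of 0 0] by (metis add.right_neutral add_left_cancel)
  have Pneg: "P (- y) = - P y" for y using P(2)[of "- y" y] P0 by (simp add: eq_neg_iff_add_eq_0)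
  \<comment> \<open>Additivity of \<open>\<Lambda>\<close> compares three of its values, each of
    norm below \<open>r\<close>. Their combination stays under \<open>\<rho>\<close>, where
    \<open>P\<close> vanishes only at 0.\<close>
  define r where "r = \<rho> / 4"
  have r: "r > 0" "4 * r = \<rho>" using \<rho>(1) by (auto simp: r_def)
  obtain N where N: "open N" "0 \<in> N" "N \<subseteq> P ` ball 0 r" using op[OF r(1)] by blast
  define \<Lambda> where "\<Lambda> = (\<lambda>g. SOME y. norm y < r \<and> P y = g)"
  have \<Lambda>: "norm (\<Lambda> g) < r \<and> P (\<Lambda> g) = g" if "g \<in> N" for g
  proof -
    have "g \<in> P ` ball 0 r" using that N(3) by blast
    then have "\<exists>y. norm y < r \<and> P y = g" by auto
    then show ?thesis unfolding \<Lambda>_def by (rule someI_ex)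
  qed
  have inj: "y = z" if "P y = P z" "norm (y - z) < \<rho>" for y z
  proof -
    have "P (y - z) = 0" using P(2)[of y "- z"] that(1) by (simp add: Pneg)
    then show ?thesis using \<rho>(2)[OF that(2)] by simp
  qed
  have \<Lambda>_eq: "\<Lambda> (P y) = y" if "norm y < r" "P y \<in> N" for y
  proof (rule inj)
    show "P (\<Lambda> (P y)) = P y" using \<Lambda>[OF that(2)] by simp
    have "norm (\<Lambda> (P y) - y) \<le> norm (\<Lambda> (P y)) + norm y" by (rule norm_triangle_ineq4)
    then show "norm (\<Lambda> (P y) - y) < \<rho>" using \<Lambda>[OF that(2)] that(1) r by simp
  qed
  have \<Lambda>_add: "\<Lambda> (g + h) = \<Lambda> g + \<Lambda> h" if "g \<in> N" "h \<in> N" "g + h \<in> N" for g h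
  proof (rule inj)
    show "P (\<Lambda> (g + h)) = P (\<Lambda> g + \<Lambda> h)" using \<Lambda>[OF that(1)] \<Lambda>[OF that(2)] \<Lambda>[OF that(3)] by (simp add: P(2))
    have "norm (\<Lambda> (g + h) - (\<Lambda> g + \<Lambda> h)) \<le> norm (\<Lambda> (g + h)) + (norm (\<Lambda> g) + norm (\<Lambda> h))"
      by (intro order_trans[OF norm_triangle_ineq4] add_mono norm_triangle_ineq order_refl)
    then show "norm (\<Lambda> (g + h) - (\<Lambda> g + \<Lambda> h)) < \<rho>" using \<Lambda>[OF that(1)] \<Lambda>[OF that(2)] \<Lambda>[OF that(3)] r by simp
  qed
  let ?p = "\<lambda>s. P (s *\<^sub>R x)"
  have loop: "path ?p" "path (\<lambda>s::real. 0 :: 'g)"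
    unfolding path_def by (auto intro!: continuous_on_compose2[OF P(1)] continuous_intros)
  have "homotopic_loops UNIV ?p (\<lambda>s. 0)"
    using sc loop x P0 unfolding simply_connected_def by (simp add: pathfinish_def pathstart_def)
  then obtain h where h: "continuous_on ({0..1} \<times> {0..1}) h" "\<And>s. s \<in> {0..1} \<Longrightarrow> h (0::real, s::real) = P (s *\<^sub>R x)"
      "\<And>s. s \<in> {0..1} \<Longrightarrow> h (1, s) = 0" "\<And>t. t \<in> {0..1} \<Longrightarrow> h (t, 1) = h (t, 0)"
    unfolding homotopic_loops by (auto simp: pathfinish_def pathstart_def o_def)
  let ?K = "{0..1::real} \<times> {0..1::real}"
  have K: "compact ?K" by (intro compact_Times) auto
  obtain \<delta> where \<delta>: "\<delta> > 0" "\<And>p q. p \<in> ?K \<Longrightarrow> q \<in> ?K \<Longrightarrow> dist p q < \<delta> \<Longrightarrow> - h p + h q \<in> N"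
    using uniform_group_continuity[OF K h(1) N(1,2)] by blast
  define c where "c = (\<lambda>p q. \<Lambda> (- h p + h q))"
  obtain k \<eta> where k: "\<eta> > 0" "\<And>p q. p \<in> ?K \<Longrightarrow> q \<in> ?K \<Longrightarrow> dist p q < \<eta> \<Longrightarrow> k q - k p = c p q"
  proof (rule cocycle_primitive[of ?K \<delta> c])
    show "bounded ?K" by (rule compact_imp_bounded[OF K])
    show "t *\<^sub>R p \<in> ?K" if "p \<in> ?K" "0 \<le> t" "t \<le> 1" for p t
      using that by (cases p) (auto intro: mult_le_one)
    fix p q r assume pqr: "p \<in> ?K" "q \<in> ?K" "r \<in> ?K" "dist p q < \<delta>" "dist q r < \<delta>" "dist p r < \<delta>"
    have "(- h p + h q) + (- h q + h r) = - h p + h r" by (simp flip: add.assoc)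
    then show "c p r = c p q + c q r"
      unfolding c_def using \<Lambda>_add[OF \<delta>(2)[OF pqr(1,2,4)] \<delta>(2)[OF pqr(2,3,5)]] \<delta>(2)[OF pqr(1,3,6)] by simp
  qed (use \<delta> in auto)
  have "\<Lambda> 0 = 0" using \<Lambda>_eq[of 0] P0 N(2) r(1) by simp
  have A: "k (1, 0) = k (1, 1)"
  proof (rule locally_constant_01[OF k(1), of "\<lambda>s. k (1, s)"])
    fix s t :: real assume st: "s \<in> {0..1}" "t \<in> {0..1}" "\<bar>s - t\<bar> < \<eta>"
    have "k (1, t) - k (1, s) = c (1, s) (1, t)" by (rule k(2)) (use st in \<open>auto simp: dist_Pair_Pair dist_real_def\<close>)
    then show "k (1, s) = k (1, t)" using st by (simp add: c_def h \<open>\<Lambda> 0 = 0\<close>)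
  qed
  have B: "k (0, 1) - k (0, 0) = k (1, 1) - k (1, 0)"
  proof (rule locally_constant_01[OF k(1), of "\<lambda>t. k (t, 1) - k (t, 0)"])
    fix s t :: real assume st: "s \<in> {0..1}" "t \<in> {0..1}" "\<bar>s - t\<bar> < \<eta>"
    have "k (t, i) - k (s, i) = c (s, i) (t, i)" if "i \<in> {0..1}" for i
      by (rule k(2)) (use st that in \<open>auto simp: dist_Pair_Pair dist_real_def\<close>)
    from this[of 0] this[of 1] have "k (t, 1) - k (s, 1) = k (t, 0) - k (s, 0)"
      using st h(4) by (simp add: c_def)
    then show "k (s, 1) - k (s, 0) = k (t, 1) - k (t, 0)" by (simp add: algebra_simps)
  qed
  \<comment> \<open>The last bound makes \<open>(t - s) *\<^sub>R x\<close> shorter than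
    \<open>r\<close>, so that \<open>\<Lambda>\<close> recovers it from its image under
    \<open>P\<close>.\<close>
  define \<eta>' where "\<eta>' = min (min \<eta> \<delta>) (r / (norm x + 1))"
  have \<eta>': "\<eta>' > 0" using k(1) \<delta>(1) r(1) by (simp add: \<eta>'_def add_nonneg_pos)
  have C: "k (0, 0) - 0 *\<^sub>R x = k (0, 1) - 1 *\<^sub>R x"
  proof (rule locally_constant_01[OF \<eta>', of "\<lambda>s. k (0, s) - s *\<^sub>R x"])
    fix s t :: real assume st: "s \<in> {0..1}" "t \<in> {0..1}" "\<bar>s - t\<bar> < \<eta>'"
    have d: "dist (0::real, s) (0::real, t) < \<eta>" "dist (0::real, s) (0::real, t) < \<delta>" "\<bar>t - s\<bar> < r / (norm x + 1)"
      using st by (auto simp: dist_Pair_Pair dist_real_def \<eta>'_def)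
    have "k (0, t) - k (0, s) = c (0, s) (0, t)" by (rule k(2)) (use st d in auto)
    also have "\<dots> = \<Lambda> (P ((t - s) *\<^sub>R x))"
      using P(2)[of "- (s *\<^sub>R x)" "t *\<^sub>R x"] st by (simp add: c_def h Pneg algebra_simps)
    also have "\<dots> = (t - s) *\<^sub>R x"
    proof (rule \<Lambda>_eq)
      have "norm ((t - s) *\<^sub>R x) \<le> \<bar>t - s\<bar> * (norm x + 1)"
        unfolding norm_scaleR by (intro mult_left_mono) auto
      also have "\<dots> < r" using d(3) by (simp add: pos_less_divide_eq add_nonneg_pos)
      finally show "norm ((t - s) *\<^sub>R x) < r" .
      have "- h (0, s) + h (0, t) \<in> N" by (rule \<delta>(2)) (use st d in auto)
      then show "P ((t - s) *\<^sub>R x) \<in> N"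
        using P(2)[of "- (s *\<^sub>R x)" "t *\<^sub>R x"] st by (simp add: h Pneg algebra_simps)
    qed
    finally show "k (0, s) - s *\<^sub>R x = k (0, t) - t *\<^sub>R x" by (simp add: algebra_simps)
  qed
  from A B C show ?thesis by simp
qed

text \<open>
  A compact such group is commutative, and simple connectedness makes the canonical homomorphism from
  \<open>'e\<close> onto it a homeomorphism.
\<close>

lemma noncompact:
  assumes sc: "simply_connected (UNIV :: 'g set)" and st: "stratification A s V"
  shows "\<not> compact (UNIV :: 'g set)"
proof
  assume cpt: "compact (UNIV :: 'g set)"
  have br0: "br v' w = 0" for v' w
    by (rule stratification_abelian[OF st compact_br_0[OF cpt]])
  have "((\<lambda>t. Ad (ep v' t) w) has_vector_derivative 0) (at t)" for v' w t
    using Ad_ep_derivative[of v' w t] by (simp add: br0 linear_0[OF Ad_linear])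
  from constant_of_zero_derivative[OF this] have Ad_ep: "Ad (ep v' t) w = w" for v' w t
    by (simp add: one_param_0[OF ep])
  have ep_comm: "ep v' t + ep w \<tau> = ep w \<tau> + ep v' t" for v' w t \<tau>
  proof -
    have "tang (\<lambda>\<tau>. ep v' t + ep w \<tau> + - ep v' t) (\<lambda>h. Ad (ep v' t) (h *\<^sub>R w)) 0"
      by (rule tang_conj) (use ep[of w] in \<open>simp add: one_param_def\<close>)
    then have "one_param w (\<lambda>\<tau>. ep v' t + ep w \<tau> + - ep v' t)"
      unfolding one_param_def Ad_ep by (simp add: one_param_add[OF ep] add.assoc del: add_uminus_conv_diff)
    from one_param_unique[OF this ep] have "ep v' t + ep w \<tau> + - ep v' t + ep v' t = ep w \<tau> + ep v' t" by simp
    then show ?thesis by (simp add: add.assoc del: add_uminus_conv_diff)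
  qed
  obtain cs :: "'e list" where cs: "set cs = Basis" "distinct cs" using finite_distinct_list[OF finite_Basis] by blast
  define P where "P = flow_product (\<lambda>_. 0) (\<lambda>c. c) (\<lambda>c x. x \<bullet> c) cs"
  have bl: "bounded_linear (\<lambda>x. x \<bullet> c)" for c :: 'e by (rule bounded_linear_inner_left)
  have tP: "tang P (\<lambda>x. x) 0"
  proof -
    have "tang P (\<lambda>x. \<Sum>c\<leftarrow>cs. (x \<bullet> c) *\<^sub>R c) 0" unfolding P_def by (rule tang_flow_product[OF bl]) simp
    moreover have "(\<Sum>c\<leftarrow>cs. (x \<bullet> c) *\<^sub>R c) = x" for x
      using cs by (simp add: sum_list_distinct_conv_sum_set euclidean_representation)
    ultimately show ?thesis by simp
  qed
  have cP: "continuous_on UNIV P" unfolding P_def by (rule flow_product_cont[OF bl])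
  have op: "\<exists>N. open N \<and> 0 \<in> N \<and> N \<subseteq> P ` ball 0 r" if "r > 0" for r
    using tang_id_open[OF tP cP open_ball[of 0 r]] that by (metis centre_in_ball)
  obtain N where N: "open N" "0 \<in> N" "N \<subseteq> P ` ball 0 1" using op[of 1] by auto
  have generate: "H = UNIV" if H: "\<And>w t. ep w t \<in> H" "\<And>x y. x \<in> H \<Longrightarrow> y \<in> H \<Longrightarrow> x + y \<in> H" "\<And>x. x \<in> H \<Longrightarrow> - x \<in> H" for H
  proof (rule open_subgroup_UNIV[OF N(1,2) _ H(2,3)])
    have 0: "0 \<in> H" using H(1)[of 0 0] by (simp add: one_param_0[OF ep])
    have "flow_product (\<lambda>_. 0) (\<lambda>c. c) (\<lambda>c x. x \<bullet> c) ds x \<in> H" for ds x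
      by (induction ds) (auto simp: 0 intro!: H)
    then show "N \<subseteq> H" using N(3) unfolding P_def by blast
  qed
  \<comment> \<open>Two passes through \<open>generate\<close>: commuting with all exponentials is a
    subgroup property that the exponentials have, so every element has it; the exponentials are thus
    central, and being central is again a subgroup property.\<close>
  have 1: "{g. \<forall>w t. g + ep w t = ep w t + g} = UNIV"
  proof (rule generate)
    show "x + y \<in> {g. \<forall>w t. g + ep w t = ep w t + g}"
      if "x \<in> {g. \<forall>w t. g + ep w t = ep w t + g}" "y \<in> {g. \<forall>w t. g + ep w t = ep w t + g}" for x y
      using that commutes_add by blast
    show "- x \<in> {g. \<forall>w t. g + ep w t = ep w t + g}" if "x \<in> {g. \<forall>w t. g + ep w t = ep w t + g}" for x
      using that commutes_uminus by blast
  qed (simp add: ep_comm)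
  have 2: "{g::'g. \<forall>h. g + h = h + g} = UNIV"
  proof (rule generate)
    show "ep w t \<in> {g::'g. \<forall>h. g + h = h + g}" for w t
    proof -
      have "h \<in> {g. \<forall>w t. g + ep w t = ep w t + g}" for h by (simp add: 1)
      then show ?thesis by simp
    qed
    show "x + y \<in> {g::'g. \<forall>h. g + h = h + g}" if "x \<in> {g::'g. \<forall>h. g + h = h + g}" "y \<in> {g::'g. \<forall>h. g + h = h + g}" for x y
      using that commutes_add by blast
    show "- x \<in> {g::'g. \<forall>h. g + h = h + g}" if "x \<in> {g::'g. \<forall>h. g + h = h + g}" for x
      using that commutes_uminus by blast
  qed
  have comm: "g + h = h + g" for g h :: 'g
  proof -
    have "g \<in> {g::'g. \<forall>h. g + h = h + g}" by (simp add: 2)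
    then show ?thesis by simp
  qed
  have P_add: "P (x + y) = P x + P y" for x y
  proof -
    have "flow_product (\<lambda>_. 0) (\<lambda>c. c) (\<lambda>c x. x \<bullet> c) ds (x + y) =
      flow_product (\<lambda>_. 0) (\<lambda>c. c) (\<lambda>c x. x \<bullet> c) ds x + flow_product (\<lambda>_. 0) (\<lambda>c. c) (\<lambda>c x. x \<bullet> c) ds y" for ds
    proof (induction ds)
      case (Cons c ds)
      let ?p = "flow_product (\<lambda>_. 0) (\<lambda>c. c) (\<lambda>c x. x \<bullet> c) ds" and ?e = "\<lambda>x. ep c (x \<bullet> c)"
      have "?e (x + y) + ?p (x + y) = ?e x + ((?e y + ?p x) + ?p y)"
        by (simp add: Cons inner_add_left one_param_add[OF ep] add.assoc)
      also have "?e y + ?p x = ?p x + ?e y" by (rule comm)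
      finally show ?case by (simp add: add.assoc)
    qed simp
    then show ?thesis by (simp add: P_def)
  qed
  have P0: "P 0 = 0" using tP by (simp add: tang_def)
  have P_neg: "P (- y) = - P y" for y using P_add[of "- y" y] P0 by (simp add: eq_neg_iff_add_eq_0)
  have "range P = UNIV"
  proof (rule open_subgroup_UNIV[OF N(1,2)])
    show "x + y \<in> range P" if xy: "x \<in> range P" "y \<in> range P" for x y
    proof -
      obtain a b where "x = P a" "y = P b" using xy by blast
      then have "x + y = P (a + b)" by (simp add: P_add)
      then show ?thesis by blast
    qed
    show "- x \<in> range P" if x: "x \<in> range P" for x
    proof -
      obtain a where "x = P a" using x by blast
      then have "- x = P (- a)" by (simp add: P_neg)
      then show ?thesis by blast
    qed
  qed (use N in blast)
  have "\<exists>\<rho>>0. \<forall>x. norm x < \<rho> \<longrightarrow> P x = 0 \<longrightarrow> x = 0"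
  proof -
    have D: "\<forall>e>0. \<exists>d>0. \<forall>y. norm (y - 0) < d \<longrightarrow> norm (co (P y) - co (P 0) - (y - 0)) \<le> e * norm (y - 0)"
      using tang_derivative[OF tP] unfolding has_derivative_at_alt by (rule conjunct2)
    \<comment> \<open>The derivative at 0 is the identity, so a short vector \<open>y\<close> with
      \<open>P y = 0\<close> satisfies \<open>norm y \<le> 1 / 2 * norm y\<close>.\<close>
    have "\<exists>d>0. \<forall>y. norm y < d \<longrightarrow> norm (co (P y) - y) \<le> 1 / 2 * norm y"
      using D[rule_format, of "1 / 2"] P0 by simp
    then obtain d where d: "d > 0" "\<forall>y. norm y < d \<longrightarrow> norm (co (P y) - y) \<le> 1 / 2 * norm y" by blast
    have "x = 0" if "norm x < d" "P x = 0" for x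
      using d(2)[rule_format, OF that(1)] that(2) by simp
    then show ?thesis using d(1) by blast
  qed
  then obtain \<rho> where \<rho>: "\<rho> > 0" "\<And>x. norm x < \<rho> \<Longrightarrow> P x = 0 \<Longrightarrow> x = 0" by blast
  have injP: "x = y" if "P x = P y" for x y
  proof -
    have "P (x - y) = 0" using P_add[of x "- y"] that by (simp add: P_neg)
    from homotopy_period[OF sc cP P_add \<rho> op this] show ?thesis by simp
  qed
  have openP: "open (P ` ball 0 r)" for r
  proof (subst open_subopen, intro ballI)
    fix g assume "g \<in> P ` ball 0 r"
    then obtain x where x: "g = P x" "norm x < r" by auto
    obtain N where N: "open N" "0 \<in> N" "N \<subseteq> P ` ball 0 (r - norm x)" using op[of "r - norm x"] x by auto
    have "(\<lambda>y. - g + y) -` N \<subseteq> P ` ball 0 r"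
    proof
      fix y assume "y \<in> (\<lambda>y. - g + y) -` N"
      then obtain z where z: "- g + y = P z" "norm z < r - norm x" using N(3) by auto
      have "y = g + (- g + y)" by (simp flip: add.assoc)
      also have "\<dots> = P (x + z)" using z by (simp add: x P_add)
      finally show "y \<in> P ` ball 0 r" using z(2) norm_triangle_ineq[of x z] by (intro image_eqI[of _ _ "x + z"]) auto
    qed
    moreover have "open ((\<lambda>y. - g + y) -` N)" by (intro open_vimage N(1) continuous_intros)
    ultimately show "\<exists>T. open T \<and> g \<in> T \<and> T \<subseteq> P ` ball 0 r"
      using N(2) by (intro exI[of _ "(\<lambda>y. - g + y) -` N"]) auto
  qed
  \<comment> \<open>Injectivity of \<open>P\<close> pulls a finite subcover by images of balls back
    to a finite cover of the nonzero space \<open>'e\<close> by balls, which a long multiple of a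
    basis vector escapes.\<close>
  have "UNIV \<subseteq> (\<Union>m\<in>(UNIV::nat set). P ` ball 0 (real m))"
  proof
    fix g :: 'g
    obtain x where "g = P x" using \<open>range P = UNIV\<close> by blast
    moreover obtain m where "norm x < real m" using reals_Archimedean2 by blast
    then have "x \<in> ball 0 (real m)" by simp
    ultimately show "g \<in> (\<Union>m\<in>(UNIV::nat set). P ` ball 0 (real m))" by blast
  qed
  then obtain M where M: "finite M" "UNIV \<subseteq> (\<Union>m\<in>M. P ` ball 0 (real m))"
    using compactE_image[OF cpt, of UNIV "\<lambda>m. P ` ball 0 (real m)"] openP by (metis subset_UNIV)
  define m where "m = real (Max (insert 0 M))"
  obtain b :: 'e where b: "b \<in> Basis" using nonempty_Basis by blast
  obtain i where i: "i \<in> M" "P ((m + 1) *\<^sub>R b) \<in> P ` ball 0 (real i)" using M(2) by blast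
  then obtain y where y: "P ((m + 1) *\<^sub>R b) = P y" "y \<in> ball 0 (real i)" by blast
  have "norm ((m + 1) *\<^sub>R b) < real i" using y(2) unfolding injP[OF y(1)] by simp
  moreover have "real i \<le> m" unfolding m_def using i(1) M(1) by simp
  moreover have "m \<ge> 0" by (simp add: m_def)
  ultimately show False using b by simp
qed

end

section \<open>Mean oscillation and truncation\<close>

definition good_set :: "'g measure \<Rightarrow> 'g set \<Rightarrow> bool" where
  "good_set \<mu> S \<longleftrightarrow> S \<in> sets \<mu> \<and> emeasure \<mu> S \<noteq> \<infinity> \<and> 0 < measure \<mu> S"

lemma set_integrable_const_good: "good_set \<mu> S \<Longrightarrow> set_integrable \<mu> S (\<lambda>x. c)"
  unfolding good_set_def set_integrable_def
  by (rule integrable_scaleR_left, rule integrable_real_indicator) (auto simp: top.not_eq_extremum)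

lemma mean_osc_nonneg: "0 \<le> mean_osc \<mu> f S"
  unfolding mean_osc_def set_lebesgue_integral_def by (intro mult_nonneg_nonneg integral_nonneg) auto

lemma set_integral_const_good:
  fixes d :: "'d::{banach, second_countable_topology}"
  assumes "good_set \<mu> S"
  shows "(LINT x:S|\<mu>. d) = measure \<mu> S *\<^sub>R d"
  using assms unfolding set_lebesgue_integral_def good_set_def
  by (subst integral_scaleR_left) (auto simp: top.not_eq_extremum intro!: integrable_real_indicator)

text \<open>Replacing the average by an arbitrary constant \<open>c\<close> costs the distance
  between the two, which is at most the mean of \<open>norm (f x - c)\<close>; hence the factor 2.
  Most estimates below choose a convenient \<open>c\<close>.\<close>

lemma mean_osc_le:
  fixes f :: "'g \<Rightarrow> 'b::{banach, second_countable_topology}"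
  assumes S: "good_set \<mu> S" and f: "set_integrable \<mu> S f"
  shows "mean_osc \<mu> f S \<le> (2 / measure \<mu> S) * (LINT x:S|\<mu>. norm (f x - c))"
proof -
  have m: "measure \<mu> S > 0" using S by (simp add: good_set_def)
  note ci = set_integrable_const_good[OF S]
  have fi: "set_integrable \<mu> S (\<lambda>x. f x - d)" for d by (intro set_integral_diff f ci)
  have "set_average \<mu> f S - c = (1 / measure \<mu> S) *\<^sub>R (LINT x:S|\<mu>. f x - c)"
    using m by (simp add: set_average_def set_integral_diff(2)[OF f ci] set_integral_const_good[OF S] scaleR_diff_right)
  then have "norm (set_average \<mu> f S - c) = (1 / measure \<mu> S) * norm (LINT x:S|\<mu>. f x - c)"
    using m by simp
  also have "\<dots> \<le> (1 / measure \<mu> S) * (LINT x:S|\<mu>. norm (f x - c))"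
    using m by (intro mult_left_mono set_integral_norm_bound fi) auto
  finally have avg: "norm (set_average \<mu> f S - c) \<le> (1 / measure \<mu> S) * (LINT x:S|\<mu>. norm (f x - c))" .
  have "(LINT x:S|\<mu>. norm (f x - set_average \<mu> f S)) \<le> (LINT x:S|\<mu>. norm (f x - c) + norm (set_average \<mu> f S - c))"
  proof (rule set_integral_mono)
    show "norm (f x - set_average \<mu> f S) \<le> norm (f x - c) + norm (set_average \<mu> f S - c)" for x
      using norm_triangle_ineq4[of "f x - c" "set_average \<mu> f S - c"] by simp
  qed (intro set_integral_add(1) set_integrable_norm fi ci)+
  also have "\<dots> = (LINT x:S|\<mu>. norm (f x - c)) + measure \<mu> S * norm (set_average \<mu> f S - c)"
    by (simp add: set_integral_add(2)[OF set_integrable_norm[OF fi] ci] set_integral_const_good[OF S])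
  also have "\<dots> \<le> (LINT x:S|\<mu>. norm (f x - c)) + (LINT x:S|\<mu>. norm (f x - c))"
    using avg m by (simp add: field_simps)
  finally have "(LINT x:S|\<mu>. norm (f x - set_average \<mu> f S)) \<le> 2 * (LINT x:S|\<mu>. norm (f x - c))" by simp
  then have "(1 / measure \<mu> S) * (LINT x:S|\<mu>. norm (f x - set_average \<mu> f S)) \<le>
      (1 / measure \<mu> S) * (2 * (LINT x:S|\<mu>. norm (f x - c)))"
    using m by (intro mult_left_mono) auto
  then show ?thesis by (simp add: mean_osc_def)
qed

lemma mean_osc_le_osc:
  fixes f :: "'g \<Rightarrow> 'b::{banach, second_countable_topology}"
  assumes S: "good_set \<mu> S" and f: "set_integrable \<mu> S f"
    and osc: "\<And>x y. x \<in> S \<Longrightarrow> y \<in> S \<Longrightarrow> norm (f x - f y) \<le> \<epsilon>"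
  shows "mean_osc \<mu> f S \<le> 2 * \<epsilon>"
proof -
  have m: "measure \<mu> S > 0" using S by (simp add: good_set_def)
  obtain y where y: "y \<in> S" using m by (metis all_not_in_conv less_irrefl measure_empty)
  have "(LINT x:S|\<mu>. norm (f x - f y)) \<le> (LINT x:S|\<mu>. \<epsilon>)"
    by (rule set_integral_mono) (intro set_integrable_norm set_integral_diff f set_integrable_const_good[OF S] osc y | assumption)+
  also have "\<dots> = measure \<mu> S * \<epsilon>" by (simp add: set_integral_const_good[OF S])
  finally have "(2 / measure \<mu> S) * (LINT x:S|\<mu>. norm (f x - f y)) \<le> (2 / measure \<mu> S) * (measure \<mu> S * \<epsilon>)"
    using m by (intro mult_left_mono) auto
  with mean_osc_le[OF S f, of "f y"] show ?thesis using m by simp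
qed

lemma set_average_add:
  assumes "set_integrable \<mu> S f" "set_integrable \<mu> S g"
  shows "set_average \<mu> (\<lambda>x. f x + g x) S = set_average \<mu> f S + set_average \<mu> g S"
  by (simp add: set_average_def set_integral_add(2)[OF assms] scaleR_add_right)

lemma mean_osc_add:
  fixes f g :: "'g \<Rightarrow> 'b::{banach, second_countable_topology}"
  assumes S: "good_set \<mu> S" and f: "set_integrable \<mu> S f" and g: "set_integrable \<mu> S g"
  shows "mean_osc \<mu> (\<lambda>x. f x + g x) S \<le> mean_osc \<mu> f S + mean_osc \<mu> g S"
proof -
  have m: "measure \<mu> S > 0" using S by (simp add: good_set_def)
  let ?a = "set_average \<mu> f S" and ?b = "set_average \<mu> g S"
  have int: "set_integrable \<mu> S (\<lambda>x. norm (f x - ?a))" "set_integrable \<mu> S (\<lambda>x. norm (g x - ?b))"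
    by (intro set_integrable_norm set_integral_diff f g set_integrable_const_good[OF S])+
  have "(LINT x:S|\<mu>. norm (f x + g x - (?a + ?b))) \<le> (LINT x:S|\<mu>. norm (f x - ?a) + norm (g x - ?b))"
  proof (rule set_integral_mono)
    show "set_integrable \<mu> S (\<lambda>x. norm (f x + g x - (?a + ?b)))"
      by (intro set_integrable_norm set_integral_diff(1) set_integral_add(1) f g set_integrable_const_good[OF S])
    show "norm (f x + g x - (?a + ?b)) \<le> norm (f x - ?a) + norm (g x - ?b)" for x
      using norm_triangle_ineq[of "f x - ?a" "g x - ?b"] by (simp add: algebra_simps)
  qed (intro set_integral_add(1) int)
  also have "\<dots> = (LINT x:S|\<mu>. norm (f x - ?a)) + (LINT x:S|\<mu>. norm (g x - ?b))"
    by (rule set_integral_add(2)[OF int])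
  finally show ?thesis
    using m unfolding mean_osc_def set_average_add[OF f g] distrib_left[symmetric] by (intro mult_left_mono) auto
qed

lemma mean_osc_scaleR:
  fixes f :: "'g \<Rightarrow> 'b::{banach, second_countable_topology}"
  shows "mean_osc \<mu> (\<lambda>x. a *\<^sub>R f x) S = \<bar>a\<bar> * mean_osc \<mu> f S"
proof -
  have "set_average \<mu> (\<lambda>x. a *\<^sub>R f x) S = a *\<^sub>R set_average \<mu> f S"
    by (simp add: set_average_def)
  then show ?thesis by (simp add: mean_osc_def scaleR_diff_right[symmetric])
qed

lemma mean_osc_diff:
  fixes f g :: "'g \<Rightarrow> 'b::{banach, second_countable_topology}"
  assumes S: "good_set \<mu> S" and f: "set_integrable \<mu> S f" and g: "set_integrable \<mu> S g"
  shows "mean_osc \<mu> (\<lambda>x. f x - g x) S \<le> mean_osc \<mu> f S + mean_osc \<mu> g S"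
proof -
  have "set_integrable \<mu> S (\<lambda>x. (-1) *\<^sub>R g x)" using g by (intro set_integrable_scaleR_right) simp
  from mean_osc_add[OF S f this] show ?thesis by (simp only: mean_osc_scaleR) simp
qed

section \<open>Radial truncation of vector values\<close>

definition trunc :: "real \<Rightarrow> 'b::real_normed_vector \<Rightarrow> 'b" where
  "trunc h y = (if norm y \<le> h then y else (h / norm y) *\<^sub>R y)"

lemma norm_trunc: "0 \<le> h \<Longrightarrow> norm (trunc h y) \<le> h"
  by (auto simp: trunc_def)

text \<open>The retraction moves a point by the excess of its norm over \<open>h\<close>, and that
  excess is controlled by \<open>norm (y - z)\<close>. The constant is 2 because the argument uses
  the triangle inequality alone and no inner product.\<close>

lemma trunc_lipschitz:
  assumes h: "0 \<le> h"
  shows "norm (trunc h y - trunc h z) \<le> 2 * norm (y - z)"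
proof -
  have mixed: "norm (y - (h / norm z) *\<^sub>R z) \<le> 2 * norm (y - z)" if "norm y \<le> h" "h < norm z" for y z :: 'a
  proof -
    have z: "norm z > 0" using that h by linarith
    have "z - (h / norm z) *\<^sub>R z = (1 - h / norm z) *\<^sub>R z" by (simp add: scaleR_diff_left)
    then have "norm (z - (h / norm z) *\<^sub>R z) = \<bar>1 - h / norm z\<bar> * norm z" by simp
    also have "\<dots> = norm z - h" using that z by (simp add: abs_of_nonneg left_diff_distrib)
    finally have "norm (z - (h / norm z) *\<^sub>R z) \<le> norm z - norm y" using that by simp
    also have "\<dots> \<le> norm (y - z)" by (metis norm_minus_commute norm_triangle_ineq2)
    finally show ?thesis using norm_triangle_ineq[of "y - z" "z - (h / norm z) *\<^sub>R z"] by simp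
  qed
  show ?thesis
  proof (cases "norm y \<le> h"; cases "norm z \<le> h")
    assume "norm y \<le> h" "norm z \<le> h"
    then show ?thesis by (simp add: trunc_def)
  next
    assume "norm y \<le> h" "\<not> norm z \<le> h"
    then show ?thesis using mixed[of y z] by (simp add: trunc_def)
  next
    assume "\<not> norm y \<le> h" "norm z \<le> h"
    then show ?thesis using mixed[of z y] by (simp add: trunc_def norm_minus_commute)
  next
    assume *: "\<not> norm y \<le> h" "\<not> norm z \<le> h"
    then have p: "norm y > 0" "norm z > 0" "h < norm y" using h by linarith+
    have eq: "(h / norm y) *\<^sub>R y - (h / norm z) *\<^sub>R z = (h / norm y) *\<^sub>R (y - z) + (h / norm y - h / norm z) *\<^sub>R z"
      by (simp add: scaleR_diff_left scaleR_diff_right)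
    have "norm ((h / norm y - h / norm z) *\<^sub>R z) = \<bar>(h / norm y - h / norm z) * norm z\<bar>"
      by (simp add: abs_mult)
    also have "(h / norm y - h / norm z) * norm z = (h / norm y) * (norm z - norm y)"
      using p by (simp add: field_simps)
    also have "\<bar>\<dots>\<bar> \<le> 1 * norm (y - z)"
      unfolding abs_mult using p h by (intro mult_mono) (auto simp: norm_triangle_ineq3 norm_minus_commute[of y])
    finally have 1: "norm ((h / norm y - h / norm z) *\<^sub>R z) \<le> norm (y - z)" by simp
    have "norm ((h / norm y) *\<^sub>R (y - z)) \<le> 1 * norm (y - z)"
      unfolding norm_scaleR using p h by (intro mult_right_mono) auto
    with 1 have "norm ((h / norm y) *\<^sub>R y - (h / norm z) *\<^sub>R z) \<le> 2 * norm (y - z)"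
      unfolding eq using norm_triangle_ineq[of "(h / norm y) *\<^sub>R (y - z)" "(h / norm y - h / norm z) *\<^sub>R z"] by simp
    then show ?thesis using * by (simp add: trunc_def)
  qed
qed

lemma trunc_level:
  assumes "0 \<le> h" "0 \<le> h'"
  shows "norm (trunc h y - trunc h' y) \<le> \<bar>h - h'\<bar>"
proof -
  have *: "norm (trunc h y - trunc h' y) \<le> h' - h" if "0 \<le> h" "h \<le> h'" for h h'
  proof (cases "norm y \<le> h")
    case True
    then show ?thesis using that by (simp add: trunc_def)
  next
    case False
    then have p: "norm y > 0" using that by linarith
    define k where "k = min h' (norm y)"
    have t: "trunc h' y = (k / norm y) *\<^sub>R y" using p by (simp add: trunc_def k_def)
    have k: "h \<le> k" "k \<le> h'" using False that by (auto simp: k_def)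
    have "norm (trunc h y - trunc h' y) = \<bar>h / norm y - k / norm y\<bar> * norm y"
      using False unfolding t by (simp add: trunc_def scaleR_diff_left[symmetric])
    also have "\<dots> = \<bar>h - k\<bar>" using p by (simp add: diff_divide_distrib[symmetric])
    finally show ?thesis using k by simp
  qed
  show ?thesis
    using *[of h h'] *[of h' h] assms by (cases "h \<le> h'") (auto simp: norm_minus_commute)
qed

text \<open>Compare with the constant obtained by truncating the average of \<open>f\<close> at the
  average of \<open>h\<close>. The factor 2 of \<open>mean_osc_le\<close> meets the Lipschitz
  constant 2 in the value and 1 in the height, whence 4 and 2.\<close>

lemma mean_osc_trunc:
  fixes f :: "'g \<Rightarrow> 'b::{banach, second_countable_topology}" and h :: "'g \<Rightarrow> real"
  assumes S: "good_set \<mu> S" and f: "set_integrable \<mu> S f" and h: "set_integrable \<mu> S h" "\<And>x. 0 \<le> h x"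
    and fh: "set_integrable \<mu> S (\<lambda>x. trunc (h x) (f x))"
  shows "mean_osc \<mu> (\<lambda>x. trunc (h x) (f x)) S \<le> 4 * mean_osc \<mu> f S + 2 * mean_osc \<mu> h S"
proof -
  have m: "measure \<mu> S > 0" using S by (simp add: good_set_def)
  let ?a = "set_average \<mu> f S" and ?b = "set_average \<mu> h S"
  have b: "0 \<le> ?b"
    unfolding set_average_def set_lebesgue_integral_def by (intro scaleR_nonneg_nonneg integral_nonneg) (auto simp: h)
  have int: "set_integrable \<mu> S (\<lambda>x. norm (f x - ?a))" "set_integrable \<mu> S (\<lambda>x. norm (h x - ?b))"
    by (intro set_integrable_norm set_integral_diff f h set_integrable_const_good[OF S])+
  have int2: "set_integrable \<mu> S (\<lambda>x. 2 * norm (f x - ?a))" by (intro set_integrable_mult_right int)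
  have "(LINT x:S|\<mu>. norm (trunc (h x) (f x) - trunc ?b ?a)) \<le> (LINT x:S|\<mu>. 2 * norm (f x - ?a) + norm (h x - ?b))"
  proof (rule set_integral_mono)
    show "set_integrable \<mu> S (\<lambda>x. norm (trunc (h x) (f x) - trunc ?b ?a))"
      by (intro set_integrable_norm set_integral_diff(1) fh set_integrable_const_good[OF S])
    show "norm (trunc (h x) (f x) - trunc ?b ?a) \<le> 2 * norm (f x - ?a) + norm (h x - ?b)" for x
      using norm_triangle_ineq[of "trunc (h x) (f x) - trunc (h x) ?a" "trunc (h x) ?a - trunc ?b ?a"]
        trunc_lipschitz[OF h(2), of x "f x" ?a] trunc_level[OF h(2) b, of x ?a] by simp
  qed (intro set_integral_add(1) int2 int)
  also have "\<dots> = 2 * (LINT x:S|\<mu>. norm (f x - ?a)) + (LINT x:S|\<mu>. norm (h x - ?b))"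
    by (subst set_integral_add(2)[OF int2 int(2)]) simp
  finally have "(2 / measure \<mu> S) * (LINT x:S|\<mu>. norm (trunc (h x) (f x) - trunc ?b ?a)) \<le>
    (2 / measure \<mu> S) * (2 * (LINT x:S|\<mu>. norm (f x - ?a)) + (LINT x:S|\<mu>. norm (h x - ?b)))"
    using m by (intro mult_left_mono) auto
  then show ?thesis
    using mean_osc_le[OF S fh, of "trunc ?b ?a"] by (simp add: mean_osc_def distrib_left)
qed

section \<open>Vanishing mean oscillation and the gliding hump\<close>

locale carnot = horizontal A U0 \<phi> n X v
  for A :: "('g::{topological_group_add, t2_space, second_countable_topology}, 'e::euclidean_space) atlas"
    and U0 :: "'g set" and \<phi> :: "'g \<Rightarrow> 'e" and n :: nat and X :: "nat \<Rightarrow> 'g vfield" and v :: "nat \<Rightarrow> 'e" +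
  fixes \<mu> :: "'g measure"
  assumes haar: "haar_measure \<mu>" and not_compact: "\<not> compact (UNIV :: 'g set)"
begin

abbreviation dd :: "'g \<Rightarrow> 'g \<Rightarrow> real" where "dd \<equiv> cc_dist A n X"
abbreviation ball_at :: "'g \<Rightarrow> real \<Rightarrow> 'g set" where "ball_at \<equiv> dball dd"

lemma sets_mu [simp, measurable_cong]: "sets \<mu> = sets borel" using haar by (simp add: haar_measure_def)

lemma space_mu [simp]: "space \<mu> = UNIV" using sets_eq_imp_space_eq[OF sets_mu] by simp

lemma emeasure_left: "E \<in> sets borel \<Longrightarrow> emeasure \<mu> ((\<lambda>x. g + x) ` E) = emeasure \<mu> E"
  using haar by (simp add: haar_measure_def)

lemma emeasure_compact: "compact K \<Longrightarrow> emeasure \<mu> K < \<infinity>"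
  using haar by (simp add: haar_measure_def)

lemma ball_at_iff: "h \<in> ball_at g r \<longleftrightarrow> - g + h \<in> B r"
  by (simp add: dball_def cc_dist_less)

lemma ball_at_0: "ball_at 0 r = B r" using ball_at_iff[of _ 0 r] by auto

lemma ball_at_image: "ball_at g r = (\<lambda>x. g + x) ` B r"
proof -
  have "h \<in> (\<lambda>x. g + x) ` B r" if "- g + h \<in> B r" for h
    using that by (intro image_eqI[of _ _ "- g + h"]) (simp_all flip: add.assoc)
  moreover have "- g + (g + x) = x" for x by (simp flip: add.assoc)
  ultimately show ?thesis by (auto simp: ball_at_iff)
qed

lemma B_nonpos: "r \<le> 0 \<Longrightarrow> B r = {}" by (auto simp: B_def)

lemma dd_nonneg: "0 \<le> dd x y"
proof (rule ccontr)
  assume "\<not> 0 \<le> dd x y"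
  then have "- x + y \<in> B 0" by (simp add: cc_dist_less[symmetric])
  then show False by (simp add: B_nonpos)
qed

lemma dd_sym: "dd x y = dd y x"
proof -
  have "dd x y < r \<longleftrightarrow> dd y x < r" for r
  proof -
    have "- x + y \<in> B r \<longleftrightarrow> - y + x \<in> B r" for x y
      using B_uminus[of "- x + y" r] B_uminus[of "- y + x" r] by (auto simp: minus_add)
    then show ?thesis by (simp add: cc_dist_less)
  qed
  then show ?thesis by (meson less_irrefl linorder_neqE_linordered_idom)
qed

lemma dd_triangle: "dd x z \<le> dd x y + dd y z"
proof (rule field_le_epsilon)
  fix \<epsilon> :: real assume \<epsilon>: "\<epsilon> > 0"
  have "- x + y \<in> B (dd x y + \<epsilon> / 2)" "- y + z \<in> B (dd y z + \<epsilon> / 2)" using \<epsilon> by (auto simp: cc_dist_less[symmetric])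
  from B_add[OF this] have "(- x + y) + (- y + z) \<in> B (dd x y + dd y z + \<epsilon>)" by (simp add: algebra_simps)
  moreover have "(- x + y) + (- y + z) = - x + z" by (simp flip: add.assoc)
  ultimately have "dd x z < dd x y + dd y z + \<epsilon>" unfolding cc_dist_less by simp
  then show "dd x z \<le> dd x y + dd y z + \<epsilon>" by simp
qed

lemma dd_self [simp]: "dd x x = 0"
proof (rule antisym)
  show "dd x x \<le> 0"
  proof (rule field_le_epsilon)
    fix \<epsilon> :: real assume "\<epsilon> > 0"
    then show "dd x x \<le> 0 + \<epsilon>" using cc_dist_less[of x x \<epsilon>] B_0[of \<epsilon>] by simp
  qed
qed (rule dd_nonneg)

text \<open>Here local accessibility enters the metric side: \<open>B \<epsilon>\<close> contains a
  neighbourhood of the identity, and the triangle inequality turns this into continuity for the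
  manifold topology.\<close>

lemma dd_cont: "continuous_on UNIV (dd p)"
proof (rule continuous_at_imp_continuous_on, rule ballI)
  fix x
  show "isCont (dd p) x"
    unfolding isCont_def
  proof (rule tendstoI)
    fix \<epsilon> :: real assume \<epsilon>: "\<epsilon> > 0"
    obtain N where N: "open N" "0 \<in> N" "N \<subseteq> B \<epsilon>" using B_nbhd[OF \<epsilon>] by blast
    have "open ((\<lambda>y. - x + y) -` N)" by (intro open_vimage N(1) continuous_intros)
    then have "\<forall>\<^sub>F y in nhds x. y \<in> (\<lambda>y. - x + y) -` N" by (rule eventually_nhds_in_open) (simp add: N)
    then have "\<forall>\<^sub>F y in at x. y \<in> (\<lambda>y. - x + y) -` N" by (simp add: eventually_nhds_conv_at)
    then show "\<forall>\<^sub>F y in at x. dist (dd p y) (dd p x) < \<epsilon>"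
    proof (rule eventually_mono)
      fix y assume "y \<in> (\<lambda>y. - x + y) -` N"
      then have "dd x y < \<epsilon>" using N(3) by (auto simp: cc_dist_less)
      then show "dist (dd p y) (dd p x) < \<epsilon>"
        using dd_triangle[of p y x] dd_triangle[of p x y] dd_sym[of x y] by (simp add: dist_real_def)
    qed
  qed
qed

lemma ball_at_open: "open (ball_at g r)"
  unfolding dball_def by (intro open_Collect_less dd_cont continuous_intros)

lemma B_open: "open (B r)" using ball_at_open[of 0 r] by (simp add: ball_at_0)

lemma ball_at_sets [measurable]: "ball_at g r \<in> sets borel" and B_sets [measurable]: "B r \<in> sets borel"
  using ball_at_open B_open by auto

lemma emeasure_ball: "emeasure \<mu> (ball_at g r) = emeasure \<mu> (B r)"
  unfolding ball_at_image by (rule emeasure_left) simp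

lemma emeasure_B_finite: "emeasure \<mu> (B r) < \<infinity>"
proof -
  obtain K where K: "compact K" "B r \<subseteq> K" using B_compact by blast
  have "emeasure \<mu> (B r) \<le> emeasure \<mu> K" by (rule emeasure_mono[OF K(2)]) (simp add: borel_closed[OF compact_imp_closed[OF K(1)]])
  then show ?thesis using emeasure_compact[OF K(1)] by (rule le_less_trans)
qed

text \<open>By the Lindelof property countably many translates of \<open>N\<close> cover the group;
  were they null, so would the group be.\<close>

lemma emeasure_open_pos:
  assumes "open N" "0 \<in> N"
  shows "emeasure \<mu> N > 0"
proof (rule ccontr)
  assume "\<not> emeasure \<mu> N > 0"
  then have z: "emeasure \<mu> N = 0" by simp
  let ?T = "\<lambda>g. (\<lambda>x. g + x) ` N"
  have T: "?T g = (\<lambda>x. - g + x) -` N" for g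
  proof -
    have "h \<in> ?T g" if "- g + h \<in> N" for h using that by (intro image_eqI[of _ _ "- g + h"]) (simp_all flip: add.assoc)
    moreover have "- g + (g + x) = x" for x by (simp flip: add.assoc)
    ultimately show ?thesis by auto
  qed
  have op: "open (?T g)" for g unfolding T by (intro open_vimage assms(1) continuous_intros)
  obtain F where F: "F \<subseteq> range ?T" "countable F" "\<Union>F = \<Union>(range ?T)"
    using Lindelof[of "range ?T"] op by blast
  have "\<Union>(range ?T) = UNIV"
  proof -
    have "g \<in> ?T g" for g using assms(2) by (intro image_eqI[of _ _ 0]) auto
    then show ?thesis by blast
  qed
  then have U: "\<Union>F = UNIV" using F(3) by simp
  have "(\<Union>S\<in>F. S) \<in> null_sets \<mu>"
  proof (rule null_sets_UN'[OF F(2)])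
    fix S assume "S \<in> F"
    then obtain g where g: "S = ?T g" using F(1) by blast
    have "emeasure \<mu> (?T g) = 0" using emeasure_left[of N g] assms(1) z by simp
    then show "S \<in> null_sets \<mu>" unfolding g null_sets_def using op[of g] by (auto simp del: image_eqI)
  qed
  then have "emeasure \<mu> UNIV = 0" using U by (simp add: null_sets_def)
  then show False using haar by (simp add: haar_measure_def)
qed

lemma emeasure_B_pos: "r > 0 \<Longrightarrow> emeasure \<mu> (B r) > 0"
  using emeasure_open_pos[OF B_open B_0] .

lemma good_ball: "r > 0 \<Longrightarrow> good_set \<mu> (ball_at g r)"
  using emeasure_ball[of g r] emeasure_B_finite[of r] emeasure_B_pos[of r]
  by (auto simp: good_set_def measure_def enn2real_positive_iff)

lemma measure_ball: "measure \<mu> (ball_at g r) = measure \<mu> (B r)"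
  by (simp add: measure_def emeasure_ball)

lemma measure_B_pos: "r > 0 \<Longrightarrow> measure \<mu> (B r) > 0"
  using good_ball[of r 0] by (simp add: good_set_def ball_at_0)

lemma measure_B_mono: "r \<le> s \<Longrightarrow> measure \<mu> (B r) \<le> measure \<mu> (B s)"
  using emeasure_B_finite[of s] by (intro measure_mono_fmeasurable B_mono fmeasurableI) auto

lemma ball_compact: "\<exists>K. compact K \<and> ball_at g r \<subseteq> K"
proof -
  obtain K where K: "compact K" "B r \<subseteq> K" using B_compact by blast
  have "compact ((\<lambda>x. g + x) ` K)" by (intro compact_continuous_image K continuous_intros)
  then show ?thesis using K(2) unfolding ball_at_image by blast
qed

lemma li_ball: "locally_integrable \<mu> f \<Longrightarrow> set_integrable \<mu> (ball_at g r) f"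
  using ball_compact[of g r] unfolding locally_integrable_def
  by (metis ball_at_sets sets_mu set_integrable_subset)

text \<open>The distance from the identity attains every nonnegative value: a gap would disconnect
  the group, or else bound it and so make it compact. Unit balls centred at distances 0, 2, 4 and so
  on are disjoint and of equal volume.\<close>

lemma volume_unbounded: "\<exists>R>0. \<forall>r\<ge>R. measure \<mu> (B r) > C"
proof -
  have ex: "\<exists>x. dd 0 x = c" if c: "c \<ge> 0" for c
  proof (rule ccontr)
    assume no: "\<not> (\<exists>x. dd 0 x = c)"
    have "{x. dd 0 x < c} \<inter> UNIV = {} \<or> {x. c < dd 0 x} \<inter> UNIV = {}"
      by (rule connectedD[OF conn]) (use no in \<open>auto intro!: open_Collect_less dd_cont continuous_intros simp: less_linear\<close>, metis linorder_cases)
    moreover have "c \<noteq> 0" using no by (metis dd_self)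
    then have "0 \<in> {x. dd 0 x < c}" using c by simp
    ultimately have "{x. c < dd 0 x} = {}" by blast
    then have nl: "\<not> c < dd 0 h" for h by blast
    have "UNIV \<subseteq> B (c + 1)"
    proof
      fix h
      have "dd 0 h < c + 1" using nl[of h] by simp
      then show "h \<in> B (c + 1)" using cc_dist_less[of 0 h "c + 1"] by simp
    qed
    moreover obtain K where K: "compact K" "B (c + 1) \<subseteq> K" using B_compact by blast
    ultimately have "K = UNIV" by blast
    then show False using not_compact K(1) by simp
  qed
  obtain x where x: "\<And>i::nat. dd 0 (x i) = 2 * real i" using ex[of "2 * real _"] by (metis mult_nonneg_nonneg of_nat_0_le_iff zero_le_numeral)
  obtain M :: nat where M: "C / measure \<mu> (B 1) < real M" using reals_Archimedean2 by blast
  have m1: "measure \<mu> (B 1) > 0" by (rule measure_B_pos) simp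
  define R where "R = 2 * real M + 2"
  have "C < measure \<mu> (B r)" if r: "r \<ge> R" for r
  proof -
    have disj: "disjoint_family_on (\<lambda>i. ball_at (x i) 1) {..<M}"
      unfolding disjoint_family_on_def
    proof (intro ballI impI, rule ccontr)
      fix i j assume ij: "i \<noteq> j" "ball_at (x i) 1 \<inter> ball_at (x j) 1 \<noteq> {}"
      then obtain y where y: "dd (x i) y < 1" "dd (x j) y < 1" by (auto simp: dball_def)
      have "dd (x i) (x j) < 2" using dd_triangle[of "x i" "x j" y] y dd_sym[of y "x j"] by simp
      then have "\<bar>dd 0 (x i) - dd 0 (x j)\<bar> < 2"
        using dd_triangle[of 0 "x i" "x j"] dd_triangle[of 0 "x j" "x i"] dd_sym[of "x i" "x j"] by linarith
      then show False using ij(1) unfolding x by linarith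
    qed
    have fm: "ball_at (x i) 1 \<in> fmeasurable \<mu>" for i
      using emeasure_ball[of "x i" 1] emeasure_B_finite[of 1] by (intro fmeasurableI) auto
    have "real M * measure \<mu> (B 1) = (\<Sum>i<M. measure \<mu> (ball_at (x i) 1))" by (simp add: measure_ball)
    also have "\<dots> = measure \<mu> (\<Union>i<M. ball_at (x i) 1)"
      by (rule measure_finite_Union[symmetric]) (use disj emeasure_ball emeasure_B_finite[of 1] in auto)
    also have "\<dots> \<le> measure \<mu> (B r)"
    proof (rule measure_mono_fmeasurable)
      show "(\<Union>i<M. ball_at (x i) 1) \<subseteq> B r"
      proof (rule UN_least)
        fix i assume i: "i \<in> {..<M}"
        show "ball_at (x i) 1 \<subseteq> B r"
        proof
          fix y assume "y \<in> ball_at (x i) 1"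
          then have "dd 0 y < 2 * real i + 1" using dd_triangle[of 0 y "x i"] x[of i] by (simp add: dball_def)
          then have "dd 0 y < r" using i r by (simp add: R_def)
          then show "y \<in> B r" using cc_dist_less[of 0 y r] by simp
        qed
      qed
    qed (use emeasure_B_finite[of r] in \<open>auto intro!: fmeasurableI\<close>)
    finally show ?thesis using M m1 by (simp add: field_simps)
  qed
  then show ?thesis by (intro exI[of _ R]) (auto simp: R_def)
qed

section \<open>Continuous functions of compact support\<close>

lemma bounded_support_integrable:
  fixes u :: "'g \<Rightarrow> 'b::{banach, second_countable_topology}"
  assumes "u \<in> borel_measurable borel" "\<And>x. norm (u x) \<le> C" "compact K" "\<And>x. x \<notin> K \<Longrightarrow> u x = 0"
  shows "integrable \<mu> u"
proof (rule Bochner_Integration.integrable_bound)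
  have K: "K \<in> sets \<mu>" using assms(3) by (simp add: compact_imp_closed)
  then show "integrable \<mu> (\<lambda>x. indicator K x * C :: real)"
    using emeasure_compact[OF assms(3)] by (intro integrable_mult_left integrable_real_indicator) auto
  show "u \<in> borel_measurable \<mu>" using assms(1) by (simp cong: measurable_cong_sets)
  show "AE x in \<mu>. norm (u x) \<le> norm (indicator K x * C)"
    using assms(4) order_trans[OF assms(2) abs_ge_self] by (intro AE_I2) (auto simp: indicator_def)
qed

definition cc :: "('g \<Rightarrow> 'b::real_normed_vector) \<Rightarrow> bool" where
  "cc u \<longleftrightarrow> continuous_on UNIV u \<and> (\<exists>K. compact K \<and> (\<forall>x. x \<notin> K \<longrightarrow> u x = 0))"

lemma cc_bounded: "cc u \<Longrightarrow> \<exists>C>0. \<forall>x. norm (u x) \<le> C"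
proof -
  assume "cc u"
  then obtain K where K: "continuous_on UNIV u" "compact K" "\<And>x. x \<notin> K \<Longrightarrow> u x = 0" by (auto simp: cc_def)
  have "bounded (u ` K)" by (intro compact_imp_bounded compact_continuous_image K continuous_on_subset[OF K(1)]) simp
  then obtain C where C: "C > 0" "\<And>x. x \<in> K \<Longrightarrow> norm (u x) \<le> C" by (auto simp: bounded_pos)
  then have "norm (u x) \<le> C" for x using K(3)[of x] by (cases "x \<in> K") auto
  then show ?thesis using C by blast
qed

lemma cc_measurable: "cc u \<Longrightarrow> u \<in> borel_measurable borel"
  by (simp add: cc_def borel_measurable_continuous_onI)

lemma cc_integrable:
  fixes u :: "'g \<Rightarrow> 'b::{banach, second_countable_topology}"
  shows "cc u \<Longrightarrow> integrable \<mu> u"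
proof -
  assume u: "cc u"
  obtain C where "\<forall>x. norm (u x) \<le> C" using cc_bounded[OF u] by blast
  moreover obtain K where "compact K" "\<And>x. x \<notin> K \<Longrightarrow> u x = 0" using u by (auto simp: cc_def)
  ultimately show ?thesis using bounded_support_integrable[OF cc_measurable[OF u]] by blast
qed

lemma integrable_li: "integrable \<mu> f \<Longrightarrow> locally_integrable \<mu> f"
  unfolding locally_integrable_def set_integrable_def
  by (auto intro!: integrable_mult_indicator simp: compact_imp_closed)

lemma cc_uniform:
  fixes u :: "'g \<Rightarrow> 'b::real_normed_vector"
  assumes u: "cc u" and \<epsilon>: "\<epsilon> > 0"
  obtains N where "open N" "0 \<in> N" "\<And>x y. y \<in> N \<Longrightarrow> norm (u (x + y) - u x) < \<epsilon>"
proof -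
  obtain K where K: "compact K" "\<And>x. x \<notin> K \<Longrightarrow> u x = 0" and cont: "continuous_on UNIV u" using u by (auto simp: cc_def)
  obtain r K0 where K0: "r > 0" "B r \<subseteq> K0" "compact K0" using B_small[of UNIV] by auto
  \<comment> \<open>For \<open>y\<close> in \<open>K0\<close> and \<open>x\<close> outside
    \<open>K2\<close>, neither \<open>x\<close> nor \<open>x + y\<close> meets \<open>K\<close>. The
    tube lemma handles the points of the compact set \<open>K2\<close>.\<close>
  define K2 where "K2 = K \<union> (\<lambda>z. fst z + - snd z) ` (K \<times> K0)"
  have K2: "compact K2"
    unfolding K2_def by (intro compact_Un K compact_continuous_image compact_Times K0 continuous_on_add continuous_on_minus' continuous_on_fst continuous_on_snd continuous_on_id)
  let ?W = "{z. norm (u (snd z + fst z) - u (snd z)) < \<epsilon>}"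
  have "open ?W"
    by (intro open_Collect_less continuous_on_norm continuous_on_diff continuous_on_compose2[OF cont] continuous_on_add
        continuous_on_fst continuous_on_snd continuous_on_id continuous_on_const) auto
  moreover have "{0} \<times> K2 \<subseteq> ?W" using \<epsilon> by auto
  ultimately obtain N1 where N1: "0 \<in> N1" "open N1" "N1 \<times> K2 \<subseteq> ?W"
    using Elementary_Topology.tube_lemma[OF K2, of ?W 0] by blast
  show ?thesis
  proof (rule that[of "N1 \<inter> B r"])
    show "open (N1 \<inter> B r)" "0 \<in> N1 \<inter> B r" using N1 B_open B_0 K0(1) by auto
    fix x y assume y: "y \<in> N1 \<inter> B r"
    show "norm (u (x + y) - u x) < \<epsilon>"
    proof (cases "x \<in> K2")
      case True
      then have "(y, x) \<in> ?W" using y N1(3) by blast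
      then show ?thesis by simp
    next
      case False
      have "x + y \<notin> K"
      proof
        assume "x + y \<in> K"
        then have "(\<lambda>z. fst z + - snd z) (x + y, y) \<in> K2" using y K0(2) unfolding K2_def by blast
        then show False using False by (simp add: add.assoc del: add_uminus_conv_diff)
      qed
      moreover have "x \<notin> K" using False by (simp add: K2_def)
      ultimately show ?thesis using K(2) \<epsilon> by simp
    qed
  qed
qed

text \<open>One parameter for all three regimes of the theorem: small radius, large radius, distant
  centre. The pairs that are not far have centre and radius in a bounded range, with radius bounded
  away from 0.\<close>

definition far :: "real \<Rightarrow> 'g \<Rightarrow> real \<Rightarrow> bool" where
  "far R g r \<longleftrightarrow> r < 1 / R \<or> R < r \<or> R < dd 0 g"

lemma far_mono: "0 < R \<Longrightarrow> R \<le> R' \<Longrightarrow> far R' g r \<Longrightarrow> far R g r"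
proof -
  assume "0 < R" "R \<le> R'"
  then have "1 / R' \<le> 1 / R" by (simp add: frac_le)
  then show "far R' g r \<Longrightarrow> far R g r" using \<open>R \<le> R'\<close> by (auto simp: far_def)
qed

definition vanishing_osc :: "('g \<Rightarrow> 'b::{banach, second_countable_topology}) \<Rightarrow> bool" where
  "vanishing_osc f \<longleftrightarrow> (\<forall>\<epsilon>>0. \<exists>R>0. \<forall>g r. 0 < r \<longrightarrow> far R g r \<longrightarrow> mean_osc \<mu> f (ball_at g r) < \<epsilon>)"

text \<open>On small balls by uniform continuity, on large ones because the volume outgrows the
  integral of the norm, and on distant balls of moderate size because they miss the support.\<close>

lemma vanishing_osc_cc:
  fixes u :: "'g \<Rightarrow> 'b::{banach, second_countable_topology}"
  assumes u: "cc u"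
  shows "vanishing_osc u"
  unfolding vanishing_osc_def
proof (intro allI impI)
  fix \<epsilon> :: real assume \<epsilon>: "\<epsilon> > 0"
  have int: "set_integrable \<mu> (ball_at g r) u" for g r by (rule li_ball[OF integrable_li[OF cc_integrable[OF u]]])
  obtain N where N: "open N" "0 \<in> N" "\<And>x y. y \<in> N \<Longrightarrow> norm (u (x + y) - u x) < \<epsilon> / 8"
  proof (rule cc_uniform[OF u])
    show "0 < \<epsilon> / 8" using \<epsilon> by simp
  qed blast
  obtain r1 K1 where r1: "r1 > 0" "B r1 \<subseteq> K1" "K1 \<subseteq> N" by (rule B_small[OF N(1,2)])
  define I where "I = (LINT x|\<mu>. norm (u x))"
  have I: "I \<ge> 0" by (simp add: I_def)
  obtain R0 where R0: "R0 > 0" "\<And>r. r \<ge> R0 \<Longrightarrow> measure \<mu> (B r) > 2 * I / \<epsilon>" using volume_unbounded by blast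
  obtain K where K: "compact K" "\<And>x. x \<notin> K \<Longrightarrow> u x = 0" using u by (auto simp: cc_def)
  have "bounded (dd 0 ` K)" by (intro compact_imp_bounded compact_continuous_image K continuous_on_subset[OF dd_cont]) simp
  then obtain R1 where R1': "R1 > 0" "\<forall>x\<in>K. \<bar>dd 0 x\<bar> \<le> R1" by (auto simp: bounded_pos)
  then have R1: "R1 > 0" "\<And>x. x \<in> K \<Longrightarrow> dd 0 x \<le> R1" using abs_le_D1 by blast+
  \<comment> \<open>Radii below \<open>1 / R\<close> are below \<open>r1\<close>, and a ball of
    radius less than \<open>R0\<close> with centre beyond \<open>R0 + R1\<close> avoids the
    support.\<close>
  define R where "R = 1 / r1 + R0 + R1"
  have R: "R > 0" "1 / R \<le> r1" "R0 \<le> R" "R0 + R1 \<le> R"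
  proof -
    show "R > 0" using r1 R0 R1 by (simp add: R_def add_pos_pos)
    have "1 / r1 \<le> R" using R0 R1 by (simp add: R_def)
    then show "1 / R \<le> r1" using r1(1) \<open>R > 0\<close> by (simp add: field_simps)
  qed (use r1 R0 R1 in \<open>auto simp: R_def\<close>)
  show "\<exists>R>0. \<forall>g r. 0 < r \<longrightarrow> far R g r \<longrightarrow> mean_osc \<mu> u (ball_at g r) < \<epsilon>"
  proof (intro exI[of _ R] conjI allI impI R(1))
    fix g r assume r: "0 < r" and far: "far R g r"
    note S = good_ball[OF r, of g]
    have large: "mean_osc \<mu> u (ball_at g r) < \<epsilon>" if "R0 \<le> r"
    proof -
      have m: "measure \<mu> (ball_at g r) > 2 * I / \<epsilon>" "measure \<mu> (ball_at g r) > 0"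
        using R0(2)[OF that] measure_B_pos[OF r] by (auto simp: measure_ball)
      have "(LINT x:ball_at g r|\<mu>. norm (u x - 0)) \<le> I"
        unfolding I_def set_lebesgue_integral_def
      proof (rule integral_mono)
        show "integrable \<mu> (\<lambda>x. indicator (ball_at g r) x *\<^sub>R norm (u x - 0))"
          using set_integrable_norm[OF int[of g r]] by (simp add: set_integrable_def)
        show "integrable \<mu> (\<lambda>x. norm (u x))" by (rule integrable_norm[OF cc_integrable[OF u]])
      qed (simp add: indicator_def)
      then have "(2 / measure \<mu> (ball_at g r)) * (LINT x:ball_at g r|\<mu>. norm (u x - 0)) \<le> (2 / measure \<mu> (ball_at g r)) * I"
        using m by (intro mult_left_mono) auto
      also have "\<dots> < \<epsilon>" using m \<epsilon> by (simp add: field_simps)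
      finally show ?thesis using mean_osc_le[OF S int, of 0] by simp
    qed
    have "r < 1 / R \<or> R0 \<le> r \<or> (r < R0 \<and> R < dd 0 g)" using far R(3) unfolding far_def by linarith
    then consider "r < 1 / R" | "R0 \<le> r" | "r < R0" "R < dd 0 g" by blast
    then show "mean_osc \<mu> u (ball_at g r) < \<epsilon>"
    proof cases
      case 1
      have near: "norm (u x - u g) < \<epsilon> / 8" if "x \<in> ball_at g r" for x
      proof -
        have "- g + x \<in> B r1" using that 1 R(2) B_mono[of r r1] by (auto simp: ball_at_iff)
        then have "norm (u (g + (- g + x)) - u g) < \<epsilon> / 8" using r1 by (intro N(3)) auto
        then show ?thesis by (simp flip: add.assoc)
      qed
      have "mean_osc \<mu> u (ball_at g r) \<le> 2 * (\<epsilon> / 4)"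
      proof (rule mean_osc_le_osc[OF S int])
        fix x y assume "x \<in> ball_at g r" "y \<in> ball_at g r"
        then show "norm (u x - u y) \<le> \<epsilon> / 4" using near[of x] near[of y] norm_triangle_ineq4[of "u x - u g" "u y - u g"] by simp
      qed
      then show ?thesis using \<epsilon> by simp
    next
      case 3
      have z: "u x = 0" if "x \<in> ball_at g r" for x
      proof (rule K(2), rule notI)
        assume "x \<in> K"
        then have "dd 0 g < R1 + r" using R1(2)[of x] dd_triangle[of 0 g x] dd_sym[of x g] that by (simp add: dball_def)
        then show False using 3 R by linarith
      qed
      have "mean_osc \<mu> u (ball_at g r) \<le> 2 * 0"
        by (rule mean_osc_le_osc[OF S int]) (simp add: z)
      then show ?thesis using \<epsilon> by simp
    qed (rule large)
  qed
qed

section \<open>Cutoffs and plateaus\<close>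

definition cutoff :: "real \<Rightarrow> 'g \<Rightarrow> real" where
  "cutoff R x = max 0 (min 1 (2 - dd 0 x / R))"

lemma cutoff_cc: assumes "R > 0" shows "cc (cutoff R)"
proof -
  have "continuous_on UNIV (cutoff R)"
    unfolding cutoff_def by (intro continuous_intros dd_cont) (use assms in auto)
  moreover obtain K where K: "compact K" "B (2 * R) \<subseteq> K" using B_compact by blast
  moreover have "cutoff R x = 0" if "x \<notin> K" for x
  proof -
    have "\<not> dd 0 x < 2 * R" using that K(2) cc_dist_less[of 0 x "2 * R"] by auto
    then show ?thesis using assms by (simp add: cutoff_def field_simps)
  qed
  ultimately show ?thesis unfolding cc_def by blast
qed

lemma cutoff_range: "0 \<le> cutoff R x" "cutoff R x \<le> 1" by (auto simp: cutoff_def)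

lemma cutoff_eq_1: "R > 0 \<Longrightarrow> x \<in> B R \<Longrightarrow> cutoff R x = 1"
  using cc_dist_less[of 0 x R] by (simp add: cutoff_def field_simps)

lemma cutoff_lipschitz: assumes "R > 0" shows "\<bar>cutoff R x - cutoff R y\<bar> \<le> dd x y / R"
proof -
  have "\<bar>cutoff R x - cutoff R y\<bar> \<le> \<bar>dd 0 x / R - dd 0 y / R\<bar>" by (auto simp: cutoff_def max_def min_def)
  also have "\<dots> = \<bar>dd 0 x - dd 0 y\<bar> / R" using assms by (simp add: diff_divide_distrib[symmetric])
  also have "\<dots> \<le> dd x y / R"
    using dd_triangle[of 0 x y] dd_triangle[of 0 y x] dd_sym[of x y] assms by (intro divide_right_mono) auto
  finally show ?thesis .
qed

lemma cc_0: "cc (\<lambda>x. 0)" by (auto simp: cc_def intro!: exI[of _ "{}"])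

lemma cc_add: "cc u \<Longrightarrow> cc w \<Longrightarrow> cc (\<lambda>x. u x + w x)"
proof -
  assume "cc u" "cc w"
  then obtain K K' where K: "compact K" "\<And>x. x \<notin> K \<Longrightarrow> u x = 0" "compact K'" "\<And>x. x \<notin> K' \<Longrightarrow> w x = 0"
    and c: "continuous_on UNIV u" "continuous_on UNIV w" by (auto simp: cc_def)
  then show ?thesis unfolding cc_def
    by (intro conjI exI[of _ "K \<union> K'"] continuous_on_add compact_Un) auto
qed

text \<open>
  Summing cutoffs at very lacunary scales gives plateaus of arbitrary height and bounded oscillation:
  a ball only sees the cutoff whose scale matches its radius.
\<close>

lemma plateau:
  assumes \<delta>: "\<delta> > 0" and R0: "R0 > 0"
  shows "\<exists>h R. cc h \<and> (\<forall>x. 0 \<le> h x) \<and> (\<forall>x\<in>B R0. h x = real m) \<and> R > 0 \<and>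
     (\<forall>g r. 0 < r \<longrightarrow> mean_osc \<mu> h (ball_at g r) \<le> 2 + \<delta> * real m) \<and>
     (\<forall>g r. R < r \<longrightarrow> mean_osc \<mu> h (ball_at g r) \<le> \<delta> * real m)"
proof (induction m)
  case 0
  have "mean_osc \<mu> (\<lambda>x. 0 :: real) S = 0" for S by (simp add: mean_osc_def set_average_def set_lebesgue_integral_def)
  then show ?case by (intro exI[of _ "\<lambda>x. 0"] exI[of _ 1]) (auto simp: cc_0)
next
  case (Suc m)
  then obtain h R where h: "cc h" "\<forall>x. 0 \<le> h x" "\<forall>x\<in>B R0. h x = real m" "R > 0"
     "\<And>g r. 0 < r \<Longrightarrow> mean_osc \<mu> h (ball_at g r) \<le> 2 + \<delta> * real m"
     "\<And>g r. R < r \<Longrightarrow> mean_osc \<mu> h (ball_at g r) \<le> \<delta> * real m" by blast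
  \<comment> \<open>On a ball of radius at most \<open>R\<close> the new cutoff varies by at most
    \<open>2 * R / T\<close>, so its mean oscillation is at most \<open>4 * R / T\<close>, hence at
    most \<open>\<delta>\<close>. The bound \<open>R0 \<le> T\<close> makes it equal to 1 on
    \<open>B R0\<close>.\<close>
  define T where "T = max R0 (4 * R / \<delta>)"
  have T: "T > 0" "R0 \<le> T" "4 * R / T \<le> \<delta>"
  proof -
    show "T > 0" using R0 by (simp add: T_def)
    have "4 * R / \<delta> \<le> T" by (simp add: T_def)
    then show "4 * R / T \<le> \<delta>" using \<delta> \<open>T > 0\<close> by (simp add: field_simps)
  qed (simp add: T_def)
  note \<eta> = cutoff_cc[OF T(1)]
  have inth: "set_integrable \<mu> (ball_at g r) h" and int\<eta>: "set_integrable \<mu> (ball_at g r) (cutoff T)" for g r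
    using h(1) \<eta> by (auto intro!: li_ball integrable_li cc_integrable)
  have small: "mean_osc \<mu> (cutoff T) (ball_at g r) \<le> \<delta>" if r: "0 < r" "r \<le> R" for g r
  proof -
    have "mean_osc \<mu> (cutoff T) (ball_at g r) \<le> 2 * (2 * r / T)"
    proof (rule mean_osc_le_osc[OF good_ball[OF r(1)] int\<eta>])
      fix x y assume "x \<in> ball_at g r" "y \<in> ball_at g r"
      then have "dd x y \<le> 2 * r" using dd_triangle[of x y g] dd_sym[of x g] by (simp add: dball_def)
      then have "dd x y / T \<le> 2 * r / T" using T(1) by (intro divide_right_mono) auto
      then show "norm (cutoff T x - cutoff T y) \<le> 2 * r / T" using cutoff_lipschitz[OF T(1), of x y] by simp
    qed
    also have "2 * (2 * r / T) \<le> 4 * R / T" using r T(1) by (simp add: divide_right_mono)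
    finally show ?thesis using T(3) by simp
  qed
  have two: "mean_osc \<mu> (cutoff T) (ball_at g r) \<le> 2 * 1" if "0 < r" for g r
    by (rule mean_osc_le_osc[OF good_ball[OF that] int\<eta>])
      (use cutoff_range[of T] in \<open>auto simp: abs_le_iff intro: order_trans[OF diff_mono[of _ 1 0]] add_increasing\<close>)
  obtain R1 where R1: "R1 > 0" "\<And>g r. 0 < r \<Longrightarrow> far R1 g r \<Longrightarrow> mean_osc \<mu> (cutoff T) (ball_at g r) < \<delta>"
    using vanishing_osc_cc[OF \<eta>] \<delta> unfolding vanishing_osc_def by blast
  let ?h = "\<lambda>x. h x + cutoff T x"
  have add: "mean_osc \<mu> ?h (ball_at g r) \<le> mean_osc \<mu> h (ball_at g r) + mean_osc \<mu> (cutoff T) (ball_at g r)" if "0 < r" for g r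
    by (rule mean_osc_add[OF good_ball[OF that] inth int\<eta>])
  show ?case
  proof (intro exI[of _ ?h] exI[of _ "max R R1"] conjI allI impI ballI)
    show "cc ?h" by (rule cc_add[OF h(1) \<eta>])
    show "0 \<le> ?h x" for x using h(2) cutoff_range(1)[of T x] by (simp add: add_nonneg_nonneg)
    show "?h x = real (Suc m)" if "x \<in> B R0" for x
      using that h(3) cutoff_eq_1[OF T(1), of x] B_mono[OF T(2)] by auto
    show "max R R1 > 0" using h(4) by simp
    show "mean_osc \<mu> ?h (ball_at g r) \<le> 2 + \<delta> * real (Suc m)" if "0 < r" for g r
    proof (cases "r \<le> R")
      case True
      then show ?thesis using add[OF that, of g] h(5)[OF that, of g] small[OF that, of g] by (simp add: algebra_simps)
    next
      case False
      then show ?thesis using add[OF that, of g] h(6)[of r g] two[OF that, of g] \<delta> by (simp add: algebra_simps)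
    qed
    show "mean_osc \<mu> ?h (ball_at g r) \<le> \<delta> * real (Suc m)" if "max R R1 < r" for g r
    proof -
      have r: "0 < r" "R < r" "far R1 g r" using that h(4) by (auto simp: far_def)
      then show ?thesis using add[OF r(1), of g] h(6)[OF r(2), of g] R1(2)[OF r(1,3)] by (simp add: algebra_simps)
    qed
  qed
qed

text \<open>
  On each ball at most one of the summands has an oscillation that is not small.
\<close>

lemma gliding_hump:
  fixes f :: "'g \<Rightarrow> 'b::{banach, second_countable_topology}" and F :: "nat \<Rightarrow> 'g \<Rightarrow> 'b"
  assumes f: "locally_integrable \<mu> f" "vanishing_osc f" and cc: "\<And>k. cc (F k)"
    and C: "\<And>k g r. 0 < r \<Longrightarrow> mean_osc \<mu> (\<lambda>x. f x - F k x) (ball_at g r) \<le> C"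
    and lim: "\<And>R. (\<lambda>k. LINT x:B R|\<mu>. norm (f x - F k x)) \<longlonglongrightarrow> 0"
    and \<epsilon>: "\<epsilon> > 0"
  shows "\<exists>\<kappa> R. R > 0 \<and> (\<forall>g r. 0 < r \<longrightarrow> mean_osc \<mu> (\<lambda>x. \<Sum>i<N. f x - F (\<kappa> i) x) (ball_at g r) \<le> C + 2 * \<epsilon> * real N) \<and>
     (\<forall>g r. 0 < r \<longrightarrow> far R g r \<longrightarrow> mean_osc \<mu> (\<lambda>x. \<Sum>i<N. f x - F (\<kappa> i) x) (ball_at g r) \<le> 2 * \<epsilon> * real N)"
proof (induction N)
  case 0
  have "C \<ge> 0" using order_trans[OF mean_osc_nonneg C[of 1]] by simp
  moreover have "mean_osc \<mu> (\<lambda>x. 0 :: 'b) S = 0" for S by (simp add: mean_osc_def set_average_def set_lebesgue_integral_def)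
  ultimately show ?case by (intro exI[of _ id] exI[of _ 1]) auto
next
  case (Suc N)
  then obtain \<kappa> R where R: "R > 0"
    "\<And>g r. 0 < r \<Longrightarrow> mean_osc \<mu> (\<lambda>x. \<Sum>i<N. f x - F (\<kappa> i) x) (ball_at g r) \<le> C + 2 * \<epsilon> * real N"
    "\<And>g r. 0 < r \<Longrightarrow> far R g r \<Longrightarrow> mean_osc \<mu> (\<lambda>x. \<Sum>i<N. f x - F (\<kappa> i) x) (ball_at g r) \<le> 2 * \<epsilon> * real N" by blast
  have fi: "set_integrable \<mu> (ball_at g r) f" for g r by (rule li_ball[OF f(1)])
  have Fi: "set_integrable \<mu> (ball_at g r) (F k)" for g r k by (rule li_ball[OF integrable_li[OF cc_integrable[OF cc]]])
  have Di: "set_integrable \<mu> (ball_at g r) (\<lambda>x. f x - F k x)" for g r k by (intro set_integral_diff fi Fi)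
  have Si: "set_integrable \<mu> (ball_at g r) (\<lambda>x. \<Sum>i<N. f x - F (\<kappa> i) x)" for g r
    using Di unfolding set_integrable_def scaleR_sum_right by (intro Bochner_Integration.integrable_sum)
  \<comment> \<open>Balls that are not far have at least this volume and lie in
    \<open>B (2 * R + 1)\<close>. An \<open>L\<^sup>1\<close> distance below
    \<open>\<epsilon> * m / 2\<close> there bounds the mean oscillation by
    \<open>\<epsilon>\<close>, given the factor 2 of \<open>mean_osc_le\<close>.\<close>
  define m where "m = measure \<mu> (B (1 / R))"
  have m: "m > 0" unfolding m_def by (rule measure_B_pos) (use R(1) in simp)
  have "\<forall>\<^sub>F k in sequentially. (LINT x:B (2 * R + 1)|\<mu>. norm (f x - F k x)) < \<epsilon> * m / 2"
    by (rule order_tendstoD(2)[OF lim]) (use m \<epsilon> in simp)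
  then obtain k where k: "(LINT x:B (2 * R + 1)|\<mu>. norm (f x - F k x)) < \<epsilon> * m / 2"
    by (auto simp: eventually_sequentially)
  have near: "mean_osc \<mu> (\<lambda>x. f x - F k x) (ball_at g r) \<le> \<epsilon>" if r: "0 < r" and nf: "\<not> far R g r" for g r
  proof -
    have rR: "1 / R \<le> r" "r \<le> R" "dd 0 g \<le> R" using nf by (auto simp: far_def)
    have sub: "ball_at g r \<subseteq> B (2 * R + 1)"
    proof
      fix x assume "x \<in> ball_at g r"
      then have "dd 0 x < 2 * R + 1" using dd_triangle[of 0 x g] rR by (simp add: dball_def)
      then show "x \<in> B (2 * R + 1)" using cc_dist_less[of 0 x] by simp
    qed
    have M: "m \<le> measure \<mu> (ball_at g r)" unfolding m_def measure_ball by (rule measure_B_mono[OF rR(1)])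
    have "(LINT x:ball_at g r|\<mu>. norm (f x - F k x - 0)) \<le> (LINT x:B (2 * R + 1)|\<mu>. norm (f x - F k x))"
      unfolding set_lebesgue_integral_def
    proof (rule integral_mono)
      show "integrable \<mu> (\<lambda>x. indicator (ball_at g r) x *\<^sub>R norm (f x - F k x - 0))"
        using set_integrable_norm[OF Di[of g r k]] by (simp add: set_integrable_def)
      show "integrable \<mu> (\<lambda>x. indicator (B (2 * R + 1)) x *\<^sub>R norm (f x - F k x))"
        using set_integrable_norm[OF Di[of 0 "2 * R + 1" k]] by (simp add: set_integrable_def ball_at_0)
    qed (use sub in \<open>auto simp: indicator_def\<close>)
    then have "(LINT x:ball_at g r|\<mu>. norm (f x - F k x - 0)) \<le> \<epsilon> * m / 2" using k by simp
    then have "(2 / measure \<mu> (ball_at g r)) * (LINT x:ball_at g r|\<mu>. norm (f x - F k x - 0)) \<le> (2 / measure \<mu> (ball_at g r)) * (\<epsilon> * m / 2)"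
      by (intro mult_left_mono) auto
    also have "\<dots> = \<epsilon> * (m / measure \<mu> (ball_at g r))" by simp
    also have "\<dots> \<le> \<epsilon> * 1" using M m \<epsilon> by (intro mult_left_mono) auto
    finally show ?thesis using mean_osc_le[OF good_ball[OF r] Di[of g r k], of 0] by simp
  qed
  obtain R1 where R1: "R1 > 0" "\<And>g r. 0 < r \<Longrightarrow> far R1 g r \<Longrightarrow> mean_osc \<mu> f (ball_at g r) < \<epsilon>"
    using f(2) \<epsilon> unfolding vanishing_osc_def by blast
  obtain R2 where R2: "R2 > 0" "\<And>g r. 0 < r \<Longrightarrow> far R2 g r \<Longrightarrow> mean_osc \<mu> (F k) (ball_at g r) < \<epsilon>"
    using vanishing_osc_cc[OF cc[of k]] \<epsilon> unfolding vanishing_osc_def by blast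
  \<comment> \<open>Beyond \<open>R'\<close> the new difference is estimated as \<open>f\<close>
    minus \<open>F k\<close>, both of oscillation below \<open>\<epsilon>\<close>; this accounts for
    the \<open>2 * \<epsilon>\<close> per step. Only balls between \<open>R\<close> and
    \<open>R'\<close> use the bound \<open>C\<close>, and the earlier differences are small
    there.\<close>
  define R' where "R' = max R (max R1 R2)"
  have R': "R \<le> R'" "R1 \<le> R'" "R2 \<le> R'" by (auto simp: R'_def)
  define \<kappa>' where "\<kappa>' = \<kappa>(N := k)"
  have sum: "(\<lambda>x. \<Sum>i<Suc N. f x - F (\<kappa>' i) x) = (\<lambda>x. (\<Sum>i<N. f x - F (\<kappa> i) x) + (f x - F k x))"
    by (simp add: \<kappa>'_def)
  have add: "mean_osc \<mu> (\<lambda>x. \<Sum>i<Suc N. f x - F (\<kappa>' i) x) (ball_at g r) \<le>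
     mean_osc \<mu> (\<lambda>x. \<Sum>i<N. f x - F (\<kappa> i) x) (ball_at g r) + mean_osc \<mu> (\<lambda>x. f x - F k x) (ball_at g r)" if "0 < r" for g r
    unfolding sum by (rule mean_osc_add[OF good_ball[OF that] Si Di])
  show ?case
  proof (intro exI[of _ \<kappa>'] exI[of _ R'] conjI allI impI)
    show "R' > 0" using R(1) R'(1) by simp
    show "mean_osc \<mu> (\<lambda>x. \<Sum>i<Suc N. f x - F (\<kappa>' i) x) (ball_at g r) \<le> C + 2 * \<epsilon> * real (Suc N)" if r: "0 < r" for g r
    proof (cases "far R g r")
      case True
      then show ?thesis using add[OF r, of g] R(3)[OF r True] C[OF r, of k g] \<epsilon> by (simp add: algebra_simps)
    next
      case False
      then show ?thesis using add[OF r, of g] R(2)[OF r, of g] near[OF r False] \<epsilon> by (simp add: algebra_simps)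
    qed
    show "mean_osc \<mu> (\<lambda>x. \<Sum>i<Suc N. f x - F (\<kappa>' i) x) (ball_at g r) \<le> 2 * \<epsilon> * real (Suc N)" if r: "0 < r" "far R' g r" for g r
    proof -
      note fs = far_mono[OF R(1) R'(1) r(2)] far_mono[OF R1(1) R'(2) r(2)] far_mono[OF R2(1) R'(3) r(2)]
      have "mean_osc \<mu> (\<lambda>x. f x - F k x) (ball_at g r) \<le> \<epsilon> + \<epsilon>"
        using mean_osc_diff[OF good_ball[OF r(1)] fi Fi[of g r k]] R1(2)[OF r(1) fs(2)] R2(2)[OF r(1) fs(3)] by simp
      then show ?thesis using add[OF r(1), of g] R(3)[OF r(1) fs(1)] by (simp add: algebra_simps)
    qed
  qed
qed

section \<open>Mollification\<close>

lemma borel_mu [simp]: "borel_measurable \<mu> = borel_measurable borel"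
  by (rule measurable_cong_sets) simp_all

text \<open>
  Smoothness is required jointly in both variables, so that differentiation under the integral is uniform
  for \<open>z\<close> in a compact set.
\<close>

definition chart_smooth :: "'a::euclidean_space set \<Rightarrow> ('a \<Rightarrow> 'g \<Rightarrow> real) \<Rightarrow> bool" where
  "chart_smooth S q \<longleftrightarrow> (\<forall>(Z, \<zeta>)\<in>A. smooth_on (S \<times> \<zeta> ` Z) (\<lambda>p. q (fst p) (inv_into Z \<zeta> (snd p))))"

lemma chart_smoothD:
  "chart_smooth S q \<Longrightarrow> (Z, \<zeta>) \<in> A \<Longrightarrow> smooth_on (S \<times> \<zeta> ` Z) (\<lambda>p. q (fst p) (inv_into Z \<zeta> (snd p)))"
  by (auto simp: chart_smooth_def)

lemma chart_smooth_cont: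
  assumes S: "open S" and q: "chart_smooth S q"
  shows "continuous_on (S \<times> UNIV) (\<lambda>p. q (fst p) (snd p))"
proof (rule continuous_at_imp_continuous_on, rule ballI)
  fix p :: "'a \<times> 'g" assume p: "p \<in> S \<times> UNIV"
  obtain Z \<zeta> where Z: "(Z, \<zeta>) \<in> A" "snd p \<in> Z" by (rule chart_ex)
  have "continuous_on (S \<times> Z) (\<lambda>p. q (fst (fst p, \<zeta> (snd p))) (inv_into Z \<zeta> (snd (fst p, \<zeta> (snd p)))))"
    by (rule continuous_on_compose2[OF smooth_on_continuous_on[OF chart_smoothD[OF q Z(1)]]])
      (auto intro!: continuous_on_Pair continuous_on_fst continuous_on_id continuous_on_compose2[OF chart_cont[OF Z(1)]] continuous_on_snd)
  then have "continuous_on (S \<times> Z) (\<lambda>p. q (fst p) (snd p))"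
    by (rule continuous_on_eq) (auto simp: chart_inv_left[OF Z(1)])
  then show "isCont (\<lambda>p. q (fst p) (snd p)) p"
    using p Z open_Times[OF S chart_open[OF Z(1)]] by (auto simp: continuous_on_eq_continuous_at)
qed

text \<open>Joint smoothness is inherited by the derivatives in \<open>x\<close>, which is what
  allows differentiating under the integral repeatedly.\<close>

lemma chart_smooth_deriv:
  fixes q :: "'a::euclidean_space \<Rightarrow> 'g \<Rightarrow> real" and w :: 'a
  assumes S: "open S" and q: "chart_smooth S q"
  shows "x \<in> S \<Longrightarrow> ((\<lambda>x. q x z) has_derivative frechet_derivative (\<lambda>x. q x z) (at x)) (at x)"
    and "chart_smooth S (\<lambda>x z. frechet_derivative (\<lambda>x. q x z) (at x) w)"
proof -
  have D: "((\<lambda>x. q x (inv_into Z \<zeta> y)) has_derivative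
      (\<lambda>h. frechet_derivative (\<lambda>p. q (fst p) (inv_into Z \<zeta> (snd p))) (at (x, y)) (h, 0))) (at x)"
    if "(Z, \<zeta>) \<in> A" "x \<in> S" "y \<in> \<zeta> ` Z" for Z \<zeta> x y
    using smooth_on_partial(1)[OF chart_smoothD[OF q that(1)], of x y] that by simp
  show "((\<lambda>x. q x z) has_derivative frechet_derivative (\<lambda>x. q x z) (at x)) (at x)" if x: "x \<in> S"
  proof -
    obtain Z \<zeta> where Z: "(Z, \<zeta>) \<in> A" "z \<in> Z" by (rule chart_ex)
    have "(\<lambda>x. q x z) differentiable (at x)"
      using D[OF Z(1) x, of "\<zeta> z"] Z by (intro differentiableI) (auto simp: chart_inv_left[OF Z(1)])
    then show ?thesis by (simp add: frechet_derivative_works)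
  qed
  show "chart_smooth S (\<lambda>x z. frechet_derivative (\<lambda>x. q x z) (at x) w)"
    unfolding chart_smooth_def
  proof clarify
    fix Z \<zeta> assume Z: "(Z, \<zeta>) \<in> A"
    have op: "open (S \<times> \<zeta> ` Z)" by (intro open_Times S chart_image_open[OF Z])
    have "frechet_derivative (\<lambda>p. q (fst p) (inv_into Z \<zeta> (snd p))) (at p) (w, 0) =
       frechet_derivative (\<lambda>x. q x (inv_into Z \<zeta> (snd p))) (at (fst p)) w" if "p \<in> S \<times> \<zeta> ` Z" for p
      using fun_cong[OF frechet_derivative_at[OF D[OF Z, of "fst p" "snd p"]], of w] that by auto
    then show "smooth_on (S \<times> \<zeta> ` Z) (\<lambda>p. frechet_derivative (\<lambda>x. q x (inv_into Z \<zeta> (snd p))) (at (fst p)) w)"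
      by (rule smooth_on_cong[OF op _ smooth_on_frechet[OF chart_smoothD[OF q Z]]])
  qed
qed

section \<open>Differentiation under the integral\<close>

context
  fixes G :: "'g \<Rightarrow> 'b::{banach, second_countable_topology}" and K :: "'g set"
  assumes G: "integrable \<mu> G" and K: "compact K" "\<And>z. z \<notin> K \<Longrightarrow> G z = 0"
begin

lemma integrable_weight:
  fixes w :: "'g \<Rightarrow> real"
  assumes "continuous_on UNIV w"
  shows "integrable \<mu> (\<lambda>z. w z *\<^sub>R G z)"
proof -
  have "bounded (w ` K)" by (intro compact_imp_bounded compact_continuous_image K(1) continuous_on_subset[OF assms]) simp
  then obtain C where C: "C > 0" "\<forall>z\<in>K. norm (w z) \<le> C" unfolding bounded_pos by auto
  show ?thesis
  proof (rule Bochner_Integration.integrable_bound)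
    show "integrable \<mu> (\<lambda>z. C * norm (G z))" by (intro integrable_mult_right integrable_norm G)
    show "(\<lambda>z. w z *\<^sub>R G z) \<in> borel_measurable \<mu>"
      using borel_measurable_integrable[OF G] borel_measurable_continuous_onI[OF assms] by simp
    have "norm (w z *\<^sub>R G z) \<le> norm (C * norm (G z))" for z
    proof (cases "z \<in> K")
      case True
      then show ?thesis using C by (simp add: mult_right_mono)
    qed (simp add: K(2))
    then show "AE z in \<mu>. norm (w z *\<^sub>R G z) \<le> norm (C * norm (G z))" by simp
  qed
qed

lemma integral_weight_bound:
  fixes w :: "'g \<Rightarrow> real"
  assumes "continuous_on UNIV w" "\<And>z. z \<in> K \<Longrightarrow> \<bar>w z\<bar> \<le> c" "0 \<le> c"
  shows "norm (LINT z|\<mu>. w z *\<^sub>R G z) \<le> c * (LINT z|\<mu>. norm (G z))"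
proof -
  have "norm (LINT z|\<mu>. w z *\<^sub>R G z) \<le> (LINT z|\<mu>. norm (w z *\<^sub>R G z))" by (rule integral_norm_bound)
  also have "\<dots> \<le> (LINT z|\<mu>. c * norm (G z))"
  proof (rule integral_mono)
    show "norm (w z *\<^sub>R G z) \<le> c * norm (G z)" for z
      using assms(2)[of z] K(2)[of z] by (cases "z \<in> K") (auto intro: mult_right_mono)
  qed (intro integrable_norm integrable_weight assms integrable_mult_right G)+
  finally show ?thesis by simp
qed

text \<open>The first-order Taylor estimate of \<open>q\<close> at \<open>x0\<close> is uniform for
  \<open>z\<close> in the compact set carrying \<open>G\<close>; integrating it against
  \<open>G\<close> gives differentiability of the integral.\<close>

lemma has_derivative_weight_integral:
  fixes q :: "'a::euclidean_space \<Rightarrow> 'g \<Rightarrow> real"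
  assumes S: "open S" and q: "chart_smooth S q" and x0: "x0 \<in> S"
  shows "((\<lambda>x. LINT z|\<mu>. q x z *\<^sub>R G z) has_derivative
     (\<lambda>v. LINT z|\<mu>. frechet_derivative (\<lambda>x. q x z) (at x0) v *\<^sub>R G z)) (at x0)"
proof -
  let ?D = "\<lambda>x z. frechet_derivative (\<lambda>x. q x z) (at x)"
  have slice: "continuous_on UNIV (\<lambda>z. q x z)" if "chart_smooth S q" "x \<in> S" for x and q :: "'a \<Rightarrow> 'g \<Rightarrow> real"
  proof -
    have "continuous_on UNIV (\<lambda>z :: 'g. (x, z))" by (intro continuous_on_Pair continuous_on_id continuous_on_const)
    from continuous_on_compose2[OF chart_smooth_cont[OF S that(1)] this] show ?thesis using that(2) by auto
  qed
  have Dlin: "linear (?D x z)" if "x \<in> S" for x z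
    by (rule has_derivative_linear[OF chart_smooth_deriv(1)[OF S q that]])
  have Dc: "continuous_on UNIV (\<lambda>z. ?D x z v)" if "x \<in> S" for x v
    by (rule slice[OF chart_smooth_deriv(2)[OF S q] that])
  have Di: "integrable \<mu> (\<lambda>z. ?D x0 z v *\<^sub>R G z)" for v by (rule integrable_weight[OF Dc[OF x0]])
  show ?thesis
    unfolding has_derivative_at_alt
  proof (intro conjI allI impI)
    have "linear (\<lambda>v. LINT z|\<mu>. ?D x0 z v *\<^sub>R G z)"
    proof (rule linearI)
      show "(LINT z|\<mu>. ?D x0 z (v + w) *\<^sub>R G z) = (LINT z|\<mu>. ?D x0 z v *\<^sub>R G z) + (LINT z|\<mu>. ?D x0 z w *\<^sub>R G z)" for v w
        by (simp add: linear_add[OF Dlin[OF x0]] scaleR_add_left Bochner_Integration.integral_add[OF Di Di])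
      show "(LINT z|\<mu>. ?D x0 z (c *\<^sub>R v) *\<^sub>R G z) = c *\<^sub>R (LINT z|\<mu>. ?D x0 z v *\<^sub>R G z)" for c v
        by (simp add: linear_scale[OF Dlin[OF x0]] flip: scaleR_scaleR)
    qed
    then show "bounded_linear (\<lambda>v. LINT z|\<mu>. ?D x0 z v *\<^sub>R G z)" by (simp add: linear_conv_bounded_linear)
    fix e :: real assume e: "e > 0"
    define I where "I = (LINT z|\<mu>. norm (G z))"
    have I: "I \<ge> 0" by (simp add: I_def)
    \<comment> \<open>One \<open>\<epsilon>\<close> for each basis direction; \<open>I + 1\<close>
      instead of \<open>I\<close> covers the case that \<open>G\<close> vanishes almost
      everywhere.\<close>
    define \<epsilon> where "\<epsilon> = e / (real DIM('a) * (I + 1))"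
    have \<epsilon>: "\<epsilon> > 0" using e I by (simp add: \<epsilon>_def)
    \<comment> \<open>Compactness of \<open>K\<close> turns joint continuity of the partial
      derivative into continuity at \<open>x0\<close> that is uniform in \<open>z\<close>.\<close>
    have "\<exists>X. x0 \<in> X \<and> open X \<and> (\<forall>x\<in>X \<inter> S. \<forall>z\<in>K. \<bar>?D x z b - ?D x0 z b\<bar> \<le> \<epsilon>)" for b
    proof -
      have "continuous_on (S \<times> K) (\<lambda>p. ?D (fst p) (snd p) b)"
        by (rule continuous_on_subset[OF chart_smooth_cont[OF S chart_smooth_deriv(2)[OF S q]]]) auto
      from continuous_on_prod_compactE[OF this K(1) x0 \<epsilon>] show ?thesis by (simp add: dist_real_def) metis
    qed
    then obtain X where X: "\<And>b. x0 \<in> X b" "\<And>b. open (X b)"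
      "\<And>b x z. x \<in> X b \<Longrightarrow> x \<in> S \<Longrightarrow> z \<in> K \<Longrightarrow> \<bar>?D x z b - ?D x0 z b\<bar> \<le> \<epsilon>" by (metis IntI)
    have "open (S \<inter> (\<Inter>b\<in>Basis. X b))" "x0 \<in> S \<inter> (\<Inter>b\<in>Basis. X b)"
      using S X x0 by (auto intro!: open_Int open_INT)
    then obtain \<delta> where \<delta>: "\<delta> > 0" "ball x0 \<delta> \<subseteq> S \<inter> (\<Inter>b\<in>Basis. X b)" by (meson open_contains_ball)
    have close: "\<bar>?D x z h - ?D x0 z h\<bar> \<le> real DIM('a) * \<epsilon> * norm h" if "x \<in> ball x0 \<delta>" "z \<in> K" for x z h
    proof -
      have x: "x \<in> S" "\<And>b. b \<in> Basis \<Longrightarrow> x \<in> X b" using that \<delta>(2) by auto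
      have expand: "?D y z h = (\<Sum>b\<in>Basis. (h \<bullet> b) * ?D y z b)" if "y \<in> S" for y
        using linear_sum[OF Dlin[OF that], of z "\<lambda>b. (h \<bullet> b) *\<^sub>R b" Basis]
        by (simp add: euclidean_representation linear_scale[OF Dlin[OF that]])
      have "?D x z h - ?D x0 z h = (\<Sum>b\<in>Basis. (h \<bullet> b) * (?D x z b - ?D x0 z b))"
        by (simp add: expand[OF x(1)] expand[OF x0] sum_subtractf right_diff_distrib)
      also have "\<bar>\<dots>\<bar> \<le> (\<Sum>b\<in>(Basis::'a set). norm h * \<epsilon>)"
      proof (rule order_trans[OF sum_abs sum_mono])
        fix b :: 'a assume b: "b \<in> Basis"
        show "\<bar>(h \<bullet> b) * (?D x z b - ?D x0 z b)\<bar> \<le> norm h * \<epsilon>"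
          unfolding abs_mult using Basis_le_norm[OF b] X(3)[OF x(2)[OF b] x(1) that(2)] by (intro mult_mono) auto
      qed
      finally show ?thesis by (simp add: mult_ac)
    qed
    have Taylor: "\<bar>q (x0 + h) z - q x0 z - ?D x0 z h\<bar> \<le> real DIM('a) * \<epsilon> * norm h" if h: "norm h < \<delta>" and z: "z \<in> K" for h z
    proof -
      have inb: "x0 + t *\<^sub>R h \<in> ball x0 \<delta>" if "0 \<le> t" "t \<le> 1" for t
      proof -
        have "norm (t *\<^sub>R h) \<le> norm h" using that mult_left_le_one_le[of "norm h" t] by simp
        then show ?thesis using h by (simp add: dist_norm)
      qed
      have "\<exists>\<xi>::real. 0 < \<xi> \<and> \<xi> < 1 \<and> q (x0 + 1 *\<^sub>R h) z - q (x0 + 0 *\<^sub>R h) z = (1 - 0) * ?D (x0 + \<xi> *\<^sub>R h) z h"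
      proof (rule MVT2)
        fix t :: real assume "0 \<le> t" "t \<le> 1"
        then have "x0 + t *\<^sub>R h \<in> S" using inb \<delta>(2) by blast
        from chart_smooth_deriv(1)[OF S q this]
        show "((\<lambda>t. q (x0 + t *\<^sub>R h) z) has_real_derivative ?D (x0 + t *\<^sub>R h) z h) (at t)"
          by (rule has_real_derivative_along_line)
      qed simp
      then obtain \<xi> where \<xi>: "0 < \<xi>" "\<xi> < 1" "q (x0 + h) z - q x0 z = ?D (x0 + \<xi> *\<^sub>R h) z h" by auto
      show ?thesis unfolding \<xi>(3) by (rule close[OF inb z]) (use \<xi> in auto)
    qed
    show "\<exists>d>0. \<forall>y. norm (y - x0) < d \<longrightarrow>
       norm ((LINT z|\<mu>. q y z *\<^sub>R G z) - (LINT z|\<mu>. q x0 z *\<^sub>R G z) - (LINT z|\<mu>. ?D x0 z (y - x0) *\<^sub>R G z)) \<le> e * norm (y - x0)"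
    proof (intro exI[of _ \<delta>] conjI allI impI \<delta>(1))
      fix y assume y: "norm (y - x0) < \<delta>"
      have yS: "y \<in> S" using y \<delta>(2) by (auto simp: dist_norm norm_minus_commute)
      let ?w = "\<lambda>z. q y z - q x0 z - ?D x0 z (y - x0)"
      have i: "integrable \<mu> (\<lambda>z. q y z *\<^sub>R G z)" "integrable \<mu> (\<lambda>z. q x0 z *\<^sub>R G z)"
        by (intro integrable_weight slice q yS x0)+
      have "(LINT z|\<mu>. q y z *\<^sub>R G z) - (LINT z|\<mu>. q x0 z *\<^sub>R G z) - (LINT z|\<mu>. ?D x0 z (y - x0) *\<^sub>R G z) = (LINT z|\<mu>. ?w z *\<^sub>R G z)"
        by (simp add: scaleR_diff_left Bochner_Integration.integral_diff i Di)
      also have "norm \<dots> \<le> (real DIM('a) * \<epsilon> * norm (y - x0)) * I"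
        unfolding I_def
      proof (rule integral_weight_bound)
        show "continuous_on UNIV ?w" by (intro continuous_on_diff slice[OF q] Dc yS x0)
        show "\<bar>?w z\<bar> \<le> real DIM('a) * \<epsilon> * norm (y - x0)" if "z \<in> K" for z
          using Taylor[OF y that] by simp
      qed (use \<epsilon> in simp)
      also have "\<dots> = (real DIM('a) * \<epsilon> * I) * norm (y - x0)" by simp
      also have "\<dots> \<le> e * norm (y - x0)"
      proof (rule mult_right_mono)
        have "real DIM('a) * \<epsilon> * I = e * (I / (I + 1))" using I by (simp add: \<epsilon>_def)
        also have "\<dots> \<le> e * 1" using I e by (intro mult_left_mono) auto
        finally show "real DIM('a) * \<epsilon> * I \<le> e" by simp
      qed simp
      finally show "norm ((LINT z|\<mu>. q y z *\<^sub>R G z) - (LINT z|\<mu>. q x0 z *\<^sub>R G z) - (LINT z|\<mu>. ?D x0 z (y - x0) *\<^sub>R G z)) \<le> e * norm (y - x0)" .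
    qed
  qed
qed

lemma smooth_weight_integral:
  fixes q :: "'a::euclidean_space \<Rightarrow> 'g \<Rightarrow> real"
  assumes S: "open S" and q: "chart_smooth S q"
  shows "smooth_on S (\<lambda>x. LINT z|\<mu>. q x z *\<^sub>R G z)"
  unfolding smooth_on_def
proof
  fix k
  show "Ck_on k S (\<lambda>x. LINT z|\<mu>. q x z *\<^sub>R G z)"
    using q
  proof (induction k arbitrary: q)
    case 0
    then show ?case
      using has_derivative_continuous[OF has_derivative_weight_integral[OF S]] by (auto intro: continuous_at_imp_continuous_on)
  next
    case (Suc k)
    show ?case
      by (rule Ck_on_SucI[OF S has_derivative_weight_integral[OF S Suc.prems]] ) (assumption, rule Suc.IH[OF chart_smooth_deriv(2)[OF S Suc.prems]])
  qed
qed

end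

section \<open>Left translations and Minkowski's inequality\<close>

lemma distr_left: "distr \<mu> borel (\<lambda>x. g + x) = \<mu>"
proof (rule measure_eqI)
  have c: "continuous_on UNIV (\<lambda>x. g + x)" for g :: 'g by (intro continuous_intros)
  fix E assume "E \<in> sets (distr \<mu> borel (\<lambda>x. g + x))"
  then have E: "E \<in> sets borel" by simp
  have "(\<lambda>x. g + x) -` E = (\<lambda>x. - g + x) ` E"
  proof -
    have "x \<in> (\<lambda>x. - g + x) ` E" if "g + x \<in> E" for x
      using that by (intro image_eqI[of _ _ "g + x"]) (simp_all flip: add.assoc)
    moreover have "g + (- g + x) = x" for x by (simp flip: add.assoc)
    ultimately show ?thesis by auto
  qed
  then show "emeasure (distr \<mu> borel (\<lambda>x. g + x)) E = emeasure \<mu> E"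
    using E emeasure_left[OF E, of "- g"] borel_measurable_continuous_onI[OF c[of g]] by (simp add: emeasure_distr)
qed simp

lemma measurable_left [measurable]: "(\<lambda>x. g + x) \<in> borel \<rightarrow>\<^sub>M (borel :: 'g measure)"
  by (intro borel_measurable_continuous_onI continuous_intros)

lemma integral_left:
  fixes H :: "'g \<Rightarrow> 'b::{banach, second_countable_topology}"
  assumes "H \<in> borel_measurable borel"
  shows "(LINT x|\<mu>. H (g + x)) = (LINT x|\<mu>. H x)"
  using integral_distr[of "\<lambda>x. g + x" \<mu> borel H] assms measurable_left[of g] by (simp add: distr_left)

lemma integrable_left:
  fixes H :: "'g \<Rightarrow> 'b::{banach, second_countable_topology}"
  assumes "H \<in> borel_measurable borel"
  shows "integrable \<mu> (\<lambda>x. H (g + x)) \<longleftrightarrow> integrable \<mu> H"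
  using integrable_distr_eq[of "\<lambda>x. g + x" \<mu> borel H] assms measurable_left[of g] by (simp add: distr_left)

lemma ball_at_translate: "p + x \<in> ball_at (p + g) r \<longleftrightarrow> x \<in> ball_at g r"
proof -
  have "- (p + g) + (p + x) = - g + x" by (simp add: minus_add add.assoc del: add_uminus_conv_diff)
  then show ?thesis by (simp add: ball_at_iff)
qed

lemma mean_osc_translate:
  fixes F :: "'g \<Rightarrow> 'b::{banach, second_countable_topology}"
  assumes F: "F \<in> borel_measurable borel"
  shows "mean_osc \<mu> (\<lambda>x. F (p + x)) (ball_at g r) = mean_osc \<mu> F (ball_at (p + g) r)"
proof -
  have ind: "indicator (ball_at g r) x = (indicator (ball_at (p + g) r) (p + x) :: real)" for x
    by (simp add: indicator_def ball_at_translate)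
  have int: "(LINT x:ball_at g r|\<mu>. H (p + x)) = (LINT x:ball_at (p + g) r|\<mu>. H x)"
    if H: "H \<in> borel_measurable borel" for H :: "'g \<Rightarrow> 'c::{banach, second_countable_topology}"
    unfolding set_lebesgue_integral_def ind
    by (rule integral_left[of "\<lambda>x. indicator (ball_at (p + g) r) x *\<^sub>R H x"]) (use H in measurable)
  have "set_average \<mu> (\<lambda>x. F (p + x)) (ball_at g r) = set_average \<mu> F (ball_at (p + g) r)"
    unfolding set_average_def int[OF F] by (simp add: measure_ball)
  then show ?thesis
    unfolding mean_osc_def using int[of "\<lambda>x. norm (F x - set_average \<mu> F (ball_at (p + g) r))"] F
    by (simp add: measure_ball)
qed

lemma sigma_finite_mu: "sigma_finite_measure \<mu>"
proof
  let ?C = "range (\<lambda>m::nat. B (real m))"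
  have "\<exists>m::nat. h \<in> B (real m)" for h
  proof -
    obtain r where r: "h \<in> B r" using B_exhaust by blast
    obtain m :: nat where "r \<le> real m" using real_arch_simple by blast
    then show ?thesis using r B_mono by blast
  qed
  then have "\<Union>?C = UNIV" by blast
  moreover have "emeasure \<mu> (B (real m)) \<noteq> \<infinity>" for m using emeasure_B_finite[of "real m"] by simp
  ultimately show "\<exists>C. countable C \<and> C \<subseteq> sets \<mu> \<and> \<Union>C = space \<mu> \<and> (\<forall>a\<in>C. emeasure \<mu> a \<noteq> \<infinity>)"
    by (intro exI[of _ ?C]) auto
qed

interpretation pair_sigma_finite \<mu> \<mu>
  by (intro pair_sigma_finite.intro sigma_finite_mu)

lemma measurable_translate: "(\<lambda>p :: 'g \<times> 'g. - snd p + fst p) \<in> borel \<Otimes>\<^sub>M borel \<rightarrow>\<^sub>M borel"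
  unfolding borel_prod
  by (intro borel_measurable_continuous_onI continuous_on_add continuous_on_minus' continuous_on_fst continuous_on_snd continuous_on_id)

text \<open>Norm under the integral and Tonelli's theorem. The bound is asked only where
  \<open>\<rho>\<close> is nonzero, which later confines \<open>y\<close> to a small neighbourhood
  of the identity.\<close>

lemma Minkowski:
  fixes W :: "'g \<Rightarrow> 'g \<Rightarrow> 'b::{banach, second_countable_topology}" and \<rho> :: "'g \<Rightarrow> real"
  assumes W: "(\<lambda>p. W (fst p) (snd p)) \<in> borel_measurable (borel \<Otimes>\<^sub>M borel)"
    and \<rho>: "\<rho> \<in> borel_measurable borel" "\<And>y. 0 \<le> \<rho> y" and S: "S \<in> sets borel"
    and C: "\<And>y. \<rho> y \<noteq> 0 \<Longrightarrow> (\<integral>\<^sup>+x. ennreal (norm (W x y)) * indicator S x \<partial>\<mu>) \<le> C"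
  shows "(\<integral>\<^sup>+x. ennreal (norm (LINT y|\<mu>. \<rho> y *\<^sub>R W x y)) * indicator S x \<partial>\<mu>) \<le> C * (\<integral>\<^sup>+y. ennreal (\<rho> y) \<partial>\<mu>)"
proof -
  note [measurable] = \<rho>(1) S
  have W' [measurable]: "(\<lambda>p. W (fst p) (snd p)) \<in> borel_measurable (\<mu> \<Otimes>\<^sub>M \<mu>)"
    using W by (simp cong: measurable_cong_sets sets_pair_measure_cong)
  have Wx [measurable]: "(\<lambda>y. W x y) \<in> borel_measurable borel" for x
    using measurable_compose[OF measurable_Pair1'[of x borel borel] W] by simp
  have Wy [measurable]: "(\<lambda>x. W x y) \<in> borel_measurable borel" for y
    using measurable_compose[OF measurable_Pair2'[of y borel borel] W] by simp
  have "(\<integral>\<^sup>+x. ennreal (norm (LINT y|\<mu>. \<rho> y *\<^sub>R W x y)) * indicator S x \<partial>\<mu>) \<le>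
      (\<integral>\<^sup>+x. (\<integral>\<^sup>+y. ennreal (\<rho> y * norm (W x y)) * indicator S x \<partial>\<mu>) \<partial>\<mu>)"
  proof (rule nn_integral_mono)
    fix x
    have "ennreal (norm (LINT y|\<mu>. \<rho> y *\<^sub>R W x y)) \<le> (\<integral>\<^sup>+y. ennreal (\<rho> y * norm (W x y)) \<partial>\<mu>)"
    \<comment> \<open>Where the Bochner integral does not exist its value is 0 and the bound is
      trivial.\<close>
    proof (cases "integrable \<mu> (\<lambda>y. \<rho> y *\<^sub>R W x y)")
      case True
      from integral_norm_bound_ennreal[OF this] show ?thesis by (simp add: \<rho>)
    qed (simp add: not_integrable_integral_eq)
    then show "ennreal (norm (LINT y|\<mu>. \<rho> y *\<^sub>R W x y)) * indicator S x \<le> (\<integral>\<^sup>+y. ennreal (\<rho> y * norm (W x y)) * indicator S x \<partial>\<mu>)"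
      by (simp add: indicator_def)
  qed
  also have "\<dots> = (\<integral>\<^sup>+y. (\<integral>\<^sup>+x. ennreal (\<rho> y * norm (W x y)) * indicator S x \<partial>\<mu>) \<partial>\<mu>)"
  proof (rule Fubini'[symmetric])
    have "(\<lambda>p. ennreal (\<rho> (snd p) * norm (W (fst p) (snd p))) * indicator S (fst p)) \<in> borel_measurable (\<mu> \<Otimes>\<^sub>M \<mu>)"
      by measurable
    then show "(\<lambda>(x, y). ennreal (\<rho> y * norm (W x y)) * indicator S x) \<in> borel_measurable (\<mu> \<Otimes>\<^sub>M \<mu>)"
      by (simp add: case_prod_beta')
  qed
  also have "\<dots> \<le> (\<integral>\<^sup>+y. C * ennreal (\<rho> y) \<partial>\<mu>)"
  proof (rule nn_integral_mono)
    fix y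
    have "(\<integral>\<^sup>+x. ennreal (\<rho> y * norm (W x y)) * indicator S x \<partial>\<mu>) = (\<integral>\<^sup>+x. ennreal (\<rho> y) * (ennreal (norm (W x y)) * indicator S x) \<partial>\<mu>)"
      by (simp add: ennreal_mult \<rho>(2) mult.assoc)
    also have "\<dots> = ennreal (\<rho> y) * (\<integral>\<^sup>+x. ennreal (norm (W x y)) * indicator S x \<partial>\<mu>)"
      by (rule nn_integral_cmult) measurable
    also have "\<dots> \<le> ennreal (\<rho> y) * C" using C[of y] by (cases "\<rho> y = 0") (auto intro: mult_left_mono)
    finally show "(\<integral>\<^sup>+x. ennreal (\<rho> y * norm (W x y)) * indicator S x \<partial>\<mu>) \<le> C * ennreal (\<rho> y)" by (simp add: mult.commute)
  qed
  also have "\<dots> = C * (\<integral>\<^sup>+y. ennreal (\<rho> y) \<partial>\<mu>)" by (rule nn_integral_cmult) simp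
  finally show ?thesis .
qed

lemma integral_norm_left:
  fixes H :: "'g \<Rightarrow> 'b::{banach, second_countable_topology}"
  shows "H \<in> borel_measurable borel \<Longrightarrow> (LINT x|\<mu>. norm (H (g + x))) = (LINT x|\<mu>. norm (H x))"
  by (rule integral_left) simp

text \<open>Continuity at the identity of left translation in \<open>L\<^sup>1\<close>. The
  sequential form is the one that dominated convergence delivers.\<close>

definition translation_cont :: "('g \<Rightarrow> 'b::{banach, second_countable_topology}) \<Rightarrow> bool" where
  "translation_cont G \<longleftrightarrow> (\<forall>y::nat \<Rightarrow> 'g. y \<longlonglongrightarrow> 0 \<longrightarrow> (\<lambda>k. LINT x|\<mu>. norm (G (- y k + x) - G x)) \<longlonglongrightarrow> 0)"

text \<open>A three-epsilon argument: by left invariance, translating \<open>H k - G\<close> leaves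
  its \<open>L\<^sup>1\<close> norm unchanged, so the approximation is uniform over all
  translations.\<close>

lemma translation_cont_lim:
  fixes G :: "'g \<Rightarrow> 'b::{banach, second_countable_topology}"
  assumes G: "integrable \<mu> G" and H: "\<And>k. integrable \<mu> (H k)" "\<And>k. translation_cont (H k)"
    and lim: "(\<lambda>k. LINT x|\<mu>. norm (H k x - G x)) \<longlonglongrightarrow> 0"
  shows "translation_cont G"
  unfolding translation_cont_def
proof (intro allI impI LIMSEQ_I)
  fix y :: "nat \<Rightarrow> 'g" and \<epsilon> :: real assume y: "y \<longlonglongrightarrow> 0" and \<epsilon>: "0 < \<epsilon>"
  have "\<forall>\<^sub>F k in sequentially. (LINT x|\<mu>. norm (H k x - G x)) < \<epsilon> / 3"
    by (rule order_tendstoD(2)[OF lim]) (use \<epsilon> in simp)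
  then obtain k where k: "(LINT x|\<mu>. norm (H k x - G x)) < \<epsilon> / 3" by (auto simp: eventually_sequentially)
  have "\<forall>\<^sub>F i in sequentially. (LINT x|\<mu>. norm (H k (- y i + x) - H k x)) < \<epsilon> / 3"
    by (rule order_tendstoD(2)[OF H(2)[of k, unfolded translation_cont_def, rule_format, OF y]]) (use \<epsilon> in simp)
  then obtain N where N: "\<And>i. i \<ge> N \<Longrightarrow> (LINT x|\<mu>. norm (H k (- y i + x) - H k x)) < \<epsilon> / 3" by (auto simp: eventually_sequentially)
  have meas: "G \<in> borel_measurable borel" "H k \<in> borel_measurable borel"
    using borel_measurable_integrable[OF G] borel_measurable_integrable[OF H(1)] by simp_all
  have tr: "integrable \<mu> (\<lambda>x. G (g + x))" "integrable \<mu> (\<lambda>x. H k (g + x))" for g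
    using integrable_left[OF meas(1)] integrable_left[OF meas(2)] G H(1) by simp_all
  show "\<exists>N. \<forall>i\<ge>N. norm ((LINT x|\<mu>. norm (G (- y i + x) - G x)) - 0) < \<epsilon>"
  proof (intro exI allI impI)
    fix i assume i: "i \<ge> N"
    note ints = tr[of "- y i"] G H(1)[of k]
    have "(LINT x|\<mu>. norm (G (- y i + x) - G x)) \<le>
      (LINT x|\<mu>. norm (H k (- y i + x) - G (- y i + x)) + (norm (H k (- y i + x) - H k x) + norm (H k x - G x)))"
    proof (rule integral_mono)
      fix x
      have "G (- y i + x) - G x = (H k (- y i + x) - H k x + (H k x - G x)) - (H k (- y i + x) - G (- y i + x))" by simp
      then show "norm (G (- y i + x) - G x) \<le> norm (H k (- y i + x) - G (- y i + x)) + (norm (H k (- y i + x) - H k x) + norm (H k x - G x))"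
        by (smt (verit) norm_triangle_ineq norm_triangle_ineq4)
    qed (intro integrable_norm Bochner_Integration.integrable_add Bochner_Integration.integrable_diff ints)+
    also have "\<dots> = (LINT x|\<mu>. norm (H k (- y i + x) - G (- y i + x))) + ((LINT x|\<mu>. norm (H k (- y i + x) - H k x)) + (LINT x|\<mu>. norm (H k x - G x)))"
      by (simp add: Bochner_Integration.integral_add integrable_norm Bochner_Integration.integrable_add Bochner_Integration.integrable_diff ints)
    also have "(LINT x|\<mu>. norm (H k (- y i + x) - G (- y i + x))) = (LINT x|\<mu>. norm (H k x - G x))"
      by (rule integral_norm_left) (use meas in simp)
    finally have "(LINT x|\<mu>. norm (G (- y i + x) - G x)) < \<epsilon>" using k N[OF i] by linarith
    then show "norm ((LINT x|\<mu>. norm (G (- y i + x) - G x)) - 0) < \<epsilon>"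
      by (simp add: abs_of_nonneg integral_nonneg)
  qed
qed

lemma translation_cont_add:
  fixes G H :: "'g \<Rightarrow> 'b::{banach, second_countable_topology}"
  assumes G: "integrable \<mu> G" "translation_cont G" and H: "integrable \<mu> H" "translation_cont H"
  shows "translation_cont (\<lambda>x. G x + H x)"
  unfolding translation_cont_def
proof (intro allI impI)
  fix y :: "nat \<Rightarrow> 'g" assume y: "y \<longlonglongrightarrow> 0"
  have meas: "G \<in> borel_measurable borel" "H \<in> borel_measurable borel"
    using borel_measurable_integrable[OF G(1)] borel_measurable_integrable[OF H(1)] by simp_all
  have tr: "integrable \<mu> (\<lambda>x. G (g + x))" "integrable \<mu> (\<lambda>x. H (g + x))" for g
    using integrable_left[OF meas(1)] integrable_left[OF meas(2)] G H by simp_all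
  have "(\<lambda>k. (LINT x|\<mu>. norm (G (- y k + x) - G x)) + (LINT x|\<mu>. norm (H (- y k + x) - H x))) \<longlonglongrightarrow> 0 + 0"
    (is "?s \<longlonglongrightarrow> _") using G(2) H(2) y unfolding translation_cont_def by (intro tendsto_add) auto
  then have s: "?s \<longlonglongrightarrow> 0" by simp
  show "(\<lambda>k. LINT x|\<mu>. norm (G (- y k + x) + H (- y k + x) - (G x + H x))) \<longlonglongrightarrow> 0"
  proof (rule Lim_null_comparison[OF always_eventually s], rule allI)
    fix k
    note ints = tr[of "- y k"] G(1) H(1)
    have "(LINT x|\<mu>. norm (G (- y k + x) + H (- y k + x) - (G x + H x))) \<le>
      (LINT x|\<mu>. norm (G (- y k + x) - G x) + norm (H (- y k + x) - H x))"
    proof (rule integral_mono)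
      show "norm (G (- y k + x) + H (- y k + x) - (G x + H x)) \<le> norm (G (- y k + x) - G x) + norm (H (- y k + x) - H x)" for x
        using norm_triangle_ineq[of "G (- y k + x) - G x" "H (- y k + x) - H x"] by (simp add: algebra_simps)
    qed (intro integrable_norm Bochner_Integration.integrable_add Bochner_Integration.integrable_diff ints)+
    also have "\<dots> = (LINT x|\<mu>. norm (G (- y k + x) - G x)) + (LINT x|\<mu>. norm (H (- y k + x) - H x))"
      by (intro Bochner_Integration.integral_add integrable_norm Bochner_Integration.integrable_diff ints)
    finally show "norm (LINT x|\<mu>. norm (G (- y k + x) + H (- y k + x) - (G x + H x))) \<le> \<dots>"
      by (simp add: abs_of_nonneg integral_nonneg)
  qed
qed

text \<open>A point of an open set stays in it under small translations, so the mass lost from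
  \<open>E\<close> tends to 0 by dominated convergence. The mass gained equals the mass lost,
  because both indicators have the same integral.\<close>

lemma translation_cont_open:
  assumes E: "open E" and fin: "emeasure \<mu> E < \<infinity>"
  shows "translation_cont (indicat_real E)"
  unfolding translation_cont_def
proof (intro allI impI)
  fix y :: "nat \<Rightarrow> 'g" assume y: "y \<longlonglongrightarrow> 0"
  have Em: "E \<in> sets borel" using E by simp
  have i: "integrable \<mu> (indicat_real E)" using Em fin by simp
  have meas: "indicat_real E \<in> borel_measurable borel" using Em by simp
  have tm [measurable]: "(\<lambda>x. indicat_real E (g + x)) \<in> borel_measurable borel" for g
    by (rule measurable_compose[OF measurable_left meas])
  have it: "integrable \<mu> (\<lambda>x. indicat_real E (g + x))" for g by (simp only: integrable_left[OF meas] i)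
  let ?d = "\<lambda>k x. max 0 (indicat_real E x - indicat_real E (- y k + x))"
  have lim: "(\<lambda>k. LINT x|\<mu>. ?d k x) \<longlonglongrightarrow> (LINT x|\<mu>. 0)"
  proof (rule integral_dominated_convergence[where w = "indicat_real E"])
    show "AE x in \<mu>. (\<lambda>k. ?d k x) \<longlonglongrightarrow> 0"
    proof (rule AE_I2)
      fix x
      show "(\<lambda>k. ?d k x) \<longlonglongrightarrow> 0"
      proof (cases "x \<in> E")
        case True
        have "(\<lambda>k. - y k + x) \<longlonglongrightarrow> - 0 + x" by (intro tendsto_intros y)
        then have "\<forall>\<^sub>F k in sequentially. - y k + x \<in> E"
          by (rule topological_tendstoD) (use E True in auto)
        then have "\<forall>\<^sub>F k in sequentially. ?d k x = 0" by (rule eventually_mono) (use True in simp)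
        then show ?thesis by (rule tendsto_eventually)
      next
        case False
        then have "?d k x = 0" for k by simp
        then show ?thesis by simp
      qed
    qed
    show "(\<lambda>x. ?d k x) \<in> borel_measurable \<mu>" for k
      using Em by simp
    show "AE x in \<mu>. norm (?d k x) \<le> indicat_real E x" for k
      by (rule AE_I2) (simp add: indicator_def)
  qed (use i in simp_all)
  have eq: "(LINT x|\<mu>. norm (indicat_real E (- y k + x) - indicat_real E x)) = 2 * (LINT x|\<mu>. ?d k x)" for k
  proof -
    have id: "integrable \<mu> (?d k)"
      by (rule Bochner_Integration.integrable_bound[OF i]) (use Em in \<open>auto simp: indicator_def\<close>)
    \<comment> \<open>The identity \<open>\<bar>b - a\<bar> = 2 * max 0 (a - b) + (b - a)\<close>,
      whose last term integrates to 0.\<close>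
    have "norm (indicat_real E (- y k + x) - indicat_real E x) = 2 * ?d k x + (indicat_real E (- y k + x) - indicat_real E x)" for x
      by (auto simp: max_def)
    then have "(LINT x|\<mu>. norm (indicat_real E (- y k + x) - indicat_real E x)) =
      (LINT x|\<mu>. 2 * ?d k x + (indicat_real E (- y k + x) - indicat_real E x))" by simp
    also have "\<dots> = 2 * (LINT x|\<mu>. ?d k x) + ((LINT x|\<mu>. indicat_real E (- y k + x)) - (LINT x|\<mu>. indicat_real E x))"
      using id it[of "- y k"] i by simp
    also have "(LINT x|\<mu>. indicat_real E (- y k + x)) = (LINT x|\<mu>. indicat_real E x)" by (rule integral_left[OF meas])
    finally show ?thesis by simp
  qed
  show "(\<lambda>k. LINT x|\<mu>. norm (indicat_real E (- y k + x) - indicat_real E x)) \<longlonglongrightarrow> 0"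
    unfolding eq using tendsto_mult_left[OF lim, of 2] by simp
qed

lemma translation_cont_scaleR:
  fixes c :: "'b::{banach, second_countable_topology}" and u :: "'g \<Rightarrow> real"
  assumes "translation_cont u"
  shows "translation_cont (\<lambda>x. u x *\<^sub>R c)"
  unfolding translation_cont_def
proof (intro allI impI)
  fix y :: "nat \<Rightarrow> 'g" assume y: "y \<longlonglongrightarrow> 0"
  have "(LINT x|\<mu>. norm (u (- y k + x) *\<^sub>R c - u x *\<^sub>R c)) = (LINT x|\<mu>. norm (u (- y k + x) - u x)) * norm c" for k
    by (simp flip: scaleR_diff_left)
  moreover have "(\<lambda>k. (LINT x|\<mu>. norm (u (- y k + x) - u x)) * norm c) \<longlonglongrightarrow> 0 * norm c"
    using assms y unfolding translation_cont_def by (intro tendsto_mult_right) auto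
  ultimately show "(\<lambda>k. LINT x|\<mu>. norm (u (- y k + x) *\<^sub>R c - u x *\<^sub>R c)) \<longlonglongrightarrow> 0" by simp
qed

text \<open>Open sets are stable under intersection and generate the Borel sets; the property passes
  to complements and disjoint unions. Intersecting with \<open>B r\<close> keeps all measures finite
  throughout.\<close>

lemma translation_cont_indicator_Int:
  assumes "E \<in> sets borel"
  shows "translation_cont (indicat_real (E \<inter> B r))"
proof -
  have ib: "integrable \<mu> (indicat_real (E \<inter> B r))" if "E \<in> sets borel" for E
  proof (rule integrable_real_indicator)
    show "emeasure \<mu> (E \<inter> B r) < \<infinity>"
      using emeasure_mono[of "E \<inter> B r" "B r" \<mu>] emeasure_B_finite[of r] by (simp add: le_less_trans)
  qed (use that in simp)
  have B: "translation_cont (indicat_real (B r))" by (rule translation_cont_open[OF B_open emeasure_B_finite])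
  have Is: "Int_stable {S :: 'g set. open S}" by (auto simp: Int_stable_def)
  have sub: "{S :: 'g set. open S} \<subseteq> Pow UNIV" by simp
  have "E \<in> sigma_sets UNIV {S. open S}" using assms by (simp add: borel_def)
  from Is sub this show ?thesis
  proof (induction rule: sigma_sets_induct_disjoint)
    case (basic E)
    have "emeasure \<mu> (E \<inter> B r) \<le> emeasure \<mu> (B r)" by (rule emeasure_mono) auto
    then show ?case using basic emeasure_B_finite[of r] by (intro translation_cont_open open_Int B_open) (auto intro: le_less_trans)
  next
    case empty
    then show ?case by (simp add: translation_cont_def)
  next
    case (compl E)
    have E: "E \<in> sets borel" using compl(1) by (simp add: borel_def)
    have "indicat_real ((UNIV - E) \<inter> B r) = (\<lambda>x. indicat_real (B r) x + indicat_real (E \<inter> B r) x *\<^sub>R (- 1))"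
      by (auto simp: indicator_def fun_eq_iff)
    moreover have "integrable \<mu> (indicat_real (B r))" using ib[of UNIV] by simp
    ultimately show ?case
      using translation_cont_add[OF _ B _ translation_cont_scaleR[OF compl(2), of "-1"]] ib[OF E] by simp
  next
    case (union E)
    have E: "E i \<in> sets borel" for i using union(2) by (auto simp: borel_def)
    let ?H = "\<lambda>k x. indicat_real ((\<Union>i<k. E i) \<inter> B r) x"
    have Hi: "integrable \<mu> (?H k)" for k by (rule ib) (use E in auto)
    have Hc: "translation_cont (?H k)" for k
    proof (induction k)
      case 0
      then show ?case by (simp add: translation_cont_def)
    next
      case (Suc k)
      have "E i \<inter> E k = {}" if "i < k" for i using union(1) that by (auto simp: disjoint_family_on_def)
      then have "(\<Union>i<k. E i) \<inter> E k = {}" by blast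
      then have "?H (Suc k) = (\<lambda>x. ?H k x + indicat_real (E k \<inter> B r) x)"
        by (auto simp: indicator_def fun_eq_iff less_Suc_eq)
      then show ?case using translation_cont_add[OF Hi Suc ib[OF E] union(3)] by simp
    qed
    have iU: "integrable \<mu> (indicat_real ((\<Union>i. E i) \<inter> B r))" by (rule ib) (use E in auto)
    show ?case
    proof (rule translation_cont_lim[OF iU Hi Hc])
      have "(\<lambda>k. LINT x|\<mu>. norm (?H k x - indicat_real ((\<Union>i. E i) \<inter> B r) x)) \<longlonglongrightarrow> (LINT x|\<mu>. 0)"
      proof (rule integral_dominated_convergence[where w = "indicat_real (B r)"])
        show "AE x in \<mu>. (\<lambda>k. norm (?H k x - indicat_real ((\<Union>i. E i) \<inter> B r) x)) \<longlonglongrightarrow> 0"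
        proof (rule AE_I2)
          fix x
          show "(\<lambda>k. norm (?H k x - indicat_real ((\<Union>i. E i) \<inter> B r) x)) \<longlonglongrightarrow> 0"
          proof (cases "x \<in> (\<Union>i. E i)")
            case True
            then obtain j where j: "x \<in> E j" by blast
            have "\<forall>\<^sub>F k in sequentially. norm (?H k x - indicat_real ((\<Union>i. E i) \<inter> B r) x) = 0"
              using eventually_gt_at_top[of j] by (rule eventually_mono) (use j in \<open>auto simp: indicator_def\<close>)
            then show ?thesis by (rule tendsto_eventually)
          next
            case False
            then have "norm (?H k x - indicat_real ((\<Union>i. E i) \<inter> B r) x) = 0" for k by (auto simp: indicator_def)
            then show ?thesis by simp
          qed
        qed
        show "(\<lambda>x. norm (?H k x - indicat_real ((\<Union>i. E i) \<inter> B r) x)) \<in> borel_measurable \<mu>" for k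
          using borel_measurable_integrable[OF Hi[of k]] borel_measurable_integrable[OF iU] by measurable
        show "AE x in \<mu>. norm (norm (?H k x - indicat_real ((\<Union>i. E i) \<inter> B r) x)) \<le> indicat_real (B r) x" for k
          by (rule AE_I2) (auto simp: indicator_def)
      qed (use ib[of UNIV] in simp_all)
      then show "(\<lambda>k. LINT x|\<mu>. norm (?H k x - indicat_real ((\<Union>i. E i) \<inter> B r) x)) \<longlonglongrightarrow> 0" by simp
    qed
  qed
qed

text \<open>Approximation by simple functions, where a set of finite measure is exhausted by its
  intersections with balls.\<close>

lemma translation_cont_integrable:
  fixes G :: "'g \<Rightarrow> 'b::{banach, second_countable_topology}"
  assumes "integrable \<mu> G"
  shows "translation_cont G"
  using assms
proof (induction rule: integrable_induct)
  case (base E c)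
  have E: "E \<in> sets borel" using base(1) by simp
  have iE: "integrable \<mu> (\<lambda>x. indicat_real (E \<inter> S) x)" if "S \<in> sets borel" for S
  proof (rule integrable_real_indicator)
    show "emeasure \<mu> (E \<inter> S) < \<infinity>"
      using emeasure_mono[of "E \<inter> S" E \<mu>] base by (simp add: le_less_trans)
  qed (use E that in simp)
  have iEE: "integrable \<mu> (indicat_real E)" using iE[of UNIV] by simp
  have "translation_cont (indicat_real E)"
  proof (rule translation_cont_lim[OF iEE, of "\<lambda>k. indicat_real (E \<inter> B (real k))"])
    show "translation_cont (indicat_real (E \<inter> B (real k)))" for k by (rule translation_cont_indicator_Int[OF E])
    show "integrable \<mu> (indicat_real (E \<inter> B (real k)))" for k by (rule iE) simp
    have "(\<lambda>k. LINT x|\<mu>. norm (indicat_real (E \<inter> B (real k)) x - indicat_real E x)) \<longlonglongrightarrow> (LINT x|\<mu>. 0)"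
    proof (rule integral_dominated_convergence[where w = "indicat_real E"])
      show "AE x in \<mu>. (\<lambda>k. norm (indicat_real (E \<inter> B (real k)) x - indicat_real E x)) \<longlonglongrightarrow> 0"
      proof (rule AE_I2)
        fix x
        obtain r where r: "x \<in> B r" using B_exhaust by blast
        obtain j :: nat where j: "r \<le> real j" using real_arch_simple by blast
        have "x \<in> B (real k)" if "k \<ge> j" for k using r j that B_mono[of r "real k"] by auto
        then have "\<forall>\<^sub>F k in sequentially. norm (indicat_real (E \<inter> B (real k)) x - indicat_real E x) = 0"
          by (intro eventually_sequentiallyI[of j]) (simp add: indicator_def)
        then show "(\<lambda>k. norm (indicat_real (E \<inter> B (real k)) x - indicat_real E x)) \<longlonglongrightarrow> 0" by (rule tendsto_eventually)
      qed
      show "(\<lambda>x. norm (indicat_real (E \<inter> B (real k)) x - indicat_real E x)) \<in> borel_measurable \<mu>" for k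
        using E by simp
      show "AE x in \<mu>. norm (norm (indicat_real (E \<inter> B (real k)) x - indicat_real E x)) \<le> indicat_real E x" for k
        by (rule AE_I2) (auto simp: indicator_def)
    qed (use iEE in simp_all)
    then show "(\<lambda>k. LINT x|\<mu>. norm (indicat_real (E \<inter> B (real k)) x - indicat_real E x)) \<longlonglongrightarrow> 0" by simp
  qed
  then show ?case by (rule translation_cont_scaleR)
next
  case (add f g)
  then show ?case by (intro translation_cont_add)
next
  case (lim f s)
  show ?case
  proof (rule translation_cont_lim[OF lim(4) lim(1) lim(5)])
    have "(\<lambda>k. LINT x|\<mu>. norm (s k x - f x)) \<longlonglongrightarrow> (LINT x|\<mu>. 0)"
    proof (rule integral_dominated_convergence[where w = "\<lambda>x. 3 * norm (f x)"])
      show "AE x in \<mu>. (\<lambda>k. norm (s k x - f x)) \<longlonglongrightarrow> 0"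
        using lim(2) by (intro AE_I2 tendsto_norm_zero LIM_zero)
      show "(\<lambda>x. norm (s k x - f x)) \<in> borel_measurable \<mu>" for k
        using borel_measurable_integrable[OF lim(1)[of k]] borel_measurable_integrable[OF lim(4)] by measurable
      show "AE x in \<mu>. norm (norm (s k x - f x)) \<le> 3 * norm (f x)" for k
      proof (rule AE_I2)
        fix x assume "x \<in> space \<mu>"
        then show "norm (norm (s k x - f x)) \<le> 3 * norm (f x)"
          using lim(3)[of x k] norm_triangle_ineq4[of "s k x" "f x"] by simp
      qed
    qed (use lim(4) in simp_all)
    then show "(\<lambda>k. LINT x|\<mu>. norm (s k x - f x)) \<longlonglongrightarrow> 0" by simp
  qed
qed

text \<open>Countable neighbourhood bases convert the sequential statement into one about
  neighbourhoods.\<close>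

lemma translation_cont_nhd:
  fixes G :: "'g \<Rightarrow> 'b::{banach, second_countable_topology}"
  assumes "integrable \<mu> G" "\<epsilon> > 0"
  shows "\<exists>N. open N \<and> 0 \<in> N \<and> (\<forall>y\<in>N. (LINT x|\<mu>. norm (G (- y + x) - G x)) < \<epsilon>)"
proof -
  have "\<forall>\<^sub>F y in nhds 0. (LINT x|\<mu>. norm (G (- y + x) - G x)) < \<epsilon>"
  unfolding eventually_nhds_iff_sequentially
  proof (intro allI impI)
    fix y :: "nat \<Rightarrow> 'g" assume y: "y \<longlonglongrightarrow> 0"
    show "\<forall>\<^sub>F k in sequentially. (LINT x|\<mu>. norm (G (- y k + x) - G x)) < \<epsilon>"
      by (rule order_tendstoD(2)[OF translation_cont_integrable[OF assms(1), unfolded translation_cont_def, rule_format, OF y] assms(2)])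
  qed
  then show ?thesis by (simp add: eventually_nhds)
qed

section \<open>Mollifiers and convolution\<close>

lemma compact_uminus: "compact K \<Longrightarrow> compact (uminus ` (K :: 'g set))"
  by (intro compact_continuous_image continuous_on_minus' continuous_on_id)

lemma set_nn_integral_norm:
  fixes f :: "'g \<Rightarrow> 'b::{banach, second_countable_topology}"
  assumes "set_integrable \<mu> S f"
  shows "(\<integral>\<^sup>+x. ennreal (norm (f x)) * indicator S x \<partial>\<mu>) = ennreal (LINT x:S|\<mu>. norm (f x))"
proof -
  have i: "integrable \<mu> (\<lambda>x. indicat_real S x *\<^sub>R norm (f x))"
    using set_integrable_norm[OF assms] by (simp add: set_integrable_def)
  have "ennreal (norm (f x)) * indicator S x = ennreal (indicat_real S x *\<^sub>R norm (f x))" for x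
    by (simp add: indicator_def)
  then show ?thesis unfolding set_lebesgue_integral_def using nn_integral_eq_integral[OF i] by simp
qed

lemma mollifier:
  assumes "open N" "0 \<in> N"
  obtains \<rho> :: "'g \<Rightarrow> real" where "smooth_fun A \<rho>" "cc \<rho>" "\<And>x. 0 \<le> \<rho> x" "\<And>x. x \<notin> N \<Longrightarrow> \<rho> x = 0" "(LINT x|\<mu>. \<rho> x) = 1"
proof -
  obtain \<beta> K where \<beta>: "smooth_fun A \<beta>" "\<beta> 0 = (1::real)" "\<And>p. 0 \<le> \<beta> p" "\<And>p. p \<notin> K \<Longrightarrow> \<beta> p = 0"
    and K: "compact K" "K \<subseteq> N" by (rule bump_fun[OF assms]) blast
  have cont: "continuous_on UNIV \<beta>" by (rule smooth_fun_cont[OF \<beta>(1)])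
  have cc: "cc \<beta>" using \<beta>(4) K cont by (auto simp: cc_def)
  \<comment> \<open>An open neighbourhood of the identity, hence of positive measure; a bump with
    zero integral would have to vanish almost everywhere on it.\<close>
  let ?N = "{x. 1 / 2 < \<beta> x}"
  have oN: "open ?N" "0 \<in> ?N" by (intro open_Collect_less cont continuous_on_const) (simp add: \<beta>(2))
  have pos: "(LINT x|\<mu>. \<beta> x) > 0"
  proof -
    have "(LINT x|\<mu>. \<beta> x) \<noteq> 0"
    proof
      assume "(LINT x|\<mu>. \<beta> x) = 0"
      then have "AE x in \<mu>. \<beta> x = 0" using integral_nonneg_eq_0_iff_AE[OF cc_integrable[OF cc]] \<beta>(3) by simp
      then have "AE x in \<mu>. x \<notin> ?N" by (rule AE_mp) (auto intro: AE_I2)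
      then have "emeasure \<mu> ?N = 0" using oN(1) by (subst (asm) AE_iff_measurable[of ?N]) auto
      then show False using emeasure_open_pos[OF oN] by simp
    qed
    moreover have "(LINT x|\<mu>. \<beta> x) \<ge> 0" by (rule Bochner_Integration.integral_nonneg) (simp add: \<beta>)
    ultimately show ?thesis by simp
  qed
  let ?\<rho> = "\<lambda>x. (1 / (LINT x|\<mu>. \<beta> x)) * \<beta> x"
  show ?thesis
  proof (rule that[of ?\<rho>])
    show "smooth_fun A ?\<rho>" by (intro smooth_fun_mult smooth_fun_const \<beta>)
    show "cc ?\<rho>" unfolding cc_def
      using \<beta>(4) K(1) by (intro conjI exI[of _ K] continuous_on_mult continuous_on_const cont) auto
    show "0 \<le> ?\<rho> x" for x using pos \<beta>(3)[of x] by simp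
    show "?\<rho> x = 0" if "x \<notin> N" for x using \<beta>(4)[of x] K(2) that by auto
    show "(LINT x|\<mu>. ?\<rho> x) = 1" using pos by (subst Bochner_Integration.integral_mult_right_zero) simp
  qed
qed

lemma test_functions_iff:
  fixes u :: "'g \<Rightarrow> 'b::real_normed_vector"
  shows "u \<in> test_functions A \<longleftrightarrow> smooth_fun A u \<and> cc u"
proof
  assume u: "u \<in> test_functions A"
  then have "u x = 0" if "x \<notin> closure {p. u p \<noteq> 0}" for x
    using that closure_subset[of "{p. u p \<noteq> 0}"] by blast
  then show "smooth_fun A u \<and> cc u" using u smooth_fun_cont unfolding test_functions_def cc_def by blast
next
  assume u: "smooth_fun A u \<and> cc u"
  then obtain K where K: "compact K" "\<And>x. x \<notin> K \<Longrightarrow> u x = 0" by (auto simp: cc_def)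
  have "closure {p. u p \<noteq> 0} \<subseteq> K" using K by (intro closure_minimal compact_imp_closed) auto
  then have "compact (closure {p. u p \<noteq> 0})" using compact_Int_closed[OF K(1), of "closure {p. u p \<noteq> 0}"] by (simp add: Int_absorb1)
  then show "u \<in> test_functions A" using u by (simp add: test_functions_def)
qed

context
  fixes G :: "'g \<Rightarrow> 'b::{banach, second_countable_topology}" and K :: "'g set" and M :: real and \<rho> :: "'g \<Rightarrow> real"
  assumes G: "G \<in> borel_measurable borel" "\<And>x. norm (G x) \<le> M" and K: "compact K" "\<And>x. x \<notin> K \<Longrightarrow> G x = 0"
    and \<rho>: "smooth_fun A \<rho>" "cc \<rho>" "\<And>y. 0 \<le> \<rho> y" "(LINT y|\<mu>. \<rho> y) = 1"
begin

text \<open>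
  An average of left translates of \<open>G\<close>; these have the same mean oscillations as \<open>G\<close>, over translated balls.
\<close>

definition conv :: "'g \<Rightarrow> 'b" where "conv x = (LINT y|\<mu>. \<rho> y *\<^sub>R G (- y + x))"

lemma mollified_int: "integrable \<mu> G"
  by (rule bounded_support_integrable[OF G K])

lemma kernel_meas: "\<rho> \<in> borel_measurable borel" by (rule cc_measurable[OF \<rho>(2)])

lemma kernel_nn: "(\<integral>\<^sup>+y. ennreal (\<rho> y) \<partial>\<mu>) = 1"
  using nn_integral_eq_integral[OF cc_integrable[OF \<rho>(2)]] \<rho>(3,4) by simp

lemma kernel_integrable:
  fixes H :: "'g \<Rightarrow> 'b"
  assumes "H \<in> borel_measurable borel" "\<And>y. norm (H y) \<le> C"
  shows "integrable \<mu> (\<lambda>y. \<rho> y *\<^sub>R H y)"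
proof (rule Bochner_Integration.integrable_bound)
  show "integrable \<mu> (\<lambda>y. C * \<rho> y)" by (intro integrable_mult_right cc_integrable \<rho>)
  show "(\<lambda>y. \<rho> y *\<^sub>R H y) \<in> borel_measurable \<mu>" using kernel_meas assms(1) by simp
  show "AE y in \<mu>. norm (\<rho> y *\<^sub>R H y) \<le> norm (C * \<rho> y)"
  proof (rule AE_I2)
    fix y
    have "\<rho> y * norm (H y) \<le> \<rho> y * \<bar>C\<bar>" using assms(2)[of y] \<rho>(3) by (intro mult_left_mono) auto
    then show "norm (\<rho> y *\<^sub>R H y) \<le> norm (C * \<rho> y)" using \<rho>(3)[of y] by (simp add: abs_mult mult.commute)
  qed
qed

lemma kernel_const: "(LINT y|\<mu>. \<rho> y *\<^sub>R (c :: 'b)) = c"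
  using integral_scaleR_left[OF cc_integrable[OF \<rho>(2)], of c] \<rho>(4) by simp

lemma G_slice: "(\<lambda>y. G (- y + x)) \<in> borel_measurable borel"
proof -
  have "(\<lambda>y :: 'g. - y + x) \<in> borel_measurable borel"
    by (intro borel_measurable_continuous_onI continuous_on_add continuous_on_minus' continuous_on_id continuous_on_const)
  from measurable_compose[OF this G(1)] show ?thesis .
qed

lemma conv_diff:
  assumes "a \<in> borel_measurable borel" "\<And>y. norm (a y) \<le> C"
  shows "conv x - (LINT y|\<mu>. \<rho> y *\<^sub>R a y) = (LINT y|\<mu>. \<rho> y *\<^sub>R (G (- y + x) - a y))"
  unfolding conv_def scaleR_diff_right
  by (intro Bochner_Integration.integral_diff[symmetric] kernel_integrable[OF assms] kernel_integrable[OF G_slice G(2)])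

lemma conv_smooth: "smooth_fun A conv"
proof (rule smooth_funI)
  fix W \<kappa> assume W: "(W, \<kappa>) \<in> A"
  \<comment> \<open>Substituting \<open>x + z\<close> for \<open>y\<close> moves the variable
    \<open>x\<close> from \<open>G\<close>, which is merely measurable, to the smooth
    kernel.\<close>
  have conv_eq: "conv x = (LINT z|\<mu>. \<rho> (x + z) *\<^sub>R G (- z))" for x
  proof -
    have "(\<lambda>y. \<rho> y *\<^sub>R G (- y + x)) \<in> borel_measurable borel" using kernel_meas G_slice by simp
    from integral_left[OF this, of x] show ?thesis by (simp add: conv_def minus_add add.assoc del: add_uminus_conv_diff)
  qed
  have "chart_smooth (\<kappa> ` W) (\<lambda>x z. \<rho> (inv_into W \<kappa> x + z))"
    unfolding chart_smooth_def
  proof clarify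
    fix Z \<zeta> assume Z: "(Z, \<zeta>) \<in> A"
    have op: "open (\<kappa> ` W \<times> \<zeta> ` Z)" by (intro open_Times chart_image_open W Z)
    show "smooth_on (\<kappa> ` W \<times> \<zeta> ` Z) (\<lambda>p. \<rho> (inv_into W \<kappa> (fst p) + inv_into Z \<zeta> (snd p)))"
    proof (rule smap_smooth_fun[OF smap_add \<rho>(1)])
      show "smap (\<kappa> ` W \<times> \<zeta> ` Z) (\<lambda>p. inv_into W \<kappa> (fst p))"
        by (rule smap_compose[OF smap_inv_chart[OF W] op smooth_on_linear[OF bounded_linear_fst op]]) auto
      show "smap (\<kappa> ` W \<times> \<zeta> ` Z) (\<lambda>p. inv_into Z \<zeta> (snd p))"
        by (rule smap_compose[OF smap_inv_chart[OF Z] op smooth_on_linear[OF bounded_linear_snd op]]) auto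
    qed
  qed
  moreover have "integrable \<mu> (\<lambda>z. G (- z))"
  proof (rule bounded_support_integrable[OF _ G(2) compact_uminus[OF K(1)]])
    show "(\<lambda>z. G (- z)) \<in> borel_measurable borel" using G_slice[of 0] by simp
    fix z assume "z \<notin> uminus ` K"
    then have "- z \<notin> K" by (metis imageI minus_minus)
    then show "G (- z) = 0" by (rule K(2))
  qed
  moreover have "G (- z) = 0" if "z \<notin> uminus ` K" for z
    using that K(2)[of "- z"] by (metis imageI minus_minus)
  ultimately show "smooth_on (\<kappa> ` W) (\<lambda>x. conv (inv_into W \<kappa> x))"
    unfolding conv_eq using compact_uminus[OF K(1)] chart_image_open[OF W] by (intro smooth_weight_integral)
qed

lemma conv_cc: "cc conv"
proof -
  obtain K1 where K1: "compact K1" "\<And>x. x \<notin> K1 \<Longrightarrow> \<rho> x = 0" using \<rho>(2) by (auto simp: cc_def)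
  let ?K = "(\<lambda>p. fst p + snd p) ` (K1 \<times> K)"
  have "compact ?K" by (intro compact_continuous_image compact_Times K1 K continuous_on_add continuous_on_fst continuous_on_snd continuous_on_id)
  moreover have "conv x = 0" if "x \<notin> ?K" for x
  proof -
    have "\<rho> y *\<^sub>R G (- y + x) = 0" for y
    proof (rule ccontr)
      assume "\<rho> y *\<^sub>R G (- y + x) \<noteq> 0"
      then have "y \<in> K1" "- y + x \<in> K" using K1(2) K(2) by (metis scaleR_eq_0_iff)+
      then have "y + (- y + x) \<in> ?K" by (intro image_eqI[of _ _ "(y, - y + x)"]) auto
      then show False using that by (simp flip: add.assoc)
    qed
    then have "(\<lambda>y. \<rho> y *\<^sub>R G (- y + x)) = (\<lambda>y. 0)" by (rule ext)
    then show ?thesis by (simp only: conv_def Bochner_Integration.integral_zero)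
  qed
  ultimately show ?thesis using smooth_fun_cont[OF conv_smooth] by (auto simp: cc_def)
qed

lemma G_translate: "(\<lambda>p. G (- snd p + fst p)) \<in> borel_measurable (borel \<Otimes>\<^sub>M borel)"
  by (rule measurable_compose[OF measurable_translate G(1)])

lemma conv_L1:
  assumes \<epsilon>: "\<And>y. \<rho> y \<noteq> 0 \<Longrightarrow> (LINT x|\<mu>. norm (G (- y + x) - G x)) \<le> \<epsilon>" and "0 \<le> \<epsilon>"
  shows "(LINT x|\<mu>. norm (conv x - G x)) \<le> \<epsilon>"
proof -
  have it: "integrable \<mu> (\<lambda>x. G (g + x))" for g by (simp only: integrable_left[OF G(1)] mollified_int)
  have ic: "integrable \<mu> (\<lambda>x. norm (conv x - G x))"
    by (intro integrable_norm Bochner_Integration.integrable_diff mollified_int cc_integrable conv_cc)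
  have "(\<integral>\<^sup>+x. ennreal (norm (LINT y|\<mu>. \<rho> y *\<^sub>R (G (- y + x) - G x))) * indicator UNIV x \<partial>\<mu>)
    \<le> ennreal \<epsilon> * (\<integral>\<^sup>+y. ennreal (\<rho> y) \<partial>\<mu>)"
  proof (rule Minkowski[OF _ kernel_meas \<rho>(3)])
    show "(\<lambda>p. G (- snd p + fst p) - G (fst p)) \<in> borel_measurable (borel \<Otimes>\<^sub>M borel)"
      using G_translate measurable_compose[OF measurable_fst G(1)] by (intro borel_measurable_diff) auto
    fix y assume y: "\<rho> y \<noteq> 0"
    have "(\<integral>\<^sup>+x. ennreal (norm (G (- y + x) - G x)) \<partial>\<mu>) = ennreal (LINT x|\<mu>. norm (G (- y + x) - G x))"
      by (intro nn_integral_eq_integral integrable_norm Bochner_Integration.integrable_diff mollified_int it) simp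
    also have "\<dots> \<le> ennreal \<epsilon>" using \<epsilon>[OF y] by (rule ennreal_leI)
    finally show "(\<integral>\<^sup>+x. ennreal (norm (G (- y + x) - G x)) * indicator UNIV x \<partial>\<mu>) \<le> ennreal \<epsilon>" by simp
  qed simp
  also have "(\<lambda>x. LINT y|\<mu>. \<rho> y *\<^sub>R (G (- y + x) - G x)) = (\<lambda>x. conv x - G x)"
    using conv_diff[of "\<lambda>y. G x" "norm (G x)" x for x] by (simp add: kernel_const fun_eq_iff)
  finally have "(\<integral>\<^sup>+x. ennreal (norm (conv x - G x)) \<partial>\<mu>) \<le> ennreal \<epsilon>" by (simp add: kernel_nn)
  then have "ennreal (LINT x|\<mu>. norm (conv x - G x)) \<le> ennreal \<epsilon>"
    using nn_integral_eq_integral[OF ic] by simp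
  then show ?thesis using assms(2) by (simp add: ennreal_le_iff)
qed

text \<open>Each translate is compared with its own mean \<open>a y\<close> over \<open>S\<close>;
  its oscillation over \<open>S\<close> is that of \<open>G\<close> over a translated ball, so at
  most \<open>C\<close>. Minkowski's inequality averages these bounds. The constant subtracted is
  the mean of the \<open>a y\<close>, and passing to the average of \<open>conv\<close> costs the
  factor 2 of \<open>mean_osc_le\<close>.\<close>

lemma conv_osc:
  assumes C: "\<And>g r. 0 < r \<Longrightarrow> mean_osc \<mu> G (ball_at g r) \<le> C" and r: "0 < r"
  shows "mean_osc \<mu> conv (ball_at g r) \<le> 2 * C"
proof -
  define S where "S = ball_at g r"
  have S: "good_set \<mu> S" "S \<in> sets borel" unfolding S_def by (rule good_ball[OF r]) simp
  have m: "measure \<mu> S > 0" using S(1) by (simp add: good_set_def)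
  have C0: "C \<ge> 0" using order_trans[OF mean_osc_nonneg C[OF r]] .
  define a where "a y = set_average \<mu> (\<lambda>x. G (- y + x)) S" for y
  have it: "integrable \<mu> (\<lambda>x. G (g + x))" for g by (simp only: integrable_left[OF G(1)] mollified_int)
  have its: "set_integrable \<mu> S (\<lambda>x. G (g + x))" for g
    unfolding set_integrable_def by (rule integrable_mult_indicator[OF _ it]) (use S in simp)
  have ab: "norm (a y) \<le> (1 / measure \<mu> S) * (LINT x|\<mu>. norm (G x))" for y
  proof -
    have "norm (LINT x:S|\<mu>. G (- y + x)) \<le> (LINT x:S|\<mu>. norm (G (- y + x)))" by (rule set_integral_norm_bound[OF its])
    also have "\<dots> \<le> (LINT x|\<mu>. norm (G (- y + x)))"
      unfolding set_lebesgue_integral_def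
    proof (rule integral_mono)
      show "integrable \<mu> (\<lambda>x. indicat_real S x *\<^sub>R norm (G (- y + x)))"
        using set_integrable_norm[OF its[of "- y"]] by (simp add: set_integrable_def)
    qed (use it in \<open>auto simp: indicator_def\<close>)
    also have "\<dots> = (LINT x|\<mu>. norm (G x))" by (rule integral_norm_left[OF G(1)])
    finally show ?thesis using m by (simp add: a_def set_average_def divide_right_mono)
  qed
  have am: "a \<in> borel_measurable borel"
  proof -
    have "(\<lambda>y. LINT x|\<mu>. indicat_real S x *\<^sub>R G (- y + x)) \<in> borel_measurable borel"
    proof (rule sigma_finite_measure.borel_measurable_lebesgue_integral[OF sigma_finite_mu])
      have "(\<lambda>p :: 'g \<times> 'g. - fst p + snd p) \<in> borel \<Otimes>\<^sub>M borel \<rightarrow>\<^sub>M borel"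
        unfolding borel_prod
        by (intro borel_measurable_continuous_onI continuous_on_add continuous_on_minus' continuous_on_fst continuous_on_snd continuous_on_id)
      from measurable_compose[OF this G(1)]
      have "(\<lambda>p. indicat_real S (snd p) *\<^sub>R G (- fst p + snd p)) \<in> borel_measurable (borel \<Otimes>\<^sub>M borel)"
        using measurable_compose[OF measurable_snd, of "indicat_real S" borel borel borel] S(2) by (intro borel_measurable_scaleR) auto
      then show "(\<lambda>(y, x). indicat_real S x *\<^sub>R G (- y + x)) \<in> borel_measurable (borel \<Otimes>\<^sub>M \<mu>)"
        by (simp add: case_prod_beta' cong: measurable_cong_sets sets_pair_measure_cong)
    qed
    then show ?thesis unfolding a_def set_average_def set_lebesgue_integral_def by simp
  qed
  let ?c = "LINT y|\<mu>. \<rho> y *\<^sub>R a y"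
  have ics: "set_integrable \<mu> S conv" unfolding S_def by (rule li_ball[OF integrable_li[OF cc_integrable[OF conv_cc]]])
  have icd: "set_integrable \<mu> S (\<lambda>x. conv x - ?c)" by (intro set_integral_diff ics set_integrable_const_good[OF S(1)])
  have "(\<integral>\<^sup>+x. ennreal (norm (LINT y|\<mu>. \<rho> y *\<^sub>R (G (- y + x) - a y))) * indicator S x \<partial>\<mu>)
    \<le> ennreal (measure \<mu> S * C) * (\<integral>\<^sup>+y. ennreal (\<rho> y) \<partial>\<mu>)"
  proof (rule Minkowski[OF _ kernel_meas \<rho>(3) S(2)])
    show "(\<lambda>p. G (- snd p + fst p) - a (snd p)) \<in> borel_measurable (borel \<Otimes>\<^sub>M borel)"
      using G_translate measurable_compose[OF measurable_snd am] by (intro borel_measurable_diff) auto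
    fix y assume y: "\<rho> y \<noteq> 0"
    have "set_integrable \<mu> S (\<lambda>x. G (- y + x) - a y)" by (intro set_integral_diff its set_integrable_const_good[OF S(1)])
    then have "(\<integral>\<^sup>+x. ennreal (norm (G (- y + x) - a y)) * indicator S x \<partial>\<mu>) = ennreal (LINT x:S|\<mu>. norm (G (- y + x) - a y))"
      by (rule set_nn_integral_norm)
    also have "(LINT x:S|\<mu>. norm (G (- y + x) - a y)) = measure \<mu> S * mean_osc \<mu> (\<lambda>x. G (- y + x)) S"
      using m by (simp add: mean_osc_def a_def)
    also have "mean_osc \<mu> (\<lambda>x. G (- y + x)) S = mean_osc \<mu> G (ball_at (- y + g) r)"
      unfolding S_def by (rule mean_osc_translate[OF G(1)])
    also have "ennreal (measure \<mu> S * mean_osc \<mu> G (ball_at (- y + g) r)) \<le> ennreal (measure \<mu> S * C)"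
      using C[OF r] by (intro ennreal_leI mult_left_mono) auto
    finally show "(\<integral>\<^sup>+x. ennreal (norm (G (- y + x) - a y)) * indicator S x \<partial>\<mu>) \<le> ennreal (measure \<mu> S * C)" .
  qed
  then have "(\<integral>\<^sup>+x. ennreal (norm (conv x - ?c)) * indicator S x \<partial>\<mu>) \<le> ennreal (measure \<mu> S * C)"
    by (simp add: kernel_nn conv_diff[OF am ab])
  then have "(LINT x:S|\<mu>. norm (conv x - ?c)) \<le> measure \<mu> S * C"
    unfolding set_nn_integral_norm[OF icd] using C0 by (subst (asm) ennreal_le_iff) auto
  then have "(2 / measure \<mu> S) * (LINT x:S|\<mu>. norm (conv x - ?c)) \<le> (2 / measure \<mu> S) * (measure \<mu> S * C)"
    using m by (intro mult_left_mono) auto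
  also have "\<dots> = 2 * C" using m by simp
  finally show ?thesis using mean_osc_le[OF S(1) ics, of ?c] by (simp add: S_def)
qed

end

lemma smooth_approx:
  fixes G :: "'g \<Rightarrow> 'b::{banach, second_countable_topology}"
  assumes G: "G \<in> borel_measurable borel" "\<And>x. norm (G x) \<le> M" and K: "compact K" "\<And>x. x \<notin> K \<Longrightarrow> G x = 0"
    and C: "\<And>g r. 0 < r \<Longrightarrow> mean_osc \<mu> G (ball_at g r) \<le> C" and \<epsilon>: "\<epsilon> > 0"
  shows "\<exists>F. smooth_fun A F \<and> cc F \<and> (LINT x|\<mu>. norm (F x - G x)) \<le> \<epsilon> \<and>
     (\<forall>g r. 0 < r \<longrightarrow> mean_osc \<mu> F (ball_at g r) \<le> 2 * C)"
proof -
  have "integrable \<mu> G" by (rule bounded_support_integrable[OF G K])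
  from translation_cont_nhd[OF this \<epsilon>] obtain N where N: "open N" "0 \<in> N"
    "\<And>y. y \<in> N \<Longrightarrow> (LINT x|\<mu>. norm (G (- y + x) - G x)) < \<epsilon>" by blast
  obtain \<rho> :: "'g \<Rightarrow> real" where \<rho>: "smooth_fun A \<rho>" "cc \<rho>" "\<And>x. 0 \<le> \<rho> x" "(LINT x|\<mu>. \<rho> x) = 1"
    and \<rho>N: "\<And>x. x \<notin> N \<Longrightarrow> \<rho> x = 0" by (rule mollifier[OF N(1,2)]) blast
  note facts = G K \<rho>
  have "(LINT x|\<mu>. norm (conv G \<rho> x - G x)) \<le> \<epsilon>"
  proof (rule conv_L1[OF facts])
    show "(LINT x|\<mu>. norm (G (- y + x) - G x)) \<le> \<epsilon>" if "\<rho> y \<noteq> 0" for y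
      using N(3)[of y] \<rho>N[of y] that by force
    show "0 \<le> \<epsilon>" using \<epsilon> by (rule less_imp_le)
  qed
  then show ?thesis
    using conv_smooth[OF facts] conv_cc[OF facts] conv_osc[OF facts C] by blast
qed

section \<open>Approximation in BMO\<close>

lemma bmo_norm_le:
  assumes "0 \<le> C"
  shows "bmo_norm \<mu> dd f \<le> ennreal C \<longleftrightarrow> (\<forall>g r. 0 < r \<longrightarrow> mean_osc \<mu> f (ball_at g r) \<le> C)"
proof -
  have "bmo_norm \<mu> dd f \<le> ennreal C \<longleftrightarrow> (\<forall>g r. 0 < r \<longrightarrow> ennreal (mean_osc \<mu> f (ball_at g r)) \<le> ennreal C)"
    unfolding bmo_norm_def by (auto simp: SUP_le_iff)
  then show ?thesis using assms by (simp add: ennreal_le_iff)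
qed

text \<open>Every point lies in all sufficiently large balls about the identity, so \<open>f\<close>
  is a pointwise limit of its restrictions to balls.\<close>

lemma locally_integrable_measurable:
  fixes f :: "'g \<Rightarrow> 'b::{banach, second_countable_topology}"
  assumes "locally_integrable \<mu> f"
  shows "f \<in> borel_measurable borel"
proof (rule borel_measurable_LIMSEQ_metric)
  show "(\<lambda>x. indicat_real (B (real k)) x *\<^sub>R f x) \<in> borel_measurable borel" for k
    using borel_measurable_integrable[OF li_ball[OF assms, of 0 "real k", unfolded set_integrable_def]] by (simp add: ball_at_0)
  fix x
  obtain r where r: "x \<in> B r" using B_exhaust by blast
  obtain j :: nat where j: "r \<le> real j" using real_arch_simple by blast
  have "x \<in> B (real k)" if "k \<ge> j" for k using r j that B_mono[of r "real k"] by auto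
  then have "\<forall>\<^sub>F k in sequentially. indicat_real (B (real k)) x *\<^sub>R f x = f x"
    by (intro eventually_sequentiallyI[of j]) (simp add: indicator_def)
  then show "(\<lambda>k. indicat_real (B (real k)) x *\<^sub>R f x) \<longlonglongrightarrow> f x" by (rule tendsto_eventually)
qed

lemma norm_trunc_le: "0 \<le> h \<Longrightarrow> norm (trunc h y) \<le> norm y"
  by (auto simp: trunc_def)

text \<open>Both the height and the radius of the plateau grow with \<open>k\<close>, so at each
  point of a ball truncation eventually changes nothing; since it never increases the norm,
  dominated convergence applies on the ball.\<close>

lemma bmo_approx:
  fixes f :: "'g \<Rightarrow> 'b::{banach, second_countable_topology}"
  assumes f: "locally_integrable \<mu> f" and C: "\<And>g r. 0 < r \<Longrightarrow> mean_osc \<mu> f (ball_at g r) \<le> C"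
  shows "\<exists>F. (\<forall>k. smooth_fun A (F k)) \<and> (\<forall>k. cc (F k)) \<and>
    (\<forall>k g r. 0 < r \<longrightarrow> mean_osc \<mu> (F k) (ball_at g r) \<le> 2 * (4 * C + 6)) \<and>
    (\<forall>R. (\<lambda>k. LINT x:B R|\<mu>. norm (f x - F k x)) \<longlonglongrightarrow> 0)"
proof -
  have fm [measurable]: "f \<in> borel_measurable borel" by (rule locally_integrable_measurable[OF f])
  have G_meas: "(\<lambda>x. trunc (h x) (f x)) \<in> borel_measurable borel" if [measurable]: "h \<in> borel_measurable borel" for h :: "'g \<Rightarrow> real"
    unfolding trunc_def by measurable
  define P where "P k h F \<longleftrightarrow> cc h \<and> (\<forall>x. 0 \<le> h x) \<and> (\<forall>x\<in>B (real (Suc k)). h x = real (Suc k)) \<and> smooth_fun A F \<and> cc F \<and>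
      (LINT x|\<mu>. norm (F x - trunc (h x) (f x))) \<le> 1 / real (Suc k) \<and>
      (\<forall>g r. 0 < r \<longrightarrow> mean_osc \<mu> F (ball_at g r) \<le> 2 * (4 * C + 6))" for k and h :: "'g \<Rightarrow> real" and F :: "'g \<Rightarrow> 'b"
  have "\<forall>k. \<exists>h F. P k h F"
  proof
    fix k
    \<comment> \<open>The error \<open>1 / real (Suc k)\<close> per unit of height, over height
      \<open>Suc k\<close>, adds 1 to the basic bound 2. The plateaus thus have mean oscillation at
      most 3, however tall they are.\<close>
    obtain h where h: "cc h" "\<And>x. 0 \<le> h x" "\<forall>x\<in>B (real (Suc k)). h x = real (Suc k)"
      "\<And>g r. 0 < r \<Longrightarrow> mean_osc \<mu> h (ball_at g r) \<le> 2 + 1 / real (Suc k) * real (Suc k)"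
      using plateau[of "1 / real (Suc k)" "real (Suc k)" "Suc k"] by auto
    let ?G = "\<lambda>x. trunc (h x) (f x)"
    obtain M where M: "\<And>x. norm (h x) \<le> M" using cc_bounded[OF h(1)] by blast
    obtain K where K: "compact K" "\<And>x. x \<notin> K \<Longrightarrow> h x = 0" using h(1) by (auto simp: cc_def)
    have Gm: "?G \<in> borel_measurable borel" by (rule G_meas[OF cc_measurable[OF h(1)]])
    have Gb: "norm (?G x) \<le> M" for x
      using norm_trunc[OF h(2)[of x], of "f x"] M[of x] by simp
    have GK: "?G x = 0" if "x \<notin> K" for x
      using norm_trunc[OF h(2)[of x], of "f x"] K(2)[OF that] by simp
    have Gi: "set_integrable \<mu> (ball_at g r) ?G" for g r
      by (rule li_ball[OF integrable_li[OF bounded_support_integrable[OF Gm Gb K(1) GK]]])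
    \<comment> \<open>By \<open>mean_osc_trunc\<close>: four times the oscillation of
      \<open>f\<close>, and twice the bound 3 for the plateau. Mollification doubles the result
      later.\<close>
    have osc: "mean_osc \<mu> ?G (ball_at g r) \<le> 4 * C + 6" if r: "0 < r" for g r
    proof -
      have "mean_osc \<mu> ?G (ball_at g r) \<le> 4 * mean_osc \<mu> f (ball_at g r) + 2 * mean_osc \<mu> h (ball_at g r)"
        by (rule mean_osc_trunc[OF good_ball[OF r] li_ball[OF f] li_ball[OF integrable_li[OF cc_integrable[OF h(1)]]] h(2) Gi])
      then show ?thesis using C[OF r, of g] h(4)[OF r, of g] by simp
    qed
    have e: "0 < 1 / real (Suc k)" by simp
    obtain F where "smooth_fun A F" "cc F" "(LINT x|\<mu>. norm (F x - ?G x)) \<le> 1 / real (Suc k)"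
      "\<forall>g r. 0 < r \<longrightarrow> mean_osc \<mu> F (ball_at g r) \<le> 2 * (4 * C + 6)"
      using smooth_approx[OF Gm Gb K(1) GK osc e] by blast
    then have "P k h F" unfolding P_def using h(1-3) by blast
    then show "\<exists>h F. P k h F" by blast
  qed
  from choice[OF this] obtain h where "\<forall>k. \<exists>F. P k (h k) F" ..
  from choice[OF this] obtain F where PF: "\<forall>k. P k (h k) (F k)" ..
  have h: "\<And>k. cc (h k)" "\<And>k x. 0 \<le> h k x" "\<And>k x. x \<in> B (real (Suc k)) \<Longrightarrow> h k x = real (Suc k)"
    and F: "\<And>k. smooth_fun A (F k)" "\<And>k. cc (F k)" "\<And>k. (LINT x|\<mu>. norm (F k x - trunc (h k x) (f x))) \<le> 1 / real (Suc k)"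
      "\<And>k g r. 0 < r \<Longrightarrow> mean_osc \<mu> (F k) (ball_at g r) \<le> 2 * (4 * C + 6)"
    using PF unfolding P_def by simp_all
  have "(\<lambda>k. LINT x:B R|\<mu>. norm (f x - F k x)) \<longlonglongrightarrow> 0" for R
  proof -
    let ?G = "\<lambda>k x. trunc (h k x) (f x)"
    let ?I = "\<lambda>x. indicat_real (B R) x"
    have fi: "integrable \<mu> (\<lambda>x. ?I x *\<^sub>R f x)"
      using li_ball[OF f, of 0 R] by (simp add: set_integrable_def ball_at_0)
    have fn: "integrable \<mu> (\<lambda>x. 2 * norm (?I x *\<^sub>R f x))" by (intro integrable_mult_right integrable_norm fi)
    have Gm: "?G k \<in> borel_measurable borel" for k by (rule G_meas[OF cc_measurable[OF h(1)]])
    have Gi: "integrable \<mu> (?G k)" for k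
    proof -
      obtain M where M: "\<And>x. norm (h k x) \<le> M" using cc_bounded[OF h(1)] by blast
      obtain K where K: "compact K" "\<And>x. x \<notin> K \<Longrightarrow> h k x = 0" using h(1)[of k] by (auto simp: cc_def)
      show ?thesis
      proof (rule bounded_support_integrable[OF Gm _ K(1)])
        show "norm (?G k x) \<le> M" for x using norm_trunc[OF h(2)[of k x], of "f x"] M[of x] by simp
        show "?G k x = 0" if "x \<notin> K" for x using norm_trunc[OF h(2)[of k x], of "f x"] K(2)[OF that] by simp
      qed
    qed
    have 1: "norm (?I x *\<^sub>R norm (f x - ?G k x)) \<le> 2 * norm (?I x *\<^sub>R f x)" for k x
      using norm_trunc_le[OF h(2)[of k x], of "f x"] norm_triangle_ineq4[of "f x" "?G k x"] by (simp add: indicator_def)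
    have dm: "(\<lambda>x. ?I x *\<^sub>R norm (f x - ?G k x)) \<in> borel_measurable \<mu>" for k
      using Gm[of k] fm by simp
    have lim: "(\<lambda>k. LINT x|\<mu>. ?I x *\<^sub>R norm (f x - ?G k x)) \<longlonglongrightarrow> (LINT x|\<mu>. 0)"
    proof (rule integral_dominated_convergence[OF _ dm fn])
      show "AE x in \<mu>. (\<lambda>k. ?I x *\<^sub>R norm (f x - ?G k x)) \<longlonglongrightarrow> 0"
      proof (rule AE_I2)
        fix x
        obtain j :: nat where j: "max R (norm (f x)) \<le> real j" using real_arch_simple by blast
        have "?I x *\<^sub>R norm (f x - ?G k x) = 0" if k: "k \<ge> j" for k
        proof (cases "x \<in> B R")
          case True
          have "R \<le> real (Suc k)" "norm (f x) \<le> real (Suc k)" using j k by auto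
          then have "h k x = real (Suc k)" using h(3) True B_mono by blast
          then show ?thesis using \<open>norm (f x) \<le> real (Suc k)\<close> by (simp add: trunc_def)
        qed simp
        then have "\<forall>\<^sub>F k in sequentially. ?I x *\<^sub>R norm (f x - ?G k x) = 0" by (rule eventually_sequentiallyI)
        then show "(\<lambda>k. ?I x *\<^sub>R norm (f x - ?G k x)) \<longlonglongrightarrow> 0" by (rule tendsto_eventually)
      qed
      show "AE x in \<mu>. norm (?I x *\<^sub>R norm (f x - ?G k x)) \<le> 2 * norm (?I x *\<^sub>R f x)" for k
        using 1 by (rule AE_I2)
    qed simp
    have "(\<lambda>k. (LINT x|\<mu>. ?I x *\<^sub>R norm (f x - ?G k x)) + 1 / real (Suc k)) \<longlonglongrightarrow> (LINT x|\<mu>. 0 :: real) + 0"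
      by (intro tendsto_add lim LIMSEQ_Suc lim_1_over_n)
    then have s: "(\<lambda>k. (LINT x|\<mu>. ?I x *\<^sub>R norm (f x - ?G k x)) + 1 / real (Suc k)) \<longlonglongrightarrow> 0" by simp
    show ?thesis
    proof (rule Lim_null_comparison[OF always_eventually s], rule allI)
      fix k
      have i1: "integrable \<mu> (\<lambda>x. ?I x *\<^sub>R norm (f x - ?G k x))"
        by (rule Bochner_Integration.integrable_bound[OF fn dm]) (use 1 in \<open>auto intro: AE_I2 order_trans\<close>)
      have i2: "integrable \<mu> (\<lambda>x. norm (F k x - ?G k x))"
        by (intro integrable_norm Bochner_Integration.integrable_diff Gi cc_integrable F)
      have i3: "integrable \<mu> (\<lambda>x. ?I x *\<^sub>R norm (f x - F k x))"
        using set_integrable_norm[OF set_integral_diff(1)[OF li_ball[OF f, of 0 R] li_ball[OF integrable_li[OF cc_integrable[OF F(2)[of k]]], of 0 R]]]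
        by (simp add: set_integrable_def ball_at_0)
      have "(LINT x|\<mu>. ?I x *\<^sub>R norm (f x - F k x)) \<le> (LINT x|\<mu>. ?I x *\<^sub>R norm (f x - ?G k x) + norm (F k x - ?G k x))"
      proof (rule integral_mono[OF i3 Bochner_Integration.integrable_add[OF i1 i2]])
        show "?I x *\<^sub>R norm (f x - F k x) \<le> ?I x *\<^sub>R norm (f x - ?G k x) + norm (F k x - ?G k x)" for x
          using norm_triangle_ineq4[of "f x - ?G k x" "F k x - ?G k x"] by (simp add: indicator_def)
      qed
      also have "\<dots> = (LINT x|\<mu>. ?I x *\<^sub>R norm (f x - ?G k x)) + (LINT x|\<mu>. norm (F k x - ?G k x))"
        by (rule Bochner_Integration.integral_add[OF i1 i2])
      also have "\<dots> \<le> (LINT x|\<mu>. ?I x *\<^sub>R norm (f x - ?G k x)) + 1 / real (Suc k)" using F(3)[of k] by simp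
      finally have "(LINT x:B R|\<mu>. norm (f x - F k x)) \<le> (LINT x|\<mu>. ?I x *\<^sub>R norm (f x - ?G k x)) + 1 / real (Suc k)"
        by (simp add: set_lebesgue_integral_def)
      moreover have "(LINT x:B R|\<mu>. norm (f x - F k x)) \<ge> 0"
        unfolding set_lebesgue_integral_def by (rule Bochner_Integration.integral_nonneg) simp
      ultimately show "norm (LINT x:B R|\<mu>. norm (f x - F k x)) \<le> (LINT x|\<mu>. ?I x *\<^sub>R norm (f x - ?G k x)) + 1 / real (Suc k)" by simp
    qed
  qed
  then show ?thesis using F(1,2,4) by (intro exI[of _ F]) simp
qed

lemma cc_scaleR: "cc u \<Longrightarrow> cc (\<lambda>x. c *\<^sub>R u x)"
  unfolding cc_def by (auto intro: continuous_on_scaleR continuous_on_const)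

lemma cc_sum: "(\<And>i. i < N \<Longrightarrow> cc (u i)) \<Longrightarrow> cc (\<lambda>x. \<Sum>i<N. u i x)" for N :: nat
  by (induction N) (auto simp: cc_0 intro: cc_add)

lemma ennreal_real_below: "0 < \<epsilon> \<Longrightarrow> \<exists>e>0. ennreal e < \<epsilon>"
proof (cases \<epsilon> rule: ennreal_cases)
  case (real r)
  assume "0 < \<epsilon>"
  then have "r / 2 > 0 \<and> ennreal (r / 2) < \<epsilon>" using real by (simp add: ennreal_less_iff)
  then show ?thesis by blast
qed (auto intro: exI[of _ 1])

lemma VMO_iff_vanishing_osc:
  fixes f :: "'g \<Rightarrow> 'b::{banach, second_countable_topology}"
  assumes f: "f \<in> BMO \<mu> dd"
  shows "f \<in> VMO A \<mu> dd \<longleftrightarrow> vanishing_osc f"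
proof
  have li: "locally_integrable \<mu> f" using f by (simp add: BMO_def)
  have fi: "set_integrable \<mu> (ball_at g r) f" for g r by (rule li_ball[OF li])
  {
    assume v: "f \<in> VMO A \<mu> dd"
    show "vanishing_osc f"
      unfolding vanishing_osc_def
    proof (intro allI impI)
      fix \<epsilon> :: real assume \<epsilon>: "\<epsilon> > 0"
      then have "ennreal (\<epsilon> / 2) > 0" by simp
      then obtain u where u: "u \<in> test_functions A" "bmo_norm \<mu> dd (\<lambda>p. f p - u p) < ennreal (\<epsilon> / 2)"
        using v unfolding VMO_def by blast
      have cu: "cc u" using u(1) by (simp add: test_functions_iff)
      have d: "mean_osc \<mu> (\<lambda>p. f p - u p) (ball_at g r) \<le> \<epsilon> / 2" if "0 < r" for g r
        using less_imp_le[OF u(2)] bmo_norm_le[of "\<epsilon> / 2" "\<lambda>p. f p - u p"] \<epsilon> that by simp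
      have "\<epsilon> / 2 > 0" using \<epsilon> by simp
      with vanishing_osc_cc[OF cu] obtain R where R: "R > 0" "\<And>g r. 0 < r \<Longrightarrow> far R g r \<Longrightarrow> mean_osc \<mu> u (ball_at g r) < \<epsilon> / 2"
        unfolding vanishing_osc_def by blast
      have ui: "set_integrable \<mu> (ball_at g r) u" for g r by (rule li_ball[OF integrable_li[OF cc_integrable[OF cu]]])
      show "\<exists>R>0. \<forall>g r. 0 < r \<longrightarrow> far R g r \<longrightarrow> mean_osc \<mu> f (ball_at g r) < \<epsilon>"
      proof (intro exI[of _ R] conjI allI impI R(1))
        fix g r assume r: "0 < r" "far R g r"
        show "mean_osc \<mu> f (ball_at g r) < \<epsilon>"
          using mean_osc_add[OF good_ball[OF r(1)] set_integral_diff(1)[OF fi ui] ui, of g] d[OF r(1), of g] R(2)[OF r] by simp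
      qed
    qed
  next
    assume va: "vanishing_osc f"
    obtain C where C: "C \<ge> 0" "\<And>g r. 0 < r \<Longrightarrow> mean_osc \<mu> f (ball_at g r) \<le> C"
    proof -
      have "bmo_norm \<mu> dd f < \<infinity>" using f by (simp add: BMO_def)
      then have e: "bmo_norm \<mu> dd f \<le> ennreal (enn2real (bmo_norm \<mu> dd f))" by simp
      show ?thesis
        by (rule that[of "enn2real (bmo_norm \<mu> dd f)"]) (use e bmo_norm_le[of "enn2real (bmo_norm \<mu> dd f)" f] in auto)
    qed
    obtain F :: "nat \<Rightarrow> 'g \<Rightarrow> 'b" where "(\<forall>k. smooth_fun A (F k)) \<and> (\<forall>k. cc (F k)) \<and>
      (\<forall>k g r. 0 < r \<longrightarrow> mean_osc \<mu> (F k) (ball_at g r) \<le> 2 * (4 * C + 6)) \<and>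
      (\<forall>R. (\<lambda>k. LINT x:B R|\<mu>. norm (f x - F k x)) \<longlonglongrightarrow> 0)"
      using bmo_approx[OF li C(2)] ..
    then have F: "\<And>k. smooth_fun A (F k)" "\<And>k. cc (F k)"
      "\<And>k g r. 0 < r \<Longrightarrow> mean_osc \<mu> (F k) (ball_at g r) \<le> 2 * (4 * C + 6)"
      "\<And>R. (\<lambda>k. LINT x:B R|\<mu>. norm (f x - F k x)) \<longlonglongrightarrow> 0" by simp_all
    define D where "D = C + 2 * (4 * C + 6)"
    have D0: "D > 0" using C(1) by (simp add: D_def)
    have Fi: "set_integrable \<mu> (ball_at g r) (F k)" for g r k by (rule li_ball[OF integrable_li[OF cc_integrable[OF F(2)]]])
    have D: "mean_osc \<mu> (\<lambda>x. f x - F k x) (ball_at g r) \<le> D" if r: "0 < r" for k g r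
      using mean_osc_diff[OF good_ball[OF r] fi Fi[of g r k]] C(2)[OF r, of g] F(3)[OF r, of k g] by (simp add: D_def)
    have "\<exists>u\<in>test_functions A. bmo_norm \<mu> dd (\<lambda>p. f p - u p) < \<epsilon>" if pos: "0 < \<epsilon>" for \<epsilon>
    proof -
      obtain e where e: "e > 0" "ennreal e < \<epsilon>" using ennreal_real_below[OF pos] by blast
      \<comment> \<open>Dividing the sum of the differences by \<open>N\<close> leaves
        \<open>D / real N\<close>, which is then at most \<open>e / 2\<close>, plus twice the
        \<open>e / 4\<close> handed to \<open>gliding_hump\<close>.\<close>
      obtain N :: nat where N: "2 * D / e < real N" using reals_Archimedean2 by blast
      have "2 * D / e > 0" using D0 e(1) by simp
      with N have N0: "real N > 0" by linarith
      have e4: "e / 4 > 0" using e(1) by simp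
      obtain \<kappa> where \<kappa>: "\<And>g r. 0 < r \<Longrightarrow> mean_osc \<mu> (\<lambda>x. \<Sum>i<N. f x - F (\<kappa> i) x) (ball_at g r) \<le> D + 2 * (e / 4) * real N"
        using gliding_hump[OF li va F(2) D F(4) e4, of N] by blast
      define u where "u x = (1 / real N) *\<^sub>R (\<Sum>i<N. F (\<kappa> i) x)" for x
      have "u \<in> test_functions A"
        unfolding test_functions_iff u_def
        by (intro conjI smooth_fun_scaleR[OF smooth_fun_const] smooth_fun_sum cc_scaleR cc_sum F)
      moreover have "mean_osc \<mu> (\<lambda>x. f x - u x) (ball_at g r) \<le> e" if r: "0 < r" for g r
      proof -
        have "f x - u x = (1 / real N) *\<^sub>R (\<Sum>i<N. f x - F (\<kappa> i) x)" for x
          using N0 by (simp add: u_def sum_subtractf scaleR_diff_right sum_constant_scaleR)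
        then have "mean_osc \<mu> (\<lambda>x. f x - u x) (ball_at g r) = (1 / real N) * mean_osc \<mu> (\<lambda>x. \<Sum>i<N. f x - F (\<kappa> i) x) (ball_at g r)"
          using N0 by (simp only: mean_osc_scaleR) simp
        also have "\<dots> \<le> (1 / real N) * (D + 2 * (e / 4) * real N)" using N0 by (intro mult_left_mono \<kappa>[OF r]) simp
        also have "\<dots> = D / real N + e / 2" using N0 by (simp add: field_simps)
        also have "\<dots> \<le> e" using N N0 e(1) by (simp add: field_simps)
        finally show ?thesis .
      qed
      then have "bmo_norm \<mu> dd (\<lambda>x. f x - u x) \<le> ennreal e"
        using bmo_norm_le[of e "\<lambda>x. f x - u x"] e(1) by simp
      ultimately show ?thesis using e(2) by (auto intro: le_less_trans)
    qed
    then show "f \<in> VMO A \<mu> dd" using f by (simp add: VMO_def)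
  }
qed

text \<open>The predicate \<open>P\<close> lets one statement serve the three conditions of the
  theorem. In \<open>ennreal\<close> the supremum of an empty family is 0, in agreement with the
  vacuous truth on the right.\<close>

lemma SUP_tendsto_0:
  fixes f :: "'g \<Rightarrow> 'b::{banach, second_countable_topology}" and P :: "real \<Rightarrow> 'g \<Rightarrow> real \<Rightarrow> bool"
  shows "((\<lambda>a. SUP (g, r)\<in>{(g, r). P a g r}. ennreal (mean_osc \<mu> f (ball_at g r))) \<longlongrightarrow> 0) F \<longleftrightarrow>
    (\<forall>\<epsilon>>0. \<forall>\<^sub>F a in F. \<forall>g r. P a g r \<longrightarrow> mean_osc \<mu> f (ball_at g r) \<le> \<epsilon>)"
    (is "(?s \<longlongrightarrow> 0) F \<longleftrightarrow> ?R")
proof -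
  have le: "?s a \<le> ennreal \<epsilon> \<longleftrightarrow> (\<forall>g r. P a g r \<longrightarrow> mean_osc \<mu> f (ball_at g r) \<le> \<epsilon>)" if "\<epsilon> > 0" for a \<epsilon>
    using that by (auto simp: SUP_le_iff ennreal_le_iff)
  show ?thesis
  proof
    assume l: "(?s \<longlongrightarrow> 0) F"
    show ?R
    proof (intro allI impI)
      fix \<epsilon> :: real assume \<epsilon>: "\<epsilon> > 0"
      have "\<forall>\<^sub>F a in F. ?s a < ennreal \<epsilon>" by (rule order_tendstoD(2)[OF l]) (use \<epsilon> in simp)
      then show "\<forall>\<^sub>F a in F. \<forall>g r. P a g r \<longrightarrow> mean_osc \<mu> f (ball_at g r) \<le> \<epsilon>"
        by (rule eventually_mono) (simp only: le[OF \<epsilon>, symmetric] less_imp_le)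
    qed
  next
    assume R: ?R
    show "(?s \<longlongrightarrow> 0) F"
    proof (rule order_tendstoI)
      fix c :: ennreal assume "0 < c"
      then obtain e where e: "e > 0" "ennreal e < c" using ennreal_real_below by blast
      have "\<forall>\<^sub>F a in F. ?s a \<le> ennreal e" using R[rule_format, OF e(1)] by (simp only: le[OF e(1)])
      then show "\<forall>\<^sub>F a in F. ?s a < c" by (rule eventually_mono) (use e(2) in simp)
    qed simp
  qed
qed

text \<open>The conditions overlap: a ball with distant centre need not avoid a given ball about the
  identity. If it meets that ball its radius is large and the second condition takes over; otherwise
  the third applies.\<close>

lemma vanishing_osc_iff:
  fixes f :: "'g \<Rightarrow> 'b::{banach, second_countable_topology}"
  shows "vanishing_osc f \<longleftrightarrow>
      ((\<lambda>a. SUP g. ennreal (mean_osc \<mu> f (ball_at g a))) \<longlongrightarrow> 0) (at_right 0) \<and>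
      ((\<lambda>a. SUP g. ennreal (mean_osc \<mu> f (ball_at g a))) \<longlongrightarrow> 0) at_top \<and>
      ((\<lambda>r. SUP (g, \<rho>)\<in>{(g, \<rho>). 0 < \<rho> \<and> ball_at g \<rho> \<subseteq> - ball_at 0 r}. ennreal (mean_osc \<mu> f (ball_at g \<rho>))) \<longlongrightarrow> 0) at_top"
proof -
  have s: "(SUP g. ennreal (mean_osc \<mu> f (ball_at g a))) = (SUP (g, r)\<in>{(g, r). r = a}. ennreal (mean_osc \<mu> f (ball_at g r)))" for a
  proof -
    have "{(g :: 'g, r). r = a} = range (\<lambda>g. (g, a))" by auto
    then show ?thesis by (simp add: image_image)
  qed
  show ?thesis
    unfolding s SUP_tendsto_0
  proof safe
    fix \<epsilon> :: real assume va: "vanishing_osc f" and \<epsilon>: "\<epsilon> > 0"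
    then obtain R where R: "R > 0" "\<And>g r. 0 < r \<Longrightarrow> far R g r \<Longrightarrow> mean_osc \<mu> f (ball_at g r) \<le> \<epsilon>"
      unfolding vanishing_osc_def by (meson less_imp_le)
    show "\<forall>\<^sub>F a in at_right 0. \<forall>g r. r = a \<longrightarrow> mean_osc \<mu> f (ball_at g r) \<le> \<epsilon>"
      unfolding eventually_at_right_field using R by (intro exI[of _ "1 / R"]) (auto simp: far_def)
    show "\<forall>\<^sub>F a in at_top. \<forall>g r. r = a \<longrightarrow> mean_osc \<mu> f (ball_at g r) \<le> \<epsilon>"
      using eventually_gt_at_top[of R] by (rule eventually_mono) (use R in \<open>auto simp: far_def\<close>)
    show "\<forall>\<^sub>F a in at_top. \<forall>g r. 0 < r \<and> ball_at g r \<subseteq> - ball_at 0 a \<longrightarrow> mean_osc \<mu> f (ball_at g r) \<le> \<epsilon>"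
      using eventually_gt_at_top[of R]
    proof (rule eventually_mono, intro allI impI)
      fix a g r assume a: "R < a" and gr: "0 < r \<and> ball_at g r \<subseteq> - ball_at 0 a"
      have "g \<in> ball_at g r" using gr by (simp add: dball_def)
      then have "g \<notin> ball_at 0 a" using gr by blast
      then have "R < dd 0 g" using a by (simp add: dball_def)
      then show "mean_osc \<mu> f (ball_at g r) \<le> \<epsilon>" using gr R(2) by (simp add: far_def)
    qed
  next
    assume 1: "\<forall>\<epsilon>>0. \<forall>\<^sub>F a in at_right 0. \<forall>g r. r = a \<longrightarrow> mean_osc \<mu> f (ball_at g r) \<le> \<epsilon>"
      and 2: "\<forall>\<epsilon>>0. \<forall>\<^sub>F a in at_top. \<forall>g r. r = a \<longrightarrow> mean_osc \<mu> f (ball_at g r) \<le> \<epsilon>"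
      and 3: "\<forall>\<epsilon>>0. \<forall>\<^sub>F a in at_top. \<forall>g r. 0 < r \<and> ball_at g r \<subseteq> - ball_at 0 a \<longrightarrow> mean_osc \<mu> f (ball_at g r) \<le> \<epsilon>"
    show "vanishing_osc f"
      unfolding vanishing_osc_def
    proof (intro allI impI)
      fix \<epsilon> :: real assume "\<epsilon> > 0"
      then have e: "\<epsilon> / 2 > 0" by simp
      obtain b where b: "b > 0" "\<And>r g. 0 < r \<Longrightarrow> r < b \<Longrightarrow> mean_osc \<mu> f (ball_at g r) \<le> \<epsilon> / 2"
        using 1[rule_format, OF e] unfolding eventually_at_right_field by auto
      obtain R2 where R2: "\<And>r g. R2 \<le> r \<Longrightarrow> mean_osc \<mu> f (ball_at g r) \<le> \<epsilon> / 2"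
        using 2[rule_format, OF e] unfolding eventually_at_top_linorder by auto
      obtain R3 where R3': "\<forall>a\<ge>R3. \<forall>g r. 0 < r \<and> ball_at g r \<subseteq> - ball_at 0 a \<longrightarrow> mean_osc \<mu> f (ball_at g r) \<le> \<epsilon> / 2"
        using 3[rule_format, OF e] unfolding eventually_at_top_linorder ..
      have R3: "mean_osc \<mu> f (ball_at g r) \<le> \<epsilon> / 2" if "0 < r" "ball_at g r \<subseteq> - ball_at 0 R3" for r g
        using R3'[rule_format, OF order_refl conjI[OF that]] .
      \<comment> \<open>A ball of radius below \<open>R2\<close> with centre beyond
        \<open>R2 + R3\<close> avoids \<open>ball_at 0 R3\<close>. Absolute values are taken because
        the thresholds \<open>R2\<close> and \<open>R3\<close> may be negative.\<close>
      define R where "R = 1 / b + \<bar>R2\<bar> + \<bar>R3\<bar>"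
      have R: "R > 0" "1 / R \<le> b" "R2 \<le> R" "R2 + R3 \<le> R"
      proof -
        show "R > 0" using b(1) by (simp add: R_def add_pos_nonneg)
        have "1 / b \<le> R" by (simp add: R_def)
        then show "1 / R \<le> b" using b(1) \<open>R > 0\<close> by (simp add: field_simps)
        have "1 / b > 0" using b(1) by simp
        then show "R2 \<le> R" "R2 + R3 \<le> R" unfolding R_def by linarith+
      qed
      have half: "mean_osc \<mu> f (ball_at g r) \<le> \<epsilon> / 2" if r: "0 < r" and far: "far R g r" for g r
      proof -
        consider "r < b" | "R2 \<le> r" | "r < R2" "R < dd 0 g" using far R unfolding far_def by linarith
        then show ?thesis
        proof cases
          case 3
          have "ball_at g r \<subseteq> - ball_at 0 R3"
          proof
            fix x assume "x \<in> ball_at g r"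
            then have "R3 < dd 0 x" using 3 R(4) dd_triangle[of 0 g x] dd_sym[of x g] by (simp add: dball_def)
            then show "x \<in> - ball_at 0 R3" by (simp add: dball_def)
          qed
          then show ?thesis by (rule R3[OF r])
        qed (use b(2)[OF r] R2 in auto)
      qed
      have "mean_osc \<mu> f (ball_at g r) < \<epsilon>" if "0 < r" "far R g r" for g r
        using half[OF that] e by linarith
      then show "\<exists>R>0. \<forall>g r. 0 < r \<longrightarrow> far R g r \<longrightarrow> mean_osc \<mu> f (ball_at g r) < \<epsilon>" using R(1) by blast
    qed
  qed
qed

end

theorem theorem4p4:
  fixes A :: "('g::{topological_group_add, t2_space, second_countable_topology},
               'e::euclidean_space) atlas"
    and s :: nat and V :: "nat \<Rightarrow> 'g vfield set"
    and n :: nat and X :: "nat \<Rightarrow> 'g vfield"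
    and \<mu> :: "'g measure" and d :: "'g \<Rightarrow> 'g \<Rightarrow> real"
    and f :: "'g \<Rightarrow> 'b::{real_normed_field, euclidean_space}"
  assumes "lie_group A"
    and "connected (UNIV :: 'g set)" and "simply_connected (UNIV :: 'g set)"
    and "nilpotent_group TYPE('g)"
    and "stratification A s V"
    and "indexed_basis n X (V 1)"
    and "haar_measure \<mu>"
    and d_def: "d = cc_dist A n X"
    and "f \<in> BMO \<mu> d"
  shows "f \<in> VMO A \<mu> d \<longleftrightarrow>
      ((\<lambda>a. SUP g. ennreal (mean_osc \<mu> f (dball d g a))) \<longlongrightarrow> 0) (at_right 0) \<and>
      ((\<lambda>a. SUP g. ennreal (mean_osc \<mu> f (dball d g a))) \<longlongrightarrow> 0) at_top \<and>
      ((\<lambda>r. SUP (g, \<rho>)\<in>{(g, \<rho>). 0 < \<rho> \<and> dball d g \<rho> \<subseteq> - dball d 0 r}.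
            ennreal (mean_osc \<mu> f (dball d g \<rho>))) \<longlongrightarrow> 0) at_top"
proof -
  interpret lie A by unfold_locales fact
  obtain U0 \<phi> where U0: "(U0, \<phi>) \<in> A" "0 \<in> U0" by (rule chart_ex)
  interpret lie0 A U0 \<phi> by unfold_locales (fact U0)+
  have V1: "V 1 \<subseteq> lie_algebra A" using assms(5) by (simp add: stratification_def)
  have X: "span (X ` {1..n}) = V 1" using assms(6) by (simp add: indexed_basis_def)
  have rep: "represents (X j) (ev (X j))" if "j \<in> {1..n}" for j
    using that X V1 span_base[of "X j" "X ` {1..n}"] by (intro ev_represents) blast
  have evV: "ev ` V 1 \<subseteq> W" if W: "subspace W" "\<And>j. j \<in> {1..n} \<Longrightarrow> ev (X j) \<in> W" for W
  proof
    fix w assume "w \<in> ev ` V 1"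
    then obtain Y where Y: "Y \<in> span (X ` {1..n})" "w = ev Y" using X by blast
    have "\<exists>w\<in>W. represents Y w"
      by (rule span_represents[OF Y(1) W(1)]) (use rep W(2) in blast)
    then show "w \<in> W" using ev_eqI Y(2) by auto
  qed
  interpret horizontal A U0 \<phi> n X "\<lambda>j. ev (X j)"
  proof
    show "represents (X j) (ev (X j))" if "j \<in> {1..n}" for j using that by (rule rep)
    show "W = UNIV" if W: "subspace W" "(\<lambda>j. ev (X j)) ` {1..n} \<subseteq> W"
      "\<And>j w. j \<in> {1..n} \<Longrightarrow> w \<in> W \<Longrightarrow> br (ev (X j)) w \<in> W" for W
    proof (rule stratification_generates[OF assms(5) W(1)])
      show "ev ` V 1 \<subseteq> W" by (rule evV[OF W(1)]) (use W(2) in blast)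
      fix y w assume y: "y \<in> ev ` V 1" and w: "w \<in> W"
      \<comment> \<open>Invariance of \<open>W\<close> is given for the basis fields only; linearity
        of the bracket in its first argument extends it to the whole first stratum.\<close>
      have "subspace {y. br y w \<in> W}"
        using linear_subspace_vimage[OF br_linear_left W(1), of w] by (simp add: vimage_def)
      then have "ev ` V 1 \<subseteq> {y. br y w \<in> W}" by (rule evV) (use W(3) w in simp)
      then show "br y w \<in> W" using y by blast
    qed
  qed (fact assms(2))
  interpret carnot A U0 \<phi> n X "\<lambda>j. ev (X j)" \<mu>
    by unfold_locales (fact assms(7), rule noncompact[OF assms(3,5)])
  show ?thesis using VMO_iff_vanishing_osc vanishing_osc_iff assms(9) unfolding d_def by blast
qed

end
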